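(* Let $n\ge1$. For all $k\in\mathbb N=\{0,1,2,\dots\}$, all $f\in\mathcal H^k(\mathbb R^n,\gamma_n)$ with $\|f\|_{L^\infty}\le1$, and all $p\in[1,2)$, $$\big\||\nabla^kf|\big\|_{L^p}^{p}\ \ge\ C(p)^k\,W^{\ge k}(f)\left[1+\frac{1}{2k}\ln\Big(\frac{1}{W^{\ge k}(f)}\Big)\right]^{\frac{kp}{2}},$$ and further $$\max_{\kappa\in\mathbb N^n:|\kappa|=k}\|D^\kappa f\|_{L^p}^{p}\ \ge\ C(p)^k\,\frac{W^{\ge k}(f)}{\binom{n+k-1}{k}}\left[1+\frac{1}{2k}\ln\left(\frac{\binom{n+k-1}{k}}{W^{\ge k}(f)}\right)\right]^{\frac{kp}{2}},$$ where $$C(p)=\Big(M(p)^{-\frac2p}+\frac{p}{2e(2-p)}\Big)^{-\frac p2},\qquad M(p):=p\,2^{-\frac p2}\max_{x\ge0}\frac{1-e^{-x}}{x^{p/2}}.$$ Moreover there is an absolute constant $c>0$ with $C(p)\ge c\,(2-p)$ for all $p\in[1,2)$.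
   Context: $\gamma_n$ is the standard Gaussian measure on $\mathbb R^n$, with density $\varphi_n(x)=(2\pi)^{-n/2}e^{-|x|^2/2}$; all norms and inner products are with respect to $\gamma_n$. For $\kappa\in\mathbb N^n$, $|\kappa|=\sum_i\kappa_i$ and $D^\kappa:=\prod_{i=1}^n\frac{1}{\sqrt{\kappa_i!}}\partial_i^{\kappa_i}$ is the normalized weak partial derivative ($D^{0}$ is the identity). $\mathcal H^k(\mathbb R^n,\gamma_n):=\{f\in L^2(\gamma_n): D^\kappa f\in L^2(\gamma_n)\text{ for all }|\kappa|\le k\}$. $\nabla^kf:=(D^\kappa f)_{|\kappa|=k}$ and $|\nabla^kf|^2:=\sum_{|\kappa|=k}|D^\kappa f|^2$ (pointwise). For $f\in L^2(\gamma_n)$, $f^{\ge k}$ is the component of $f$ orthogonal in $L^2(\gamma_n)$ to the null space of $\nabla^k$ (polynomials of degree less than $k$), and $W^{\ge k}(f):=\|f^{\ge k}\|_{L^2}^2$; equivalently $W^{\ge k}(f)=\sum_{|\alpha|\ge k}\widehat f(\alpha)^2$, $\widehat f(\alpha)=\langle f,h_\alpha\rangle_{L^2}$, with $h_\alpha=(-1)^{|\alpha|}\varphi_n^{-1}D^\alpha\varphi_n$ the normalized Hermite polynomials. Conventions: the right-hand sides are $0$ if $W^{\ge k}(f)=0$; for $k=0$ a bracket raised to the power $0$ equals $1$. *)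

theory Defs
  imports "HOL-Probability.Probability" "HOL-Probability.Essential_Supremum"
begin

subsection \<open>Gaussian measure and norms\<close>

definition gauss_density :: "real ^ 'n::finite \<Rightarrow> real" where
  "gauss_density x = (2 * pi) powr (- real CARD('n) / 2) * exp (- (norm x)\<^sup>2 / 2)"

definition gauss :: "(real ^ 'n::finite) measure" where
  "gauss = density lborel (\<lambda>x. ennreal (gauss_density x))"

text \<open>Elements of \<open>L\<^sup>2\<close> are represented by Borel functions; equality in \<open>L\<^sup>2\<close> is equality
  almost everywhere.\<close>

definition L2 :: "(real ^ 'n::finite \<Rightarrow> real) set" where
  "L2 = {f. f \<in> borel_measurable borel \<and> integrable gauss (\<lambda>x. (f x)\<^sup>2)}"

definition L2_inner :: "(real ^ 'n::finite \<Rightarrow> real) \<Rightarrow> (real ^ 'n \<Rightarrow> real) \<Rightarrow> real" where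
  "L2_inner f g = (\<integral>x. f x * g x \<partial>gauss)"

definition Lp_norm :: "real \<Rightarrow> (real ^ 'n::finite \<Rightarrow> real) \<Rightarrow> real" where
  "Lp_norm p f = (\<integral>x. \<bar>f x\<bar> powr p \<partial>gauss) powr (1 / p)"

definition Linf_norm :: "(real ^ 'n::finite \<Rightarrow> real) \<Rightarrow> ereal" where
  "Linf_norm f = esssup gauss (\<lambda>x. ereal \<bar>f x\<bar>)"

subsection \<open>Weak derivatives\<close>

definition mdeg :: "('n::finite \<Rightarrow> nat) \<Rightarrow> nat" where
  "mdeg \<kappa> = (\<Sum>i\<in>UNIV. \<kappa> i)"

definition partial_deriv :: "'n::finite \<Rightarrow> (real ^ 'n \<Rightarrow> real) \<Rightarrow> real ^ 'n \<Rightarrow> real" where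
  "partial_deriv i \<phi> x = frechet_derivative \<phi> (at x) (axis i 1)"

definition smooth :: "(real ^ 'n::finite \<Rightarrow> real) \<Rightarrow> bool" where
  "smooth \<phi> \<longleftrightarrow> (\<forall>is x. foldr partial_deriv is \<phi> differentiable at x)"

text \<open>The classical \<open>\<partial>\<^sup>\<kappa> \<phi>\<close>, only applied to smooth \<open>\<phi>\<close>. The list contains each direction \<open>i\<close>
  exactly \<open>\<kappa> i\<close> times; by symmetry of mixed partial derivatives its order is irrelevant.\<close>

definition multi_deriv :: "('n::finite \<Rightarrow> nat) \<Rightarrow> (real ^ 'n \<Rightarrow> real) \<Rightarrow> real ^ 'n \<Rightarrow> real" where
  "multi_deriv \<kappa> \<phi> = foldr partial_deriv (SOME is. \<forall>i. count_list is i = \<kappa> i) \<phi>"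

definition test_function :: "(real ^ 'n::finite \<Rightarrow> real) \<Rightarrow> bool" where
  "test_function \<phi> \<longleftrightarrow> smooth \<phi> \<and> compact (closure {x. \<phi> x \<noteq> 0})"

definition loc_integrable :: "(real ^ 'n::finite \<Rightarrow> real) \<Rightarrow> bool" where
  "loc_integrable f \<longleftrightarrow> (\<forall>K. compact K \<longrightarrow> set_integrable lborel K f)"

definition has_weak_deriv ::
    "('n::finite \<Rightarrow> nat) \<Rightarrow> (real ^ 'n \<Rightarrow> real) \<Rightarrow> (real ^ 'n \<Rightarrow> real) \<Rightarrow> bool" where
  "has_weak_deriv \<kappa> f g \<longleftrightarrow> loc_integrable f \<and> loc_integrable g \<and>
     (\<forall>\<phi>. test_function \<phi> \<longrightarrow>
        (\<integral>x. f x * multi_deriv \<kappa> \<phi> x \<partial>lborel) = (-1) ^ mdeg \<kappa> * (\<integral>x. g x * \<phi> x \<partial>lborel))"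

text \<open>The normalized weak derivative \<open>D\<^sup>\<kappa> f\<close>. Weak derivatives are unique up to null sets, so the
  choice of representative does not affect integrals; in particular \<open>D\<^sup>0 f = f\<close> almost everywhere.\<close>

definition D :: "('n::finite \<Rightarrow> nat) \<Rightarrow> (real ^ 'n \<Rightarrow> real) \<Rightarrow> real ^ 'n \<Rightarrow> real" where
  "D \<kappa> f x = (\<Prod>i\<in>UNIV. 1 / sqrt (fact (\<kappa> i))) * (SOME g. has_weak_deriv \<kappa> f g) x"

definition Hspace :: "nat \<Rightarrow> (real ^ 'n::finite \<Rightarrow> real) set" where
  "Hspace k = {f \<in> L2. \<forall>\<kappa>. mdeg \<kappa> \<le> k \<longrightarrow> (\<exists>g. has_weak_deriv \<kappa> f g) \<and> D \<kappa> f \<in> L2}"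

text \<open>The pointwise norm \<open>|\<nabla>\<^sup>k f|\<close> of the family of all \<open>D\<^sup>\<kappa> f\<close> with \<open>|\<kappa>| = k\<close>.\<close>

definition grad_norm :: "nat \<Rightarrow> (real ^ 'n::finite \<Rightarrow> real) \<Rightarrow> real ^ 'n \<Rightarrow> real" where
  "grad_norm k f x = sqrt (\<Sum>\<kappa> | mdeg \<kappa> = k. (D \<kappa> f x)\<^sup>2)"

subsection \<open>High-degree weight\<close>

definition null_space :: "nat \<Rightarrow> (real ^ 'n::finite \<Rightarrow> real) set" where
  "null_space k = {g \<in> Hspace k. \<forall>\<kappa>. mdeg \<kappa> = k \<longrightarrow> (AE x in gauss. D \<kappa> g x = 0)}"

text \<open>The component of \<open>f\<close> orthogonal to the null space of \<open>\<nabla>\<^sup>k\<close>. The null space is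
  finite-dimensional in \<open>L\<^sup>2\<close> (polynomials of degree less than \<open>k\<close>, up to null sets), so this
  component exists; it is unique up to null sets.\<close>

definition high_part :: "nat \<Rightarrow> (real ^ 'n::finite \<Rightarrow> real) \<Rightarrow> real ^ 'n \<Rightarrow> real" where
  "high_part k f = (SOME h. h \<in> L2 \<and> (\<lambda>x. f x - h x) \<in> null_space k \<and>
                            (\<forall>g\<in>null_space k. L2_inner h g = 0))"

definition W :: "nat \<Rightarrow> (real ^ 'n::finite \<Rightarrow> real) \<Rightarrow> real" where
  "W k f = (Lp_norm 2 (high_part k f))\<^sup>2"

text \<open>In bounds of the form \<open>W k f * (1 + 1 / (2 * k) * ln (1 / W k f)) powr (k * p / 2)\<close>, the
  factor \<open>W k f\<close> makes the value \<open>0\<close> if \<open>W k f = 0\<close>; for \<open>k = 0\<close>, \<open>x / 0 = 0\<close> gives bracket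
  \<open>1\<close>, whose power is \<open>1 powr 0 = 1\<close>. So the usual conventions hold without case distinctions.\<close>

subsection \<open>Constants\<close>

text \<open>The supremum is attained for \<open>1 \<le> p < 2\<close>, as the quotient is bounded, continuous and tends
  to \<open>0\<close> both at \<open>0\<close> and at infinity. At \<open>x = 0\<close> the quotient is \<open>0 / 0 = 0\<close>, its limit there.\<close>

definition M_const :: "real \<Rightarrow> real" where
  "M_const p = p * 2 powr (- p / 2) * (SUP x\<in>{0..}. (1 - exp (- x)) / x powr (p / 2))"

definition C_const :: "real \<Rightarrow> real" where
  "C_const p = (M_const p powr (- 2 / p) + p / (2 * exp 1 * (2 - p))) powr (- p / 2)"

end

theory Submission
  imports Defs "HOL-Real_Asymp.Real_Asymp"
begin

text \<open>
Let \<open>OU r\<close> be the Ornstein-Uhlenbeck operator, \<open>corr r f g\<close> the inner product of \<open>f\<close> with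
\<open>OU r g\<close>, and let \<open>T r\<close> be the sum of \<open>corr r (D \<kappa> f) (D \<kappa> f)\<close> over all \<open>\<kappa>\<close> of degree \<open>k\<close>
(\<open>phi k f f r\<close> below). The corresponding sum over degree \<open>j\<close> has derivative \<open>j + 1\<close> times the sum over
degree \<open>j + 1\<close> (\<open>phi_DERIV\<close>), so Taylor's formula on \<open>[0, r]\<close>, with \<open>r\<close> tending to \<open>1\<close>, shows that,
for \<open>f\<close> bounded by \<open>1\<close>, \<open>W k f\<close> is the integral of \<open>k (1 - r)\<^sup>k\<^sup>-\<^sup>1 T r\<close> over \<open>[0, 1]\<close> (\<open>corr_Taylor\<close>, \<open>W_eq\<close>). The theorem
is therefore a matter of bounding \<open>T\<close> from above by the moment \<open>N\<close> of the gradient.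

There are two bounds on \<open>T\<close>. Integration by parts identifies \<open>OU r (D \<kappa> f) x\<close> with a rescaled Hermite
coefficient of the bounded function that sends \<open>z\<close> to \<open>f (r x + sqrt (1 - r\<^sup>2) z)\<close>; Bessel's inequality then
bounds the smoothed gradient by \<open>(1 - r\<^sup>2)\<close> to the power \<open>- k / 2\<close>, and interpolation between this sup bound
and \<open>L\<^sup>p\<close> gives \<open>T r \<le> N (1 - r\<^sup>2)\<close> to the power \<open>- k (2 - p) / 2\<close> (\<open>corr_sum_le\<close>). This alone yields the
theorem without the logarithm. The logarithm comes from hypercontractivity: passing from correlation \<open>r\<close> to
\<open>r (1 - \<alpha>) / (1 + \<alpha>)\<close> replaces \<open>L\<^sup>2\<close> norms by norms with exponent \<open>2 / (1 + \<alpha>)\<close>, and these are again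
interpolated between \<open>L\<^sup>p\<close> and \<open>L\<^sup>2\<close> (\<open>corr_sum_hypercontractive\<close>).

To combine the bounds, put \<open>U u = (T (1 - u) / W)\<close> to the power \<open>1 / k\<close>. If \<open>P\<close> is nonnegative at \<open>0\<close> and
its derivative dominates \<open>U\<close>, then \<open>P u \<ge> u U u\<close> because \<open>U\<close> is nonincreasing, hence \<open>k u\<^sup>k\<^sup>-\<^sup>1 U\<^sup>k\<close> is at most
the derivative of \<open>P\<^sup>k\<close>, and the integral formula for \<open>W\<close> forces \<open>P 1 \<ge> 1\<close> (\<open>supersolution_ge_1\<close>). This
statement is free of \<open>k\<close>. If \<open>(N / W)\<close> to the power \<open>1 / k\<close> were too small, an explicit \<open>P\<close> built from the two
bounds would have \<open>P 1 < 1\<close> (\<open>growth_lower_bound\<close>); the last step of that computation is a polynomial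
inequality in two variables, visible from its Bernstein expansion (\<open>final_polynomial_less\<close>). The elementary
inequality \<open>ln y \<le> y / e\<close> turns the outcome into the form with \<open>C_const\<close> (\<open>W_bound\<close>).

For the second inequality the two bounds are applied to each \<open>D \<kappa> f\<close> separately and summed over the at most
\<open>(n + k - 1) choose k\<close> multi-indices of degree \<open>k\<close>.
\<close>

section \<open>The Gaussian measure\<close>

text \<open>Gaussian densities, Hermite polynomials and test functions are all used in this product form, which reduces
  statements about them to one variable.\<close>
definition tens :: "('n::finite => real => real) => real ^ 'n => real" where
  "tens u x = (\<Prod>i\<in>UNIV. u i (x $ i))"

lemma borel_measurable_tens [measurable]:
  assumes "\<And>i. u i \<in> borel_measurable borel"
  shows "tens u \<in> borel_measurable borel"
proof -
  have "(\<lambda>x. u i (x $ i)) \<in> borel_measurable borel" for i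
    using assms[of i] by measurable
  then show ?thesis unfolding tens_def by measurable
qed

text \<open>\<open>lborel\<close> on a Euclidean space is a product measure over the standard basis.\<close>
lemma lborel_tens:
  fixes u :: "'n::finite => real => real"
  assumes "\<And>i. integrable lborel (u i)"
  shows "integrable lborel (tens u)" "(\<integral>x. tens u x \<partial>lborel) = (\<Prod>i\<in>UNIV. \<integral>t. u i t \<partial>lborel)"
proof -
  define ix :: "real ^ 'n => 'n" where "ix b = (THE i. b = axis i 1)" for b
  have ix: "ix (axis i 1) = i" for i :: 'n
    unfolding ix_def by (auto simp: axis_eq_axis)
  have B: "Basis = range (\<lambda>i::'n. axis i (1::real))"
    by (auto simp: Basis_vec_def)
  have inj: "inj (\<lambda>i::'n. axis i (1::real))" by (auto simp: inj_def axis_eq_axis)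
  interpret product_sigma_finite "\<lambda>_::real^'n. lborel :: real measure" ..
  have T: "tens u (\<Sum>b\<in>Basis. f b *\<^sub>R b) = (\<Prod>b\<in>Basis. u (ix b) (f b))" for f :: "real^'n => real"
  proof -
    have "(\<Sum>b\<in>Basis. f b *\<^sub>R b) $ i = f (axis i 1)" for i :: 'n
    proof -
      have "(\<Sum>b\<in>Basis. f b *\<^sub>R b) $ i = (\<Sum>b\<in>Basis. f b *\<^sub>R b) \<bullet> axis i 1"
        by (simp add: inner_axis)
      also have "... = f (axis i 1)"
        by (subst inner_sum_left_Basis) (auto simp: B)
      finally show ?thesis .
    qed
    then show ?thesis unfolding tens_def B
      by (subst prod.reindex[OF inj]) (simp add: ix)
  qed
  have m: "(\<lambda>f. \<Sum>b\<in>Basis. f b *\<^sub>R b) \<in> measurable (\<Pi>\<^sub>M b\<in>Basis. lborel) (borel :: (real^'n) measure)"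
    by measurable
  have mu: "tens u \<in> borel_measurable borel"
    using assms by (intro borel_measurable_tens) auto
  have i: "integrable (\<Pi>\<^sub>M b\<in>Basis. lborel) (\<lambda>f. \<Prod>b\<in>Basis. u (ix b) (f b :: real))"
    by (intro product_integrable_prod) (use assms in auto)
  show "integrable lborel (tens u)"
    unfolding lborel_eq[where 'a="real^'n"]
    by (subst integrable_distr_eq[OF m mu]) (use i in \<open>simp add: T\<close>)
  have "(\<integral>x. tens u x \<partial>lborel) = (\<integral>f. (\<Prod>b\<in>Basis. u (ix b) (f b)) \<partial>(\<Pi>\<^sub>M b\<in>Basis. lborel))"
    unfolding lborel_eq[where 'a="real^'n"]
    by (subst integral_distr[OF m mu]) (simp add: T)
  also have "... = (\<Prod>b\<in>Basis. \<integral>t. u (ix b) t \<partial>lborel)"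
    by (intro product_integral_prod) (use assms in auto)
  also have "... = (\<Prod>i\<in>UNIV. \<integral>t. u i t \<partial>lborel)"
    unfolding B by (subst prod.reindex[OF inj]) (simp add: ix)
  finally show "(\<integral>x. tens u x \<partial>lborel) = (\<Prod>i\<in>UNIV. \<integral>t. u i t \<partial>lborel)" .
qed

lemma norm_vec_squared: "(norm (x :: real ^ 'n::finite))\<^sup>2 = (\<Sum>i\<in>UNIV. (x $ i)\<^sup>2)"
  by (simp add: norm_vec_def L2_set_def sum_nonneg)

lemma gauss_density_eq_tens: "gauss_density = tens (\<lambda>_. std_normal_density)"
proof
  fix x :: "real ^ 'n"
  have "(\<Prod>i::'n\<in>UNIV. 1 / sqrt (2 * pi)) = (2 * pi) powr (- real CARD('n) / 2)"
  proof -
    have "1 / sqrt (2*pi) = (2*pi) powr (-1/2)"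
      by (simp add: powr_minus_divide powr_half_sqrt)
    then have "(\<Prod>i::'n\<in>UNIV. 1 / sqrt (2 * pi)) = ((2*pi) powr (-1/2)) powr real CARD('n)"
      by (simp add: powr_realpow)
    also have "... = (2 * pi) powr (- real CARD('n) / 2)"
      by (simp only: powr_powr) simp
    finally show ?thesis .
  qed
  moreover have "(\<Prod>i\<in>UNIV. exp (- (x $ i)\<^sup>2 / 2)) = exp (- (norm x)\<^sup>2 / 2)"
    by (simp add: norm_vec_squared exp_sum[symmetric] sum_negf sum_divide_distrib)
  ultimately show "gauss_density x = tens (\<lambda>_. std_normal_density) x"
    unfolding gauss_density_def tens_def std_normal_density_def prod.distrib by simp
qed

lemma gauss_density_pos [simp]: "gauss_density x > 0"
  by (simp add: gauss_density_def)

lemma gauss_density_nonneg [simp]: "gauss_density x \<ge> 0"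
  using gauss_density_pos[of x] by linarith

lemma borel_measurable_gauss_density [measurable]: "gauss_density \<in> borel_measurable borel"
  unfolding gauss_density_def[abs_def] by measurable

lemma sets_gauss [simp, measurable_cong]: "sets gauss = sets borel"
  by (simp add: gauss_def)

lemma space_gauss [simp]: "space gauss = UNIV"
  by (simp add: gauss_def)

lemma integrable_gauss_iff:
  assumes "f \<in> borel_measurable borel"
  shows "integrable gauss (f :: real^'n::finite => real) \<longleftrightarrow> integrable lborel (\<lambda>x. gauss_density x * f x)"
  unfolding gauss_def using assms by (subst integrable_density) auto

lemma integral_gauss_eq:
  assumes "f \<in> borel_measurable borel"
  shows "(\<integral>x. f x \<partial>gauss) = (\<integral>x. gauss_density x * (f x :: real) \<partial>lborel)"
  unfolding gauss_def using assms by (subst integral_density) auto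

lemma nn_integral_gauss_eq:
  assumes "f \<in> borel_measurable borel"
  shows "(\<integral>\<^sup>+x. f x \<partial>gauss) = (\<integral>\<^sup>+x. ennreal (gauss_density x) * f x \<partial>lborel)"
  unfolding gauss_def using assms by (subst nn_integral_density) auto

lemma AE_gauss_iff: "(AE x in gauss. P x) \<longleftrightarrow> (AE x in lborel. P x)"
  unfolding gauss_def by (subst AE_density) auto

lemma tens_mult: "tens u x * tens v x = tens (\<lambda>i t. u i t * v i t) x"
  by (simp add: tens_def prod.distrib)

lemma gauss_tens:
  fixes u :: "'n::finite => real => real"
  assumes [measurable]: "\<And>i. u i \<in> borel_measurable borel"
    and "\<And>i. integrable lborel (\<lambda>t. std_normal_density t * u i t)"
  shows "integrable gauss (tens u)"
    "(\<integral>x. tens u x \<partial>gauss) = (\<Prod>i\<in>UNIV. \<integral>t. std_normal_density t * u i t \<partial>lborel)"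
proof -
  have [measurable]: "tens u \<in> borel_measurable borel" using assms(1) by (rule borel_measurable_tens)
  show "integrable gauss (tens u)"
    by (subst integrable_gauss_iff) (simp_all add: gauss_density_eq_tens tens_mult lborel_tens(1) assms(2))
  show "(\<integral>x. tens u x \<partial>gauss) = (\<Prod>i\<in>UNIV. \<integral>t. std_normal_density t * u i t \<partial>lborel)"
    by (subst integral_gauss_eq) (simp_all add: gauss_density_eq_tens tens_mult lborel_tens(2) assms(2))
qed

lemma prob_space_gauss: "prob_space (gauss :: (real^'n::finite) measure)"
proof
  have 1: "integrable lborel std_normal_density" by simp
  have "emeasure gauss (space (gauss :: (real^'n) measure)) = (\<integral>\<^sup>+x. ennreal (gauss_density (x::real^'n)) \<partial>lborel)"
    by (simp add: gauss_def emeasure_density)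
  also have "... = ennreal (\<integral>x. gauss_density (x::real^'n) \<partial>lborel)"
    by (intro nn_integral_eq_integral) (use lborel_tens(1)[OF 1] in \<open>auto simp: gauss_density_eq_tens[symmetric]\<close>)
  also have "(\<integral>x. gauss_density (x::real^'n) \<partial>lborel) = 1"
    unfolding gauss_density_eq_tens by (subst lborel_tens(2)) auto
  finally show "emeasure gauss (space (gauss :: (real^'n) measure)) = 1" by simp
qed

interpretation gauss: prob_space "gauss :: (real^'n::finite) measure"
  by (rule prob_space_gauss)

interpretation gauss2: pair_prob_space "gauss :: (real^'n::finite) measure" "gauss :: (real^'n::finite) measure"
  by unfold_locales

lemma nn_integral_lborel_affine:
  fixes \<mu> :: "'a::euclidean_space"
  assumes [measurable]: "f \<in> borel_measurable borel" and "s \<noteq> 0"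
  shows "(\<integral>\<^sup>+y. f y \<partial>lborel) = ennreal (\<bar>s\<bar> ^ DIM('a)) * (\<integral>\<^sup>+z. f (\<mu> + s *\<^sub>R z) \<partial>lborel)"
  by (subst lborel_affine[OF assms(2), of \<mu>])
    (simp add: nn_integral_density nn_integral_distr nn_integral_cmult)

lemma lborel_affine_integrable:
  fixes \<mu> :: "'a::euclidean_space" and f :: "'a => real"
  assumes [measurable]: "f \<in> borel_measurable borel" and "s \<noteq> 0"
  shows "integrable lborel f \<longleftrightarrow> integrable lborel (\<lambda>z. f (\<mu> + s *\<^sub>R z))"
  using assms(2)
  by (subst lborel_affine[OF assms(2), of \<mu>]) (simp add: integrable_density integrable_distr_eq)

lemma lborel_affine_integral:
  fixes \<mu> :: "'a::euclidean_space" and f :: "'a => real"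
  assumes [measurable]: "f \<in> borel_measurable borel" and "s \<noteq> 0"
  shows "(\<integral>y. f y \<partial>lborel) = \<bar>s\<bar> ^ DIM('a) * (\<integral>z. f (\<mu> + s *\<^sub>R z) \<partial>lborel)"
  using assms(2)
  by (subst lborel_affine[OF assms(2), of \<mu>]) (simp add: integral_density integral_distr)

lemma gauss_density_rot:
  fixes x z :: "real^'n::finite"
  assumes "c\<^sup>2 + s\<^sup>2 = 1"
  shows "gauss_density (c *\<^sub>R x + s *\<^sub>R z) * gauss_density (s *\<^sub>R x - c *\<^sub>R z) = gauss_density x * gauss_density z"
proof -
  have "(norm (c *\<^sub>R x + s *\<^sub>R z))\<^sup>2 + (norm (s *\<^sub>R x - c *\<^sub>R z))\<^sup>2 = (c\<^sup>2+s\<^sup>2) * ((norm x)\<^sup>2 + (norm z)\<^sup>2)"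
    unfolding power2_norm_eq_inner
    by (simp add: inner_add_left inner_add_right inner_diff_left inner_diff_right inner_commute algebra_simps power2_eq_square)
  then have *: "(norm (c *\<^sub>R x + s *\<^sub>R z))\<^sup>2 + (norm (s *\<^sub>R x - c *\<^sub>R z))\<^sup>2 = (norm x)\<^sup>2 + (norm z)\<^sup>2"
    using assms by simp
  have e: "gauss_density u * gauss_density v
      = ((2 * pi) powr (- real CARD('n) / 2))\<^sup>2 * exp (- ((norm u)\<^sup>2 + (norm v)\<^sup>2) / 2)" for u v :: "real^'n"
  proof -
    have "exp (- ((norm u)\<^sup>2 + (norm v)\<^sup>2) / 2) = exp (- (norm u)\<^sup>2 / 2) * exp (- (norm v)\<^sup>2 / 2)"
      by (subst exp_add[symmetric]) (simp add: add_divide_distrib diff_divide_distrib)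
    then show ?thesis unfolding gauss_density_def by (simp add: power2_eq_square)
  qed
  show ?thesis by (simp only: e *)
qed

text \<open>Rotation invariance of a pair of independent Gaussians. The map is written as a reflection, which is its own
  inverse; it is split into two affine substitutions, each in one of the two vectors, so that only
  translations and dilations of Lebesgue measure occur.\<close>
lemma nn_integral_gauss_rot:
  fixes H :: "real^'n::finite => real^'n => ennreal"
  assumes [measurable]: "case_prod H \<in> borel_measurable (borel \<Otimes>\<^sub>M borel)"
    and cs: "c\<^sup>2 + s\<^sup>2 = 1" "s > 0"
  shows "(\<integral>\<^sup>+x. \<integral>\<^sup>+z. H (c *\<^sub>R x + s *\<^sub>R z) (s *\<^sub>R x - c *\<^sub>R z) \<partial>gauss \<partial>gauss) = (\<integral>\<^sup>+x. \<integral>\<^sup>+z. H x z \<partial>gauss \<partial>gauss)"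
proof -
  let ?g = "\<lambda>x::real^'n. ennreal (gauss_density x)"
  let ?n = "DIM(real^'n)"
  define G where "G a b = ?g a * ?g b * H a b" for a b
  have [measurable]: "case_prod G \<in> borel_measurable (borel \<Otimes>\<^sub>M borel)"
    unfolding G_def[abs_def] by measurable
  have dbl: "(\<integral>\<^sup>+x. \<integral>\<^sup>+z. K x z \<partial>gauss \<partial>gauss) = (\<integral>\<^sup>+x. \<integral>\<^sup>+z. ?g x * ?g z * K x z \<partial>lborel \<partial>lborel)"
    if [measurable]: "case_prod K \<in> borel_measurable (borel \<Otimes>\<^sub>M borel)" for K :: "real^'n => real^'n => ennreal"
    by (simp add: nn_integral_gauss_eq nn_integral_cmult[symmetric] mult.assoc)
  have "(\<integral>\<^sup>+x. \<integral>\<^sup>+z. H (c *\<^sub>R x + s *\<^sub>R z) (s *\<^sub>R x - c *\<^sub>R z) \<partial>gauss \<partial>gauss)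
     = (\<integral>\<^sup>+x. \<integral>\<^sup>+z. G (c *\<^sub>R x + s *\<^sub>R z) (s *\<^sub>R x - c *\<^sub>R z) \<partial>lborel \<partial>lborel)"
    by (subst dbl) (simp_all add: G_def ennreal_mult[symmetric] gauss_density_rot[OF cs(1)])
  also have "... = (\<integral>\<^sup>+x. \<integral>\<^sup>+y. ennreal ((1/s) ^ ?n) * G y ((1/s) *\<^sub>R (x - c *\<^sub>R y)) \<partial>lborel \<partial>lborel)"
  proof (rule nn_integral_cong)
    fix x :: "real^'n"
    have "(\<integral>\<^sup>+z. G (c *\<^sub>R x + s *\<^sub>R z) (s *\<^sub>R x - c *\<^sub>R z) \<partial>lborel)
       = ennreal (\<bar>1/s\<bar> ^ ?n) * (\<integral>\<^sup>+y. G (c *\<^sub>R x + s *\<^sub>R (-(c/s) *\<^sub>R x + (1/s) *\<^sub>R y)) (s *\<^sub>R x - c *\<^sub>R (-(c/s) *\<^sub>R x + (1/s) *\<^sub>R y)) \<partial>lborel)"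
      using cs by (intro nn_integral_lborel_affine) auto
    also have "(\<lambda>y. c *\<^sub>R x + s *\<^sub>R (-(c/s) *\<^sub>R x + (1/s) *\<^sub>R y)) = (\<lambda>y. y)"
      using cs by (intro ext) (simp add: algebra_simps)
    also have "(\<lambda>y. s *\<^sub>R x - c *\<^sub>R (-(c/s) *\<^sub>R x + (1/s) *\<^sub>R y)) = (\<lambda>y. (1/s) *\<^sub>R (x - c *\<^sub>R y))"
    proof
      fix y
      have "s + c * c / s = 1 / s" using cs by (simp add: field_simps power2_eq_square)
      then have "s *\<^sub>R x + (c * c / s) *\<^sub>R x = (1/s) *\<^sub>R x" by (metis scaleR_add_left)
      then show "s *\<^sub>R x - c *\<^sub>R (-(c/s) *\<^sub>R x + (1/s) *\<^sub>R y) = (1/s) *\<^sub>R (x - c *\<^sub>R y)"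
        by (simp add: scaleR_diff_right algebra_simps)
    qed
    finally show "(\<integral>\<^sup>+z. G (c *\<^sub>R x + s *\<^sub>R z) (s *\<^sub>R x - c *\<^sub>R z) \<partial>lborel) = (\<integral>\<^sup>+y. ennreal ((1/s) ^ ?n) * G y ((1/s) *\<^sub>R (x - c *\<^sub>R y)) \<partial>lborel)"
      using cs by (simp add: nn_integral_cmult)
  qed
  also have "... = (\<integral>\<^sup>+y. \<integral>\<^sup>+x. ennreal ((1/s) ^ ?n) * G y ((1/s) *\<^sub>R (x - c *\<^sub>R y)) \<partial>lborel \<partial>lborel)"
    by (rule lborel_pair.Fubini') measurable
  also have "... = (\<integral>\<^sup>+y. \<integral>\<^sup>+w. G y w \<partial>lborel \<partial>lborel)"
  proof (rule nn_integral_cong)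
    fix y :: "real^'n"
    have "(\<integral>\<^sup>+x. ennreal ((1/s) ^ ?n) * G y ((1/s) *\<^sub>R (x - c *\<^sub>R y)) \<partial>lborel)
      = ennreal (\<bar>s\<bar> ^ ?n) * (\<integral>\<^sup>+w. ennreal ((1/s) ^ ?n) * G y ((1/s) *\<^sub>R ((c *\<^sub>R y + s *\<^sub>R w) - c *\<^sub>R y)) \<partial>lborel)"
      using cs by (intro nn_integral_lborel_affine) auto
    also have "... = ennreal (s ^ ?n) * (ennreal ((1/s) ^ ?n) * (\<integral>\<^sup>+w. G y w \<partial>lborel))"
      using cs by (simp add: nn_integral_cmult)
    also have "... = (\<integral>\<^sup>+w. G y w \<partial>lborel)"
      using cs by (simp add: mult.assoc[symmetric] ennreal_mult[symmetric] power_one_over)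
    finally show "(\<integral>\<^sup>+x. ennreal ((1/s) ^ ?n) * G y ((1/s) *\<^sub>R (x - c *\<^sub>R y)) \<partial>lborel) = (\<integral>\<^sup>+w. G y w \<partial>lborel)" .
  qed
  also have "... = (\<integral>\<^sup>+x. \<integral>\<^sup>+z. H x z \<partial>gauss \<partial>gauss)"
    unfolding G_def by (subst dbl) simp_all
  finally show ?thesis .
qed

lemma distr_gauss_rot:
  assumes cs: "c\<^sup>2 + s\<^sup>2 = 1" "s > 0"
  shows "distr (gauss \<Otimes>\<^sub>M gauss) (borel \<Otimes>\<^sub>M borel) (\<lambda>(x, z). (c *\<^sub>R x + s *\<^sub>R z, s *\<^sub>R x - c *\<^sub>R z))
    = (gauss \<Otimes>\<^sub>M gauss :: ((real^'n::finite) \<times> (real^'n)) measure)"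
proof (rule measure_eqI)
  have S: "sets (borel \<Otimes>\<^sub>M borel) = sets (gauss \<Otimes>\<^sub>M gauss :: ((real^'n) \<times> (real^'n)) measure)"
    by (intro sets_pair_measure_cong) auto
  show "sets (distr (gauss \<Otimes>\<^sub>M gauss) (borel \<Otimes>\<^sub>M borel) (\<lambda>(x, z). (c *\<^sub>R x + s *\<^sub>R z, s *\<^sub>R x - c *\<^sub>R z)))
    = sets (gauss \<Otimes>\<^sub>M gauss :: ((real^'n) \<times> (real^'n)) measure)"
    unfolding sets_distr by (rule S)
  fix A :: "((real^'n) \<times> (real^'n)) set"
  assume "A \<in> sets (distr (gauss \<Otimes>\<^sub>M gauss) (borel \<Otimes>\<^sub>M borel) (\<lambda>(x, z). (c *\<^sub>R x + s *\<^sub>R z, s *\<^sub>R x - c *\<^sub>R z)))"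
  then have A [measurable]: "A \<in> sets (borel \<Otimes>\<^sub>M borel)" by simp
  have A': "A \<in> sets (gauss \<Otimes>\<^sub>M gauss)" using A unfolding S .
  have "emeasure (distr (gauss \<Otimes>\<^sub>M gauss) (borel \<Otimes>\<^sub>M borel) (\<lambda>(x, z). (c *\<^sub>R x + s *\<^sub>R z, s *\<^sub>R x - c *\<^sub>R z))) A
     = (\<integral>\<^sup>+p. indicator A (fst p, snd p) \<partial>distr (gauss \<Otimes>\<^sub>M gauss) (borel \<Otimes>\<^sub>M borel) (\<lambda>(x, z). (c *\<^sub>R x + s *\<^sub>R z, s *\<^sub>R x - c *\<^sub>R z)))"
    by simp
  also have "... = (\<integral>\<^sup>+p. indicator A (c *\<^sub>R fst p + s *\<^sub>R snd p, s *\<^sub>R fst p - c *\<^sub>R snd p) \<partial>(gauss \<Otimes>\<^sub>M gauss))"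
    by (subst nn_integral_distr) (auto simp: split_beta)
  also have "... = (\<integral>\<^sup>+x. \<integral>\<^sup>+z. indicator A (c *\<^sub>R x + s *\<^sub>R z, s *\<^sub>R x - c *\<^sub>R z) \<partial>gauss \<partial>gauss)"
    by (subst gauss.nn_integral_fst[symmetric]) auto
  also have "... = (\<integral>\<^sup>+x. \<integral>\<^sup>+z. indicator A (x, z) \<partial>gauss \<partial>gauss)"
    by (rule nn_integral_gauss_rot[OF _ cs]) auto
  also have "... = emeasure (gauss \<Otimes>\<^sub>M gauss) A"
    by (rule gauss.emeasure_pair_measure[OF A', symmetric])
  finally show "emeasure (distr (gauss \<Otimes>\<^sub>M gauss) (borel \<Otimes>\<^sub>M borel) (\<lambda>(x, z). (c *\<^sub>R x + s *\<^sub>R z, s *\<^sub>R x - c *\<^sub>R z))) A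
     = emeasure (gauss \<Otimes>\<^sub>M gauss) A" .
qed

section \<open>Square-integrable functions and the Ornstein-Uhlenbeck semigroup\<close>

lemma gauss_prob_UNIV [simp]: "measure (gauss :: (real^'n::finite) measure) UNIV = 1"
  using gauss.prob_space by simp

lemma abs_mult_le_sum_squares: "\<bar>a * b\<bar> \<le> a\<^sup>2 + (b::real)\<^sup>2"
proof -
  have "2 * (\<bar>a\<bar> * \<bar>b\<bar>) \<le> a\<^sup>2 + b\<^sup>2" using sum_squares_bound[of "\<bar>a\<bar>" "\<bar>b\<bar>"] by (simp add: mult.assoc)
  moreover have "0 \<le> \<bar>a\<bar> * \<bar>b\<bar>" by simp
  ultimately show ?thesis unfolding abs_mult by linarith
qed

lemma gauss_rot_integrable:
  fixes K :: "(real^'n::finite) \<times> (real^'n) => real"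
  assumes cs: "c\<^sup>2 + s\<^sup>2 = 1" "s > 0" and [measurable]: "K \<in> borel_measurable (borel \<Otimes>\<^sub>M borel)"
  shows "integrable (gauss \<Otimes>\<^sub>M gauss) (\<lambda>(x,z). K (c *\<^sub>R x + s *\<^sub>R z, s *\<^sub>R x - c *\<^sub>R z)) \<longleftrightarrow> integrable (gauss \<Otimes>\<^sub>M gauss) K"
    and "(\<integral>p. (case p of (x,z) => K (c *\<^sub>R x + s *\<^sub>R z, s *\<^sub>R x - c *\<^sub>R z)) \<partial>(gauss \<Otimes>\<^sub>M gauss)) = (\<integral>p. K p \<partial>(gauss \<Otimes>\<^sub>M gauss))"
proof -
  let ?R = "\<lambda>(x::real^'n, z::real^'n). (c *\<^sub>R x + s *\<^sub>R z, s *\<^sub>R x - c *\<^sub>R z)"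
  have R: "?R \<in> measurable (gauss \<Otimes>\<^sub>M gauss) (borel \<Otimes>\<^sub>M borel)" by measurable
  have eq: "(\<lambda>(x,z). K (c *\<^sub>R x + s *\<^sub>R z, s *\<^sub>R x - c *\<^sub>R z)) = (\<lambda>p. K (?R p))" by auto
  show "integrable (gauss \<Otimes>\<^sub>M gauss) (\<lambda>(x,z). K (c *\<^sub>R x + s *\<^sub>R z, s *\<^sub>R x - c *\<^sub>R z)) \<longleftrightarrow> integrable (gauss \<Otimes>\<^sub>M gauss) K"
    unfolding eq by (subst (2) distr_gauss_rot[OF cs, symmetric]) (rule integrable_distr_eq[OF R assms(3), symmetric])
  show "(\<integral>p. (case p of (x,z) => K (c *\<^sub>R x + s *\<^sub>R z, s *\<^sub>R x - c *\<^sub>R z)) \<partial>(gauss \<Otimes>\<^sub>M gauss)) = (\<integral>p. K p \<partial>(gauss \<Otimes>\<^sub>M gauss))"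
    unfolding eq by (subst (2) distr_gauss_rot[OF cs, symmetric]) (rule integral_distr[OF R assms(3), symmetric])
qed

lemma gauss_fst_integrable:
  fixes g :: "real^'n::finite => real"
  assumes g: "integrable gauss g"
  shows "integrable (gauss \<Otimes>\<^sub>M (gauss :: (real^'m::finite) measure)) (\<lambda>p. g (fst p))"
    "(\<integral>p. g (fst p) \<partial>(gauss \<Otimes>\<^sub>M (gauss :: (real^'m::finite) measure))) = (\<integral>x. g x \<partial>gauss)"
proof -
  interpret P: pair_prob_space "gauss :: (real^'n) measure" "gauss :: (real^'m) measure" by unfold_locales
  have [measurable]: "g \<in> borel_measurable borel" using borel_measurable_integrable[OF g] by simp
  show 1: "integrable (gauss \<Otimes>\<^sub>M (gauss :: (real^'m::finite) measure)) (\<lambda>p. g (fst p))"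
    by (intro P.Fubini_integrable) (use g in \<open>auto simp: gauss.prob_space\<close>)
  show "(\<integral>p. g (fst p) \<partial>(gauss \<Otimes>\<^sub>M (gauss :: (real^'m::finite) measure))) = (\<integral>x. g x \<partial>gauss)"
    using P.integral_fst[of "\<lambda>x z. g x"] 1 by (simp add: split_beta' gauss.prob_space)
qed

lemma gauss_mix_integrable:
  fixes g :: "real^'n::finite => real"
  assumes cs: "c\<^sup>2 + s\<^sup>2 = 1" "s > 0" and g: "integrable gauss g"
  shows "integrable (gauss \<Otimes>\<^sub>M gauss) (\<lambda>(x,z). g (c *\<^sub>R x + s *\<^sub>R z))"
    "(\<integral>p. (case p of (x,z) => g (c *\<^sub>R x + s *\<^sub>R z)) \<partial>(gauss \<Otimes>\<^sub>M gauss)) = (\<integral>x. g x \<partial>gauss)"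
proof -
  have [measurable]: "g \<in> borel_measurable borel" using borel_measurable_integrable[OF g] by simp
  show "integrable (gauss \<Otimes>\<^sub>M gauss) (\<lambda>(x,z). g (c *\<^sub>R x + s *\<^sub>R z))"
    using gauss_rot_integrable(1)[OF cs, of "\<lambda>p. g (fst p)"] gauss_fst_integrable(1)[OF g] by simp
  show "(\<integral>p. (case p of (x,z) => g (c *\<^sub>R x + s *\<^sub>R z)) \<partial>(gauss \<Otimes>\<^sub>M gauss)) = (\<integral>x. g x \<partial>gauss)"
    using gauss_rot_integrable(2)[OF cs, of "\<lambda>p. g (fst p)"] gauss_fst_integrable(2)[OF g] by simp
qed

lemma L2_borel [measurable_dest]: "f \<in> L2 ==> f \<in> borel_measurable borel"
  by (simp add: L2_def)

lemma L2_sq: "f \<in> L2 ==> integrable gauss (\<lambda>x. (f x)\<^sup>2)"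
  by (simp add: L2_def)

lemma L2_mult:
  assumes f: "f \<in> L2" and g: "g \<in> L2"
  shows "integrable gauss (\<lambda>x. f x * g x)"
proof (rule Bochner_Integration.integrable_bound)
  show "integrable gauss (\<lambda>x. (f x)\<^sup>2 + (g x)\<^sup>2)" using f g by (intro Bochner_Integration.integrable_add L2_sq)
  show "(\<lambda>x. f x * g x) \<in> borel_measurable gauss" using f g by measurable
  show "AE x in gauss. norm (f x * g x) \<le> norm ((f x)\<^sup>2 + (g x)\<^sup>2)"
    using abs_mult_le_sum_squares by auto
qed

lemma L2_const [simp]: "(\<lambda>_. c) \<in> L2"
  by (simp add: L2_def)

lemma L2_integrable: "f \<in> L2 ==> integrable gauss f"
  using L2_mult[of f "\<lambda>_. 1"] by simp

lemma L2_cmult: "f \<in> L2 ==> (\<lambda>x. c * f x) \<in> L2"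
  by (auto simp: L2_def power_mult_distrib)

lemma L2_add: "f \<in> L2 ==> g \<in> L2 ==> (\<lambda>x. f x + g x) \<in> L2"
  using L2_mult[of f g] L2_sq[of f] L2_sq[of g]
  by (auto simp: L2_def power2_sum mult.assoc)

lemma L2_diff: "f \<in> L2 ==> g \<in> L2 ==> (\<lambda>x. f x - g x) \<in> L2"
  using L2_add[of f "\<lambda>x. (-1) * g x"] L2_cmult[of g "-1"] by simp

lemma L2_sum: "finite I ==> (\<And>i. i \<in> I ==> f i \<in> L2) ==> (\<lambda>x. \<Sum>i\<in>I. f i x) \<in> L2"
  by (induction I rule: finite_induct) (auto intro: L2_add)

lemma L2_bounded:
  assumes [measurable]: "f \<in> borel_measurable borel" and "\<And>x. \<bar>f x\<bar> \<le> C"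
  shows "f \<in> L2"
proof -
  have "(f x)\<^sup>2 \<le> C\<^sup>2" for x using assms(2)[of x] by (metis abs_ge_zero power2_abs power_mono)
  then show ?thesis by (auto simp: L2_def intro!: gauss.integrable_const_bound[where B="C\<^sup>2"])
qed

lemma L2_AE_cong:
  assumes "f \<in> L2" "g \<in> borel_measurable borel" "AE x in gauss. f x = g x"
  shows "g \<in> L2"
proof -
  have "integrable gauss (\<lambda>x. (g x)\<^sup>2)"
    by (rule integrable_cong_AE_imp[OF L2_sq[OF assms(1)]]) (use assms in auto)
  then show ?thesis using assms(2) by (simp add: L2_def)
qed

lemma integrable_exp_neg_norm:
  assumes "c > 0"
  shows "integrable lborel (\<lambda>x::real^'n::finite. exp (- c * (norm x)\<^sup>2))"
proof -
  have "integrable lborel (\<lambda>t::real. exp (- c * t\<^sup>2))"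
  proof -
    have "(\<lambda>t. sqrt (2 * pi * (1/(2*c))) * normal_density 0 (sqrt (1/(2*c))) t) = (\<lambda>t. exp (- c * t\<^sup>2))"
      using assms by (intro ext) (simp add: normal_density_def real_sqrt_divide power_divide real_sqrt_mult power_mult_distrib)
    moreover have "integrable lborel (\<lambda>t. sqrt (2 * pi * (1/(2*c))) * normal_density 0 (sqrt (1/(2*c))) t)"
      using assms by (intro integrable_mult_right integrable_normal_density) simp
    ultimately show ?thesis by simp
  qed
  then have "integrable lborel (tens (\<lambda>(_::'n) t. exp (- c * t\<^sup>2)))" by (rule lborel_tens(1))
  moreover have "tens (\<lambda>(_::'n) t. exp (- c * t\<^sup>2)) = (\<lambda>x::real^'n. exp (- c * (norm x)\<^sup>2))"
    by (intro ext) (simp add: tens_def norm_vec_squared exp_sum[symmetric] sum_distrib_left)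
  ultimately show ?thesis by simp
qed

text \<open>Lebesgue integrability follows from Cauchy-Schwarz: the square of \<open>g\<close> absorbs the weight
  \<open>exp (- (norm y)\<^sup>2 / 2)\<close>, so half of that exponent is spent on \<open>g\<close> and
  anything beyond \<open>1/4\<close> is left for integrability.\<close>
lemma L2_integrable_weight:
  assumes g: "g \<in> L2" and c: "c > 1/4"
  shows "integrable lborel (\<lambda>y::real^'n::finite. g y * exp (- c * (norm y)\<^sup>2))"
proof (rule Bochner_Integration.integrable_bound)
  have m: "(\<lambda>x. (g x)\<^sup>2) \<in> borel_measurable borel" using g by measurable
  have "integrable lborel (\<lambda>x. gauss_density x * (g x)\<^sup>2)"
    using L2_sq[OF g] integrable_gauss_iff[OF m] by simp
  then have "integrable lborel (\<lambda>x. (1 / (2 * pi) powr (- real CARD('n) / 2)) * (gauss_density x * (g x)\<^sup>2))"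
    by (rule integrable_mult_right)
  then have "integrable lborel (\<lambda>x. exp (- (norm x)\<^sup>2 / 2) * (g x)\<^sup>2)"
    by (simp add: gauss_density_def)
  moreover have "integrable lborel (\<lambda>x::real^'n. exp (- (2*c - 1/2) * (norm x)\<^sup>2))"
    by (rule integrable_exp_neg_norm) (use c in simp)
  ultimately show "integrable lborel (\<lambda>x. exp (- (norm x)\<^sup>2 / 2) * (g x)\<^sup>2 + exp (- (2*c - 1/2) * (norm x)\<^sup>2))"
    by (rule Bochner_Integration.integrable_add)
  show "(\<lambda>y. g y * exp (- c * (norm y)\<^sup>2)) \<in> borel_measurable lborel" using g by measurable
  have "\<bar>g x\<bar> * exp (- c * (norm x)\<^sup>2) \<le> exp (- (norm x)\<^sup>2 / 2) * (g x)\<^sup>2 + exp (- (2*c - 1/2) * (norm x)\<^sup>2)" for x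
  proof -
    define u where "u = \<bar>g x\<bar> * exp (- (1/4) * (norm x)\<^sup>2)"
    define v where "v = exp (- (c - 1/4) * (norm x)\<^sup>2)"
    have "u * v \<le> u\<^sup>2 + v\<^sup>2"
      using abs_mult_le_sum_squares[of u v] by simp
    moreover have "u * v = \<bar>g x\<bar> * exp (- c * (norm x)\<^sup>2)"
      unfolding u_def v_def mult.assoc by (subst exp_add[symmetric]) (simp add: algebra_simps)
    moreover have "u\<^sup>2 = exp (- (norm x)\<^sup>2 / 2) * (g x)\<^sup>2"
      unfolding u_def power_mult_distrib by (simp add: exp_double[symmetric] power2_abs)
    moreover have "v\<^sup>2 = exp (- (2*c - 1/2) * (norm x)\<^sup>2)"
      unfolding v_def by (simp add: exp_double[symmetric] algebra_simps)
    ultimately show ?thesis by simp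
  qed
  then show "AE x in lborel. norm (g x * exp (- c * (norm x)\<^sup>2)) \<le> norm (exp (- (norm x)\<^sup>2 / 2) * (g x)\<^sup>2 + exp (- (2*c - 1/2) * (norm x)\<^sup>2))"
    by (auto simp: abs_mult)
qed

text \<open>Substituting \<open>z = (y - \<mu>) / s\<close> with \<open>s \<le> 1\<close> costs only a constant in the
  Gaussian weight. The exponent \<open>15/32\<close> is \<open>1/2 - 1/32\<close>, which leaves room for
  polynomial factors, and \<open>3/8\<close> still exceeds the threshold \<open>1/4\<close> of
  \<open>L2_integrable_weight\<close>.\<close>
lemma affine_weight_le:
  fixes y \<mu> z :: "'a::real_inner"
  assumes "y = \<mu> + s *\<^sub>R z" "0 < s" "s \<le> 1"
  shows "exp (- (15/32) * (norm z)\<^sup>2) \<le> exp ((15/8) * (norm \<mu>)\<^sup>2) * exp (- (3/8) * (norm y)\<^sup>2)"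
proof -
  have "y - \<mu> = s *\<^sub>R z" using assms by simp
  then have "norm (y - \<mu>) = s * norm z" using assms by simp
  then have 1: "norm (y - \<mu>) \<le> norm z" using assms by (simp add: mult_left_le_one_le)
  have "0 \<le> (norm (y - 5 *\<^sub>R \<mu>))\<^sup>2" by simp
  also have "... = 5 * (norm (y - \<mu>))\<^sup>2 - 4 * (norm y)\<^sup>2 + 20 * (norm \<mu>)\<^sup>2"
    unfolding power2_norm_eq_inner by (simp add: inner_diff_left inner_diff_right inner_commute algebra_simps)
  finally have "(norm y)\<^sup>2 * (4/5) - 4 * (norm \<mu>)\<^sup>2 \<le> (norm (y - \<mu>))\<^sup>2" by simp
  also have "... \<le> (norm z)\<^sup>2" using 1 by (simp add: power_mono)
  finally have "- (15/32) * (norm z)\<^sup>2 \<le> (15/8) * (norm \<mu>)\<^sup>2 + - (3/8) * (norm y)\<^sup>2" by simp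
  then show ?thesis by (simp only: exp_add[symmetric] exp_le_cancel_iff)
qed

text \<open>Since \<open>s \<le> 1\<close>, this holds for every centre \<open>\<mu>\<close>, not only for almost every
  one; all pointwise identities for the semigroup below rely on that.\<close>
lemma L2_affine_integrable:
  fixes g q :: "real^'n::finite => real"
  assumes g: "g \<in> L2" and s: "0 < s" "s \<le> 1"
    and q [measurable]: "q \<in> borel_measurable borel" and qb: "\<And>z. \<bar>q z\<bar> \<le> C * exp ((norm z)\<^sup>2 / 32)"
  shows "integrable gauss (\<lambda>z. g (\<mu> + s *\<^sub>R z) * q z)"
proof -
  have [measurable]: "g \<in> borel_measurable borel" using g by measurable
  define c0 where "c0 = (2 * pi) powr (- real CARD('n) / 2)"
  have c0: "c0 > 0" by (simp add: c0_def)
  have C: "C \<ge> 0" using order_trans[OF abs_ge_zero qb[of 0]] by simp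
  have "integrable lborel (\<lambda>y. g y * exp (- (3/8) * (norm y)\<^sup>2))" by (rule L2_integrable_weight[OF g]) simp
  then have "integrable lborel (\<lambda>z. g (\<mu> + s *\<^sub>R z) * exp (- (3/8) * (norm (\<mu> + s *\<^sub>R z))\<^sup>2))"
    using s by (subst lborel_affine_integrable[symmetric]) auto
  then have 1: "integrable lborel (\<lambda>z. (c0 * C * exp ((15/8) * (norm \<mu>)\<^sup>2)) * (g (\<mu> + s *\<^sub>R z) * exp (- (3/8) * (norm (\<mu> + s *\<^sub>R z))\<^sup>2)))"
    by (rule integrable_mult_right)
  have "integrable lborel (\<lambda>z. gauss_density z * (g (\<mu> + s *\<^sub>R z) * q z))"
  proof (rule Bochner_Integration.integrable_bound[OF 1])
    show "AE z in lborel. norm (gauss_density z * (g (\<mu> + s *\<^sub>R z) * q z))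
      \<le> norm ((c0 * C * exp ((15/8) * (norm \<mu>)\<^sup>2)) * (g (\<mu> + s *\<^sub>R z) * exp (- (3/8) * (norm (\<mu> + s *\<^sub>R z))\<^sup>2)))"
    proof (intro AE_I2)
      fix z :: "real^'n"
      have "gauss_density z * \<bar>q z\<bar> \<le> c0 * exp (- (norm z)\<^sup>2 / 2) * (C * exp ((norm z)\<^sup>2 / 32))"
        unfolding gauss_density_def c0_def by (intro mult_left_mono qb) auto
      also have "... = c0 * C * exp (- (15/32) * (norm z)\<^sup>2)"
        by (simp add: mult.assoc mult.left_commute exp_add[symmetric])
      also have "... \<le> c0 * C * (exp ((15/8) * (norm \<mu>)\<^sup>2) * exp (- (3/8) * (norm (\<mu> + s *\<^sub>R z))\<^sup>2))"
        using c0 C s by (intro mult_left_mono affine_weight_le) auto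
      finally have "\<bar>g (\<mu> + s *\<^sub>R z)\<bar> * (gauss_density z * \<bar>q z\<bar>)
        \<le> \<bar>g (\<mu> + s *\<^sub>R z)\<bar> * (c0 * C * (exp ((15/8) * (norm \<mu>)\<^sup>2) * exp (- (3/8) * (norm (\<mu> + s *\<^sub>R z))\<^sup>2)))"
        by (intro mult_left_mono) auto
      then show "norm (gauss_density z * (g (\<mu> + s *\<^sub>R z) * q z))
      \<le> norm ((c0 * C * exp ((15/8) * (norm \<mu>)\<^sup>2)) * (g (\<mu> + s *\<^sub>R z) * exp (- (3/8) * (norm (\<mu> + s *\<^sub>R z))\<^sup>2)))"
        using c0 C by (simp add: abs_mult mult_ac)
    qed
  qed measurable
  then show ?thesis by (subst integrable_gauss_iff) auto
qed

lemma L2_affine_integrable1: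
  assumes "g \<in> L2" "0 < s" "s \<le> 1"
  shows "integrable gauss (\<lambda>z. g (\<mu> + s *\<^sub>R z))"
  using L2_affine_integrable[OF assms, of "\<lambda>_. 1" 1 \<mu>] by simp

text \<open>Mehler's formula for the Ornstein-Uhlenbeck semigroup, with the correlation instead of the time as
  parameter.\<close>
definition OU :: "real => (real^'n::finite => real) => real^'n => real" where
  "OU r g x = (\<integral>z. g (r *\<^sub>R x + sqrt (1 - r\<^sup>2) *\<^sub>R z) \<partial>gauss)"

lemma borel_measurable_OU [measurable]:
  assumes [measurable]: "g \<in> borel_measurable borel"
  shows "OU r g \<in> borel_measurable borel"
  unfolding OU_def[abs_def] by measurable

lemma OU_cs:
  assumes "0 \<le> r" "r < 1"
  shows "r\<^sup>2 + (sqrt (1 - r\<^sup>2))\<^sup>2 = 1" "sqrt (1 - r\<^sup>2) > 0" "sqrt (1 - r\<^sup>2) \<le> 1"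
  using assms by (auto simp: abs_square_less_1 power_le_one)

lemma OU_integrable:
  assumes "g \<in> L2" "0 \<le> r" "r < 1"
  shows "integrable gauss (\<lambda>z. g (r *\<^sub>R x + sqrt (1 - r\<^sup>2) *\<^sub>R z))"
  using assms OU_cs by (intro L2_affine_integrable1) auto

lemma OU_1: "OU 1 g = g"
  by (intro ext) (simp add: OU_def gauss.prob_space)

text \<open>Both sides average over a Gaussian vector; two independent Gaussian increments add up to one, by rotation
  invariance.\<close>
lemma OU_semigroup:
  assumes g: "g \<in> L2" and c: "0 \<le> c" "c \<le> 1" and d: "0 \<le> d" "d < 1"
  shows "OU c (OU d g) x = OU (c * d) g x"
proof (cases "c = 1")
  case False
  then have c1: "c < 1" using c by simp
  have cd: "0 \<le> c * d" "c * d < 1" using c d by (auto intro: mult_le_less_imp_less[of c 1 d 1, simplified] simp: mult_le_one)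
     (metis c1 c(1) d mult_left_le_one_le order_le_less_trans less_eq_real_def mult.commute)+
  define S where "S = sqrt (1 - (c*d)\<^sup>2)"
  define sc where "sc = sqrt (1 - c\<^sup>2)"
  define sd where "sd = sqrt (1 - d\<^sup>2)"
  have S: "S > 0" "S \<le> 1" "S\<^sup>2 = 1 - (c*d)\<^sup>2" and sd: "sd > 0" "sd\<^sup>2 = 1 - d\<^sup>2" and sc: "sc\<^sup>2 = 1 - c\<^sup>2"
    using OU_cs[OF cd] OU_cs[OF d] OU_cs[OF c(1) c1] unfolding S_def sd_def sc_def by auto
  have ab: "(d * sc / S)\<^sup>2 + (sd / S)\<^sup>2 = 1" "sd / S > 0"
    using S sd sc by (auto simp: power_divide add_divide_distrib[symmetric] power_mult_distrib divide_simps) (simp add: algebra_simps)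
  define g' where "g' v = g ((c*d) *\<^sub>R x + S *\<^sub>R v)" for v
  have g'i: "integrable gauss g'"
    unfolding g'_def S_def by (rule OU_integrable[OF g cd])
  have "OU c (OU d g) x = (\<integral>z. \<integral>z'. g (d *\<^sub>R (c *\<^sub>R x + sc *\<^sub>R z) + sd *\<^sub>R z') \<partial>gauss \<partial>gauss)"
    by (simp add: OU_def sc_def sd_def)
  also have "... = (\<integral>z. \<integral>z'. g' ((d * sc / S) *\<^sub>R z + (sd / S) *\<^sub>R z') \<partial>gauss \<partial>gauss)"
    using S by (simp add: g'_def algebra_simps)
  also have "... = (\<integral>p. (case p of (z,z') => g' ((d * sc / S) *\<^sub>R z + (sd / S) *\<^sub>R z')) \<partial>(gauss \<Otimes>\<^sub>M gauss))"
    by (rule gauss2.integral_fst) (rule gauss_mix_integrable(1)[OF ab g'i])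
  also have "... = (\<integral>v. g' v \<partial>gauss)" by (rule gauss_mix_integrable(2)[OF ab g'i])
  also have "... = OU (c * d) g x" by (simp add: OU_def g'_def S_def)
  finally show ?thesis .
qed (simp add: OU_1)

lemma corr_integrable:
  assumes f: "f \<in> L2" and g: "g \<in> L2" and r: "0 \<le> r" "r < 1"
  shows "integrable (gauss \<Otimes>\<^sub>M gauss) (\<lambda>(x,z). f x * g (r *\<^sub>R x + sqrt (1 - r\<^sup>2) *\<^sub>R z))"
proof (rule Bochner_Integration.integrable_bound)
  have [measurable]: "f \<in> borel_measurable borel" "g \<in> borel_measurable borel" using f g by auto
  have "integrable (gauss \<Otimes>\<^sub>M gauss) (\<lambda>p. (f (fst p))\<^sup>2)"
    using gauss_fst_integrable(1)[OF L2_sq[OF f]] .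
  moreover have "integrable (gauss \<Otimes>\<^sub>M gauss) (\<lambda>(x,z). (g (r *\<^sub>R x + sqrt (1 - r\<^sup>2) *\<^sub>R z))\<^sup>2)"
    using gauss_mix_integrable(1)[OF OU_cs(1,2)[OF r] L2_sq[OF g]] .
  ultimately show "integrable (gauss \<Otimes>\<^sub>M gauss) (\<lambda>p. (f (fst p))\<^sup>2 + (case p of (x,z) => (g (r *\<^sub>R x + sqrt (1 - r\<^sup>2) *\<^sub>R z))\<^sup>2))"
    by (rule Bochner_Integration.integrable_add)
  show "AE p in gauss \<Otimes>\<^sub>M gauss. norm (case p of (x, z) => f x * g (r *\<^sub>R x + sqrt (1 - r\<^sup>2) *\<^sub>R z))
     \<le> norm ((f (fst p))\<^sup>2 + (case p of (x,z) => (g (r *\<^sub>R x + sqrt (1 - r\<^sup>2) *\<^sub>R z))\<^sup>2))"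
    using abs_mult_le_sum_squares by (auto simp: split_beta)
  show "(\<lambda>(x, z). f x * g (r *\<^sub>R x + sqrt (1 - r\<^sup>2) *\<^sub>R z)) \<in> borel_measurable (gauss \<Otimes>\<^sub>M gauss)" by measurable
qed

text \<open>The covariance form of a pair of standard Gaussian vectors with correlation \<open>r\<close>.\<close>
definition corr :: "real => (real^'n::finite => real) => (real^'n => real) => real" where
  "corr r f g = (\<integral>x. f x * OU r g x \<partial>gauss)"

lemma corr_pair:
  assumes f: "f \<in> L2" and g: "g \<in> L2" and r: "0 \<le> r" "r < 1"
  shows "corr r f g = (\<integral>p. (case p of (x,z) => f x * g (r *\<^sub>R x + sqrt (1 - r\<^sup>2) *\<^sub>R z)) \<partial>(gauss \<Otimes>\<^sub>M gauss))"
    and "integrable gauss (\<lambda>x. f x * OU r g x)"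
proof -
  note i = corr_integrable[OF assms]
  have "corr r f g = (\<integral>x. \<integral>z. f x * g (r *\<^sub>R x + sqrt (1 - r\<^sup>2) *\<^sub>R z) \<partial>gauss \<partial>gauss)"
    by (simp add: corr_def OU_def)
  also have "... = (\<integral>p. (case p of (x,z) => f x * g (r *\<^sub>R x + sqrt (1 - r\<^sup>2) *\<^sub>R z)) \<partial>(gauss \<Otimes>\<^sub>M gauss))"
    by (rule gauss2.integral_fst[OF i])
  finally show "corr r f g = (\<integral>p. (case p of (x,z) => f x * g (r *\<^sub>R x + sqrt (1 - r\<^sup>2) *\<^sub>R z)) \<partial>(gauss \<Otimes>\<^sub>M gauss))" .
  have "integrable gauss (\<lambda>x. \<integral>z. f x * g (r *\<^sub>R x + sqrt (1 - r\<^sup>2) *\<^sub>R z) \<partial>gauss)"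
    by (rule gauss2.integrable_fst[OF i])
  then show "integrable gauss (\<lambda>x. f x * OU r g x)" by (simp add: OU_def)
qed

text \<open>The reflection of the Gaussian pair interchanges the two correlated vectors.\<close>
lemma corr_sym:
  assumes f: "f \<in> L2" and g: "g \<in> L2" and r: "0 \<le> r" "r < 1"
  shows "corr r f g = corr r g f"
proof -
  have [measurable]: "f \<in> borel_measurable borel" "g \<in> borel_measurable borel" using f g by auto
  define s where "s = sqrt (1 - r\<^sup>2)"
  have cs: "r\<^sup>2 + s\<^sup>2 = 1" "s > 0" using OU_cs[OF r] by (auto simp: s_def)
  have e: "r *\<^sub>R (r *\<^sub>R x + s *\<^sub>R z) + s *\<^sub>R (s *\<^sub>R x - r *\<^sub>R z) = x" for x z :: "real^'n"
  proof -
    have "r *\<^sub>R (r *\<^sub>R x + s *\<^sub>R z) + s *\<^sub>R (s *\<^sub>R x - r *\<^sub>R z) = (r\<^sup>2 + s\<^sup>2) *\<^sub>R x"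
      by (simp add: algebra_simps power2_eq_square)
    then show ?thesis using cs by simp
  qed
  have "corr r g f = (\<integral>p. (case p of (x,z) => g x * f (r *\<^sub>R x + s *\<^sub>R z)) \<partial>(gauss \<Otimes>\<^sub>M gauss))"
    unfolding s_def by (rule corr_pair(1)[OF g f r])
  also have "... = (\<integral>p. (case p of (x,z) => (case (r *\<^sub>R x + s *\<^sub>R z, s *\<^sub>R x - r *\<^sub>R z) of (x,z) => g x * f (r *\<^sub>R x + s *\<^sub>R z))) \<partial>(gauss \<Otimes>\<^sub>M gauss))"
    by (rule gauss_rot_integrable(2)[OF cs, symmetric]) measurable
  also have "... = (\<integral>p. (case p of (x,z) => f x * g (r *\<^sub>R x + s *\<^sub>R z)) \<partial>(gauss \<Otimes>\<^sub>M gauss))"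
    by (simp add: e mult.commute)
  also have "... = corr r f g" unfolding s_def by (rule corr_pair(1)[OF f g r, symmetric])
  finally show ?thesis by simp
qed

text \<open>Jensen's inequality and invariance of the Gaussian measure.\<close>
lemma OU_L2:
  assumes g: "g \<in> L2" and r: "0 \<le> r" "r < 1"
  shows "OU r g \<in> L2" and OU_L2_le: "(\<integral>x. (OU r g x)\<^sup>2 \<partial>gauss) \<le> (\<integral>x. (g x)\<^sup>2 \<partial>gauss)"
proof -
  have [measurable]: "g \<in> borel_measurable borel" using g by auto
  note i = gauss_mix_integrable[OF OU_cs(1,2)[OF r] L2_sq[OF g]]
  have P: "AE x in gauss. integrable gauss (\<lambda>z. (g (r *\<^sub>R x + sqrt (1 - r\<^sup>2) *\<^sub>R z))\<^sup>2)"
    using gauss2.AE_integrable_fst[OF i(1)] .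
  have J: "AE x in gauss. (OU r g x)\<^sup>2 \<le> OU r (\<lambda>x. (g x)\<^sup>2) x"
    using P
  proof eventually_elim
    case (elim x)
    let ?h = "\<lambda>z. g (r *\<^sub>R x + sqrt (1 - r\<^sup>2) *\<^sub>R z)"
    have h: "integrable gauss ?h" by (rule OU_integrable[OF g r])
    have "0 \<le> (\<integral>z. (?h z - OU r g x)\<^sup>2 \<partial>gauss)" by simp
    also have "... = (\<integral>z. (?h z)\<^sup>2 \<partial>gauss) - (OU r g x)\<^sup>2"
      using elim h by (simp add: power2_diff gauss.prob_space OU_def power2_eq_square[of "integral\<^sup>L gauss _"])
    finally show ?case by (simp add: OU_def)
  qed
  have Pi: "integrable gauss (OU r (\<lambda>x. (g x)\<^sup>2))"
    using gauss2.integrable_fst[OF i(1)] by (simp add: OU_def[abs_def])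
  have I: "integrable gauss (\<lambda>x. (OU r g x)\<^sup>2)"
    by (rule Bochner_Integration.integrable_bound[OF Pi]) (use J in \<open>auto\<close>)
  then show "OU r g \<in> L2" by (simp add: L2_def)
  have "(\<integral>x. (OU r g x)\<^sup>2 \<partial>gauss) \<le> (\<integral>x. OU r (\<lambda>x. (g x)\<^sup>2) x \<partial>gauss)"
    by (rule integral_mono_AE[OF I Pi J])
  also have "... = (\<integral>x. (g x)\<^sup>2 \<partial>gauss)"
    using gauss2.integral_fst[OF i(1)] i(2) by (simp add: OU_def)
  finally show "(\<integral>x. (OU r g x)\<^sup>2 \<partial>gauss) \<le> (\<integral>x. (g x)\<^sup>2 \<partial>gauss)" .
qed

lemma corr_split:
  assumes f: "f \<in> L2" and g: "g \<in> L2" and c: "0 \<le> c" "c < 1" and d: "0 \<le> d" "d < 1"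
  shows "corr (c * d) f g = (\<integral>x. OU c f x * OU d g x \<partial>gauss)"
proof -
  have "corr (c * d) f g = corr c f (OU d g)"
    using OU_semigroup[OF g c(1) _ d] c by (simp add: corr_def)
  also have "... = corr c (OU d g) f" by (rule corr_sym[OF f OU_L2(1)[OF g d] c])
  also have "... = (\<integral>x. OU c f x * OU d g x \<partial>gauss)" by (simp add: corr_def mult.commute)
  finally show ?thesis .
qed

text \<open>This makes the form positive semidefinite for nonnegative correlation.\<close>
lemma corr_sqrt:
  assumes f: "f \<in> L2" and r: "0 \<le> r" "r < 1"
  shows "corr r f f = (\<integral>x. (OU (sqrt r) f x)\<^sup>2 \<partial>gauss)"
  using corr_split[OF f f, of "sqrt r" "sqrt r"] r by (simp add: power2_eq_square)

lemma corr_nonneg: "f \<in> L2 ==> 0 \<le> r ==> r < 1 ==> 0 \<le> corr r f f"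
  by (simp add: corr_sqrt)

lemma corr_mono:
  assumes f: "f \<in> L2" and r: "0 \<le> r" "r \<le> r'" "r' < 1"
  shows "corr r f f \<le> corr r' f f"
proof (cases "r = r'")
  case False
  define c where "c = sqrt (r / r')"
  have rp: "r' > 0" using r False by simp
  have c: "0 \<le> c" "c < 1" using r False rp by (auto simp: c_def)
  have e: "c * sqrt r' = sqrt r" using rp r by (simp add: c_def real_sqrt_divide)
  have "OU (sqrt r) f = OU c (OU (sqrt r') f)"
    using OU_semigroup[OF f c(1) _ , of "sqrt r'"] c r e by (intro ext) auto
  then have "corr r f f = (\<integral>x. (OU c (OU (sqrt r') f) x)\<^sup>2 \<partial>gauss)"
    using corr_sqrt[OF f, of r] r by simp
  also have "... \<le> (\<integral>x. (OU (sqrt r') f x)\<^sup>2 \<partial>gauss)"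
    using r by (intro OU_L2_le c OU_L2(1) f) auto
  also have "... = corr r' f f" using corr_sqrt[OF f, of r'] r by simp
  finally show ?thesis .
qed simp

section \<open>Weak derivatives tested against Hermite functions\<close>

text \<open>A function together with all its derivatives, as one sequence. Closure under products
  (\<open>dfam_leib\<close>) and affine substitutions replaces a theory of smooth functions of one variable.\<close>
definition dfam :: "(nat => real => real) => bool" where
  "dfam U \<longleftrightarrow> (\<forall>j t. (U j has_real_derivative U (Suc j) t) (at t))"

lemma dfamD: "dfam U ==> (U j has_real_derivative U (Suc j) t) (at t)"
  by (simp add: dfam_def)

lemma dfam_continuous: "dfam U ==> continuous_on UNIV (U j)"
  by (intro continuous_at_imp_continuous_on ballI DERIV_isCont[OF dfamD])

lemma dfam_borel: "dfam U ==> U j \<in> borel_measurable borel"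
  by (intro borel_measurable_continuous_onI dfam_continuous)

lemma tens_has_derivative:
  fixes U :: "'n::finite => nat => real => real"
  assumes "\<And>l. dfam (U l)"
  shows "(tens (\<lambda>l. U l (m l)) has_derivative
     (\<lambda>h. \<Sum>i\<in>UNIV. U i (Suc (m i)) (x $ i) * h $ i * (\<Prod>l\<in>UNIV - {i}. U l (m l) (x $ l)))) (at x)"
  unfolding tens_def[abs_def]
proof (rule has_derivative_prod)
  fix i
  have "((\<lambda>x. x $ i) has_derivative (\<lambda>h. h $ i)) (at x)"
    by (rule bounded_linear.has_derivative[OF bounded_linear_vec_nth has_derivative_ident])
  then show "((\<lambda>x. U i (m i) (x $ i)) has_derivative (\<lambda>h. U i (Suc (m i)) (x $ i) * h $ i)) (at x)"
    by (rule has_derivative_compose[OF _ dfamD[OF assms, unfolded has_field_derivative_def]])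
qed

lemma partial_deriv_tens:
  fixes U :: "'n::finite => nat => real => real"
  assumes "\<And>l. dfam (U l)"
  shows "partial_deriv i (tens (\<lambda>l. U l (m l))) = tens (\<lambda>l. U l (m l + (if l = i then 1 else 0)))"
proof
  fix x :: "real ^ 'n"
  have "partial_deriv i (tens (\<lambda>l. U l (m l))) x
    = (\<Sum>j\<in>UNIV. U j (Suc (m j)) (x $ j) * (axis i 1 :: real^'n) $ j * (\<Prod>l\<in>UNIV - {j}. U l (m l) (x $ l)))"
    unfolding partial_deriv_def
    by (subst frechet_derivative_at[OF tens_has_derivative[OF assms, where m=m and x=x], symmetric]) (rule refl)
  also have "... = (\<Sum>j\<in>UNIV. if j = i then U i (Suc (m i)) (x $ i) * (\<Prod>l\<in>UNIV - {i}. U l (m l) (x $ l)) else 0)"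
    by (intro sum.cong) (auto simp: axis_def)
  also have "... = U i (Suc (m i)) (x $ i) * (\<Prod>l\<in>UNIV - {i}. U l (m l) (x $ l))" by simp
  also have "... = tens (\<lambda>l. U l (m l + (if l = i then 1 else 0))) x"
    unfolding tens_def by (subst prod.remove[of UNIV i]) (auto intro!: arg_cong2[where f="(*)"] prod.cong)
  finally show "partial_deriv i (tens (\<lambda>l. U l (m l))) x = tens (\<lambda>l. U l (m l + (if l = i then 1 else 0))) x" .
qed

lemma foldr_partial_deriv_tens:
  fixes U :: "'n::finite => nat => real => real"
  assumes "\<And>l. dfam (U l)"
  shows "foldr partial_deriv is (tens (\<lambda>l. U l (m l))) = tens (\<lambda>l. U l (m l + count_list is l))"
proof (induction "is")
  case (Cons i "is")
  have "foldr partial_deriv (i # is) (tens (\<lambda>l. U l (m l))) = partial_deriv i (tens (\<lambda>l. U l (m l + count_list is l)))"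
    using Cons by simp
  also have "... = tens (\<lambda>l. U l (m l + count_list is l + (if l = i then 1 else 0)))"
    by (rule partial_deriv_tens[OF assms])
  also have "(\<lambda>l. U l (m l + count_list is l + (if l = i then 1 else 0))) = (\<lambda>l. U l (m l + count_list (i # is) l))"
    by (intro ext) simp
  finally show ?case .
qed simp

lemma smooth_tens:
  fixes U :: "'n::finite => nat => real => real"
  assumes "\<And>l. dfam (U l)"
  shows "smooth (tens (\<lambda>l. U l 0))"
proof -
  have "foldr partial_deriv is (tens (\<lambda>l. U l 0)) differentiable at x" for "is" x
    unfolding foldr_partial_deriv_tens[OF assms, where m="\<lambda>_. 0"] differentiable_def
    by (rule exI, rule tens_has_derivative[OF assms])
  then show ?thesis by (simp add: smooth_def)
qed

text \<open>Multi-derivatives are taken along a chosen list of directions; such a list exists.\<close>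
lemma ex_list_count: "\<exists>is. \<forall>i. count_list is i = (\<kappa> :: 'n::finite => nat) i"
proof -
  obtain xs :: "'n list" where xs: "set xs = UNIV" "distinct xs"
    using finite_distinct_list[of "UNIV::'n set"] by auto
  have r: "count_list (replicate m i) j = (if i = j then m else 0)" for m and i j :: 'n
    by (induction m) auto
  have "distinct xs ==> count_list (concat (map (\<lambda>i. replicate (\<kappa> i) i) xs)) j = (if j \<in> set xs then \<kappa> j else 0)" for j and xs :: "'n list"
    by (induction xs) (auto simp: r)
  from this[OF xs(2)] show ?thesis using xs(1) by auto
qed

lemma multi_deriv_tens:
  fixes U :: "'n::finite => nat => real => real"
  assumes "\<And>l. dfam (U l)"
  shows "multi_deriv \<kappa> (tens (\<lambda>l. U l 0)) = tens (\<lambda>l. U l (\<kappa> l))"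
proof -
  have "count_list (SOME is. \<forall>i. count_list is i = \<kappa> i) i = \<kappa> i" for i
    using someI_ex[OF ex_list_count[of \<kappa>]] by blast
  then show ?thesis
    unfolding multi_deriv_def foldr_partial_deriv_tens[OF assms, where m="\<lambda>_. 0"] by simp
qed

text \<open>Leibniz's rule for the \<open>j\<close>-th derivative of a product, by recursion instead of binomial
  coefficients.\<close>
primrec leib :: "nat => (nat => real) => (nat => real) => real" where
  "leib 0 U V = U 0 * V 0"
| "leib (Suc j) U V = leib j (\<lambda>i. U (Suc i)) V + leib j U (\<lambda>i. V (Suc i))"

lemma dfam_leib:
  assumes "dfam U" "dfam V"
  shows "dfam (\<lambda>j t. leib j (\<lambda>i. U i t) (\<lambda>i. V i t))"
proof -
  have "((\<lambda>t. leib j (\<lambda>i. U i t) (\<lambda>i. V i t)) has_real_derivative leib (Suc j) (\<lambda>i. U i t) (\<lambda>i. V i t)) (at t)"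
    if "dfam U" "dfam V" for j t U V
    using that
  proof (induction j arbitrary: U V)
    case 0
    then show ?case using DERIV_mult[OF dfamD[OF 0(1), of 0 t] dfamD[OF 0(2), of 0 t]] by (simp add: mult.commute add.commute)
  next
    case (Suc j)
    have s: "dfam (\<lambda>i. U (Suc i))" "dfam (\<lambda>i. V (Suc i))" using Suc.prems by (auto simp: dfam_def)
    show ?case
      using DERIV_add[OF Suc.IH[OF s(1) Suc.prems(2)] Suc.IH[OF Suc.prems(1) s(2)]] by simp
  qed
  then show ?thesis using assms by (simp add: dfam_def del: leib.simps)
qed

lemma leib_bound:
  assumes "\<And>i. \<bar>U i\<bar> \<le> A i * w" "\<And>i. \<bar>V i\<bar> \<le> B i" "w \<ge> 0"
  shows "\<bar>leib j U V\<bar> \<le> leib j A B * w"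
  using assms(1,2)
proof (induction j arbitrary: U V A B)
  case 0
  have "\<bar>U 0\<bar> * \<bar>V 0\<bar> \<le> (A 0 * w) * B 0"
    using 0[of 0] by (intro mult_mono) (auto intro: order_trans[OF abs_ge_zero])
  then show ?case by (simp add: abs_mult mult_ac)
next
  case (Suc j)
  have "\<bar>leib j (\<lambda>i. U (Suc i)) V\<bar> \<le> leib j (\<lambda>i. A (Suc i)) B * w" "\<bar>leib j U (\<lambda>i. V (Suc i))\<bar> \<le> leib j A (\<lambda>i. B (Suc i)) * w"
    using Suc.prems by (auto intro!: Suc.IH)
  then show ?case using abs_triangle_ineq[of "leib j (\<lambda>i. U (Suc i)) V" "leib j U (\<lambda>i. V (Suc i))"]
    by (simp add: distrib_right)
qed

lemma leib_tendsto:
  assumes "\<And>i. ((\<lambda>n. U n i) \<longlongrightarrow> u i) F" "\<And>i. ((\<lambda>n. V n i) \<longlongrightarrow> v i) F"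
  shows "((\<lambda>n. leib j (U n) (V n)) \<longlongrightarrow> leib j u v) F"
  using assms
proof (induction j arbitrary: U V u v)
  case 0
  show ?case unfolding leib.simps by (intro tendsto_mult 0)
next
  case (Suc j)
  show ?case unfolding leib.simps by (intro tendsto_add Suc.IH Suc.prems)
qed

lemma leib_zero [simp]: "leib j U (\<lambda>_. 0) = 0"
  by (induction j arbitrary: U) auto

lemma leib_delta: "leib j U (\<lambda>i. if i = 0 then d else 0) = U j * d"
  by (induction j arbitrary: U) auto

lemma dfam_affine:
  assumes "dfam U"
  shows "dfam (\<lambda>j t. m ^ j * U j (m * t + c))"
proof -
  have "((\<lambda>t. m ^ j * U j (m * t + c)) has_real_derivative m ^ j * (U (Suc j) (m * t + c) * m)) (at t)" for j t
    by (rule DERIV_cmult, rule DERIV_chain'[of "\<lambda>t. m * t + c" m t UNIV "U j"])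
      (auto intro!: derivative_eq_intros dfamD[OF assms])
  then show ?thesis by (simp add: dfam_def mult_ac)
qed

lemma dfam_cmult: "dfam U ==> dfam (\<lambda>j t. c * U j t)"
  by (auto simp: dfam_def intro!: DERIV_cmult)

lemma power_le_fact_exp: "0 \<le> (s::real) ==> s ^ i \<le> fact i * exp s"
proof -
  assume s: "0 \<le> s"
  have "sum (\<lambda>n. s ^ n /\<^sub>R fact n) {i} \<le> (\<Sum>n. s ^ n /\<^sub>R fact n)"
    using s by (intro sum_le_suminf) (use summable_exp_generic[of s] in auto)
  then have "s ^ i / fact i \<le> exp s" by (simp add: exp_def divide_inverse mult.commute)
  then show ?thesis by (simp add: field_simps)
qed

lemma poly_le_exp: "\<exists>C\<ge>0. \<forall>s. \<bar>poly P s\<bar> \<le> C * exp \<bar>s::real\<bar>"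
proof -
  have "\<bar>poly P s\<bar> \<le> (\<Sum>i\<le>degree P. \<bar>coeff P i\<bar> * fact i) * exp \<bar>s\<bar>" for s
  proof -
    have "\<bar>poly P s\<bar> \<le> (\<Sum>i\<le>degree P. \<bar>coeff P i * s ^ i\<bar>)"
      unfolding poly_altdef by (rule sum_abs)
    also have "... \<le> (\<Sum>i\<le>degree P. \<bar>coeff P i\<bar> * (fact i * exp \<bar>s\<bar>))"
      unfolding abs_mult power_abs by (intro sum_mono mult_left_mono power_le_fact_exp) auto
    finally show ?thesis by (simp add: sum_distrib_right mult.assoc)
  qed
  then show ?thesis by (intro exI[of _ "\<Sum>i\<le>degree P. \<bar>coeff P i\<bar> * fact i"]) (auto intro: sum_nonneg)
qed

lemma poly_le_exp_square: "\<exists>C\<ge>0. \<forall>s. \<bar>poly P s\<bar> \<le> C * exp (s\<^sup>2 / 32 :: real)"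
proof -
  obtain C where C: "C \<ge> 0" "\<And>s. \<bar>poly P s\<bar> \<le> C * exp \<bar>s\<bar>" using poly_le_exp[of P] by auto
  have "\<bar>poly P s\<bar> \<le> (C * exp 8) * exp (s\<^sup>2 / 32)" for s
  proof -
    have "0 \<le> (\<bar>s\<bar> - 16)\<^sup>2" by simp
    then have "\<bar>s\<bar> \<le> 8 + s\<^sup>2 / 32" by (simp add: power2_diff)
    then have "C * exp \<bar>s\<bar> \<le> C * exp (8 + s\<^sup>2 / 32)" using C(1) by (intro mult_left_mono) auto
    then show ?thesis using C(2)[of s] by (simp add: exp_add mult.assoc)
  qed
  then show ?thesis using C(1) by (intro exI[of _ "C * exp 8"]) auto
qed

text \<open>The polynomial factor, in the variable \<open>1/t\<close>, of the \<open>j\<close>-th derivative of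
  \<open>exp (- 1 / t)\<close>.\<close>
primrec bump_poly :: "nat => real poly" where
  "bump_poly 0 = 1"
| "bump_poly (Suc j) = [:0, 0, 1:] * (bump_poly j - pderiv (bump_poly j))"

definition ebump :: "nat => real => real" where
  "ebump j t = (if t > 0 then poly (bump_poly j) (1/t) * exp (- (1/t)) else 0)"

lemma ebump_bound: "\<exists>B\<ge>0. \<forall>t. \<bar>ebump j t\<bar> \<le> B"
proof -
  obtain C where C: "C \<ge> 0" "\<And>s. \<bar>poly (bump_poly j) s\<bar> \<le> C * exp \<bar>s\<bar>" using poly_le_exp by blast
  have "\<bar>ebump j t\<bar> \<le> C" for t
  proof (cases "t > 0")
    case True
    have "\<bar>ebump j t\<bar> = \<bar>poly (bump_poly j) (1/t)\<bar> * exp (- (1/t))" using True by (simp add: ebump_def abs_mult)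
    also have "... \<le> C * exp \<bar>1/t\<bar> * exp (- (1/t))" by (intro mult_right_mono C) auto
    also have "... = C" using True by (simp add: exp_minus)
    finally show ?thesis .
  qed (use C in \<open>simp add: ebump_def\<close>)
  then show ?thesis using C by auto
qed

text \<open>At \<open>0\<close> the difference quotient vanishes because \<open>exp (- 1 / t)\<close> decays faster than
  any power of \<open>t\<close>.\<close>
lemma dfam_ebump: "dfam ebump"
proof -
  have "(ebump j has_real_derivative ebump (Suc j) t) (at t)" for j t
  proof -
    consider "t > 0" | "t < 0" | "t = 0" by linarith
    then show ?thesis
    proof cases
      case 1
      have "((\<lambda>t. poly (bump_poly j) (1/t) * exp (- (1/t))) has_real_derivative ebump (Suc j) t) (at t)"
      proof -
        have 0: "((\<lambda>t. 1 / t) has_real_derivative - ((1/t)\<^sup>2)) (at t)"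
          using DERIV_inverse[of t] 1 by (simp add: inverse_eq_divide power_one_over power2_eq_square)
        have a: "((\<lambda>t. poly (bump_poly j) (1/t)) has_real_derivative poly (pderiv (bump_poly j)) (1/t) * - ((1/t)\<^sup>2)) (at t)"
          by (rule DERIV_chain'[OF 0 poly_DERIV])
        have b: "((\<lambda>t. exp (- (1/t))) has_real_derivative exp (- (1/t)) * (1/t)\<^sup>2) (at t)"
          using DERIV_chain'[OF DERIV_minus[OF 0] DERIV_exp] by simp
        have e: "ebump (Suc j) t = poly (pderiv (bump_poly j)) (1/t) * - ((1/t)\<^sup>2) * exp (- (1/t)) + exp (- (1/t)) * (1/t)\<^sup>2 * poly (bump_poly j) (1/t)"
          using 1 by (simp add: ebump_def power2_eq_square) (simp add: algebra_simps diff_divide_distrib)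
        show ?thesis unfolding e by (rule DERIV_mult[OF a b])
      qed
      then show ?thesis
        by (rule has_field_derivative_transform_within_open[of _ _ _ "{0<..}"]) (use 1 in \<open>auto simp: ebump_def\<close>)
    next
      case 2
      have "((\<lambda>t. 0) has_real_derivative ebump (Suc j) t) (at t)" using 2 by (simp add: ebump_def)
      then show ?thesis
        by (rule has_field_derivative_transform_within_open[of _ _ _ "{..<0}"]) (use 2 in \<open>auto simp: ebump_def\<close>)
    next
      case 3
      obtain C where C: "C \<ge> 0" "\<And>s. \<bar>poly ([:0,0,1:] * bump_poly j) s\<bar> \<le> C * exp \<bar>s\<bar>" using poly_le_exp by blast
      have b: "\<bar>ebump j h / h\<bar> \<le> C * \<bar>h\<bar>" for h
      proof (cases "h > 0")
        case True
        have "\<bar>ebump j h / h\<bar> = \<bar>poly ([:0,0,1:] * bump_poly j) (1/h)\<bar> * exp (- (1/h)) * h"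
          using True by (simp add: ebump_def abs_mult field_simps power2_eq_square)
        also have "... \<le> C * exp \<bar>1/h\<bar> * exp (- (1/h)) * h" using True by (intro mult_right_mono C) auto
        also have "... = C * \<bar>h\<bar>" using True by (simp add: exp_minus)
        finally show ?thesis .
      next
        case False
        then show ?thesis using mult_nonneg_nonneg[OF C(1) abs_ge_zero[of h]] by (simp add: ebump_def del: mult_nonneg_nonneg)
      qed
      have "((\<lambda>h. ebump j h / h) \<longlongrightarrow> 0) (at 0)"
      proof (rule Lim_null_comparison)
        show "\<forall>\<^sub>F h in at 0. norm (ebump j h / h) \<le> C * \<bar>h\<bar>" using b by (auto intro: always_eventually)
        have "((\<lambda>h. C * \<bar>h\<bar>) \<longlongrightarrow> C * \<bar>0\<bar>) (at 0)" by (intro tendsto_intros)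
        then show "((\<lambda>h. C * \<bar>h\<bar>) \<longlongrightarrow> 0) (at 0)" by simp
      qed
      then show ?thesis unfolding 3 DERIV_def by (simp add: ebump_def)
    qed
  qed
  then show ?thesis by (simp add: dfam_def)
qed

text \<open>A smooth cutoff supported in \<open>[- R, R]\<close>, a product of two copies of \<open>ebump 0\<close>; the
  factor \<open>exp 2\<close> makes it tend to \<open>1\<close> as \<open>R\<close> grows.\<close>
definition cut :: "real => nat => real => real" where
  "cut R j t = exp 2 * leib j (\<lambda>i. (1/R) ^ i * ebump i ((1/R) * t + 1)) (\<lambda>i. (-(1/R)) ^ i * ebump i (-(1/R) * t + 1))"

lemma dfam_cut: "dfam (cut R)"
  unfolding cut_def[abs_def]
  by (rule dfam_cmult, rule dfam_leib)
    (rule dfam_affine[OF dfam_ebump, of "1/R" 1], rule dfam_affine[OF dfam_ebump, of "-(1/R)" 1])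

lemma cut_support: "R > 0 ==> cut R 0 t \<noteq> 0 ==> \<bar>t\<bar> \<le> R"
proof (rule ccontr)
  assume R: "R > 0" and c: "cut R 0 t \<noteq> 0" and "\<not> \<bar>t\<bar> \<le> R"
  then have "t > R \<or> t < - R" by auto
  then have "(1/R) * t + 1 \<le> 0 \<or> -(1/R) * t + 1 \<le> 0"
  proof
    assume "t > R"
    then have "-(1/R) * t + 1 \<le> 0" using R by (simp add: field_simps)
    then show ?thesis ..
  next
    assume "t < - R"
    then have "(1/R) * t + 1 \<le> 0" using R by (simp add: field_simps)
    then show ?thesis ..
  qed
  then have "ebump 0 ((1/R) * t + 1) = 0 \<or> ebump 0 (-(1/R) * t + 1) = 0" by (auto simp: ebump_def)
  then show False using c by (auto simp: cut_def)
qed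

lemma cut_bound: "\<exists>B. \<forall>R\<ge>1. \<forall>j t. \<bar>cut R j t\<bar> \<le> B j"
proof -
  have "\<forall>j. \<exists>B\<ge>0. \<forall>t. \<bar>ebump j t\<bar> \<le> B" using ebump_bound by blast
  then obtain B where B: "\<And>j. B j \<ge> 0" "\<And>j t. \<bar>ebump j t\<bar> \<le> B j" by metis
  have "\<bar>cut R j t\<bar> \<le> exp 2 * leib j B B" if R: "R \<ge> 1" for R j t
  proof -
    have b: "\<bar>c ^ i * ebump i s\<bar> \<le> B i" if "\<bar>c\<bar> \<le> 1" for i c s
    proof -
      have "\<bar>c\<bar> ^ i * \<bar>ebump i s\<bar> \<le> 1 * B i" using that B by (intro mult_mono power_le_one) auto
      then show ?thesis by (simp add: abs_mult power_abs)
    qed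
    have "\<bar>leib j (\<lambda>i. (1/R) ^ i * ebump i ((1/R) * t + 1)) (\<lambda>i. (-(1/R)) ^ i * ebump i (-(1/R) * t + 1))\<bar> \<le> leib j B B * 1"
    proof (rule leib_bound)
      show "\<bar>(1/R) ^ i * ebump i ((1/R) * t + 1)\<bar> \<le> B i * 1" for i using b[of "1/R"] R by simp
      show "\<bar>(-(1/R)) ^ i * ebump i (-(1/R) * t + 1)\<bar> \<le> B i" for i by (rule b) (use R in auto)
    qed simp
    then show ?thesis by (simp add: cut_def abs_mult)
  qed
  then show ?thesis by (intro exI[of _ "\<lambda>j. exp 2 * leib j B B"]) auto
qed

lemma cut_tendsto: "(\<lambda>n. cut (real (Suc n)) j t) \<longlonglongrightarrow> (if j = 0 then 1 else 0)"
proof -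
  have inv: "(\<lambda>n. 1 / real (Suc n)) \<longlonglongrightarrow> 0" using LIMSEQ_inverse_real_of_nat by (simp add: inverse_eq_divide)
  have l: "(\<lambda>n. (c * (1 / real (Suc n))) ^ i * ebump i ((c * (1 / real (Suc n))) * t + 1)) \<longlonglongrightarrow> (if i = 0 then exp (-1) else 0)" for i c
  proof -
    have c0: "(\<lambda>n. c * (1 / real (Suc n))) \<longlonglongrightarrow> c * 0" by (intro tendsto_intros inv)
    have "isCont (ebump i) 1" using dfamD[OF dfam_ebump] by (rule DERIV_isCont)
    moreover have "(\<lambda>n. (c * (1 / real (Suc n))) * t + 1) \<longlonglongrightarrow> c * 0 * t + 1" by (intro tendsto_intros inv)
    ultimately have "(\<lambda>n. ebump i ((c * (1 / real (Suc n))) * t + 1)) \<longlonglongrightarrow> ebump i 1"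
      by (intro isCont_tendsto_compose[of 1 "ebump i"]) auto
    then have "(\<lambda>n. (c * (1 / real (Suc n))) ^ i * ebump i ((c * (1 / real (Suc n))) * t + 1)) \<longlonglongrightarrow> (c * 0) ^ i * ebump i 1"
      by (intro tendsto_mult tendsto_power c0)
    moreover have "(c * 0) ^ i * ebump i 1 = (if i = 0 then exp (-1) else 0)"
      by (auto simp: ebump_def)
    ultimately show ?thesis by simp
  qed
  have "(\<lambda>n. cut (real (Suc n)) j t) \<longlonglongrightarrow> exp 2 * leib j (\<lambda>i. if i = 0 then exp (-1) else 0) (\<lambda>i. if i = 0 then exp (-1) else 0)"
    unfolding cut_def using l[of 1] l[of "-1"] by (intro tendsto_intros leib_tendsto) auto
  moreover have "exp 2 * leib j (\<lambda>i. if i = 0 then exp (-1) else 0) (\<lambda>i. if i = 0 then exp (-1) else (0::real)) = (if j = 0 then 1 else 0)"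
    unfolding leib_delta by (simp add: exp_add[symmetric])
  ultimately show ?thesis by simp
qed

lemma test_function_tens:
  fixes U :: "'n::finite => nat => real => real"
  assumes "\<And>l. dfam (U l)" "\<And>l t. U l 0 t \<noteq> 0 ==> \<bar>t\<bar> \<le> R"
  shows "test_function (tens (\<lambda>l. U l 0))"
  unfolding test_function_def compact_closure
proof
  show "smooth (tens (\<lambda>l. U l 0))" by (rule smooth_tens[OF assms(1)])
  have "norm x \<le> (\<Sum>i\<in>(UNIV::'n set). R)" if "tens (\<lambda>l. U l 0) x \<noteq> 0" for x :: "real^'n"
  proof -
    have "\<bar>x $ i\<bar> \<le> R" for i using that assms(2)[of i "x $ i"] by (auto simp: tens_def)
    then show ?thesis using norm_le_l1_cart[of x] sum_mono[of UNIV "\<lambda>i. \<bar>x $ i\<bar>" "\<lambda>_. R"] by (auto simp del: sum_constant)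
  qed
  then show "bounded {x. tens (\<lambda>l. U l 0) x \<noteq> 0}" by (auto simp: bounded_iff)
qed

lemma tens_weight_bound:
  fixes u :: "'n::finite => real => real"
  assumes "\<And>l t. \<bar>u l t\<bar> \<le> C l * exp (c * t\<^sup>2)"
  shows "\<bar>tens u x\<bar> \<le> (\<Prod>l\<in>UNIV. C l) * exp (c * (norm x)\<^sup>2)"
proof -
  have "\<bar>tens u x\<bar> = (\<Prod>l\<in>UNIV. \<bar>u l (x $ l)\<bar>)" by (simp add: tens_def abs_prod)
  also have "... \<le> (\<Prod>l\<in>UNIV. C l * exp (c * (x $ l)\<^sup>2))" using assms by (intro prod_mono) auto
  also have "... = (\<Prod>l\<in>UNIV. C l) * exp (c * (norm x)\<^sup>2)"
    by (simp add: prod.distrib norm_vec_squared sum_distrib_left exp_sum)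
  finally show ?thesis .
qed

text \<open>The definition of the weak derivative tests against compactly supported functions. Products of cutoffs
  extend it to functions with Gaussian decay, by dominated convergence.\<close>
lemma weak_deriv_ibp:
  fixes U :: "'n::finite => nat => real => real"
  assumes w: "has_weak_deriv \<kappa> f g" and f: "f \<in> L2" and g: "g \<in> L2" and U: "\<And>l. dfam (U l)"
    and bd: "\<And>l j. \<exists>C. \<forall>t. \<bar>U l j t\<bar> \<le> C * exp (- (3/8) * t\<^sup>2)"
  shows "(\<integral>x. f x * tens (\<lambda>l. U l (\<kappa> l)) x \<partial>lborel) = (-1) ^ mdeg \<kappa> * (\<integral>x. g x * tens (\<lambda>l. U l 0) x \<partial>lborel)"
proof -
  obtain B where B: "\<And>R j t. R \<ge> 1 ==> \<bar>cut R j t\<bar> \<le> B j" using cut_bound by blast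
  from bd obtain C where C: "\<And>l j t. \<bar>U l j t\<bar> \<le> C l j * exp (- (3/8) * t\<^sup>2)" by metis
  define V where "V n l j t = leib j (\<lambda>i. U l i t) (\<lambda>i. cut (real (Suc n)) i t)" for n l j t
  have dV: "dfam (V n l)" for n l unfolding V_def[abs_def] by (intro dfam_leib U dfam_cut)
  have Vm [measurable]: "tens (\<lambda>l. V n l (m l)) \<in> borel_measurable borel" for n m
    by (intro borel_measurable_tens dfam_borel dV)
  have Vb: "\<bar>V n l j t\<bar> \<le> leib j (C l) B * exp (- (3/8) * t\<^sup>2)" for n l j t
    unfolding V_def by (intro leib_bound C B) auto
  have Vl: "(\<lambda>n. V n l j t) \<longlonglongrightarrow> U l j t" for l j t
  proof -
    have "(\<lambda>n. V n l j t) \<longlonglongrightarrow> leib j (\<lambda>i. U l i t) (\<lambda>i. if i = 0 then 1 else 0)"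
      unfolding V_def by (intro leib_tendsto cut_tendsto tendsto_const)
    then show ?thesis by (simp add: leib_delta)
  qed
  have test: "test_function (tens (\<lambda>l. V n l 0))" for n
  proof (rule test_function_tens[where R="real (Suc n)"])
    show "V n l 0 t \<noteq> 0 ==> \<bar>t\<bar> \<le> real (Suc n)" for l t
      using cut_support[of "real (Suc n)" t] by (auto simp: V_def)
  qed (rule dV)
  have lim: "(\<lambda>n. \<integral>x. h x * tens (\<lambda>l. V n l (m l)) x \<partial>lborel) \<longlonglongrightarrow> (\<integral>x. h x * tens (\<lambda>l. U l (m l)) x \<partial>lborel)"
    if h: "h \<in> L2" for h m
  proof (rule integral_dominated_convergence)
    define K where "K = (\<Prod>l\<in>UNIV. leib (m l) (C l) B)"
    have "integrable lborel (\<lambda>x. \<bar>K\<bar> * \<bar>h x * exp (- (3/8) * (norm x)\<^sup>2)\<bar>)"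
      by (intro integrable_mult_right integrable_abs L2_integrable_weight h) simp
    then show "integrable lborel (\<lambda>x. \<bar>K\<bar> * \<bar>h x * exp (- (3/8) * (norm x)\<^sup>2)\<bar>)" .
    show "(\<lambda>x. h x * tens (\<lambda>l. U l (m l)) x) \<in> borel_measurable lborel"
      using L2_borel[OF h] borel_measurable_tens[OF dfam_borel[OF U]] by measurable
    show "(\<lambda>x. h x * tens (\<lambda>l. V n l (m l)) x) \<in> borel_measurable lborel" for n
      using L2_borel[OF h] by measurable
    show "AE x in lborel. (\<lambda>n. h x * tens (\<lambda>l. V n l (m l)) x) \<longlonglongrightarrow> h x * tens (\<lambda>l. U l (m l)) x"
      unfolding tens_def by (intro AE_I2 tendsto_intros Vl)
    show "AE x in lborel. norm (h x * tens (\<lambda>l. V n l (m l)) x) \<le> \<bar>K\<bar> * \<bar>h x * exp (- (3/8) * (norm x)\<^sup>2)\<bar>" for n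
    proof (intro AE_I2)
      fix x
      have "\<bar>tens (\<lambda>l. V n l (m l)) x\<bar> \<le> K * exp (- (3/8) * (norm x)\<^sup>2)"
        unfolding K_def by (rule tens_weight_bound[OF Vb])
      also have "... \<le> \<bar>K\<bar> * exp (- (3/8) * (norm x)\<^sup>2)" by (intro mult_right_mono) auto
      finally show "norm (h x * tens (\<lambda>l. V n l (m l)) x) \<le> \<bar>K\<bar> * \<bar>h x * exp (- (3/8) * (norm x)\<^sup>2)\<bar>"
        using mult_left_mono[of "\<bar>tens (\<lambda>l. V n l (m l)) x\<bar>" "\<bar>K\<bar> * exp (- (3/8) * (norm x)\<^sup>2)" "\<bar>h x\<bar>"]
        by (simp add: abs_mult mult_ac)
    qed
  qed
  have eq: "(\<integral>x. f x * tens (\<lambda>l. V n l (\<kappa> l)) x \<partial>lborel) = (-1) ^ mdeg \<kappa> * (\<integral>x. g x * tens (\<lambda>l. V n l 0) x \<partial>lborel)" for n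
    using w[unfolded has_weak_deriv_def, THEN conjunct2, THEN conjunct2, rule_format, OF test[of n]]
    unfolding multi_deriv_tens[OF dV] .
  have "(\<lambda>n. \<integral>x. f x * tens (\<lambda>l. V n l (\<kappa> l)) x \<partial>lborel) \<longlonglongrightarrow> (-1) ^ mdeg \<kappa> * (\<integral>x. g x * tens (\<lambda>l. U l 0) x \<partial>lborel)"
    unfolding eq by (intro tendsto_mult tendsto_const lim[OF g])
  with lim[OF f] show ?thesis by (rule LIMSEQ_unique)
qed

text \<open>The probabilists' Hermite polynomials, unnormalized.\<close>
primrec He :: "nat => real poly" where
  "He 0 = 1"
| "He (Suc m) = [:0, 1:] * He m - pderiv (He m)"

text \<open>The Gaussian of mean \<open>\<mu>\<close> and deviation \<open>\<sigma>\<close> with all its derivatives, up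
  to normalization.\<close>
definition gfam :: "real => real => nat => real => real" where
  "gfam \<mu> \<sigma> j t = (- 1 / \<sigma>) ^ j * poly (He j) ((t - \<mu>) / \<sigma>) * exp (- (((t - \<mu>) / \<sigma>)\<^sup>2 / 2))"

lemma dfam_gfam:
  assumes "\<sigma> \<noteq> 0"
  shows "dfam (gfam \<mu> \<sigma>)"
proof -
  have "(gfam \<mu> \<sigma> j has_real_derivative gfam \<mu> \<sigma> (Suc j) t) (at t)" for j t
  proof -
    define z where "z = (t - \<mu>) / \<sigma>"
    have 0: "((\<lambda>t. (t - \<mu>) / \<sigma>) has_real_derivative 1 / \<sigma>) (at t)" using assms by (auto intro!: derivative_eq_intros)
    have 1: "((\<lambda>t. poly (He j) ((t - \<mu>) / \<sigma>)) has_real_derivative poly (pderiv (He j)) z * (1 / \<sigma>)) (at t)"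
      unfolding z_def by (rule DERIV_chain'[OF 0 poly_DERIV])
    have 2: "((\<lambda>t. exp (- (((t - \<mu>) / \<sigma>)\<^sup>2 / 2))) has_real_derivative exp (- (z\<^sup>2 / 2)) * (- (z * (1 / \<sigma>)))) (at t)"
      using DERIV_chain'[OF DERIV_minus[OF DERIV_cdivide[OF DERIV_power[OF 0, of 2], of 2]] DERIV_exp]
      by (rule DERIV_cong) (simp add: z_def[symmetric])
    have g: "gfam \<mu> \<sigma> j = (\<lambda>t. (- 1 / \<sigma>) ^ j * (poly (He j) ((t - \<mu>) / \<sigma>) * exp (- (((t - \<mu>) / \<sigma>)\<^sup>2 / 2))))"
      by (intro ext) (simp add: gfam_def)
    have a: "(- i) * C * (z * h - p) * e = C * (p * i * e + e * (- (z * i)) * h)" for i C z h p e :: real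
      by (simp add: algebra_simps)
    have e: "gfam \<mu> \<sigma> (Suc j) t = (- 1 / \<sigma>) ^ j *
       (poly (pderiv (He j)) z * (1 / \<sigma>) * exp (- (z\<^sup>2 / 2)) + exp (- (z\<^sup>2 / 2)) * (- (z * (1 / \<sigma>))) * poly (He j) z)"
    proof -
      have "gfam \<mu> \<sigma> (Suc j) t = (- (1 / \<sigma>)) * (- 1 / \<sigma>) ^ j * (z * poly (He j) z - poly (pderiv (He j)) z) * exp (- (z\<^sup>2 / 2))"
        by (simp add: gfam_def z_def[symmetric])
      also note a
      finally show ?thesis .
    qed
    show ?thesis unfolding g e
      using DERIV_cmult[OF DERIV_mult[OF 1 2], of "(- 1 / \<sigma>) ^ j"] unfolding z_def .
  qed
  then show ?thesis by (simp add: dfam_def)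
qed

lemma gfam_bound:
  assumes "0 < \<sigma>" "\<sigma> \<le> 1"
  shows "\<exists>C. \<forall>t. \<bar>gfam \<mu> \<sigma> j t\<bar> \<le> C * exp (- (3/8) * t\<^sup>2)"
proof -
  obtain C where C: "C \<ge> 0" "\<And>s. \<bar>poly (He j) s\<bar> \<le> C * exp (s\<^sup>2 / 32)" using poly_le_exp_square by blast
  have "\<bar>gfam \<mu> \<sigma> j t\<bar> \<le> (\<bar>- 1 / \<sigma>\<bar> ^ j * C * exp ((15/8) * \<mu>\<^sup>2)) * exp (- (3/8) * t\<^sup>2)" for t
  proof -
    let ?z = "(t - \<mu>) / \<sigma>"
    have "\<bar>gfam \<mu> \<sigma> j t\<bar> = \<bar>- 1 / \<sigma>\<bar> ^ j * \<bar>poly (He j) ?z\<bar> * exp (- (?z\<^sup>2 / 2))"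
      by (simp add: gfam_def abs_mult power_abs)
    also have "... \<le> \<bar>- 1 / \<sigma>\<bar> ^ j * (C * exp (?z\<^sup>2 / 32)) * exp (- (?z\<^sup>2 / 2))"
      by (intro mult_right_mono mult_left_mono C) auto
    also have "... = \<bar>- 1 / \<sigma>\<bar> ^ j * C * exp (?z\<^sup>2 / 32 + - (?z\<^sup>2 / 2))"
      by (simp only: exp_add mult.assoc)
    also have "?z\<^sup>2 / 32 + - (?z\<^sup>2 / 2) = - (15/32) * ?z\<^sup>2" by simp
    also have "exp (- (15/32) * ?z\<^sup>2) \<le> exp ((15/8) * \<mu>\<^sup>2) * exp (- (3/8) * t\<^sup>2)"
      using affine_weight_le[of t \<mu> \<sigma> ?z] assms by (simp only: real_norm_def power2_abs) simp
    finally show ?thesis using C(1) by (simp add: mult_left_mono mult.assoc)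
  qed
  then show ?thesis by blast
qed

definition hp :: "('n::finite => nat) => real^'n => real" where
  "hp m = tens (\<lambda>l. poly (He (m l)))"

lemma borel_measurable_hp [measurable]: "hp m \<in> borel_measurable borel"
  unfolding hp_def by (intro borel_measurable_tens borel_measurable_continuous_onI continuous_at_imp_continuous_on ballI poly_isCont)

lemma hp_bound: "\<exists>C. \<forall>z. \<bar>hp m z\<bar> \<le> C * exp ((norm z)\<^sup>2 / 32)"
proof -
  have "\<forall>l. \<exists>C. \<forall>s. \<bar>poly (He (m l)) s\<bar> \<le> C * exp ((1/32) * s\<^sup>2)"
    using poly_le_exp_square by (metis mult_1 times_divide_eq_left)
  then obtain C where "\<And>l s. \<bar>poly (He (m l)) s\<bar> \<le> C l * exp ((1/32) * s\<^sup>2)" by metis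
  from tens_weight_bound[of _ _ "1/32", OF this] show ?thesis unfolding hp_def by (intro exI[of _ "\<Prod>l\<in>UNIV. C l"]) auto
qed

lemma L2_affine_hp:
  assumes "g \<in> L2" "0 < s" "s \<le> 1"
  shows "integrable gauss (\<lambda>z. g (\<mu> + s *\<^sub>R z) * hp m z)"
proof -
  obtain C where "\<And>z. \<bar>hp m z\<bar> \<le> C * exp ((norm z)\<^sup>2 / 32)" using hp_bound[of m] by auto
  then show ?thesis by (intro L2_affine_integrable[OF assms borel_measurable_hp])
qed

text \<open>Gaussian integration by parts: the derivatives of the Gaussian density produce the Hermite polynomials, and
  the scaling by \<open>s\<close> gives one factor \<open>s\<close> for each derivative.\<close>
lemma weak_deriv_hermite:
  fixes \<mu> :: "real^'n::finite"
  assumes w: "has_weak_deriv \<kappa> f g" and f: "f \<in> L2" and g: "g \<in> L2" and s: "0 < s" "s \<le> 1"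
  shows "(\<integral>z. f (\<mu> + s *\<^sub>R z) * hp (\<lambda>l. \<kappa> l + m l) z \<partial>gauss) = s ^ mdeg \<kappa> * (\<integral>z. g (\<mu> + s *\<^sub>R z) * hp m z \<partial>gauss)"
proof -
  have [measurable]: "f \<in> borel_measurable borel" "g \<in> borel_measurable borel" using f g by auto
  define U where "U l j = gfam (\<mu> $ l) s (j + m l)" for l j
  have dU: "dfam (U l)" for l using dfam_gfam[of s "\<mu> $ l"] s by (simp add: dfam_def U_def)
  have bU: "\<exists>C. \<forall>t. \<bar>U l j t\<bar> \<le> C * exp (- (3/8) * t\<^sup>2)" for l j unfolding U_def by (rule gfam_bound[OF s])
  have [measurable]: "tens (\<lambda>l. U l (q l)) \<in> borel_measurable borel" for q
    by (intro borel_measurable_tens dfam_borel dU)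
  define c0 where "c0 = (2 * pi) powr (- real CARD('n) / 2)"
  have c0: "c0 > 0" by (simp add: c0_def)
  have T: "tens (\<lambda>l. U l (q l)) (\<mu> + s *\<^sub>R z) = (- 1 / s) ^ mdeg (\<lambda>l. q l + m l) * (1 / c0) * (gauss_density z * hp (\<lambda>l. q l + m l) z)" for q z
  proof -
    have "tens (\<lambda>l. U l (q l)) (\<mu> + s *\<^sub>R z) = (\<Prod>l\<in>UNIV. (- 1 / s) ^ (q l + m l)) * hp (\<lambda>l. q l + m l) z * (\<Prod>l\<in>UNIV. exp (- ((z $ l)\<^sup>2 / 2)))"
      using s by (simp add: tens_def U_def gfam_def hp_def prod.distrib)
    also have "(\<Prod>l\<in>UNIV. exp (- ((z $ l)\<^sup>2 / 2))) = (1 / c0) * gauss_density z"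
      using c0 by (simp add: gauss_density_def c0_def norm_vec_squared exp_sum[symmetric] sum_negf sum_divide_distrib)
    also have "(\<Prod>l\<in>UNIV. (- 1 / s) ^ (q l + m l)) = (- 1 / s) ^ mdeg (\<lambda>l. q l + m l)"
      unfolding mdeg_def by (rule power_sum[symmetric])
    finally show ?thesis by (simp add: mult_ac)
  qed
  have I: "(\<integral>x. h x * tens (\<lambda>l. U l (q l)) x \<partial>lborel) = s ^ DIM(real^'n) * (- 1 / s) ^ mdeg (\<lambda>l. q l + m l) * (1 / c0) * (\<integral>z. h (\<mu> + s *\<^sub>R z) * hp (\<lambda>l. q l + m l) z \<partial>gauss)"
    if [measurable]: "h \<in> borel_measurable borel" for h q
  proof -
    have "(\<integral>x. h x * tens (\<lambda>l. U l (q l)) x \<partial>lborel) = s ^ DIM(real^'n) * (\<integral>z. h (\<mu> + s *\<^sub>R z) * tens (\<lambda>l. U l (q l)) (\<mu> + s *\<^sub>R z) \<partial>lborel)"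
      using s by (subst lborel_affine_integral[of _ s \<mu>]) auto
    also have "(\<integral>z. h (\<mu> + s *\<^sub>R z) * tens (\<lambda>l. U l (q l)) (\<mu> + s *\<^sub>R z) \<partial>lborel)
      = (\<integral>z. ((- 1 / s) ^ mdeg (\<lambda>l. q l + m l) * (1 / c0)) * (gauss_density z * (h (\<mu> + s *\<^sub>R z) * hp (\<lambda>l. q l + m l) z)) \<partial>lborel)"
      unfolding T by (simp add: mult_ac)
    also have "... = ((- 1 / s) ^ mdeg (\<lambda>l. q l + m l) * (1 / c0)) * (\<integral>z. h (\<mu> + s *\<^sub>R z) * hp (\<lambda>l. q l + m l) z \<partial>gauss)"
      by (subst integral_gauss_eq) simp_all
    finally show ?thesis by (simp add: mult_ac)
  qed
  have "(\<integral>x. f x * tens (\<lambda>l. U l (\<kappa> l)) x \<partial>lborel) = (-1) ^ mdeg \<kappa> * (\<integral>x. g x * tens (\<lambda>l. U l 0) x \<partial>lborel)"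
    by (rule weak_deriv_ibp[OF w f g dU bU])
  moreover have md: "mdeg (\<lambda>l. \<kappa> l + m l) = mdeg \<kappa> + mdeg m" by (simp add: mdeg_def sum.distrib)
  have e: "(- 1 / s) ^ mdeg \<kappa> = (-1) ^ mdeg \<kappa> / s ^ mdeg \<kappa>" by (simp only: power_divide)
  define d where "d = s ^ DIM(real^'n) * (- 1 / s) ^ mdeg m * (1 / c0) * (-1) ^ mdeg \<kappa>"
  have d: "d \<noteq> 0" using s c0 by (simp add: d_def)
  ultimately have "d * ((1 / s ^ mdeg \<kappa>) * (\<integral>z. f (\<mu> + s *\<^sub>R z) * hp (\<lambda>l. \<kappa> l + m l) z \<partial>gauss)) = d * (\<integral>z. g (\<mu> + s *\<^sub>R z) * hp m z \<partial>gauss)"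
    using I[of f \<kappa>] I[of g "\<lambda>_. 0"] unfolding md power_add e d_def by (simp add: mult_ac)
  then have "(1 / s ^ mdeg \<kappa>) * (\<integral>z. f (\<mu> + s *\<^sub>R z) * hp (\<lambda>l. \<kappa> l + m l) z \<partial>gauss) = (\<integral>z. g (\<mu> + s *\<^sub>R z) * hp m z \<partial>gauss)"
    by (rule mult_left_cancel[OF d, THEN iffD1])
  then show ?thesis using s by (simp add: field_simps)
qed

section \<open>Hermite polynomials and derivatives of functions in \<open>Hspace\<close>\<close>

definition gmean :: "real poly => real" where
  "gmean p = (\<integral>t. std_normal_density t * poly p t \<partial>lborel)"

lemma integrable_std_normal_poly: "integrable lborel (\<lambda>t. std_normal_density t * poly p t)"
proof -
  have "integrable lborel (\<lambda>t. \<Sum>i\<le>degree p. coeff p i * (std_normal_density t * (t - 0) ^ i))"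
    by (intro Bochner_Integration.integrable_sum integrable_mult_right integrable_normal_moment) simp
  then show ?thesis by (simp add: poly_altdef sum_distrib_left mult_ac)
qed

lemma gmean_add: "gmean (p + q) = gmean p + gmean q"
  unfolding gmean_def by (subst Bochner_Integration.integral_add[symmetric])
    (simp_all add: integrable_std_normal_poly distrib_left)

lemma gmean_smult: "gmean (smult c p) = c * gmean p"
  unfolding gmean_def by (subst integral_mult_right_zero[symmetric]) (simp add: mult_ac)

lemma gmean_diff: "gmean (p - q) = gmean p - gmean q"
  using gmean_add[of p "smult (-1) q"] gmean_smult[of "-1" q] by simp

lemma gmean_zero [simp]: "gmean 0 = 0" by (simp add: gmean_def)

lemma gmean_one [simp]: "gmean 1 = 1" by (simp add: gmean_def)

lemma gmean_monom_even: "gmean (monom 1 (2 * k)) = fact (2 * k) / (2 ^ k * fact k)"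
  using integral_normal_moment_even[of 1 0 k] by (simp add: gmean_def poly_monom)

lemma gmean_monom_odd: "gmean (monom 1 (2 * k + 1)) = 0"
  using integral_normal_moment_odd[of 1 0 k] by (simp add: gmean_def poly_monom)

text \<open>Gaussian integration by parts, verified on the explicit moments.\<close>
lemma gmean_ibp: "gmean ([:0, 1:] * p) = gmean (pderiv p)"
proof -
  have m: "gmean (monom 1 (Suc j)) = real j * gmean (monom 1 (j - 1))" for j
  proof (cases "even j")
    case True
    then obtain i where j: "j = 2 * i" by (auto elim: evenE)
    have "real j * gmean (monom 1 (j - 1)) = 0"
    proof (cases i)
      case (Suc i')
      then have "j - 1 = 2 * i' + 1" using j by simp
      then show ?thesis by (simp only: gmean_monom_odd)
    qed (simp add: j)
    then show ?thesis using gmean_monom_odd[of i] j by simp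
  next
    case False
    then obtain i where j: "j = 2 * i + 1" by (auto elim: oddE)
    have "gmean (monom 1 (Suc j)) = fact (2 * Suc i) / (2 ^ Suc i * fact (Suc i))"
      using gmean_monom_even[of "Suc i"] j by simp
    also have "... = real j * (fact (2 * i) / (2 ^ i * fact i))"
    proof -
      have "fact (2 * Suc i) = (2 * real i + 2) * (2 * real i + 1) * fact (2 * i)" by (simp add: algebra_simps)
      moreover have "2 ^ Suc i * fact (Suc i) = (2 * real i + 2) * (2 ^ i * fact i)" by (simp add: algebra_simps)
      ultimately have "fact (2 * Suc i) / (2 ^ Suc i * fact (Suc i))
        = ((2 * real i + 2) * ((2 * real i + 1) * fact (2 * i))) / ((2 * real i + 2) * (2 ^ i * fact i))"
        by (simp only: mult.assoc)
      also have "... = ((2 * real i + 1) * fact (2 * i)) / (2 ^ i * fact i)"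
        by (rule mult_divide_mult_cancel_left) simp
      finally show ?thesis by (simp add: j add.commute)
    qed
    also have "... = real j * gmean (monom 1 (j - 1))" using gmean_monom_even[of i] j by simp
    finally show ?thesis .
  qed
  have mm: "gmean ([:0, 1:] * monom c j) = gmean (pderiv (monom c j))" for c j
  proof -
    have "[:0, 1:] * monom c j = smult c (monom 1 (Suc j))"
      by (simp add: monom_Suc smult_monom)
    moreover have "pderiv (monom c j) = smult (c * real j) (monom 1 (j - 1))"
      by (simp add: pderiv_monom smult_monom mult.commute)
    ultimately show ?thesis by (simp only: gmean_smult m mult.assoc)
  qed
  have s: "gmean (\<Sum>i\<in>I. P i) = (\<Sum>i\<in>I. gmean (P i))" for I :: "nat set" and P
    by (induction I rule: infinite_finite_induct) (auto simp: gmean_add)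
  have pderiv_sum: "pderiv (\<Sum>i\<in>I. P i) = (\<Sum>i\<in>I. pderiv (P i))" for I :: "nat set" and P :: "nat => real poly"
    by (induction I rule: infinite_finite_induct) (auto simp: pderiv_add)
  have "gmean ([:0, 1:] * (\<Sum>i\<le>degree p. monom (coeff p i) i)) = gmean (pderiv (\<Sum>i\<le>degree p. monom (coeff p i) i))"
    unfolding sum_distrib_left pderiv_sum s by (intro sum.cong refl mm)
  then show ?thesis by (simp only: poly_as_sum_of_monoms)
qed

lemma pderiv_He: "pderiv (He (Suc m)) = smult (real (Suc m)) (He m)"
proof (induction m)
  case 0
  show ?case by (simp add: pderiv_pCons pderiv_mult)
next
  case (Suc m)
  have "pderiv (He (Suc (Suc m))) = He (Suc m) + [:0,1:] * pderiv (He (Suc m)) - pderiv (pderiv (He (Suc m)))"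
    by (simp only: He.simps(2)[of "Suc m"] pderiv_diff pderiv_mult) (simp add: pderiv_pCons algebra_simps)
  also have "... = He (Suc m) + smult (real (Suc m)) ([:0,1:] * He m - pderiv (He m))"
    unfolding Suc by (simp only: pderiv_smult mult_smult_right smult_diff_right add_diff_eq)
  also have "[:0,1:] * He m - pderiv (He m) = He (Suc m)" by simp
  also have "He (Suc m) + smult (real (Suc m)) (He (Suc m)) = smult (real (Suc (Suc m))) (He (Suc m))"
    by (simp only: of_nat_Suc[of "Suc m"] smult_add_left smult_1_left)
  finally show ?case .
qed

lemma gmean_He_mult: "gmean (He (Suc m) * q) = gmean (He m * pderiv q)"
proof -
  have "gmean (He (Suc m) * q) = gmean ([:0,1:] * (He m * q)) - gmean (pderiv (He m) * q)"
    by (simp only: He.simps left_diff_distrib gmean_diff mult.assoc)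
  also have "... = gmean (He m * pderiv q)"
    unfolding gmean_ibp pderiv_mult by (simp add: gmean_add mult.commute)
  finally show ?thesis .
qed

lemma gmean_He_He: "gmean (He m * He j) = (if m = j then fact m else 0)"
proof (induction m arbitrary: j)
  case 0
  show ?case
  proof (cases j)
    case (Suc j')
    have "gmean (He 0 * He (Suc j')) = gmean (He (Suc j') * 1)" by simp
    also have "... = 0" unfolding gmean_He_mult by simp
    finally show ?thesis using Suc by simp
  qed simp
next
  case (Suc m)
  show ?case
  proof (cases j)
    case 0
    then show ?thesis unfolding gmean_He_mult by simp
  next
    case (Suc j')
    have "gmean (He (Suc m) * He (Suc j')) = real (Suc j') * gmean (He m * He j')"
      unfolding gmean_He_mult pderiv_He mult_smult_right gmean_smult ..
    then show ?thesis using Suc Suc.IH[of j'] by simp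
  qed
qed

lemma tens_poly_L2: "tens (\<lambda>l. poly (Q l)) \<in> L2"
proof -
  have m: "poly p \<in> borel_measurable borel" for p :: "real poly"
    by (intro borel_measurable_continuous_onI continuous_at_imp_continuous_on ballI poly_isCont)
  have "integrable gauss (tens (\<lambda>l. poly (Q l * Q l)))"
    by (intro gauss_tens m integrable_std_normal_poly)
  moreover have "tens (\<lambda>l. poly (Q l * Q l)) = (\<lambda>x. (tens (\<lambda>l. poly (Q l)) x)\<^sup>2)"
    by (intro ext) (simp add: tens_def prod.distrib power2_eq_square)
  moreover have "tens (\<lambda>l. poly (Q l)) \<in> borel_measurable borel" by (intro borel_measurable_tens m)
  ultimately show ?thesis by (simp add: L2_def)
qed

lemma hp_L2: "hp m \<in> L2"
  unfolding hp_def by (rule tens_poly_L2)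

text \<open>By the product structure, orthogonality reduces to the one-dimensional case.\<close>
lemma integral_hp_hp: "(\<integral>x. hp m x * hp q x \<partial>gauss) = (if m = q then (\<Prod>l\<in>UNIV. fact (m l)) else 0)"
proof -
  have ms: "poly p \<in> borel_measurable borel" for p :: "real poly"
    by (intro borel_measurable_continuous_onI continuous_at_imp_continuous_on ballI poly_isCont)
  have "(\<lambda>x. hp m x * hp q x) = tens (\<lambda>l. poly (He (m l) * He (q l)))"
    by (intro ext) (simp add: hp_def tens_def prod.distrib)
  then have "(\<integral>x. hp m x * hp q x \<partial>gauss) = (\<Prod>l\<in>UNIV. gmean (He (m l) * He (q l)))"
    unfolding gmean_def by (simp only:) (rule gauss_tens(2); intro ms integrable_std_normal_poly)
  also have "... = (if m = q then (\<Prod>l\<in>UNIV. fact (m l)) else 0)"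
  proof (cases "m = q")
    case False
    then obtain l where "m l \<noteq> q l" by auto
    then have "gmean (He (m l) * He (q l)) = 0" by (simp add: gmean_He_He)
    then have "(\<Prod>l\<in>UNIV. gmean (He (m l) * He (q l))) = 0" by (meson UNIV_I finite_UNIV prod_zero_iff finite)
    then show ?thesis using False by simp
  qed (simp add: gmean_He_He)
  finally show ?thesis .
qed

text \<open>The factor by which \<open>D\<close> differs from the weak derivative; it also normalizes the Hermite
  polynomials.\<close>
definition nrm :: "('n::finite => nat) => real" where
  "nrm \<kappa> = (\<Prod>i\<in>UNIV. 1 / sqrt (fact (\<kappa> i)))"

lemma nrm_pos: "nrm \<kappa> > 0"
  unfolding nrm_def by (intro prod_pos) simp

lemma nrm_square: "nrm \<kappa> * nrm \<kappa> * (\<Prod>l\<in>UNIV. fact (\<kappa> l)) = 1"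
  unfolding nrm_def by (simp add: prod.distrib[symmetric] del: prod_dividef)

definition hn :: "('n::finite => nat) => real^'n => real" where
  "hn \<kappa> x = nrm \<kappa> * hp \<kappa> x"

lemma hn_L2: "hn \<kappa> \<in> L2"
  unfolding hn_def[abs_def] by (intro L2_cmult hp_L2)

lemma hn_orthonormal: "(\<integral>x. hn \<kappa> x * hn \<eta> x \<partial>gauss) = (if \<kappa> = \<eta> then 1 else 0)"
proof -
  have "(\<integral>x. hn \<kappa> x * hn \<eta> x \<partial>gauss) = (\<integral>x. (nrm \<kappa> * nrm \<eta>) * (hp \<kappa> x * hp \<eta> x) \<partial>gauss)"
    by (simp add: hn_def mult_ac)
  also have "... = (nrm \<kappa> * nrm \<eta>) * (\<integral>x. hp \<kappa> x * hp \<eta> x \<partial>gauss)" by simp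
  finally show ?thesis using nrm_square[of \<kappa>] by (cases "\<kappa> = \<eta>") (simp_all add: integral_hp_hp)
qed

lemma bessel_hn:
  assumes F: "F \<in> L2" and S: "finite S"
  shows "(\<Sum>\<kappa>\<in>S. (\<integral>x. F x * hn \<kappa> x \<partial>gauss)\<^sup>2) \<le> (\<integral>x. (F x)\<^sup>2 \<partial>gauss)"
proof -
  define c where "c \<kappa> = (\<integral>x. F x * hn \<kappa> x \<partial>gauss)" for \<kappa>
  define G where "G x = (\<Sum>\<kappa>\<in>S. c \<kappa> * hn \<kappa> x)" for x
  have G: "G \<in> L2" unfolding G_def[abs_def] by (intro L2_sum S L2_cmult hn_L2)
  have FG: "(\<integral>x. F x * G x \<partial>gauss) = (\<Sum>\<kappa>\<in>S. (c \<kappa>)\<^sup>2)"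
  proof -
    have "(\<integral>x. F x * G x \<partial>gauss) = (\<integral>x. (\<Sum>\<kappa>\<in>S. c \<kappa> * (F x * hn \<kappa> x)) \<partial>gauss)"
      by (simp add: G_def sum_distrib_left mult_ac)
    also have "... = (\<Sum>\<kappa>\<in>S. c \<kappa> * (\<integral>x. F x * hn \<kappa> x \<partial>gauss))"
      by (subst Bochner_Integration.integral_sum) (auto intro!: integrable_mult_right L2_mult F hn_L2)
    finally show ?thesis by (simp add: c_def[symmetric] power2_eq_square)
  qed
  have GG: "(\<integral>x. G x * G x \<partial>gauss) = (\<Sum>\<kappa>\<in>S. (c \<kappa>)\<^sup>2)"
  proof -
    have h: "(\<integral>x. hn \<kappa> x * G x \<partial>gauss) = c \<kappa>" if "\<kappa> \<in> S" for \<kappa>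
    proof -
      have "(\<integral>x. hn \<kappa> x * G x \<partial>gauss) = (\<integral>x. (\<Sum>\<eta>\<in>S. c \<eta> * (hn \<kappa> x * hn \<eta> x)) \<partial>gauss)"
        by (simp add: G_def sum_distrib_left mult_ac)
      also have "... = (\<Sum>\<eta>\<in>S. c \<eta> * (\<integral>x. hn \<kappa> x * hn \<eta> x \<partial>gauss))"
        by (subst Bochner_Integration.integral_sum) (auto intro!: integrable_mult_right L2_mult hn_L2)
      also have "... = (\<Sum>\<eta>\<in>S. if \<kappa> = \<eta> then c \<eta> else 0)" by (intro sum.cong) (auto simp: hn_orthonormal)
      also have "... = c \<kappa>" using that S by simp
      finally show ?thesis .
    qed
    have "(\<integral>x. G x * G x \<partial>gauss) = (\<integral>x. (\<Sum>\<kappa>\<in>S. c \<kappa> * (hn \<kappa> x * G x)) \<partial>gauss)"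
      by (intro Bochner_Integration.integral_cong refl, subst (1) G_def, simp add: sum_distrib_right mult.assoc)
    also have "... = (\<Sum>\<kappa>\<in>S. c \<kappa> * (\<integral>x. hn \<kappa> x * G x \<partial>gauss))"
      by (subst Bochner_Integration.integral_sum) (auto intro!: integrable_mult_right L2_mult hn_L2 G)
    also have "... = (\<Sum>\<kappa>\<in>S. (c \<kappa>)\<^sup>2)" by (intro sum.cong) (auto simp: h power2_eq_square)
    finally show ?thesis .
  qed
  have "0 \<le> (\<integral>x. (F x - G x)\<^sup>2 \<partial>gauss)" by simp
  also have "... = (\<integral>x. (F x)\<^sup>2 + G x * G x - 2 * (F x * G x) \<partial>gauss)"
    by (intro Bochner_Integration.integral_cong) (auto simp: power2_eq_square algebra_simps)
  also have "... = (\<integral>x. (F x)\<^sup>2 \<partial>gauss) + (\<integral>x. G x * G x \<partial>gauss) - 2 * (\<integral>x. F x * G x \<partial>gauss)"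
    using L2_sq[OF F] L2_mult[OF G G] L2_mult[OF F G] by simp
  finally show ?thesis unfolding FG GG c_def by simp
qed

lemma AE_lborel_affine:
  fixes \<mu> :: "'a::euclidean_space"
  assumes "AE y in lborel. P y" "s \<noteq> 0" "Measurable.pred borel P"
  shows "AE z in lborel. P (\<mu> + s *\<^sub>R z)"
proof -
  have "AE y in density (distr lborel borel (\<lambda>x. \<mu> + s *\<^sub>R x)) (\<lambda>_. \<bar>s\<bar> ^ DIM('a)). P y"
    by (subst lborel_affine[OF assms(2), of \<mu>, symmetric]) (rule assms(1))
  then have "AE y in distr lborel borel (\<lambda>x. \<mu> + s *\<^sub>R x). P y"
    using assms(2) by (simp add: AE_density)
  then show ?thesis using assms(3) by (subst (asm) AE_distr_iff) auto
qed

lemma finite_mdeg_le: "finite {\<kappa> :: 'n::finite => nat. mdeg \<kappa> \<le> k}"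
proof -
  have "{\<kappa> :: 'n => nat. mdeg \<kappa> \<le> k} \<subseteq> {\<kappa>. \<forall>i. (i \<in> UNIV \<longrightarrow> \<kappa> i \<in> {..k}) \<and> (i \<notin> UNIV \<longrightarrow> \<kappa> i = 0)}"
  proof -
    have "\<kappa> i \<le> mdeg \<kappa>" for \<kappa> :: "'n => nat" and i unfolding mdeg_def by (rule member_le_sum) auto
    then show ?thesis by (auto intro: order_trans)
  qed
  then show ?thesis by (rule finite_subset) (rule finite_set_of_finite_funs; simp)
qed

lemma finite_mdeg_eq [simp]: "finite {\<kappa> :: 'n::finite => nat. mdeg \<kappa> = k}"
  by (rule finite_subset[OF _ finite_mdeg_le[of k]]) auto

lemma finite_mdeg_less [simp]: "finite {\<kappa> :: 'n::finite => nat. mdeg \<kappa> < k}"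
  by (rule finite_subset[OF _ finite_mdeg_le[of k]]) auto

definition wd :: "('n::finite => nat) => (real ^ 'n => real) => real ^ 'n => real" where
  "wd \<kappa> f = (SOME g. has_weak_deriv \<kappa> f g)"

lemma D_eq_wd: "D \<kappa> f x = nrm \<kappa> * wd \<kappa> f x"
  by (simp add: D_def nrm_def wd_def)

lemma Hspace_L2: "f \<in> Hspace k ==> f \<in> L2"
  by (simp add: Hspace_def)

lemma Hspace_D: "f \<in> Hspace k ==> mdeg \<kappa> \<le> k ==> D \<kappa> f \<in> L2"
  by (simp add: Hspace_def)

lemma Hspace_wd:
  assumes "f \<in> Hspace k" "mdeg \<kappa> \<le> k"
  shows "has_weak_deriv \<kappa> f (wd \<kappa> f)" "wd \<kappa> f \<in> L2"
proof -
  show "has_weak_deriv \<kappa> f (wd \<kappa> f)"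
    using assms unfolding wd_def Hspace_def by (intro someI_ex[of "has_weak_deriv \<kappa> f"]) auto
  have "wd \<kappa> f = (\<lambda>x. (1 / nrm \<kappa>) * D \<kappa> f x)"
    using nrm_pos[of \<kappa>] by (intro ext) (simp add: D_eq_wd)
  then show "wd \<kappa> f \<in> L2" using L2_cmult[OF Hspace_D[OF assms], of "1 / nrm \<kappa>"] by simp
qed

lemma hp_0: "hp (\<lambda>_. 0) z = 1"
  by (simp add: hp_def tens_def)

text \<open>With the normalizations of \<open>D\<close> and \<open>hn\<close> no constant remains besides the scaling.
  For \<open>\<mu> = 0\<close> and \<open>s = 1\<close> the Hermite coefficient of \<open>f\<close> is the
  mean of the derivative.\<close>
lemma D_hermite:
  assumes "f \<in> Hspace k" "mdeg \<kappa> \<le> k" "0 < s" "s \<le> 1"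
  shows "(\<integral>z. f (\<mu> + s *\<^sub>R z) * hn \<kappa> z \<partial>gauss) = s ^ mdeg \<kappa> * (\<integral>z. D \<kappa> f (\<mu> + s *\<^sub>R z) \<partial>gauss)"
proof -
  have "(\<integral>z. f (\<mu> + s *\<^sub>R z) * hn \<kappa> z \<partial>gauss) = nrm \<kappa> * (\<integral>z. f (\<mu> + s *\<^sub>R z) * hp \<kappa> z \<partial>gauss)"
    by (simp add: hn_def mult.left_commute)
  also have "(\<integral>z. f (\<mu> + s *\<^sub>R z) * hp \<kappa> z \<partial>gauss) = s ^ mdeg \<kappa> * (\<integral>z. wd \<kappa> f (\<mu> + s *\<^sub>R z) * hp (\<lambda>_. 0) z \<partial>gauss)"
    using weak_deriv_hermite[OF Hspace_wd(1)[OF assms(1,2)] Hspace_L2[OF assms(1)] Hspace_wd(2)[OF assms(1,2)] assms(3,4), of \<mu> "\<lambda>_. 0"]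
    by simp
  also have "nrm \<kappa> * (s ^ mdeg \<kappa> * (\<integral>z. wd \<kappa> f (\<mu> + s *\<^sub>R z) * hp (\<lambda>_. 0) z \<partial>gauss)) = s ^ mdeg \<kappa> * (\<integral>z. D \<kappa> f (\<mu> + s *\<^sub>R z) \<partial>gauss)"
    by (simp add: D_eq_wd hp_0)
  finally show ?thesis .
qed

lemma mdeg_add_single: "mdeg (\<lambda>l. \<kappa> l + (if l = i then 1 else 0)) = Suc (mdeg \<kappa>)"
  by (simp add: mdeg_def sum.distrib)

lemma nrm_add_single: "nrm \<kappa> = sqrt (real (Suc (\<kappa> i))) * nrm (\<lambda>l. \<kappa> l + (if l = i then 1 else 0))"
proof -
  have "nrm (\<lambda>l. \<kappa> l + (if l = i then 1 else 0)) = (\<Prod>l\<in>UNIV. (1 / sqrt (fact (\<kappa> l))) * (if l = i then 1 / sqrt (real (Suc (\<kappa> i))) else 1))"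
    unfolding nrm_def by (intro prod.cong) (auto simp: real_sqrt_mult)
  also have "... = nrm \<kappa> * (1 / sqrt (real (Suc (\<kappa> i))))"
    unfolding nrm_def prod.distrib by simp
  finally show ?thesis by simp
qed

text \<open>Raises the order of the derivative by one at the expense of one Hermite degree; used to differentiate
  \<open>corr\<close>.\<close>
lemma D_hermite_step:
  assumes f: "f \<in> Hspace k" and \<kappa>: "mdeg \<kappa> < k" and s: "0 < s" "s \<le> 1"
  shows "(\<integral>z. D \<kappa> f (\<mu> + s *\<^sub>R z) * hp (\<lambda>l. m l + (if l = i then 1 else 0)) z \<partial>gauss)
    = s * sqrt (real (Suc (\<kappa> i))) * (\<integral>z. D (\<lambda>l. \<kappa> l + (if l = i then 1 else 0)) f (\<mu> + s *\<^sub>R z) * hp m z \<partial>gauss)"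
proof -
  let ?e = "\<lambda>l. (if l = i then 1 else 0::nat)"
  let ?k = "\<lambda>l. \<kappa> l + ?e l"
  have k: "mdeg \<kappa> \<le> k" "mdeg ?k \<le> k" using \<kappa> mdeg_add_single[of \<kappa> i] by auto
  note L = Hspace_L2[OF f]
  have 1: "(\<integral>z. f (\<mu> + s *\<^sub>R z) * hp (\<lambda>l. \<kappa> l + (m l + ?e l)) z \<partial>gauss) = s ^ mdeg \<kappa> * (\<integral>z. wd \<kappa> f (\<mu> + s *\<^sub>R z) * hp (\<lambda>l. m l + ?e l) z \<partial>gauss)"
    by (rule weak_deriv_hermite[OF Hspace_wd(1)[OF f k(1)] L Hspace_wd(2)[OF f k(1)] s])
  have 2: "(\<integral>z. f (\<mu> + s *\<^sub>R z) * hp (\<lambda>l. ?k l + m l) z \<partial>gauss) = s ^ mdeg ?k * (\<integral>z. wd ?k f (\<mu> + s *\<^sub>R z) * hp m z \<partial>gauss)"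
    by (rule weak_deriv_hermite[OF Hspace_wd(1)[OF f k(2)] L Hspace_wd(2)[OF f k(2)] s])
  have e: "(\<lambda>l. \<kappa> l + (m l + ?e l)) = (\<lambda>l. ?k l + m l)" by auto
  have "s ^ mdeg \<kappa> * (\<integral>z. wd \<kappa> f (\<mu> + s *\<^sub>R z) * hp (\<lambda>l. m l + ?e l) z \<partial>gauss) = s ^ mdeg ?k * (\<integral>z. wd ?k f (\<mu> + s *\<^sub>R z) * hp m z \<partial>gauss)"
    using 1 2 unfolding e by simp
  also have "... = s ^ mdeg \<kappa> * (s * (\<integral>z. wd ?k f (\<mu> + s *\<^sub>R z) * hp m z \<partial>gauss))"
    by (simp add: mdeg_add_single)
  finally have 3: "(\<integral>z. wd \<kappa> f (\<mu> + s *\<^sub>R z) * hp (\<lambda>l. m l + ?e l) z \<partial>gauss) = s * (\<integral>z. wd ?k f (\<mu> + s *\<^sub>R z) * hp m z \<partial>gauss)"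
    using s by (subst (asm) mult_left_cancel) auto
  have "(\<integral>z. D \<kappa> f (\<mu> + s *\<^sub>R z) * hp (\<lambda>l. m l + ?e l) z \<partial>gauss) = nrm \<kappa> * (\<integral>z. wd \<kappa> f (\<mu> + s *\<^sub>R z) * hp (\<lambda>l. m l + ?e l) z \<partial>gauss)"
    by (simp add: D_eq_wd mult.assoc)
  also have "... = s * sqrt (real (Suc (\<kappa> i))) * (nrm ?k * (\<integral>z. wd ?k f (\<mu> + s *\<^sub>R z) * hp m z \<partial>gauss))"
    unfolding 3 nrm_add_single[of \<kappa> i] by (simp add: mult_ac)
  also have "nrm ?k * (\<integral>z. wd ?k f (\<mu> + s *\<^sub>R z) * hp m z \<partial>gauss) = (\<integral>z. D ?k f (\<mu> + s *\<^sub>R z) * hp m z \<partial>gauss)"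
    by (simp add: D_eq_wd mult.assoc)
  finally show ?thesis .
qed

text \<open>The left-hand side is, up to the factor \<open>(1 - r\<^sup>2)\<^sup>k\<close>, a sum of squared Hermite
  coefficients of a bounded function.\<close>
lemma OU_D_bound:
  assumes f: "f \<in> Hspace k" and b: "AE x in gauss. \<bar>f x\<bar> \<le> 1" and r: "0 \<le> r" "r < 1"
    and S: "S \<subseteq> {\<kappa>. mdeg \<kappa> = k}"
  shows "(\<Sum>\<kappa>\<in>S. (OU r (D \<kappa> f) x)\<^sup>2) \<le> 1 / (1 - r\<^sup>2) ^ k"
proof -
  define s where "s = sqrt (1 - r\<^sup>2)"
  have s: "0 < s" "s \<le> 1" "s\<^sup>2 = 1 - r\<^sup>2" using OU_cs[OF r] by (auto simp: s_def)
  have [measurable]: "f \<in> borel_measurable borel" using Hspace_L2[OF f] by auto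
  define F where "F z = f (r *\<^sub>R x + s *\<^sub>R z)" for z
  have ae: "AE z in gauss. \<bar>F z\<bar> \<le> 1"
    unfolding AE_gauss_iff F_def using b s by (intro AE_lborel_affine) (auto simp: AE_gauss_iff)
  then have ae2: "AE z in gauss. (F z)\<^sup>2 \<le> 1" by eventually_elim (simp add: abs_square_le_1)
  have [measurable]: "F \<in> borel_measurable borel" unfolding F_def by measurable
  have F2: "integrable gauss (\<lambda>z. (F z)\<^sup>2)" by (rule gauss.integrable_const_bound[where B=1]) (use ae2 in auto)
  then have FL: "F \<in> L2" by (simp add: L2_def)
  have F1: "(\<integral>z. (F z)\<^sup>2 \<partial>gauss) \<le> 1" by (rule gauss.integral_le_const[OF F2 ae2])
  have fin: "finite S" using S by (rule finite_subset) simp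
  have c: "(\<integral>z. F z * hn \<kappa> z \<partial>gauss) = s ^ k * OU r (D \<kappa> f) x" if "\<kappa> \<in> S" for \<kappa>
    using D_hermite[OF f _ s(1,2), of \<kappa> "r *\<^sub>R x"] that S by (auto simp: F_def OU_def s_def)
  have "(1 - r\<^sup>2) ^ k * (\<Sum>\<kappa>\<in>S. (OU r (D \<kappa> f) x)\<^sup>2) = (\<Sum>\<kappa>\<in>S. (\<integral>z. F z * hn \<kappa> z \<partial>gauss)\<^sup>2)"
    unfolding sum_distrib_left
  proof (intro sum.cong refl)
    fix \<kappa> assume "\<kappa> \<in> S"
    then show "(1 - r\<^sup>2) ^ k * (OU r (D \<kappa> f) x)\<^sup>2 = (\<integral>z. F z * hn \<kappa> z \<partial>gauss)\<^sup>2"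
      unfolding c[OF \<open>\<kappa> \<in> S\<close>] s(3)[symmetric] by (simp add: power_mult_distrib power_mult[symmetric] mult.commute)
  qed
  also have "... \<le> 1" using bessel_hn[OF FL fin] F1 by linarith
  finally have "(1 - r\<^sup>2) ^ k * (\<Sum>\<kappa>\<in>S. (OU r (D \<kappa> f) x)\<^sup>2) \<le> 1" .
  moreover have "1 - r\<^sup>2 > 0" using s by (metis zero_less_power)
  ultimately show ?thesis by (simp add: pos_le_divide_eq mult.commute)
qed

section \<open>Uniqueness of weak derivatives and polynomials in the null space\<close>

lemma loc_integrable_borel:
  assumes "loc_integrable f"
  shows "f \<in> borel_measurable borel"
proof (rule borel_measurable_LIMSEQ_real)
  show "(\<lambda>x. indicator (cball 0 (real n)) x * f x) \<in> borel_measurable borel" for n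
    using assms unfolding loc_integrable_def set_integrable_def by (auto dest!: borel_measurable_integrable spec[of _ "cball 0 (real n)"])
  fix x :: "real^'a"
  obtain N :: nat where N: "norm x \<le> real N" using real_arch_simple by blast
  have "eventually (\<lambda>n. indicator (cball 0 (real n)) x * f x = f x) sequentially"
    using eventually_ge_at_top[of N] by eventually_elim (use N in \<open>auto simp: indicator_def\<close>)
  then show "(\<lambda>n. indicator (cball 0 (real n)) x * f x) \<longlonglongrightarrow> f x" by (rule tendsto_eventually)
qed

text \<open>Smooth functions that increase to the indicator of the interval \<open>(a, b)\<close>.\<close>
definition ubox :: "real => real => nat => nat => real => real" where
  "ubox a b n j t = leib j (\<lambda>i. real (Suc n) ^ i * ebump i (real (Suc n) * t + - (real (Suc n) * a)))
     (\<lambda>i. (- real (Suc n)) ^ i * ebump i (- real (Suc n) * t + real (Suc n) * b))"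

lemma dfam_ubox: "dfam (ubox a b n)"
  unfolding ubox_def[abs_def]
  by (rule dfam_leib)
    (rule dfam_affine[OF dfam_ebump, of "real (Suc n)" "- (real (Suc n) * a)"],
     rule dfam_affine[OF dfam_ebump, of "- real (Suc n)" "real (Suc n) * b"])

lemma ubox_0: "ubox a b n 0 t = (if a < t \<and> t < b then exp (- 1 / (real (Suc n) * (t - a))) * exp (- 1 / (real (Suc n) * (b - t))) else 0)"
proof -
  have 1: "real (Suc n) * t + - (real (Suc n) * a) = real (Suc n) * (t - a)" "- real (Suc n) * t + real (Suc n) * b = real (Suc n) * (b - t)"
    by (simp_all add: algebra_simps)
  have "0 < real (Suc n) * (t - a) \<longleftrightarrow> a < t" "0 < real (Suc n) * (b - t) \<longleftrightarrow> t < b"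
    by (auto simp: zero_less_mult_iff)
  then show ?thesis unfolding ubox_def leib.simps 1 by (auto simp: ebump_def)
qed

lemma ubox_range: "0 \<le> ubox a b n 0 t" "ubox a b n 0 t \<le> 1"
  unfolding ubox_0 by (auto intro!: mult_le_one)

lemma ubox_tendsto: "(\<lambda>n. ubox a b n 0 t) \<longlonglongrightarrow> (if a < t \<and> t < b then 1 else 0)"
proof (cases "a < t \<and> t < b")
  case True
  have inv: "(\<lambda>n. 1 / real (Suc n)) \<longlonglongrightarrow> 0" using LIMSEQ_inverse_real_of_nat by (simp add: inverse_eq_divide)
  have "(\<lambda>n. exp (- (1 / (t - a)) * (1 / real (Suc n))) * exp (- (1 / (b - t)) * (1 / real (Suc n)))) \<longlonglongrightarrow> exp (- (1 / (t - a)) * 0) * exp (- (1 / (b - t)) * 0)"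
    by (intro tendsto_intros inv)
  then show ?thesis using True unfolding ubox_0 by (simp add: mult.commute)
qed (auto simp: ubox_0)

text \<open>The difference of two weak derivatives integrates to \<open>0\<close> against products of
  \<open>ubox\<close>, hence over every box; boxes generate the Borel sets, so its positive and negative
  parts define the same measure.\<close>
lemma weak_deriv_unique:
  fixes f :: "real^'n::finite => real"
  assumes 1: "has_weak_deriv \<kappa> f g1" and 2: "has_weak_deriv \<kappa> f g2"
  shows "AE x in lborel. g1 x = g2 x"
proof -
  define h where "h x = g1 x - g2 x" for x
  have loc1: "loc_integrable g1" and loc2: "loc_integrable g2" using 1 2 by (auto simp: has_weak_deriv_def)
  have [measurable]: "g1 \<in> borel_measurable borel" "g2 \<in> borel_measurable borel"
    using loc1 loc2 by (auto intro: loc_integrable_borel)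
  have [measurable]: "h \<in> borel_measurable borel" unfolding h_def by measurable
  have ki: "integrable lborel (\<lambda>x. indicator (cbox a b) x * g x)" if "loc_integrable g" for g and a b :: "real^'n"
    using that unfolding loc_integrable_def set_integrable_def by auto
  have hi: "integrable lborel (\<lambda>x. indicator (cbox a b) x * h x)" for a b :: "real^'n"
    using Bochner_Integration.integrable_diff[OF ki[OF loc1, of a b] ki[OF loc2, of a b]] by (simp add: h_def right_diff_distrib)
  have hbi: "integrable lborel (\<lambda>x. indicator (box a b) x * h x)" for a b :: "real^'n"
    by (rule Bochner_Integration.integrable_bound[OF hi[of a b]]) (auto simp: indicator_def box_subset_cbox[THEN subsetD])
  have box0: "(\<integral>x. indicator (box a b) x * h x \<partial>lborel) = 0" for a b :: "real^'n"
  proof -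
    define \<phi> where "\<phi> n = tens (\<lambda>l. ubox (a $ l) (b $ l) n 0)" for n
    have [measurable]: "\<phi> n \<in> borel_measurable borel" for n
      unfolding \<phi>_def by (intro borel_measurable_tens dfam_borel dfam_ubox)
    have \<phi>0: "\<bar>\<phi> n x\<bar> \<le> indicator (cbox a b) x" for n x
    proof (cases "x \<in> cbox a b")
      case True
      have "\<bar>\<phi> n x\<bar> = (\<Prod>l\<in>UNIV. ubox (a $ l) (b $ l) n 0 (x $ l))"
        unfolding \<phi>_def tens_def using ubox_range by (simp add: prod_nonneg)
      also have "... \<le> 1" using ubox_range by (intro prod_le_1) auto
      finally show ?thesis using True by simp
    next
      case False
      then obtain l where "\<not> (a $ l \<le> x $ l \<and> x $ l \<le> b $ l)" by (auto simp: mem_box_cart)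
      then have "\<not> (a $ l < x $ l \<and> x $ l < b $ l)" by auto
      then have "ubox (a $ l) (b $ l) n 0 (x $ l) = 0" by (simp add: ubox_0)
      then have "\<phi> n x = 0" unfolding \<phi>_def tens_def by (intro prod_zero) auto
      then show ?thesis by simp
    qed
    have test: "test_function (\<phi> n)" for n unfolding \<phi>_def
    proof (rule test_function_tens[where R="\<Sum>l\<in>UNIV. \<bar>a $ l\<bar> + \<bar>b $ l\<bar>"])
      fix l t assume "ubox (a $ l) (b $ l) n 0 t \<noteq> 0"
      then have "a $ l < t" "t < b $ l" by (auto simp: ubox_0 split: if_splits)
      then have "\<bar>t\<bar> \<le> \<bar>a $ l\<bar> + \<bar>b $ l\<bar>" by linarith
      also have "... \<le> (\<Sum>l\<in>UNIV. \<bar>a $ l\<bar> + \<bar>b $ l\<bar>)" by (rule member_le_sum[of l UNIV "\<lambda>l. \<bar>a $ l\<bar> + \<bar>b $ l\<bar>"]) auto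
      finally show "\<bar>t\<bar> \<le> (\<Sum>l\<in>UNIV. \<bar>a $ l\<bar> + \<bar>b $ l\<bar>)" .
    qed (rule dfam_ubox)
    have gi: "integrable lborel (\<lambda>x. g x * \<phi> n x)" if "loc_integrable g" for g n
    proof (rule Bochner_Integration.integrable_bound[OF ki[OF that, of a b]])
      show "(\<lambda>x. g x * \<phi> n x) \<in> borel_measurable lborel" using loc_integrable_borel[OF that] by measurable
      show "AE x in lborel. norm (g x * \<phi> n x) \<le> norm (indicator (cbox a b) x * g x)"
        using \<phi>0[of n] by (intro AE_I2) (simp add: abs_mult mult.commute mult_left_mono)
    qed
    have z: "(\<integral>x. h x * \<phi> n x \<partial>lborel) = 0" for n
    proof -
      have "(-1) ^ mdeg \<kappa> * (\<integral>x. g1 x * \<phi> n x \<partial>lborel) = (-1) ^ mdeg \<kappa> * (\<integral>x. g2 x * \<phi> n x \<partial>lborel)"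
        by (rule trans[OF 1[unfolded has_weak_deriv_def, THEN conjunct2, THEN conjunct2, rule_format, OF test, symmetric]
          2[unfolded has_weak_deriv_def, THEN conjunct2, THEN conjunct2, rule_format, OF test]])
      then have "(\<integral>x. g1 x * \<phi> n x \<partial>lborel) = (\<integral>x. g2 x * \<phi> n x \<partial>lborel)" by simp
      then show ?thesis using gi[OF loc1] gi[OF loc2] by (simp add: h_def left_diff_distrib)
    qed
    have "(\<lambda>n. \<integral>x. h x * \<phi> n x \<partial>lborel) \<longlonglongrightarrow> (\<integral>x. indicator (box a b) x * h x \<partial>lborel)"
    proof (rule integral_dominated_convergence)
      show "integrable lborel (\<lambda>x. \<bar>indicator (cbox a b) x * h x\<bar>)" by (intro integrable_abs hi)
      show "AE x in lborel. norm (h x * \<phi> n x) \<le> \<bar>indicator (cbox a b) x * h x\<bar>" for n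
        using \<phi>0[of n] by (intro AE_I2) (simp add: abs_mult mult.commute mult_left_mono)
      show "AE x in lborel. (\<lambda>n. h x * \<phi> n x) \<longlonglongrightarrow> indicator (box a b) x * h x"
      proof (intro AE_I2)
        fix x
        have "(\<lambda>n. \<phi> n x) \<longlonglongrightarrow> (\<Prod>l\<in>UNIV. if a $ l < x $ l \<and> x $ l < b $ l then 1 else 0)"
          unfolding \<phi>_def tens_def by (intro tendsto_prod ubox_tendsto)
        also have "(\<Prod>l\<in>UNIV. if a $ l < x $ l \<and> x $ l < b $ l then 1 else 0) = (indicator (box a b) x :: real)"
        proof (cases "x \<in> box a b")
          case True
          then show ?thesis by (simp add: mem_box_cart)
        next
          case False
          then obtain l where "\<not> (a $ l < x $ l \<and> x $ l < b $ l)" by (auto simp: mem_box_cart)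
          then have "(\<Prod>l\<in>UNIV. if a $ l < x $ l \<and> x $ l < b $ l then 1 else 0) = (0::real)" by (intro prod_zero) auto
          then show ?thesis using False by simp
        qed
        finally have "(\<lambda>n. \<phi> n x) \<longlonglongrightarrow> indicator (box a b) x" .
        from tendsto_mult[OF tendsto_const[of "h x"] this]
        show "(\<lambda>n. h x * \<phi> n x) \<longlonglongrightarrow> indicator (box a b) x * h x" by (simp add: mult.commute)
      qed
    qed measurable
    then show ?thesis unfolding z by (simp add: LIMSEQ_const_iff)
  qed
  have zR: "AE x in lborel. indicator (box a b) x * h x = 0" for a b :: "real^'n"
  proof -
    let ?h = "\<lambda>x. indicator (box a b) x * h x"
    let ?p = "\<lambda>x. ennreal (max 0 (?h x))" and ?m = "\<lambda>x. ennreal (max 0 (- ?h x))"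
    have pi: "integrable lborel (\<lambda>x. max 0 (?h x))" "integrable lborel (\<lambda>x. max 0 (- ?h x))"
      using hbi[of a b] by (auto intro!: integrable_max)
    have pB: "integrable lborel (\<lambda>x. indicator B x * max 0 (?h x))" "integrable lborel (\<lambda>x. indicator B x * max 0 (- ?h x))"
      if [measurable]: "B \<in> sets borel" for B
      by (rule Bochner_Integration.integrable_bound[OF pi(1)], auto simp: indicator_def,
          rule Bochner_Integration.integrable_bound[OF pi(2)], auto simp: indicator_def)
    have em: "emeasure (density lborel ?p) B = ennreal (\<integral>x. indicator B x * max 0 (?h x) \<partial>lborel)"
        "emeasure (density lborel ?m) B = ennreal (\<integral>x. indicator B x * max 0 (- ?h x) \<partial>lborel)"
      if [measurable]: "B \<in> sets borel" for B
      using pB[OF that] by (simp_all add: emeasure_density nn_integral_eq_integral[symmetric] ennreal_mult'' mult.commute ennreal_indicator)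
    have "density lborel ?p = density lborel ?m"
    proof (rule measure_eqI_generator_eq[where E="range (\<lambda>(a,b). box a b)" and \<Omega>=UNIV and A="\<lambda>i. box (- real i *\<^sub>R One) (real i *\<^sub>R One)"])
      show "Int_stable (range (\<lambda>(a,b). box a (b::real^'n)))" by (auto simp: Int_stable_def box_Int_box)
      show "sets (density lborel ?p) = sigma_sets UNIV (range (\<lambda>(a,b). box a b))"
        "sets (density lborel ?m) = sigma_sets UNIV (range (\<lambda>(a,b). box a b))"
        by (simp_all add: borel_eq_box)
      show "range (\<lambda>i. box (- real i *\<^sub>R One) (real i *\<^sub>R One)) \<subseteq> range (\<lambda>(a,b). box a (b::real^'n))" by auto
      show "(\<Union>i. box (- real i *\<^sub>R One) (real i *\<^sub>R One)) = (UNIV :: (real^'n) set)" using UN_box_eq_UNIV by simp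
      show "emeasure (density lborel ?p) (box (- real i *\<^sub>R One) (real i *\<^sub>R One)) \<noteq> \<infinity>" for i by (subst em) simp_all
      fix X :: "(real^'n) set" assume "X \<in> range (\<lambda>(a,b). box a b)"
      then obtain c d where X: "X = box c d" by auto
      obtain e f where ef: "box c d \<inter> box a b = box e f" by (rule that[OF box_Int_box])
      have "(\<integral>x. indicator X x * max 0 (?h x) \<partial>lborel) - (\<integral>x. indicator X x * max 0 (- ?h x) \<partial>lborel)
        = (\<integral>x. indicator X x * max 0 (?h x) - indicator X x * max 0 (- ?h x) \<partial>lborel)"
        by (rule Bochner_Integration.integral_diff[symmetric]; rule pB) (simp_all add: X)
      also have "(\<lambda>x. indicator X x * max 0 (?h x) - indicator X x * max 0 (- ?h x)) = (\<lambda>x. indicator (box e f) x * h x)"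
        unfolding X ef[symmetric] by (intro ext) (auto simp: indicator_def max_def)
      finally show "emeasure (density lborel ?p) X = emeasure (density lborel ?m) X"
        using box0[of e f] unfolding X by (subst em, simp, subst em, simp) simp
    qed auto
    note eq = this
    have "AE x in lborel. ?p x = ?m x"
      by (rule sigma_finite_measure.density_unique[OF sigma_finite_lborel _ _ eq]) measurable
    then show ?thesis by eventually_elim (auto simp: max_def split: if_splits)
  qed
  have "AE x in lborel. \<forall>n::nat. indicator (box (- real n *\<^sub>R One) (real n *\<^sub>R One)) x * h x = 0"
    by (subst AE_all_countable) (intro allI zR)
  then show ?thesis
  proof eventually_elim
    case (elim x)
    have "x \<in> (\<Union>i. box (- real i *\<^sub>R One) (real i *\<^sub>R One))" using UN_box_eq_UNIV[where 'a="real^'n"] by simp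
    then obtain n :: nat where "x \<in> box (- real n *\<^sub>R One) (real n *\<^sub>R One)" by auto
    then show ?case using elim[rule_format, of n] by (simp add: h_def)
  qed
qed

lemma cont_supp_integrable:
  fixes F :: "real^'n::finite => real"
  assumes "continuous_on UNIV F" "\<And>x. F x \<noteq> 0 ==> norm x \<le> R"
  shows "integrable lborel F"
proof -
  have "integrable lborel (\<lambda>x. indicator (cball 0 R) x *\<^sub>R F x)"
    by (intro borel_integrable_compact) (auto intro: continuous_on_subset[OF assms(1)])
  also have "(\<lambda>x. indicator (cball 0 R) x *\<^sub>R F x) = F"
    using assms(2) by (intro ext) (auto simp: indicator_def)
  finally show ?thesis .
qed

text \<open>The integral of a difference quotient vanishes by translation invariance; dominated convergence passes to
  the derivative.\<close>
lemma integral_directional_deriv_0: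
  fixes F G :: "real^'n::finite => real"
  assumes der: "\<And>x. ((\<lambda>t. F (x + t *\<^sub>R e)) has_real_derivative G x) (at 0)"
    and cont: "continuous_on UNIV G" and F: "integrable lborel F" and supp: "\<And>x. G x \<noteq> 0 ==> norm x \<le> R"
  shows "(\<integral>x. G x \<partial>lborel) = 0"
proof -
  have [measurable]: "F \<in> borel_measurable borel" using F by auto
  have [measurable]: "G \<in> borel_measurable borel" by (rule borel_measurable_continuous_onI[OF cont])
  have der': "((\<lambda>t. F (x + t *\<^sub>R e)) has_real_derivative G (x + s *\<^sub>R e)) (at s)" for x s
  proof -
    have "((\<lambda>t. t - s) has_real_derivative 1) (at s)" by (auto intro!: derivative_eq_intros)
    moreover have "((\<lambda>t. F ((x + s *\<^sub>R e) + t *\<^sub>R e)) has_real_derivative G (x + s *\<^sub>R e)) (at (s - s))" using der[of "x + s *\<^sub>R e"] by simp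
    ultimately have "((\<lambda>t. F ((x + s *\<^sub>R e) + (t - s) *\<^sub>R e)) has_real_derivative G (x + s *\<^sub>R e) * 1) (at s)"
      by (rule DERIV_chain')
    then show ?thesis by (simp add: algebra_simps)
  qed
  obtain B where B: "B \<ge> 0" "\<And>x. \<bar>G x\<bar> \<le> B"
  proof -
    have "compact (G ` cball 0 R)" by (intro compact_continuous_image continuous_on_subset[OF cont]) auto
    then obtain B where B: "\<And>x. x \<in> cball 0 R ==> \<bar>G x\<bar> \<le> B" using compact_imp_bounded bounded_iff by (metis imageI real_norm_def)
    have "\<bar>G x\<bar> \<le> max 0 B" for x using B[of x] supp[of x] by (cases "G x = 0") auto
    then show ?thesis by (intro that[of "max 0 B"]) auto
  qed
  define q where "q n x = (F (x + (1 / real (Suc n)) *\<^sub>R e) - F x) / (1 / real (Suc n))" for n x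
  have [measurable]: "q n \<in> borel_measurable borel" for n unfolding q_def by measurable
  have Fs: "integrable lborel (\<lambda>x. F (x + c *\<^sub>R e))" "(\<integral>x. F (x + c *\<^sub>R e) \<partial>lborel) = (\<integral>x. F x \<partial>lborel)" for c
    using lborel_affine_integrable[of F 1 "c *\<^sub>R e"] lborel_affine_integral[of F 1 "c *\<^sub>R e"] F by (simp_all add: add.commute)
  have q0: "(\<integral>x. q n x \<partial>lborel) = 0" for n
    unfolding q_def using Fs[of "1 / real (Suc n)"] F by simp
  have qb: "\<bar>q n x\<bar> \<le> B * indicator (cball 0 (R + norm e)) x" for n x
  proof -
    let ?h = "1 / real (Suc n)"
    have h: "0 < ?h" "?h \<le> 1" by auto
    obtain \<xi> where \<xi>: "0 < \<xi>" "\<xi> < ?h" "F (x + ?h *\<^sub>R e) - F (x + 0 *\<^sub>R e) = (?h - 0) * G (x + \<xi> *\<^sub>R e)"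
      using MVT2[of 0 ?h "\<lambda>t. F (x + t *\<^sub>R e)" "\<lambda>s. G (x + s *\<^sub>R e)"] der' h by auto
    have qe: "q n x = G (x + \<xi> *\<^sub>R e)" using \<xi>(3) by (simp add: q_def)
    show ?thesis
    proof (cases "x \<in> cball 0 (R + norm e)")
      case True
      then show ?thesis using B qe by simp
    next
      case False
      have "norm x \<le> norm (x + \<xi> *\<^sub>R e) + norm (\<xi> *\<^sub>R e)" using norm_triangle_ineq4[of "x + \<xi> *\<^sub>R e" "\<xi> *\<^sub>R e"] by simp
      moreover have "norm (\<xi> *\<^sub>R e) \<le> norm e"
        using \<xi>(1) less_le_trans[OF \<xi>(2) h(2)] by (simp add: mult_left_le_one_le)
      ultimately have "norm (x + \<xi> *\<^sub>R e) > R" using False by simp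
      then have "G (x + \<xi> *\<^sub>R e) = 0" using supp[of "x + \<xi> *\<^sub>R e"] by auto
      then show ?thesis using qe B by simp
    qed
  qed
  have "(\<lambda>n. \<integral>x. q n x \<partial>lborel) \<longlonglongrightarrow> (\<integral>x. G x \<partial>lborel)"
  proof (rule integral_dominated_convergence)
    have "integrable lborel (indicator (cball 0 (R + norm e)) :: real^'n => real)"
      using integrable_real_indicator[of "cball 0 (R + norm e)" lborel] emeasure_bounded_finite[of "cball 0 (R + norm e)"] by auto
    then show "integrable lborel (\<lambda>x::real^'n. B * indicator (cball 0 (R + norm e)) x)" by (rule integrable_mult_right)
    show "AE x in lborel. norm (q n x) \<le> B * indicator (cball 0 (R + norm e)) x" for n using qb by auto
    show "AE x in lborel. (\<lambda>n. q n x) \<longlonglongrightarrow> G x"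
    proof (intro AE_I2)
      fix x
      have "((\<lambda>h. (F (x + h *\<^sub>R e) - F x) / h) \<longlongrightarrow> G x) (at 0)"
        using der[of x] unfolding DERIV_def by simp
      moreover have "filterlim (\<lambda>n. 1 / real (Suc n)) (at 0) sequentially"
        using LIMSEQ_inverse_real_of_nat by (intro filterlim_atI) (auto simp: inverse_eq_divide)
      ultimately show "(\<lambda>n. q n x) \<longlonglongrightarrow> G x"
        unfolding q_def by (rule filterlim_compose)
    qed
  qed measurable
  then show ?thesis by (simp add: q0 LIMSEQ_const_iff)
qed

lemma partial_deriv_DERIV:
  assumes "\<phi> differentiable (at x)"
  shows "((\<lambda>t. \<phi> (x + t *\<^sub>R axis i 1)) has_real_derivative partial_deriv i \<phi> x) (at 0)"
proof -
  have 1: "((\<lambda>t::real. x + t *\<^sub>R axis i 1) has_derivative (\<lambda>t. t *\<^sub>R axis i 1)) (at 0)"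
    by (auto intro!: derivative_eq_intros)
  have d: "(\<phi> has_derivative frechet_derivative \<phi> (at x)) (at x)" using assms by (simp add: frechet_derivative_works)
  have "((\<lambda>t. \<phi> (x + t *\<^sub>R axis i 1)) has_derivative (\<lambda>t. frechet_derivative \<phi> (at x) (t *\<^sub>R axis i 1))) (at 0)"
    by (rule has_derivative_compose[OF 1]) (use d in simp)
  moreover have "frechet_derivative \<phi> (at x) (t *\<^sub>R axis i 1) = partial_deriv i \<phi> x * t" for t
    using linear_frechet_derivative[OF assms] by (simp add: partial_deriv_def linear_cmul)
  ultimately show ?thesis by (simp add: has_field_derivative_def)
qed

lemma partial_deriv_support:
  assumes "\<And>x. norm x > R ==> \<phi> x = 0" "norm x > R"
  shows "partial_deriv i \<phi> x = 0"
proof -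
  have "open {x::real^'n. R < norm x}" by (intro open_Collect_less continuous_intros)
  note op = this
  have "(\<phi> has_derivative (\<lambda>_. 0)) (at x)"
    by (rule has_derivative_transform_within_open[of "\<lambda>_. 0" _ x UNIV "{x. R < norm x}"]) (use assms op in auto)
  from frechet_derivative_at[OF this] show ?thesis unfolding partial_deriv_def by metis
qed

text \<open>Linear combinations of products of polynomials, each factor differentiated \<open>m l\<close> times in the
  \<open>l\<close>-th coordinate. In this form classical derivatives of Hermite sums stay in the same
  family.\<close>
definition pfun :: "'i set => ('i => real) => ('i => 'n::finite => real poly) => ('n => nat) => real^'n => real" where
  "pfun I c Q m x = (\<Sum>i\<in>I. c i * tens (\<lambda>l. poly ((pderiv ^^ m l) (Q i l))) x)"

lemma dfam_poly: "dfam (\<lambda>j. poly ((pderiv ^^ j) q))"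
  by (simp add: dfam_def)

lemma pfun_DERIV:
  "((\<lambda>t. pfun I c Q m (x + t *\<^sub>R axis i 1)) has_real_derivative pfun I c Q (\<lambda>l. m l + (if l = i then 1 else 0)) x) (at 0)"
proof -
  have "((\<lambda>t. tens (\<lambda>l. poly ((pderiv ^^ m l) (Q j l))) (x + t *\<^sub>R axis i 1)) has_real_derivative
     tens (\<lambda>l. poly ((pderiv ^^ (m l + (if l = i then 1 else 0))) (Q j l))) x) (at 0)" for j
  proof -
    have d: "\<And>l. dfam (\<lambda>k. poly ((pderiv ^^ k) (Q j l)))" by (rule dfam_poly)
    have "tens (\<lambda>l. poly ((pderiv ^^ m l) (Q j l))) differentiable (at x)"
      unfolding differentiable_def by (rule exI, rule tens_has_derivative[OF d])
    from partial_deriv_DERIV[OF this, of i] show ?thesis by (simp only: partial_deriv_tens[OF d])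
  qed
  then show ?thesis unfolding pfun_def by (intro DERIV_sum DERIV_cmult) auto
qed

lemma pfun_continuous: "continuous_on UNIV (pfun I c Q m :: real^'n::finite => real)"
proof -
  have "continuous_on UNIV (\<lambda>x::real^'n. poly p (x $ l))" for p :: "real poly" and l :: 'n
    by (intro continuous_on_poly continuous_intros)
  then show ?thesis unfolding pfun_def[abs_def] tens_def by (intro continuous_intros)
qed

lemma pfun_L2: "finite I ==> pfun I c Q m \<in> L2"
  unfolding pfun_def[abs_def] by (intro L2_sum L2_cmult tens_poly_L2)

text \<open>One partial derivative is moved at a time, by \<open>integral_directional_deriv_0\<close> applied to the
  product.\<close>
lemma pfun_ibp:
  fixes \<phi> :: "real^'n::finite => real"
  assumes sm: "\<And>is x. foldr partial_deriv is \<phi> differentiable at x" and supp: "\<And>x. norm x > R ==> \<phi> x = 0"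
  shows "(\<integral>x. pfun I c Q m x * foldr partial_deriv is \<phi> x \<partial>lborel)
    = (-1) ^ length is * (\<integral>x. pfun I c Q (\<lambda>l. m l + count_list is l) x * \<phi> x \<partial>lborel)"
proof (induction "is" arbitrary: m)
  case (Cons i "is")
  define \<psi> where "\<psi> = foldr partial_deriv is \<phi>"
  have \<psi>s: "norm x > R ==> \<psi> x = 0" for x
    unfolding \<psi>_def by (induction "is" arbitrary: x) (auto intro: supp partial_deriv_support)
  have \<psi>'s: "norm x > R ==> partial_deriv i \<psi> x = 0" for x
    by (rule partial_deriv_support[OF \<psi>s])
  have \<psi>d: "\<psi> differentiable (at x)" for x unfolding \<psi>_def by (rule sm)
  have \<psi>'d: "partial_deriv i \<psi> differentiable (at x)" for x unfolding \<psi>_def using sm[of "i # is"] by simp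
  have c1: "continuous_on UNIV \<psi>" and c2: "continuous_on UNIV (partial_deriv i \<psi>)"
    using \<psi>d \<psi>'d by (auto intro!: continuous_at_imp_continuous_on differentiable_imp_continuous_within)
  let ?m = "\<lambda>l. m l + (if l = i then 1 else 0)"
  have i1: "integrable lborel (\<lambda>x. pfun I c Q m x * partial_deriv i \<psi> x)"
    by (rule cont_supp_integrable[where R=R]) (use \<psi>'s in \<open>auto intro!: continuous_intros pfun_continuous c2 simp: not_less[symmetric]\<close>)
  have i2: "integrable lborel (\<lambda>x. pfun I c Q ?m x * \<psi> x)"
    by (rule cont_supp_integrable[where R=R]) (use \<psi>s in \<open>auto intro!: continuous_intros pfun_continuous c1 simp: not_less[symmetric]\<close>)
  have "(\<integral>x. pfun I c Q ?m x * \<psi> x + pfun I c Q m x * partial_deriv i \<psi> x \<partial>lborel) = 0"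
  proof (rule integral_directional_deriv_0[where F="\<lambda>x. pfun I c Q m x * \<psi> x" and e="axis i 1" and R=R])
    show "((\<lambda>t. pfun I c Q m (x + t *\<^sub>R axis i 1) * \<psi> (x + t *\<^sub>R axis i 1)) has_real_derivative
      pfun I c Q ?m x * \<psi> x + pfun I c Q m x * partial_deriv i \<psi> x) (at 0)" for x
      using DERIV_mult[OF pfun_DERIV[of I c Q m x i] partial_deriv_DERIV[OF \<psi>d[of x], of i]] by (simp add: mult.commute)
    show "continuous_on UNIV (\<lambda>x. pfun I c Q ?m x * \<psi> x + pfun I c Q m x * partial_deriv i \<psi> x)"
      by (intro continuous_intros pfun_continuous c1 c2)
    show "integrable lborel (\<lambda>x. pfun I c Q m x * \<psi> x)"
      by (rule cont_supp_integrable[where R=R]) (use \<psi>s in \<open>auto intro!: continuous_intros pfun_continuous c1 simp: not_less[symmetric]\<close>)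
    show "norm x \<le> R" if "pfun I c Q ?m x * \<psi> x + pfun I c Q m x * partial_deriv i \<psi> x \<noteq> 0" for x
      using that \<psi>s[of x] \<psi>'s[of x] by (cases "norm x > R") auto
  qed
  then have "(\<integral>x. pfun I c Q m x * partial_deriv i \<psi> x \<partial>lborel) = - (\<integral>x. pfun I c Q ?m x * \<psi> x \<partial>lborel)"
    using i1 i2 by simp
  also have "(\<integral>x. pfun I c Q ?m x * \<psi> x \<partial>lborel) = (-1) ^ length is * (\<integral>x. pfun I c Q (\<lambda>l. ?m l + count_list is l) x * \<phi> x \<partial>lborel)"
    unfolding \<psi>_def by (rule Cons.IH)
  also have "(\<lambda>l. ?m l + count_list is l) = (\<lambda>l. m l + count_list (i # is) l)" by (intro ext) simp
  finally show ?case by (simp add: \<psi>_def)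
qed simp

lemma pfun_weak_deriv:
  fixes \<kappa> :: "'n::finite => nat"
  shows "has_weak_deriv \<kappa> (pfun I c Q (\<lambda>_. 0)) (pfun I c Q \<kappa>)"
  unfolding has_weak_deriv_def
proof (intro conjI allI impI)
  have l: "loc_integrable (pfun I c Q m)" for m
    unfolding loc_integrable_def set_integrable_def
    by (intro allI impI borel_integrable_compact continuous_on_subset[OF pfun_continuous]) auto
  show "loc_integrable (pfun I c Q (\<lambda>_. 0))" "loc_integrable (pfun I c Q \<kappa>)" by (rule l)+
  fix \<phi> :: "real^'n => real" assume t: "test_function \<phi>"
  then obtain R where R: "\<And>x. \<phi> x \<noteq> 0 ==> norm x \<le> R"
    by (auto simp: test_function_def compact_closure bounded_iff)
  define xs where "xs = (SOME is. \<forall>i. count_list is i = \<kappa> i)"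
  have xs: "count_list xs i = \<kappa> i" for i
    using someI_ex[OF ex_list_count[of \<kappa>]] unfolding xs_def by blast
  have "length xs = (\<Sum>i\<in>UNIV. count_list xs i)" by (rule sum_count_set[symmetric]) auto
  then have len: "length xs = mdeg \<kappa>" by (simp add: xs mdeg_def)
  have "(\<integral>x. pfun I c Q (\<lambda>_. 0) x * foldr partial_deriv xs \<phi> x \<partial>lborel)
    = (-1) ^ length xs * (\<integral>x. pfun I c Q (\<lambda>l. 0 + count_list xs l) x * \<phi> x \<partial>lborel)"
    by (rule pfun_ibp[where R=R]) (use t R in \<open>auto simp: test_function_def smooth_def not_less[symmetric]\<close>)
  then show "(\<integral>x. pfun I c Q (\<lambda>_. 0) x * multi_deriv \<kappa> \<phi> x \<partial>lborel) = (-1) ^ mdeg \<kappa> * (\<integral>x. pfun I c Q \<kappa> x * \<phi> x \<partial>lborel)"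
    unfolding multi_deriv_def xs_def[symmetric] by (simp add: xs len)
qed

lemma pderiv_funpow_0: "degree p < j ==> (pderiv ^^ j) p = (0 :: real poly)"
proof (induction j arbitrary: p)
  case (Suc j)
  have "(pderiv ^^ Suc j) p = (pderiv ^^ j) (pderiv p)" by (simp only: funpow_Suc_right o_apply)
  also have "... = 0"
  proof (cases "degree p = 0")
    case True
    then have "pderiv p = 0" by (simp add: pderiv_eq_0_iff)
    moreover have "(pderiv ^^ j) 0 = (0 :: real poly)" by (induction j) auto
    ultimately show ?thesis by simp
  next
    case False
    then show ?thesis using Suc by (intro Suc.IH) (simp add: degree_pderiv)
  qed
  finally show ?case .
qed simp

lemma degree_He: "degree (He m) \<le> m"
proof (induction m)
  case (Suc m)
  have "degree ([:0,1:] * He m) \<le> Suc m"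
    by (rule order_trans[OF degree_mult_le]) (use Suc in simp)
  moreover have "degree (pderiv (He m)) \<le> Suc m" using Suc by (simp add: degree_pderiv)
  ultimately show ?case by (simp only: He.simps) (intro degree_diff_le)
qed simp

text \<open>Polynomials have their classical derivatives as weak derivatives, and each factor \<open>He (\<kappa>
  l)\<close> is a polynomial of degree at most \<open>\<kappa> l\<close>, so all derivatives of order
  \<open>k\<close> vanish.\<close>
lemma hermite_sum_null_space:
  fixes c :: "('n::finite => nat) => real"
  shows "(\<lambda>x. \<Sum>\<kappa> | mdeg \<kappa> < k. c \<kappa> * hn \<kappa> x) \<in> null_space k"
proof -
  define I where "I = {\<kappa> :: 'n => nat. mdeg \<kappa> < k}"
  define p where "p = pfun I (\<lambda>\<kappa>. c \<kappa> * nrm \<kappa>) (\<lambda>\<kappa> l. He (\<kappa> l))"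
  have fin: "finite I" by (simp add: I_def)
  have g: "(\<lambda>x. \<Sum>\<kappa> | mdeg \<kappa> < k. c \<kappa> * hn \<kappa> x) = p (\<lambda>_. 0)"
    by (intro ext) (simp add: p_def pfun_def I_def hn_def hp_def mult.assoc)
  have w: "has_weak_deriv \<eta> (p (\<lambda>_. 0)) (p \<eta>)" for \<eta> unfolding p_def by (rule pfun_weak_deriv)
  have w': "has_weak_deriv \<eta> (p (\<lambda>_. 0)) (wd \<eta> (p (\<lambda>_. 0)))" for \<eta>
    unfolding wd_def by (rule someI[of "has_weak_deriv \<eta> (p (\<lambda>_. 0))", OF w])
  have ae: "AE x in gauss. p \<eta> x = wd \<eta> (p (\<lambda>_. 0)) x" for \<eta>
    unfolding AE_gauss_iff by (rule weak_deriv_unique[OF w w'])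
  have pL: "p \<eta> \<in> L2" for \<eta> unfolding p_def by (rule pfun_L2[OF fin])
  have "wd \<eta> (p (\<lambda>_. 0)) \<in> L2" for \<eta>
    using w'[of \<eta>] by (intro L2_AE_cong[OF pL _ ae] loc_integrable_borel) (auto simp: has_weak_deriv_def)
  then have DL: "D \<eta> (p (\<lambda>_. 0)) \<in> L2" for \<eta>
    using L2_cmult[of "wd \<eta> (p (\<lambda>_. 0))" "nrm \<eta>"] by (simp add: D_eq_wd[abs_def])
  have H: "p (\<lambda>_. 0) \<in> Hspace k" unfolding Hspace_def using pL DL w by blast
  have z: "AE x in gauss. D \<eta> (p (\<lambda>_. 0)) x = 0" if \<eta>: "mdeg \<eta> = k" for \<eta>
  proof -
    have "p \<eta> x = 0" for x
      unfolding p_def pfun_def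
    proof (intro sum.neutral ballI)
      fix \<kappa> assume "\<kappa> \<in> I"
      then have "mdeg \<kappa> < mdeg \<eta>" using \<eta> by (simp add: I_def)
      then obtain l where "\<kappa> l < \<eta> l" unfolding mdeg_def by (meson sum_mono not_less)
      then have "(pderiv ^^ \<eta> l) (He (\<kappa> l)) = 0" using degree_He[of "\<kappa> l"] by (intro pderiv_funpow_0) simp
      then have "tens (\<lambda>l. poly ((pderiv ^^ \<eta> l) (He (\<kappa> l)))) x = 0"
        unfolding tens_def by (intro prod_zero) (auto intro!: exI[of _ l])
      then show "c \<kappa> * nrm \<kappa> * tens (\<lambda>l. poly ((pderiv ^^ \<eta> l) (He (\<kappa> l)))) x = 0" by simp
    qed
    then show ?thesis using ae[of \<eta>] by (auto simp: D_eq_wd)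
  qed
  show ?thesis unfolding g null_space_def using H z by blast
qed

section \<open>Differentiating the Mehler kernel in the correlation\<close>

lemma has_real_derivative_integral_dominated:
  fixes F :: "real => 'a => real"
  assumes x0: "x0 \<in> {a<..<b}"
    and int: "\<And>t. t \<in> {a<..<b} ==> integrable M (F t)"
    and der: "\<And>t w. t \<in> {a<..<b} ==> ((\<lambda>t. F t w) has_real_derivative F' t w) (at t)"
    and bd: "\<And>t w. t \<in> {a<..<b} ==> \<bar>F' t w\<bar> \<le> B w"
    and B: "integrable M B" and meas: "F' x0 \<in> borel_measurable M"
  shows "((\<lambda>t. \<integral>w. F t w \<partial>M) has_real_derivative (\<integral>w. F' x0 w \<partial>M)) (at x0)"
  unfolding DERIV_def
proof (subst tendsto_at_iff_sequentially, intro allI impI)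
  fix X :: "nat => real" assume X: "\<forall>i. X i \<in> UNIV - {0}" "X \<longlonglongrightarrow> 0"
  define q where "q h = ((\<integral>w. F (x0 + h) w \<partial>M) - (\<integral>w. F x0 w \<partial>M)) / h" for h
  have "(\<lambda>n. x0 + X n) \<longlonglongrightarrow> x0 + 0" by (intro tendsto_intros X)
  then have "eventually (\<lambda>n. x0 + X n \<in> {a<..<b}) sequentially"
    using x0 by (intro topological_tendstoD) auto
  then obtain N where N: "\<And>n. n \<ge> N ==> x0 + X n \<in> {a<..<b}" by (auto simp: eventually_sequentially)
  have X0: "X n \<noteq> 0" for n using X(1) by auto
  have "(\<lambda>n. \<integral>w. (F (x0 + X (n + N)) w - F x0 w) / X (n + N) \<partial>M) \<longlonglongrightarrow> (\<integral>w. F' x0 w \<partial>M)"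
  proof (rule integral_dominated_convergence[OF meas _ B])
    show "(\<lambda>w. (F (x0 + X (n + N)) w - F x0 w) / X (n + N)) \<in> borel_measurable M" for n
      using borel_measurable_integrable[OF int[OF N[of "n+N"]]] borel_measurable_integrable[OF int[OF x0]] by simp
    show "AE w in M. (\<lambda>n. (F (x0 + X (n + N)) w - F x0 w) / X (n + N)) \<longlonglongrightarrow> F' x0 w"
    proof (intro AE_I2)
      fix w
      have "((\<lambda>h. (F (x0 + h) w - F x0 w) / h) \<longlongrightarrow> F' x0 w) (at 0)"
        using der[OF x0, of w] unfolding DERIV_def .
      moreover have "filterlim (\<lambda>n. X (n + N)) (at 0) sequentially"
        using X0 LIMSEQ_ignore_initial_segment[OF X(2)] by (intro filterlim_atI) auto
      ultimately show "(\<lambda>n. (F (x0 + X (n + N)) w - F x0 w) / X (n + N)) \<longlonglongrightarrow> F' x0 w"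
        by (rule filterlim_compose)
    qed
    show "AE w in M. norm ((F (x0 + X (n + N)) w - F x0 w) / X (n + N)) \<le> B w" for n
    proof (intro AE_I2)
      fix w
      let ?y = "x0 + X (n + N)"
      have y: "?y \<in> {a<..<b}" using N by simp
      have d: "((\<lambda>t. F t w) has_field_derivative F' t w) (at t within {a<..<b})" if "t \<in> {a<..<b}" for t
        using der[OF that] by (rule has_field_derivative_at_within)
      have "norm (F ?y w - F x0 w) \<le> B w * norm (?y - x0)"
        by (rule field_differentiable_bound[where S="{a<..<b}" and f'="\<lambda>t. F' t w"])
          (use d bd y x0 in \<open>auto simp: convex_real_interval\<close>)
      then show "norm ((F ?y w - F x0 w) / X (n + N)) \<le> B w"
        using X0[of "n + N"] by (simp add: abs_divide pos_divide_le_eq)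
    qed
  qed
  also have "(\<lambda>n. \<integral>w. (F (x0 + X (n + N)) w - F x0 w) / X (n + N) \<partial>M) = (\<lambda>n. q (X (n + N)))"
    using int[OF N] int[OF x0] by (simp add: q_def)
  finally have "(\<lambda>n. q (X n)) \<longlonglongrightarrow> (\<integral>w. F' x0 w \<partial>M)" by (rule LIMSEQ_offset)
  then show "((\<lambda>h. ((\<integral>w. F (x0 + h) w \<partial>M) - (\<integral>w. F x0 w \<partial>M)) / h) \<circ> X) \<longlonglongrightarrow> (\<integral>w. F' x0 w \<partial>M)"
    by (simp add: o_def q_def)
qed

text \<open>The joint density of a Gaussian pair of correlation \<open>r\<close> (the Mehler kernel). The normalizing
  power of \<open>1 - r\<^sup>2\<close> is written as an exponential so that the whole kernel is
  differentiated as one.\<close>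
definition kern :: "real => real^'n::finite => real^'n => real" where
  "kern r x y = (1 / (2*pi)) ^ CARD('n) * exp (- (real CARD('n) / 2) * ln (1 - r\<^sup>2) - ((norm x)\<^sup>2 - 2 * r * (x \<bullet> y) + (norm y)\<^sup>2) / (2 * (1 - r\<^sup>2)))"

lemma kern_sym: "kern r x y = kern r y x"
  by (simp add: kern_def inner_commute algebra_simps)

lemma borel_measurable_kern [measurable]:
  "(\<lambda>p. kern r (fst p) (snd p)) \<in> borel_measurable (borel \<Otimes>\<^sub>M borel)"
  unfolding kern_def by measurable

lemma borel_measurable_kern1 [measurable]: "kern r x \<in> borel_measurable borel"
  unfolding kern_def[abs_def] by measurable

lemma kern_affine:
  fixes x z :: "real^'n::finite"
  assumes "\<bar>r\<bar> < 1"
  shows "sqrt (1 - r\<^sup>2) ^ CARD('n) * kern r x (r *\<^sub>R x + sqrt (1 - r\<^sup>2) *\<^sub>R z) = gauss_density x * gauss_density z"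
proof -
  define s where "s = sqrt (1 - r\<^sup>2)"
  have "r\<^sup>2 < 1" using assms by (simp add: abs_square_less_1)
  then have s: "s > 0" "s\<^sup>2 = 1 - r\<^sup>2" by (auto simp: s_def)
  have "(norm x)\<^sup>2 - 2 * r * (x \<bullet> (r *\<^sub>R x + s *\<^sub>R z)) + (norm (r *\<^sub>R x + s *\<^sub>R z))\<^sup>2 = (1 - r\<^sup>2) * (norm x)\<^sup>2 + s\<^sup>2 * (norm z)\<^sup>2"
    unfolding power2_norm_eq_inner by (simp add: inner_add_left inner_add_right inner_commute algebra_simps power2_eq_square)
  also have "... = s\<^sup>2 * ((norm x)\<^sup>2 + (norm z)\<^sup>2)" unfolding s(2)[symmetric] by (rule distrib_left[symmetric])
  finally have q0: "(norm x)\<^sup>2 - 2 * r * (x \<bullet> (r *\<^sub>R x + s *\<^sub>R z)) + (norm (r *\<^sub>R x + s *\<^sub>R z))\<^sup>2 = s\<^sup>2 * ((norm x)\<^sup>2 + (norm z)\<^sup>2)" .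
  have q: "((norm x)\<^sup>2 - 2 * r * (x \<bullet> (r *\<^sub>R x + s *\<^sub>R z)) + (norm (r *\<^sub>R x + s *\<^sub>R z))\<^sup>2) / (2 * (1 - r\<^sup>2)) = ((norm x)\<^sup>2 + (norm z)\<^sup>2) / 2"
    unfolding q0 s(2)[symmetric] using s(1) by simp
  have "ln (1 - r\<^sup>2) = 2 * ln s" using s by (metis ln_realpow of_nat_numeral)
  then have "s ^ CARD('n) * exp (- (real CARD('n) / 2) * ln (1 - r\<^sup>2)) = 1"
    using s by (simp add: exp_minus exp_of_nat_mult)
  then have e: "s ^ CARD('n) * (c * (exp (- (real CARD('n) / 2) * ln (1 - r\<^sup>2)) * d)) = c * d" for c d :: real
    by (metis mult.assoc mult.commute mult_1)
  have "s ^ CARD('n) * kern r x (r *\<^sub>R x + s *\<^sub>R z) = (1 / (2*pi)) ^ CARD('n) * exp (- (((norm x)\<^sup>2 + (norm z)\<^sup>2) / 2))"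
    unfolding kern_def q diff_conv_add_uminus[of "- (real CARD('n) / 2) * ln (1 - r\<^sup>2)"] exp_add by (rule e)
  also have "... = gauss_density x * gauss_density z"
  proof -
    have "((2 * pi) powr (- real CARD('n) / 2)) * ((2 * pi) powr (- real CARD('n) / 2)) = (1 / (2*pi)) ^ CARD('n)"
      by (simp add: powr_add[symmetric] powr_minus powr_realpow power_one_over inverse_eq_divide)
    moreover have "exp (- (((norm x)\<^sup>2 + (norm z)\<^sup>2) / 2)) = exp (- (norm x)\<^sup>2 / 2) * exp (- (norm z)\<^sup>2 / 2)"
      by (subst exp_add[symmetric]) (simp add: add_divide_distrib)
    ultimately have "(1 / (2*pi)) ^ CARD('n) * exp (- (((norm x)\<^sup>2 + (norm z)\<^sup>2) / 2))
      = (((2 * pi) powr (- real CARD('n) / 2)) * ((2 * pi) powr (- real CARD('n) / 2))) * (exp (- (norm x)\<^sup>2 / 2) * exp (- (norm z)\<^sup>2 / 2))"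
      by (simp only:)
    then show ?thesis unfolding gauss_density_def by (simp only: mult.assoc mult.left_commute)
  qed
  finally show ?thesis unfolding s_def .
qed

lemma kern_integral:
  fixes x :: "real^'n::finite"
  assumes r: "\<bar>r\<bar> < 1" and [measurable]: "h \<in> borel_measurable borel"
  shows "(\<integral>y. h y * kern r x y \<partial>lborel) = gauss_density x * (\<integral>z. h (r *\<^sub>R x + sqrt (1 - r\<^sup>2) *\<^sub>R z) \<partial>gauss)"
proof -
  define s where "s = sqrt (1 - r\<^sup>2)"
  have s: "s > 0" using r by (auto simp: s_def abs_square_less_1)
  have "(\<integral>y. h y * kern r x y \<partial>lborel) = s ^ DIM(real^'n) * (\<integral>z. h (r *\<^sub>R x + s *\<^sub>R z) * kern r x (r *\<^sub>R x + s *\<^sub>R z) \<partial>lborel)"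
    using s by (subst lborel_affine_integral[of _ s "r *\<^sub>R x"]) auto
  also have "... = (\<integral>z. h (r *\<^sub>R x + s *\<^sub>R z) * (s ^ CARD('n) * kern r x (r *\<^sub>R x + s *\<^sub>R z)) \<partial>lborel)"
    by (subst integral_mult_right_zero[symmetric]) (simp add: mult_ac)
  also have "... = (\<integral>z. gauss_density x * (gauss_density z * h (r *\<^sub>R x + s *\<^sub>R z)) \<partial>lborel)"
    unfolding s_def kern_affine[OF r] by (simp add: mult_ac)
  also have "... = gauss_density x * (\<integral>z. h (r *\<^sub>R x + s *\<^sub>R z) \<partial>gauss)"
    by (subst integral_gauss_eq) simp_all
  finally show ?thesis unfolding s_def .
qed

text \<open>A polynomial factor costs an arbitrarily small part of the Gaussian decay of the kernel.\<close>
lemma kern_bound: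
  assumes R: "0 < R" "R < 1" and K: "K \<ge> 0"
  shows "\<exists>c C. c > 1/4 \<and> C \<ge> 0 \<and> (\<forall>r (x::real^'n::finite) y q. \<bar>r\<bar> \<le> R \<longrightarrow> \<bar>q\<bar> \<le> K * (1 + (norm x)\<^sup>2 + (norm y)\<^sup>2) \<longrightarrow>
     \<bar>kern r x y * q\<bar> \<le> C * (exp (- c * (norm x)\<^sup>2) * exp (- c * (norm y)\<^sup>2)))"
proof -
  define c1 where "c1 = 1 / (2 * (1 + R))"
  define e where "e = (c1 - 1/4) / 2"
  define c where "c = c1 - e"
  have e: "e > 0" using R by (simp add: e_def c1_def field_simps)
  have c: "c > 1/4" using e by (simp add: c_def e_def field_simps)
  define P where "P = (1 / (2*pi)) ^ CARD('n) * exp (- (real CARD('n) / 2) * ln (1 - R\<^sup>2))"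
  have R2: "0 < 1 - R\<^sup>2" using R by (simp add: abs_square_less_1)
  have "\<bar>kern r x y * q\<bar> \<le> (P * K * (1 + 1/e)) * (exp (- c * (norm x)\<^sup>2) * exp (- c * (norm y)\<^sup>2))"
    if r: "\<bar>r\<bar> \<le> R" and q: "\<bar>q\<bar> \<le> K * (1 + (norm x)\<^sup>2 + (norm y)\<^sup>2)" for r q and x y :: "real^'n"
  proof -
    define t where "t = (norm x)\<^sup>2 + (norm y)\<^sup>2"
    have t: "t \<ge> 0" by (simp add: t_def)
    have r2: "1 - R\<^sup>2 \<le> 1 - r\<^sup>2" using r R by (simp add: abs_le_square_iff[symmetric])
    have "\<bar>x \<bullet> y\<bar> \<le> norm x * norm y" by (rule Cauchy_Schwarz_ineq2)
    also have "2 * (norm x * norm y) \<le> t" using sum_squares_bound[of "norm x" "norm y"] by (simp add: t_def)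
    finally have xy: "2 * \<bar>x \<bullet> y\<bar> \<le> t" by simp
    have "2 * r * (x \<bullet> y) \<le> \<bar>r\<bar> * (2 * \<bar>x \<bullet> y\<bar>)"
      using abs_ge_self[of "r * (x \<bullet> y)"] by (simp add: abs_mult)
    also have "... \<le> \<bar>r\<bar> * t" by (intro mult_left_mono xy) simp
    finally have "(1 - \<bar>r\<bar>) * t \<le> (norm x)\<^sup>2 - 2 * r * (x \<bullet> y) + (norm y)\<^sup>2" by (simp add: t_def algebra_simps)
    moreover have "c1 * t * (2 * (1 - r\<^sup>2)) \<le> (1 - \<bar>r\<bar>) * t"
    proof -
      have "(1 - r\<^sup>2) = (1 - \<bar>r\<bar>) * (1 + \<bar>r\<bar>)" by (simp add: algebra_simps power2_eq_square)
      then have "c1 * t * (2 * (1 - r\<^sup>2)) = ((1 - \<bar>r\<bar>) * t) * ((1 + \<bar>r\<bar>) / (1 + R))" using R by (simp add: c1_def field_simps)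
      also have "... \<le> ((1 - \<bar>r\<bar>) * t) * 1" using r R t by (intro mult_left_mono) auto
      finally show ?thesis by simp
    qed
    ultimately have h1: "c1 * t \<le> ((norm x)\<^sup>2 - 2 * r * (x \<bullet> y) + (norm y)\<^sup>2) / (2 * (1 - r\<^sup>2))"
      using R2 r2 by (subst pos_le_divide_eq) auto
    have "ln (1 - R\<^sup>2) \<le> ln (1 - r\<^sup>2)" using R2 r2 by simp
    then have h2: "- (real CARD('n) / 2) * ln (1 - r\<^sup>2) \<le> - (real CARD('n) / 2) * ln (1 - R\<^sup>2)" by (intro mult_left_mono_neg) auto
    have "exp (- (real CARD('n) / 2) * ln (1 - r\<^sup>2) - ((norm x)\<^sup>2 - 2 * r * (x \<bullet> y) + (norm y)\<^sup>2) / (2 * (1 - r\<^sup>2)))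
      \<le> exp (- (real CARD('n) / 2) * ln (1 - R\<^sup>2) + - (c1 * t))"
      unfolding exp_le_cancel_iff using h1 h2 by linarith
    then have k: "kern r x y \<le> P * exp (- (c1 * t))"
      unfolding kern_def P_def mult.assoc exp_add[symmetric] by (intro mult_left_mono) auto
    have k0: "0 \<le> kern r x y" by (simp add: kern_def)
    have "1 + t \<le> (1 + 1/e) * exp (e * t)"
    proof -
      have h1: "1 \<le> exp (e * t)" using e t by simp
      have "e * t \<le> exp (e * t)" using exp_ge_add_one_self[of "e * t"] by linarith
      then have h2: "t \<le> (1/e) * exp (e * t)" using e by (simp add: field_simps)
      show ?thesis unfolding distrib_right using h1 h2 by linarith
    qed
    then have "\<bar>q\<bar> \<le> K * ((1 + 1/e) * exp (e * t))" using q K mult_left_mono[of "1 + t" "(1 + 1/e) * exp (e * t)" K] by (simp add: t_def add.assoc)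
    then have "\<bar>kern r x y * q\<bar> \<le> (P * exp (- (c1 * t))) * (K * ((1 + 1/e) * exp (e * t)))"
      unfolding abs_mult using k k0 by (intro mult_mono) auto
    also have "... = (P * K * (1 + 1/e)) * exp (- (c1 * t) + e * t)" unfolding exp_add by (simp only: mult_ac)
    also have "- (c1 * t) + e * t = - c * (norm x)\<^sup>2 + - c * (norm y)\<^sup>2" by (simp add: c_def t_def algebra_simps)
    also have "exp (- c * (norm x)\<^sup>2 + - c * (norm y)\<^sup>2) = exp (- c * (norm x)\<^sup>2) * exp (- c * (norm y)\<^sup>2)" by (rule exp_add)
    finally show ?thesis .
  qed
  moreover have "P * K * (1 + 1/e) \<ge> 0" using K e by (simp add: P_def)
  ultimately show ?thesis using c by blast
qed

lemma L2_pair_weight_integrable: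
  fixes f g :: "real^'n::finite => real"
  assumes f: "f \<in> L2" and g: "g \<in> L2" and c: "c > 1/4"
  shows "integrable (lborel \<Otimes>\<^sub>M lborel) (\<lambda>p. (f (fst p) * exp (- c * (norm (fst p))\<^sup>2)) * (g (snd p) * exp (- c * (norm (snd p))\<^sup>2)))"
proof (rule lborel_pair.Fubini_integrable)
  let ?f = "\<lambda>x. f x * exp (- c * (norm x)\<^sup>2)" and ?g = "\<lambda>x. g x * exp (- c * (norm x)\<^sup>2)"
  note fi = L2_integrable_weight[OF f c] and gi = L2_integrable_weight[OF g c]
  have [measurable]: "f \<in> borel_measurable borel" "g \<in> borel_measurable borel" using f g by auto
  show "(\<lambda>p. ?f (fst p) * ?g (snd p)) \<in> borel_measurable (lborel \<Otimes>\<^sub>M lborel)" by measurable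
  have "integrable lborel (\<lambda>x. norm (?f x) * (\<integral>y. norm (?g y) \<partial>lborel))"
    using fi by (intro integrable_mult_left integrable_norm)
  then show "integrable lborel (\<lambda>x. \<integral>y. norm (?f (fst (x, y)) * ?g (snd (x, y))) \<partial>lborel)"
    by (simp add: norm_mult del: real_norm_def)
  show "AE x in lborel. integrable lborel (\<lambda>y. ?f (fst (x, y)) * ?g (snd (x, y)))"
    using gi by (intro AE_I2) simp
qed

lemma kern_pair_integrable:
  fixes f g :: "real^'n::finite => real"
  assumes f: "f \<in> L2" and g: "g \<in> L2" and r: "\<bar>r\<bar> < 1"
    and [measurable]: "case_prod q \<in> borel_measurable (borel \<Otimes>\<^sub>M borel)"
    and q: "\<And>x y. \<bar>q x y\<bar> \<le> K * (1 + (norm x)\<^sup>2 + (norm y)\<^sup>2)"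
  shows "integrable (lborel \<Otimes>\<^sub>M lborel) (\<lambda>(x, y). f x * g y * (kern r x y * q x y))"
proof -
  have [measurable]: "f \<in> borel_measurable borel" "g \<in> borel_measurable borel" using f g by auto
  have K: "K \<ge> 0" using order_trans[OF abs_ge_zero q[of 0 0]] by simp
  obtain R where R: "\<bar>r\<bar> < R" "R < 1" using dense[OF r] by auto
  have R0: "0 < R" using R by linarith
  obtain c C where c: "c > 1/4" "C \<ge> 0" and
    b: "\<And>r (x::real^'n) y q. \<bar>r\<bar> \<le> R ==> \<bar>q\<bar> \<le> K * (1 + (norm x)\<^sup>2 + (norm y)\<^sup>2) ==>
     \<bar>kern r x y * q\<bar> \<le> C * (exp (- c * (norm x)\<^sup>2) * exp (- c * (norm y)\<^sup>2))"
    using kern_bound[OF R0 R(2) K, where 'n='n] by metis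
  have I: "integrable (lborel \<Otimes>\<^sub>M lborel) (\<lambda>p. C * ((f (fst p) * exp (- c * (norm (fst p))\<^sup>2)) * (g (snd p) * exp (- c * (norm (snd p))\<^sup>2))))"
    by (intro integrable_mult_right L2_pair_weight_integrable f g c)
  show ?thesis
  proof (rule Bochner_Integration.integrable_bound[OF I])
    show "(\<lambda>(x, y). f x * g y * (kern r x y * q x y)) \<in> borel_measurable (lborel \<Otimes>\<^sub>M lborel)"
      unfolding kern_def by measurable
    have "\<bar>f x * g y * (kern r x y * q x y)\<bar> \<le> \<bar>C * ((f x * exp (- c * (norm x)\<^sup>2)) * (g y * exp (- c * (norm y)\<^sup>2)))\<bar>" for x y
    proof -
      have "\<bar>f x * g y\<bar> * \<bar>kern r x y * q x y\<bar> \<le> \<bar>f x * g y\<bar> * (C * (exp (- c * (norm x)\<^sup>2) * exp (- c * (norm y)\<^sup>2)))"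
        using R by (intro mult_left_mono b q) auto
      then show ?thesis using c by (simp add: abs_mult mult_ac)
    qed
    then show "AE p in lborel \<Otimes>\<^sub>M lborel. norm (case p of (x, y) => f x * g y * (kern r x y * q x y))
      \<le> norm (C * ((f (fst p) * exp (- c * (norm (fst p))\<^sup>2)) * (g (snd p) * exp (- c * (norm (snd p))\<^sup>2))))"
      by (intro AE_I2) (simp add: split_beta)
  qed
qed

lemma corr_kern:
  assumes f: "f \<in> L2" and g: "g \<in> L2" and r: "\<bar>r\<bar> < 1"
  shows "corr r f g = (\<integral>p. (case p of (x, y) => f x * g y * kern r x y) \<partial>(lborel \<Otimes>\<^sub>M lborel))"
proof -
  have [measurable]: "f \<in> borel_measurable borel" "g \<in> borel_measurable borel" using f g by auto
  have i: "integrable (lborel \<Otimes>\<^sub>M lborel) (\<lambda>(x, y). f x * g y * kern r x y)"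
    using kern_pair_integrable[OF f g r, of "\<lambda>_ _. 1" 1] by simp
  have "(\<integral>p. (case p of (x, y) => f x * g y * kern r x y) \<partial>(lborel \<Otimes>\<^sub>M lborel))
    = (\<integral>x. (\<integral>y. f x * g y * kern r x y \<partial>lborel) \<partial>lborel)"
    by (rule lborel_pair.integral_fst[OF i, symmetric])
  also have "... = (\<integral>x. f x * (\<integral>y. g y * kern r x y \<partial>lborel) \<partial>lborel)"
    by (simp add: mult.assoc)
  also have "... = (\<integral>x. gauss_density x * (f x * OU r g x) \<partial>lborel)"
    unfolding kern_integral[OF r L2_borel[OF g]] OU_def by (simp add: mult_ac)
  also have "... = corr r f g" unfolding corr_def by (subst integral_gauss_eq) simp_all
  finally show ?thesis by simp
qed

text \<open>The logarithmic derivative of \<open>kern\<close> in \<open>r\<close>.\<close>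
definition kbr :: "real => real^'n::finite => real^'n => real" where
  "kbr r x y = (real CARD('n) * r + x \<bullet> y) / (1 - r\<^sup>2) - r * ((norm x)\<^sup>2 - 2 * r * (x \<bullet> y) + (norm y)\<^sup>2) / (1 - r\<^sup>2)\<^sup>2"

lemma kern_DERIV:
  fixes x y :: "real^'n::finite"
  assumes "\<bar>r\<bar> < 1"
  shows "((\<lambda>r. kern r x y) has_real_derivative kern r x y * kbr r x y) (at r)"
proof -
  have p: "1 - r\<^sup>2 > 0" using assms by (simp add: abs_square_less_1)
  have s: "((\<lambda>r. 1 - r\<^sup>2) has_real_derivative - (2 * r)) (at r)" by (auto intro!: derivative_eq_intros)
  have l: "((\<lambda>r. - (real CARD('n) / 2) * ln (1 - r\<^sup>2)) has_real_derivative - (real CARD('n) / 2) * (inverse (1 - r\<^sup>2) * - (2 * r))) (at r)"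
    by (intro DERIV_cmult DERIV_chain'[OF s] DERIV_ln p)
  have n: "((\<lambda>r. (norm x)\<^sup>2 - 2 * r * (x \<bullet> y) + (norm y)\<^sup>2) has_real_derivative - (2 * (x \<bullet> y))) (at r)"
    by (auto intro!: derivative_eq_intros)
  have d: "((\<lambda>r. 2 * (1 - r\<^sup>2)) has_real_derivative 2 * - (2 * r)) (at r)" by (intro DERIV_cmult s)
  have qq: "((\<lambda>r. ((norm x)\<^sup>2 - 2 * r * (x \<bullet> y) + (norm y)\<^sup>2) / (2 * (1 - r\<^sup>2))) has_real_derivative
     (- (2 * (x \<bullet> y)) * (2 * (1 - r\<^sup>2)) - ((norm x)\<^sup>2 - 2 * r * (x \<bullet> y) + (norm y)\<^sup>2) * (2 * - (2 * r))) / ((2 * (1 - r\<^sup>2)) * (2 * (1 - r\<^sup>2)))) (at r)"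
    by (rule DERIV_divide[OF n d]) (use p in simp)
  have alg: "- (real CARD('n) / 2) * (inverse w * - (2 * r)) - (- (2 * u) * (2 * w) - Q * (2 * - (2 * r))) / ((2 * w) * (2 * w))
      = (real CARD('n) * r + u) / w - r * Q / w\<^sup>2" if "w > 0" for w u Q :: real
    using that by (simp add: field_simps power2_eq_square)
  have "((\<lambda>r. - (real CARD('n) / 2) * ln (1 - r\<^sup>2) - ((norm x)\<^sup>2 - 2 * r * (x \<bullet> y) + (norm y)\<^sup>2) / (2 * (1 - r\<^sup>2))) has_real_derivative kbr r x y) (at r)"
    unfolding kbr_def alg[OF p, symmetric] by (rule DERIV_diff[OF l qq])
  from DERIV_cmult[OF DERIV_chain'[OF this DERIV_exp], of "(1 / (2*pi)) ^ CARD('n)"]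
  show ?thesis by (simp add: kern_def mult.assoc)
qed

lemma kbr_bound:
  assumes R: "0 < R" "R < 1"
  shows "\<exists>K\<ge>0. \<forall>r (x::real^'n::finite) y. \<bar>r\<bar> \<le> R \<longrightarrow> \<bar>kbr r x y\<bar> \<le> K * (1 + (norm x)\<^sup>2 + (norm y)\<^sup>2)"
proof -
  have R2: "0 < 1 - R\<^sup>2" using R by (simp add: abs_square_less_1)
  define w where "w = 1 - R\<^sup>2"
  define K where "K = (real CARD('n) + 1) / w + 2 / w\<^sup>2"
  have "\<bar>kbr r x y\<bar> \<le> K * (1 + (norm x)\<^sup>2 + (norm y)\<^sup>2)" if r: "\<bar>r\<bar> \<le> R" for r and x y :: "real^'n"
  proof -
    define t where "t = (norm x)\<^sup>2 + (norm y)\<^sup>2"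
    have t: "t \<ge> 0" by (simp add: t_def)
    have r1: "\<bar>r\<bar> \<le> 1" using r R by linarith
    have v: "0 < w" "w \<le> 1 - r\<^sup>2" using R2 r R by (auto simp: w_def abs_le_square_iff[symmetric])
    have "2 * \<bar>x \<bullet> y\<bar> \<le> 2 * (norm x * norm y)" using Cauchy_Schwarz_ineq2[of x y] by simp
    also have "... \<le> t" using sum_squares_bound[of "norm x" "norm y"] by (simp add: t_def)
    finally have xy: "2 * \<bar>x \<bullet> y\<bar> \<le> t" .
    have a: "\<bar>real CARD('n) * r + x \<bullet> y\<bar> \<le> (real CARD('n) + 1) * (1 + t)"
    proof -
      have "\<bar>real CARD('n) * r\<bar> \<le> real CARD('n) * 1" unfolding abs_mult using r1 by (intro mult_mono) auto
      then have "\<bar>real CARD('n) * r + x \<bullet> y\<bar> \<le> real CARD('n) + t" using xy t by linarith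
      also have "... \<le> (real CARD('n) + 1) * (1 + t)" using t by (simp add: algebra_simps)
      finally show ?thesis .
    qed
    have "\<bar>2 * r * (x \<bullet> y)\<bar> = \<bar>r\<bar> * (2 * \<bar>x \<bullet> y\<bar>)" by (simp add: abs_mult)
    also have "... \<le> 1 * t" using r1 xy t by (intro mult_mono) auto
    finally have q: "\<bar>(norm x)\<^sup>2 - 2 * r * (x \<bullet> y) + (norm y)\<^sup>2\<bar> \<le> 2 * t" by (simp add: t_def) 
    have b: "\<bar>r * ((norm x)\<^sup>2 - 2 * r * (x \<bullet> y) + (norm y)\<^sup>2)\<bar> \<le> 2 * (1 + t)"
    proof -
      have "\<bar>r * ((norm x)\<^sup>2 - 2 * r * (x \<bullet> y) + (norm y)\<^sup>2)\<bar> \<le> 1 * (2 * t)" unfolding abs_mult using r1 q t by (intro mult_mono) auto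
      then show ?thesis by simp
    qed
    have "\<bar>kbr r x y\<bar> \<le> \<bar>(real CARD('n) * r + x \<bullet> y) / (1 - r\<^sup>2)\<bar> + \<bar>r * ((norm x)\<^sup>2 - 2 * r * (x \<bullet> y) + (norm y)\<^sup>2) / (1 - r\<^sup>2)\<^sup>2\<bar>"
      unfolding kbr_def by (rule abs_triangle_ineq4)
    also have "... \<le> ((real CARD('n) + 1) * (1 + t)) / w + (2 * (1 + t)) / w\<^sup>2"
      unfolding abs_divide using a b v t by (intro add_mono frac_le) (auto simp: power_mono)
    also have "... = K * (1 + t)" by (simp add: K_def add_divide_distrib distrib_right)
    finally show ?thesis by (simp add: t_def add.assoc)
  qed
  moreover have "K \<ge> 0" using R2 by (simp add: K_def w_def)
  ultimately show ?thesis by blast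
qed

text \<open>Differentiation under the integral sign: on \<open>\<bar>r\<bar> \<le> R < 1\<close> the differentiated
  kernel is dominated by a Gaussian that is integrable against \<open>f\<close> and \<open>g\<close>.
  Correlation \<open>0\<close> is included, which the spectral gap needs.\<close>
lemma corr_DERIV_kern:
  fixes f g :: "real^'n::finite => real"
  assumes f: "f \<in> L2" and g: "g \<in> L2" and r: "\<bar>r0\<bar> < 1"
  shows "((\<lambda>r. corr r f g) has_real_derivative
     (\<integral>p. (case p of (x, y) => f x * g y * (kern r0 x y * kbr r0 x y)) \<partial>(lborel \<Otimes>\<^sub>M lborel))) (at r0)"
proof -
  have [measurable]: "f \<in> borel_measurable borel" "g \<in> borel_measurable borel" using f g by auto
  obtain R where R: "\<bar>r0\<bar> < R" "R < 1" using dense[OF r] by auto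
  have R0: "0 < R" using R by linarith
  obtain K where K: "K \<ge> 0" "\<And>r (x::real^'n) y. \<bar>r\<bar> \<le> R ==> \<bar>kbr r x y\<bar> \<le> K * (1 + (norm x)\<^sup>2 + (norm y)\<^sup>2)"
    using kbr_bound[OF R0 R(2), where 'n='n] by metis
  obtain c C where c: "c > 1/4" "C \<ge> 0" and
    b: "\<And>r (x::real^'n) y q. \<bar>r\<bar> \<le> R ==> \<bar>q\<bar> \<le> K * (1 + (norm x)\<^sup>2 + (norm y)\<^sup>2) ==>
     \<bar>kern r x y * q\<bar> \<le> C * (exp (- c * (norm x)\<^sup>2) * exp (- c * (norm y)\<^sup>2))"
    using kern_bound[OF R0 R(2) K(1), where 'n='n] by metis
  define B where "B p = \<bar>C * ((f (fst p) * exp (- c * (norm (fst p))\<^sup>2)) * (g (snd p) * exp (- c * (norm (snd p))\<^sup>2)))\<bar>" for p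
  have "((\<lambda>r. \<integral>p. f (fst p) * g (snd p) * kern r (fst p) (snd p) \<partial>(lborel \<Otimes>\<^sub>M lborel)) has_real_derivative
     (\<integral>p. f (fst p) * g (snd p) * (kern r0 (fst p) (snd p) * kbr r0 (fst p) (snd p)) \<partial>(lborel \<Otimes>\<^sub>M lborel))) (at r0)"
  proof (rule has_real_derivative_integral_dominated[where a="-R" and b=R and B=B])
    show "r0 \<in> {-R<..<R}" using R by auto
    show "integrable (lborel \<Otimes>\<^sub>M lborel) (\<lambda>p. f (fst p) * g (snd p) * kern t (fst p) (snd p))" if "t \<in> {-R<..<R}" for t
      using kern_pair_integrable[OF f g, of t "\<lambda>_ _. 1" 1] that R by (auto simp: split_beta')
    show "((\<lambda>t. f (fst p) * g (snd p) * kern t (fst p) (snd p)) has_real_derivative f (fst p) * g (snd p) * (kern t (fst p) (snd p) * kbr t (fst p) (snd p))) (at t)"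
      if "t \<in> {-R<..<R}" for t p
      by (intro DERIV_cmult kern_DERIV) (use that R in auto)
    show "\<bar>f (fst p) * g (snd p) * (kern t (fst p) (snd p) * kbr t (fst p) (snd p))\<bar> \<le> B p" if "t \<in> {-R<..<R}" for t p
    proof -
      have "\<bar>f (fst p) * g (snd p)\<bar> * \<bar>kern t (fst p) (snd p) * kbr t (fst p) (snd p)\<bar>
        \<le> \<bar>f (fst p) * g (snd p)\<bar> * (C * (exp (- c * (norm (fst p))\<^sup>2) * exp (- c * (norm (snd p))\<^sup>2)))"
        using that by (intro mult_left_mono b K) auto
      then show ?thesis using c by (simp add: B_def abs_mult mult_ac)
    qed
    show "integrable (lborel \<Otimes>\<^sub>M lborel) B"
      unfolding B_def by (intro integrable_abs integrable_mult_right L2_pair_weight_integrable f g c)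
    show "(\<lambda>p. f (fst p) * g (snd p) * (kern r0 (fst p) (snd p) * kbr r0 (fst p) (snd p))) \<in> borel_measurable (lborel \<Otimes>\<^sub>M lborel)"
      unfolding kbr_def by measurable
  qed
  note D = this
  have "eventually (\<lambda>t. t \<in> {-1<..<1}) (nhds r0)"
    using r by (intro eventually_nhds_in_open) auto
  then have "eventually (\<lambda>t. (\<integral>p. f (fst p) * g (snd p) * kern t (fst p) (snd p) \<partial>(lborel \<Otimes>\<^sub>M lborel)) = corr t f g) (nhds r0)"
    by eventually_elim (subst corr_kern[OF f g], auto simp: split_beta')
  from DERIV_cong_ev[OF refl this refl] D show ?thesis by (simp add: split_beta')
qed

section \<open>Taylor expansion in the correlation\<close>

abbreviation (input) inc :: "('n => nat) => 'n => 'n => nat" where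
  "inc \<kappa> i \<equiv> (\<lambda>l. \<kappa> l + (if l = i then 1 else 0))"

lemma hp_single: "hp (inc (\<lambda>_. 0) i) z = z $ i"
proof -
  have "hp (inc (\<lambda>_. 0) i) z = (\<Prod>l\<in>UNIV. if l = i then z $ i else 1)"
    unfolding hp_def tens_def by (intro prod.cong) (auto simp: pderiv_pCons)
  then show ?thesis by simp
qed

lemma hp_double: "hp (inc (inc (\<lambda>_. 0) i) i) z = (z $ i)\<^sup>2 - 1"
proof -
  have "hp (inc (inc (\<lambda>_. 0) i) i) z = (\<Prod>l\<in>UNIV. if l = i then (z $ i)\<^sup>2 - 1 else 1)"
    unfolding hp_def tens_def by (intro prod.cong) (auto simp: pderiv_pCons power2_eq_square algebra_simps)
  then show ?thesis by simp
qed

lemma D_step1: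
  assumes f: "f \<in> Hspace k" and \<kappa>: "mdeg \<kappa> < k" and s: "0 < s" "s \<le> 1"
  shows "(\<integral>z. D \<kappa> f (\<mu> + s *\<^sub>R z) * z $ i \<partial>gauss) = s * sqrt (real (Suc (\<kappa> i))) * (\<integral>z. D (inc \<kappa> i) f (\<mu> + s *\<^sub>R z) \<partial>gauss)"
  using D_hermite_step[OF assms, of \<mu> "\<lambda>_. 0" i] by (simp add: hp_single[of i, simplified] hp_0)

lemma D_step2:
  assumes f: "f \<in> Hspace k" and \<kappa>: "mdeg \<kappa> < k" and s: "0 < s" "s \<le> 1"
  shows "(\<integral>z. D \<kappa> f (\<mu> + s *\<^sub>R z) * ((z $ i)\<^sup>2 - 1) \<partial>gauss) = s * sqrt (real (Suc (\<kappa> i))) * (\<integral>z. D (inc \<kappa> i) f (\<mu> + s *\<^sub>R z) * z $ i \<partial>gauss)"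
  using D_hermite_step[OF assms, of \<mu> "inc (\<lambda>_. 0) i" i] unfolding hp_single hp_double .

lemma L2_affine_coord:
  assumes "g \<in> L2" "0 < s" "s \<le> 1"
  shows "integrable gauss (\<lambda>z. g (\<mu> + s *\<^sub>R z) * z $ i)" "integrable gauss (\<lambda>z. g (\<mu> + s *\<^sub>R z) * ((z $ i)\<^sup>2 - 1))"
  using L2_affine_hp[OF assms, of \<mu> "inc (\<lambda>_. 0) i"] L2_affine_hp[OF assms, of \<mu> "inc (inc (\<lambda>_. 0) i) i"]
  unfolding hp_single hp_double by auto

text \<open>In the coordinates that make the pair independent, the logarithmic derivative is a combination of Hermite
  polynomials of degree one and two in \<open>z\<close>.\<close>
lemma kbr_affine:
  fixes x z :: "real^'n::finite"
  assumes "0 \<le> r" "r < 1"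
  shows "kbr r x (r *\<^sub>R x + sqrt (1 - r\<^sup>2) *\<^sub>R z) = (\<Sum>i\<in>UNIV. x $ i / sqrt (1 - r\<^sup>2) * z $ i - r / (1 - r\<^sup>2) * ((z $ i)\<^sup>2 - 1))"
proof -
  define s where "s = sqrt (1 - r\<^sup>2)"
  have s: "s > 0" "1 - r\<^sup>2 = s\<^sup>2" using OU_cs[OF assms] by (auto simp: s_def)
  have r2: "r\<^sup>2 = 1 - s\<^sup>2" using s by simp
  have q: "(norm x)\<^sup>2 - 2 * r * (x \<bullet> (r *\<^sub>R x + s *\<^sub>R z)) + (norm (r *\<^sub>R x + s *\<^sub>R z))\<^sup>2 = s\<^sup>2 * ((norm x)\<^sup>2 + (norm z)\<^sup>2)"
  proof -
    have "(norm x)\<^sup>2 - 2 * r * (x \<bullet> (r *\<^sub>R x + s *\<^sub>R z)) + (norm (r *\<^sub>R x + s *\<^sub>R z))\<^sup>2 = (1 - r\<^sup>2) * (norm x)\<^sup>2 + s\<^sup>2 * (norm z)\<^sup>2"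
      unfolding power2_norm_eq_inner by (simp add: inner_add_left inner_add_right inner_commute algebra_simps power2_eq_square)
    then show ?thesis unfolding s(2) by (simp only: distrib_left)
  qed
  have xy: "x \<bullet> (r *\<^sub>R x + s *\<^sub>R z) = r * (norm x)\<^sup>2 + s * (x \<bullet> z)"
    by (simp add: inner_add_right power2_norm_eq_inner)
  have "kbr r x (r *\<^sub>R x + s *\<^sub>R z) = (real CARD('n) * r + (r * (norm x)\<^sup>2 + s * (x \<bullet> z))) / s\<^sup>2 - r * (s\<^sup>2 * ((norm x)\<^sup>2 + (norm z)\<^sup>2)) / (s\<^sup>2)\<^sup>2"
    unfolding kbr_def q unfolding xy s(2) ..
  also have "... = (x \<bullet> z) / s - r / s\<^sup>2 * ((norm z)\<^sup>2 - real CARD('n))"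
    using s(1) by (simp add: field_simps power2_eq_square)
  also have "... = (\<Sum>i\<in>UNIV. x $ i / s * z $ i - r / s\<^sup>2 * ((z $ i)\<^sup>2 - 1))"
    by (simp add: inner_vec_def norm_vec_squared sum_subtractf sum_distrib_left sum_divide_distrib right_diff_distrib)
  finally show ?thesis unfolding s_def[symmetric] unfolding s(2) .
qed

text \<open>The logarithmic derivative of the kernel is integrated by parts twice: the Hermite polynomials in one
  variable turn into a derivative of \<open>D \<eta> g\<close>, which leaves a factor linear in the other
  variable; that factor turns into a derivative of \<open>D \<kappa> f\<close>.\<close>
lemma corr_D_DERIV:
  fixes f g :: "real^'n::finite => real"
  assumes f: "f \<in> Hspace k" and g: "g \<in> Hspace k" and \<kappa>: "mdeg \<kappa> < k" and \<eta>: "mdeg \<eta> < k" and r: "0 \<le> r" "r < 1"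
  shows "((\<lambda>r. corr r (D \<kappa> f) (D \<eta> g)) has_real_derivative
     (\<Sum>i\<in>UNIV. sqrt (real (Suc (\<kappa> i))) * sqrt (real (Suc (\<eta> i))) * corr r (D (inc \<kappa> i) f) (D (inc \<eta> i) g))) (at r)"
proof -
  define s where "s = sqrt (1 - r\<^sup>2)"
  have s: "s > 0" "s \<le> 1" "1 - r\<^sup>2 = s\<^sup>2" using OU_cs[OF r] by (auto simp: s_def)
  have ar: "\<bar>r\<bar> < 1" using r by simp
  have k\<kappa>: "mdeg \<kappa> \<le> k" "mdeg (inc \<kappa> i) \<le> k" and k\<eta>: "mdeg \<eta> \<le> k" "mdeg (inc \<eta> i) \<le> k" for i
    using \<kappa> \<eta> mdeg_add_single[of \<kappa> i] mdeg_add_single[of \<eta> i] by auto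
  define F where "F = D \<kappa> f"
  define G where "G = D \<eta> g"
  define Fi where "Fi i = D (inc \<kappa> i) f" for i
  define Gi where "Gi i = D (inc \<eta> i) g" for i
  define a where "a i = sqrt (real (Suc (\<kappa> i)))" for i
  define b where "b i = sqrt (real (Suc (\<eta> i)))" for i
  have FL: "F \<in> L2" and GL: "G \<in> L2" and FiL: "Fi i \<in> L2" and GiL: "Gi i \<in> L2" for i
    unfolding F_def G_def Fi_def Gi_def using Hspace_D[OF f k\<kappa>(1)] Hspace_D[OF g k\<eta>(1)] Hspace_D[OF f k\<kappa>(2)] Hspace_D[OF g k\<eta>(2)] by auto
  have [measurable]: "F \<in> borel_measurable borel" "G \<in> borel_measurable borel" "\<And>i. Fi i \<in> borel_measurable borel" "\<And>i. Gi i \<in> borel_measurable borel"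
    using FL GL FiL GiL by auto
  define w where "w i x y = (x $ i - r * y $ i) / s\<^sup>2" for i and x y :: "real^'n"
  have wb: "\<bar>w i x y\<bar> \<le> (2 / s\<^sup>2) * (1 + (norm x)\<^sup>2 + (norm y)\<^sup>2)" for i x y
  proof -
    have n: "t \<le> 1 + t\<^sup>2" if "t \<ge> 0" for t :: real using zero_le_power2[of "t - 1"] that by (simp add: power2_diff)
    have "\<bar>x $ i - r * y $ i\<bar> \<le> \<bar>x $ i\<bar> + \<bar>r\<bar> * \<bar>y $ i\<bar>" using abs_triangle_ineq4[of "x $ i" "r * y $ i"] by (simp add: abs_mult)
    also have "... \<le> norm x + 1 * norm y" using r component_le_norm_cart[of x i] component_le_norm_cart[of y i] by (intro add_mono mult_mono) auto
    also have "... \<le> (1 + (norm x)\<^sup>2) + (1 + (norm y)\<^sup>2)" using n[of "norm x"] n[of "norm y"] by simp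
    also have "... \<le> 2 * (1 + (norm x)\<^sup>2 + (norm y)\<^sup>2)" by simp
    finally show ?thesis using s by (simp add: w_def abs_divide divide_right_mono)
  qed
  have wm: "case_prod (w i) \<in> borel_measurable (borel \<Otimes>\<^sub>M borel)" for i
    unfolding w_def cart_eq_inner_axis case_prod_beta' by measurable
  have iw: "integrable (lborel \<Otimes>\<^sub>M lborel) (\<lambda>(x, y). F x * Gi i y * (kern r x y * w i x y))" for i
    by (rule kern_pair_integrable[OF FL GiL ar wm wb])
  obtain R where R: "\<bar>r\<bar> < R" "R < 1" using dense[OF ar] by auto
  have R0: "0 < R" using R by linarith
  obtain K where K: "K \<ge> 0" "\<And>r (x::real^'n) y. \<bar>r\<bar> \<le> R ==> \<bar>kbr r x y\<bar> \<le> K * (1 + (norm x)\<^sup>2 + (norm y)\<^sup>2)"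
    using kbr_bound[OF R0 R(2), where 'n='n] by metis
  have ib: "integrable (lborel \<Otimes>\<^sub>M lborel) (\<lambda>(x, y). F x * G y * (kern r x y * kbr r x y))"
  proof (rule kern_pair_integrable[OF FL GL ar _ K(2)])
    show "case_prod (kbr r) \<in> borel_measurable (borel \<Otimes>\<^sub>M borel)" unfolding kbr_def by measurable
  qed (use R in simp)
  \<comment> \<open>integration by parts in the second variable\<close>
  have inner: "(\<integral>y. G y * (kern r x y * kbr r x y) \<partial>lborel) = (\<Sum>i\<in>UNIV. b i * (\<integral>y. Gi i y * (kern r x y * w i x y) \<partial>lborel))" for x
  proof -
    let ?e = "\<lambda>z. r *\<^sub>R x + s *\<^sub>R z"
    have [measurable]: "kbr r x \<in> borel_measurable borel" "w i x \<in> borel_measurable borel" for i unfolding kbr_def[abs_def] w_def[abs_def] by measurable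
    have "(\<integral>y. G y * (kern r x y * kbr r x y) \<partial>lborel) = (\<integral>y. (G y * kbr r x y) * kern r x y \<partial>lborel)" by (simp add: mult_ac)
    also have "... = gauss_density x * (\<integral>z. G (?e z) * kbr r x (?e z) \<partial>gauss)"
      unfolding s_def by (rule kern_integral[OF ar]) measurable
    also have "(\<integral>z. G (?e z) * kbr r x (?e z) \<partial>gauss)
      = (\<integral>z. (\<Sum>i\<in>UNIV. x $ i / s * (G (?e z) * z $ i) - r / s\<^sup>2 * (G (?e z) * ((z $ i)\<^sup>2 - 1))) \<partial>gauss)"
    proof (intro Bochner_Integration.integral_cong refl)
      fix z
      have "kbr r x (?e z) = (\<Sum>i\<in>UNIV. x $ i / s * z $ i - r / s\<^sup>2 * ((z $ i)\<^sup>2 - 1))"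
        using kbr_affine[OF r, of x z] unfolding s_def[symmetric] unfolding s(3) .
      then show "G (?e z) * kbr r x (?e z) = (\<Sum>i\<in>UNIV. x $ i / s * (G (?e z) * z $ i) - r / s\<^sup>2 * (G (?e z) * ((z $ i)\<^sup>2 - 1)))"
        by (simp add: sum_distrib_left algebra_simps)
    qed
    also have "... = (\<Sum>i\<in>UNIV. x $ i / s * (\<integral>z. G (?e z) * z $ i \<partial>gauss) - r / s\<^sup>2 * (\<integral>z. G (?e z) * ((z $ i)\<^sup>2 - 1) \<partial>gauss))"
      using L2_affine_coord[OF GL s(1,2)] by (subst Bochner_Integration.integral_sum) auto
    also have "... = (\<Sum>i\<in>UNIV. b i * (\<integral>z. Gi i (?e z) * w i x (?e z) \<partial>gauss))"
    proof (intro sum.cong refl)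
      fix i
      have "x $ i / s * (\<integral>z. G (?e z) * z $ i \<partial>gauss) - r / s\<^sup>2 * (\<integral>z. G (?e z) * ((z $ i)\<^sup>2 - 1) \<partial>gauss)
        = x $ i / s * (s * b i * (\<integral>z. Gi i (?e z) \<partial>gauss)) - r / s\<^sup>2 * (s * b i * (\<integral>z. Gi i (?e z) * z $ i \<partial>gauss))"
        unfolding G_def Gi_def b_def D_step1[OF g \<eta> s(1,2)] D_step2[OF g \<eta> s(1,2)] ..
      also have "... = b i * (x $ i * (\<integral>z. Gi i (?e z) \<partial>gauss) - r / s * (\<integral>z. Gi i (?e z) * z $ i \<partial>gauss))"
        using s(1) by (simp add: field_simps power2_eq_square)
      also have "x $ i * (\<integral>z. Gi i (?e z) \<partial>gauss) - r / s * (\<integral>z. Gi i (?e z) * z $ i \<partial>gauss)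
        = (\<integral>z. x $ i * Gi i (?e z) - r / s * (Gi i (?e z) * z $ i) \<partial>gauss)"
        using L2_affine_coord(1)[OF GiL s(1,2)] L2_affine_integrable1[OF GiL s(1,2)] by simp
      also have "... = (\<integral>z. Gi i (?e z) * w i x (?e z) \<partial>gauss)"
      proof (intro Bochner_Integration.integral_cong refl)
        fix z
        have "x $ i - r * (r * x $ i + s * z $ i) = s\<^sup>2 * x $ i - r * s * z $ i"
          unfolding s(3)[symmetric] by (simp add: algebra_simps power2_eq_square)
        then have "w i x (?e z) = x $ i - r / s * z $ i" using s(1) by (simp add: w_def diff_divide_distrib power2_eq_square)
        then show "x $ i * Gi i (?e z) - r / s * (Gi i (?e z) * z $ i) = Gi i (?e z) * w i x (?e z)"
          by (simp only: right_diff_distrib mult_ac)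
      qed
      finally show "x $ i / s * (\<integral>z. G (?e z) * z $ i \<partial>gauss) - r / s\<^sup>2 * (\<integral>z. G (?e z) * ((z $ i)\<^sup>2 - 1) \<partial>gauss)
        = b i * (\<integral>z. Gi i (?e z) * w i x (?e z) \<partial>gauss)" .
    qed
    also have "gauss_density x * (\<Sum>i\<in>UNIV. b i * (\<integral>z. Gi i (?e z) * w i x (?e z) \<partial>gauss))
      = (\<Sum>i\<in>UNIV. b i * (gauss_density x * (\<integral>z. Gi i (?e z) * w i x (?e z) \<partial>gauss)))"
      by (simp add: sum_distrib_left mult_ac)
    also have "... = (\<Sum>i\<in>UNIV. b i * (\<integral>y. Gi i y * (kern r x y * w i x y) \<partial>lborel))"
    proof (intro sum.cong refl)
      fix i
      have "(\<integral>y. (Gi i y * w i x y) * kern r x y \<partial>lborel) = gauss_density x * (\<integral>z. Gi i (?e z) * w i x (?e z) \<partial>gauss)"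
        unfolding s_def by (rule kern_integral[OF ar]) measurable
      then show "b i * (gauss_density x * (\<integral>z. Gi i (?e z) * w i x (?e z) \<partial>gauss)) = b i * (\<integral>y. Gi i y * (kern r x y * w i x y) \<partial>lborel)"
        by (simp add: mult_ac)
    qed
    finally show ?thesis .
  qed
  have outer: "(\<integral>x. F x * (kern r x y * w i x y) \<partial>lborel) = a i * (gauss_density y * OU r (Fi i) y)" for i y
  proof -
    let ?e = "\<lambda>z. r *\<^sub>R y + s *\<^sub>R z"
    have [measurable]: "(\<lambda>x. w i x y) \<in> borel_measurable borel" unfolding w_def by measurable
    have "(\<integral>x. F x * (kern r x y * w i x y) \<partial>lborel) = (\<integral>x. (F x * w i x y) * kern r y x \<partial>lborel)" by (simp add: mult_ac kern_sym)
    also have "... = gauss_density y * (\<integral>z. F (?e z) * w i (?e z) y \<partial>gauss)"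
      unfolding s_def by (rule kern_integral[OF ar]) measurable
    also have "(\<integral>z. F (?e z) * w i (?e z) y \<partial>gauss) = (\<integral>z. (1/s) * (F (?e z) * z $ i) \<partial>gauss)"
      using s(1) by (intro Bochner_Integration.integral_cong refl) (simp add: w_def power2_eq_square)
    also have "... = a i * (\<integral>z. Fi i (?e z) \<partial>gauss)"
      using s(1) by (simp add: F_def Fi_def a_def D_step1[OF f \<kappa> s(1,2)])
    finally show ?thesis by (simp add: OU_def s_def)
  qed
  have "(\<integral>p. (case p of (x, y) => F x * G y * (kern r x y * kbr r x y)) \<partial>(lborel \<Otimes>\<^sub>M lborel))
    = (\<integral>x. (\<integral>y. F x * G y * (kern r x y * kbr r x y) \<partial>lborel) \<partial>lborel)"
    by (rule lborel_pair.integral_fst[OF ib, symmetric])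
  also have "... = (\<integral>x. (\<Sum>i\<in>UNIV. b i * (\<integral>y. F x * Gi i y * (kern r x y * w i x y) \<partial>lborel)) \<partial>lborel)"
  proof (intro Bochner_Integration.integral_cong refl)
    fix x
    have "(\<integral>y. F x * G y * (kern r x y * kbr r x y) \<partial>lborel) = F x * (\<integral>y. G y * (kern r x y * kbr r x y) \<partial>lborel)" by (simp add: mult.assoc)
    also have "... = (\<Sum>i\<in>UNIV. b i * (F x * (\<integral>y. Gi i y * (kern r x y * w i x y) \<partial>lborel)))"
      unfolding inner by (simp add: sum_distrib_left mult.left_commute)
    finally show "(\<integral>y. F x * G y * (kern r x y * kbr r x y) \<partial>lborel) = (\<Sum>i\<in>UNIV. b i * (\<integral>y. F x * Gi i y * (kern r x y * w i x y) \<partial>lborel))"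
      by (simp add: mult.assoc)
  qed
  also have "... = (\<Sum>i\<in>UNIV. b i * (\<integral>x. (\<integral>y. F x * Gi i y * (kern r x y * w i x y) \<partial>lborel) \<partial>lborel))"
    using lborel_pair.integrable_fst[OF iw] by (subst Bochner_Integration.integral_sum) auto
  also have "... = (\<Sum>i\<in>UNIV. a i * b i * corr r (Fi i) (Gi i))"
  proof (intro sum.cong refl)
    fix i
    have "(\<integral>x. (\<integral>y. F x * Gi i y * (kern r x y * w i x y) \<partial>lborel) \<partial>lborel) = (\<integral>y. (\<integral>x. F x * Gi i y * (kern r x y * w i x y) \<partial>lborel) \<partial>lborel)"
      by (rule lborel_pair.Fubini_integral[OF iw, symmetric])
    also have "... = (\<integral>y. Gi i y * (\<integral>x. F x * (kern r x y * w i x y) \<partial>lborel) \<partial>lborel)"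
      by (simp add: mult.commute[of "F _"] mult.assoc)
    also have "... = (\<integral>y. a i * (gauss_density y * (Gi i y * OU r (Fi i) y)) \<partial>lborel)"
      unfolding outer by (simp add: mult_ac)
    also have "... = a i * corr r (Gi i) (Fi i)" unfolding corr_def by (subst integral_gauss_eq) simp_all
    also have "corr r (Gi i) (Fi i) = corr r (Fi i) (Gi i)" by (rule corr_sym[OF GiL FiL r])
    finally show "b i * (\<integral>x. (\<integral>y. F x * Gi i y * (kern r x y * w i x y) \<partial>lborel) \<partial>lborel) = a i * b i * corr r (Fi i) (Gi i)" by simp
  qed
  finally have e: "(\<integral>p. (case p of (x, y) => F x * G y * (kern r x y * kbr r x y)) \<partial>(lborel \<Otimes>\<^sub>M lborel)) = (\<Sum>i\<in>UNIV. a i * b i * corr r (Fi i) (Gi i))" .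
  show ?thesis using corr_DERIV_kern[OF FL GL ar] unfolding e by (simp add: F_def G_def Fi_def Gi_def a_def b_def)
qed

definition phi :: "nat => (real^'n::finite => real) => (real^'n => real) => real => real" where
  "phi j f g r = (\<Sum>\<kappa> | mdeg \<kappa> = j. corr r (D \<kappa> f) (D \<kappa> g))"

text \<open>Each \<open>\<kappa>\<close> of degree \<open>j + 1\<close> is reached from degree \<open>j\<close> by
  raising some index \<open>i\<close>, with weight \<open>\<kappa> i\<close>; the weights add up to the
  degree.\<close>
lemma sum_inc_reindex:
  fixes t :: "('n::finite => nat) => real"
  shows "(\<Sum>\<kappa> | mdeg \<kappa> = j. \<Sum>i\<in>UNIV. real (Suc (\<kappa> i)) * t (inc \<kappa> i)) = real (Suc j) * (\<Sum>\<kappa> | mdeg \<kappa> = Suc j. t \<kappa>)"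
proof -
  let ?A = "{\<kappa> :: 'n => nat. mdeg \<kappa> = j}" and ?B = "{\<kappa> :: 'n => nat. mdeg \<kappa> = Suc j}"
  have "(\<Sum>\<kappa>\<in>?A. \<Sum>i\<in>UNIV. real (Suc (\<kappa> i)) * t (inc \<kappa> i)) = (\<Sum>(\<kappa>,i)\<in>?A \<times> UNIV. real (Suc (\<kappa> i)) * t (inc \<kappa> i))"
    by (rule sum.cartesian_product)
  also have "... = (\<Sum>(\<kappa>,i)\<in>{p\<in>?B \<times> UNIV. fst p (snd p) > 0}. real (\<kappa> i) * t \<kappa>)"
  proof (rule sum.reindex_bij_witness[where i="\<lambda>(\<kappa>,i). (\<kappa>(i := \<kappa> i - 1), i)" and j="\<lambda>(\<kappa>,i). (inc \<kappa> i, i)"])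
    fix p assume "p \<in> {p\<in>?B \<times> UNIV. fst p (snd p) > 0}"
    then obtain \<kappa> i where p: "p = (\<kappa>, i)" "mdeg \<kappa> = Suc j" "\<kappa> i > 0" by (cases p) auto
    have e: "inc (\<kappa>(i := \<kappa> i - 1)) i = \<kappa>" using p(3) by (intro ext) auto
    then have "Suc (mdeg (\<kappa>(i := \<kappa> i - 1))) = Suc j" using mdeg_add_single[of "\<kappa>(i := \<kappa> i - 1)" i] p(2) by simp
    then show "(case p of (\<kappa>, i) => (\<kappa>(i := \<kappa> i - 1), i)) \<in> ?A \<times> UNIV" using p by simp
    show "(case (case p of (\<kappa>, i) => (\<kappa>(i := \<kappa> i - 1), i)) of (\<kappa>, i) => (inc \<kappa> i, i)) = p"
      using e p(1) by simp
  next
    fix p assume "p \<in> ?A \<times> (UNIV :: 'n set)"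
    then obtain \<kappa> i where p: "p = (\<kappa>, i)" "mdeg \<kappa> = j" by (cases p) auto
    show "(case (case p of (\<kappa>, i) => (inc \<kappa> i, i)) of (\<kappa>, i) => (\<kappa>(i := \<kappa> i - 1), i)) = p"
      using p(1) by (auto simp: fun_eq_iff)
    show "(case p of (\<kappa>, i) => (inc \<kappa> i, i)) \<in> {p\<in>?B \<times> UNIV. fst p (snd p) > 0}"
      using p mdeg_add_single[of \<kappa> i] by simp
    show "(case (case p of (\<kappa>, i) => (inc \<kappa> i, i)) of (\<kappa>, i) => real (\<kappa> i) * t \<kappa>) = (case p of (\<kappa>, i) => real (Suc (\<kappa> i)) * t (inc \<kappa> i))"
      using p(1) by simp
  qed
  also have "... = (\<Sum>(\<kappa>,i)\<in>?B \<times> UNIV. real (\<kappa> i) * t \<kappa>)"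
    by (rule sum.mono_neutral_left) auto
  also have "... = (\<Sum>\<kappa>\<in>?B. \<Sum>i\<in>UNIV. real (\<kappa> i) * t \<kappa>)" by (rule sum.cartesian_product[symmetric])
  also have "... = (\<Sum>\<kappa>\<in>?B. real (Suc j) * t \<kappa>)"
  proof (intro sum.cong refl)
    fix \<kappa> assume "\<kappa> \<in> ?B"
    then have "(\<Sum>i\<in>UNIV. real (\<kappa> i)) = real (Suc j)" by (simp add: mdeg_def flip: of_nat_sum)
    then show "(\<Sum>i\<in>UNIV. real (\<kappa> i) * t \<kappa>) = real (Suc j) * t \<kappa>" by (simp flip: sum_distrib_right)
  qed
  finally show ?thesis by (simp add: sum_distrib_left)
qed

lemma phi_DERIV:
  assumes f: "f \<in> Hspace k" and g: "g \<in> Hspace k" and j: "j < k" and r: "0 \<le> r" "r < 1"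
  shows "(phi j f g has_real_derivative real (Suc j) * phi (Suc j) f g r) (at r)"
proof -
  have "((\<lambda>r. \<Sum>\<kappa> | mdeg \<kappa> = j. corr r (D \<kappa> f) (D \<kappa> g)) has_real_derivative
    (\<Sum>\<kappa> | mdeg \<kappa> = j. \<Sum>i\<in>UNIV. sqrt (real (Suc (\<kappa> i))) * sqrt (real (Suc (\<kappa> i))) * corr r (D (inc \<kappa> i) f) (D (inc \<kappa> i) g))) (at r)"
    by (rule DERIV_sum) (rule corr_D_DERIV[OF f g _ _ r]; use j in simp)
  also have "(\<Sum>\<kappa> | mdeg \<kappa> = j. \<Sum>i\<in>UNIV. sqrt (real (Suc (\<kappa> i))) * sqrt (real (Suc (\<kappa> i))) * corr r (D (inc \<kappa> i) f) (D (inc \<kappa> i) g))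
    = (\<Sum>\<kappa> | mdeg \<kappa> = j. \<Sum>i\<in>UNIV. real (Suc (\<kappa> i)) * corr r (D (inc \<kappa> i) f) (D (inc \<kappa> i) g))"
    by simp
  also have "... = real (Suc j) * phi (Suc j) f g r"
    unfolding phi_def by (rule sum_inc_reindex)
  finally show ?thesis by (simp add: phi_def[abs_def])
qed

lemma OU_0: "OU 0 g x = (\<integral>z. g z \<partial>gauss)"
  by (simp add: OU_def)

lemma phi_0: "phi j f g 0 = (\<Sum>\<kappa> | mdeg \<kappa> = j. (\<integral>x. D \<kappa> f x \<partial>gauss) * (\<integral>x. D \<kappa> g x \<partial>gauss))"
  by (simp add: phi_def corr_def OU_0)

text \<open>\<open>f\<close> itself is a weak derivative of order \<open>0\<close>, and weak derivatives are unique.\<close>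
lemma D_0:
  assumes f: "f \<in> Hspace k"
  shows "AE x in gauss. D (\<lambda>_. 0) f x = f x"
proof -
  have w: "has_weak_deriv (\<lambda>_. 0) f (wd (\<lambda>_. 0) f)" using Hspace_wd(1)[OF f, of "\<lambda>_. 0"] by (simp add: mdeg_def)
  have "multi_deriv (\<lambda>_. 0) \<phi> = \<phi>" for \<phi> :: "real^'a => real"
  proof -
    have "count_list (SOME is. \<forall>i::'a. count_list is i = 0) i = 0" for i
      using someI_ex[OF ex_list_count[of "\<lambda>_::'a. 0"]] by blast
    then have "(SOME is. \<forall>i::'a. count_list is i = 0) = []"
      by (metis count_list_0_iff list.set_intros(1) neq_Nil_conv)
    then show ?thesis by (simp add: multi_deriv_def)
  qed
  then have "has_weak_deriv (\<lambda>_. 0) f f" using w by (simp add: has_weak_deriv_def mdeg_def)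
  then have "AE x in lborel. wd (\<lambda>_. 0) f x = f x" by (rule weak_deriv_unique[OF w])
  then show ?thesis by (simp add: AE_gauss_iff D_eq_wd nrm_def)
qed

lemma corr_AE_cong:
  assumes f: "f \<in> L2" "f' \<in> L2" "AE x in gauss. f x = f' x" and g: "g \<in> L2" "g' \<in> L2" "AE x in gauss. g x = g' x" and r: "0 \<le> r" "r < 1"
  shows "corr r f g = corr r f' g'"
proof -
  have 1: "corr r f g = corr r f' g" if "f \<in> L2" "f' \<in> L2" "AE x in gauss. f x = f' x" "g \<in> L2" for f f' g
  proof -
    have [measurable]: "f \<in> borel_measurable borel" "f' \<in> borel_measurable borel" "g \<in> borel_measurable borel" using that by auto
    show ?thesis unfolding corr_def by (rule integral_cong_AE) (use that(3) in auto)
  qed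
  have "corr r f g = corr r f' g" by (rule 1[OF f g(1)])
  also have "... = corr r g f'" by (rule corr_sym[OF f(2) g(1) r])
  also have "... = corr r g' f'" by (rule 1[OF g f(2)])
  also have "... = corr r f' g'" by (rule corr_sym[OF g(2) f(2) r])
  finally show ?thesis .
qed

lemma phi_zero_eq:
  assumes f: "f \<in> Hspace k" and g: "g \<in> Hspace k" and r: "0 \<le> r" "r < 1"
  shows "phi 0 f g r = corr r f g"
proof -
  have "{\<kappa> :: 'a => nat. mdeg \<kappa> = 0} = {\<lambda>_. 0}" by (auto simp: mdeg_def)
  then have "phi 0 f g r = corr r (D (\<lambda>_. 0) f) (D (\<lambda>_. 0) g)" by (simp add: phi_def)
  also have "... = corr r f g"
    by (intro corr_AE_cong D_0[OF f] D_0[OF g] Hspace_D[OF f] Hspace_D[OF g] Hspace_L2[OF f] Hspace_L2[OF g] r) (simp_all add: mdeg_def)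
  finally show ?thesis .
qed

text \<open>The Taylor coefficients at correlation \<open>0\<close> are products of means, because there the pair is
  independent.\<close>
lemma corr_Taylor:
  assumes f: "f \<in> Hspace k" and g: "g \<in> Hspace k" and k: "k > 0" and r: "0 \<le> r" "r < 1"
  shows "((\<lambda>x. real k * (r - x) ^ (k - 1) * phi k f g x) has_integral
     corr r f g - (\<Sum>\<kappa> | mdeg \<kappa> < k. r ^ mdeg \<kappa> * ((\<integral>x. D \<kappa> f x \<partial>gauss) * (\<integral>x. D \<kappa> g x \<partial>gauss)))) {0..r}"
proof -
  define Df where "Df j x = fact j * phi j f g x" for j x
  have "((\<lambda>x. ((r - x) ^ (k - 1) / fact (k - 1)) *\<^sub>R Df k x) has_integral Df 0 r - (\<Sum>i<k. ((r - 0) ^ i / fact i) *\<^sub>R Df i 0)) {0..r}"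
  proof (rule Taylor_has_integral[OF k refl _ r(1)])
    fix m t assume "m < k" "0 \<le> t" "t \<le> r"
    then have "((\<lambda>x. fact m * phi m f g x) has_real_derivative fact m * (real (Suc m) * phi (Suc m) f g t)) (at t)"
      using r by (intro DERIV_cmult phi_DERIV[OF f g]) auto
    then have "(Df m has_real_derivative Df (Suc m) t) (at t)"
      unfolding Df_def by (simp add: mult_ac)
    then show "(Df m has_vector_derivative Df (Suc m) t) (at t within {0..r})"
      using has_field_derivative_at_within has_real_derivative_iff_has_vector_derivative by blast
  qed
  moreover have "((r - x) ^ (k - 1) / fact (k - 1)) *\<^sub>R Df k x = real k * (r - x) ^ (k - 1) * phi k f g x" for x
    using k by (cases k) (simp_all add: Df_def)
  moreover have "(\<Sum>i<k. ((r - 0) ^ i / fact i) *\<^sub>R Df i 0) = (\<Sum>\<kappa> | mdeg \<kappa> < k. r ^ mdeg \<kappa> * ((\<integral>x. D \<kappa> f x \<partial>gauss) * (\<integral>x. D \<kappa> g x \<partial>gauss)))"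
  proof -
    have "(\<Sum>\<kappa> | mdeg \<kappa> < k. r ^ mdeg \<kappa> * ((\<integral>x. D \<kappa> f x \<partial>gauss) * (\<integral>x. D \<kappa> g x \<partial>gauss)))
      = (\<Sum>i<k. \<Sum>\<kappa> | \<kappa> \<in> {\<kappa>. mdeg \<kappa> < k} \<and> mdeg \<kappa> = i. r ^ mdeg \<kappa> * ((\<integral>x. D \<kappa> f x \<partial>gauss) * (\<integral>x. D \<kappa> g x \<partial>gauss)))"
      by (rule sum.group[symmetric]) auto
    also have "... = (\<Sum>i<k. r ^ i * phi i f g 0)"
    proof (intro sum.cong refl)
      fix i assume "i \<in> {..<k}"
      then have "{\<kappa>. \<kappa> \<in> {\<kappa>. mdeg \<kappa> < k} \<and> mdeg \<kappa> = i} = {\<kappa> :: 'a => nat. mdeg \<kappa> = i}" by auto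
      then show "(\<Sum>\<kappa> | \<kappa> \<in> {\<kappa>. mdeg \<kappa> < k} \<and> mdeg \<kappa> = i. r ^ mdeg \<kappa> * ((\<integral>x. D \<kappa> f x \<partial>gauss) * (\<integral>x. D \<kappa> g x \<partial>gauss))) = r ^ i * phi i f g 0"
        by (simp add: phi_0 sum_distrib_left)
    qed
    finally show ?thesis by (simp add: Df_def)
  qed
  ultimately show ?thesis by (simp add: Df_def phi_zero_eq[OF f g r])
qed

section \<open>The high-degree weight\<close>

lemma abs_mult_le_weighted:
  fixes a b t :: real
  assumes "t > 0"
  shows "\<bar>a * b\<bar> \<le> a\<^sup>2 / (2 * t) + t * b\<^sup>2 / 2"
proof -
  have "0 \<le> (\<bar>a\<bar> - t * \<bar>b\<bar>)\<^sup>2" by simp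
  then have "2 * t * \<bar>a * b\<bar> \<le> a\<^sup>2 + t\<^sup>2 * b\<^sup>2" by (simp add: power2_diff power_mult_distrib abs_mult mult_ac)
  then have "\<bar>a * b\<bar> \<le> (a\<^sup>2 + t\<^sup>2 * b\<^sup>2) / (2 * t)" using assms by (simp add: pos_le_divide_eq mult_ac)
  also have "... = a\<^sup>2 / (2 * t) + t * b\<^sup>2 / 2" using assms by (simp add: field_simps power2_eq_square)
  finally show ?thesis .
qed

lemma L2_bounded_AE:
  assumes [measurable]: "f \<in> borel_measurable borel" and "AE x in gauss. \<bar>f x\<bar> \<le> C"
  shows "f \<in> L2"
proof -
  have "AE x in gauss. (f x)\<^sup>2 \<le> C\<^sup>2"
    using assms(2) by eventually_elim (metis abs_ge_zero power2_abs power_mono)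
  then show ?thesis by (auto simp: L2_def intro!: gauss.integrable_const_bound[where B="C\<^sup>2"])
qed

text \<open>Measurable functions are almost everywhere limits of continuous ones; truncation keeps the bound.\<close>
lemma bounded_approx_continuous:
  fixes f :: "real^'n::finite => real"
  assumes [measurable]: "f \<in> borel_measurable borel" and b: "AE x in gauss. \<bar>f x\<bar> \<le> 1"
  obtains c where "\<And>m. continuous_on UNIV (c m)" "\<And>m x. \<bar>c m x\<bar> \<le> 1"
    "(\<lambda>m. \<integral>x. (f x - c m x)\<^sup>2 \<partial>gauss) \<longlonglongrightarrow> 0"
proof -
  have "f \<in> borel_measurable (lebesgue_on UNIV)" by (simp add: borel_measurable_if_D measurable_completion)
  then have "f measurable_on UNIV" by (simp add: measurable_on_iff_borel_measurable)
  then obtain N h where N: "negligible N" and h: "\<And>m. continuous_on UNIV (h m)" "\<And>x. x \<notin> N ==> (\<lambda>m. h m x) \<longlonglongrightarrow> f x"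
    by (auto simp: measurable_on_def)
  define c where "c m x = max (-1) (min 1 (h m x))" for m :: nat and x
  have c1: "continuous_on UNIV (c m)" for m unfolding c_def[abs_def] by (intro continuous_intros h)
  have c2: "\<bar>c m x\<bar> \<le> 1" for m x by (auto simp: c_def)
  have [measurable]: "c m \<in> borel_measurable borel" for m using c1 by (rule borel_measurable_continuous_onI)
  have AN: "AE x in gauss. x \<notin> N"
  proof -
    have "N \<in> null_sets lebesgue" using N by (simp add: negligible_iff_null_sets)
    then have "AE x in lebesgue. x \<notin> N" by (rule AE_not_in)
    then have "AE x in lborel. x \<notin> N" by (simp add: AE_completion_iff)
    then show ?thesis by (simp add: AE_gauss_iff)
  qed
  have "(\<lambda>m. \<integral>x. (f x - c m x)\<^sup>2 \<partial>gauss) \<longlonglongrightarrow> (\<integral>x. 0 \<partial>(gauss :: (real^'n) measure))"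
  proof (rule integral_dominated_convergence[where w="\<lambda>_. 4"])
    show "AE x in gauss. (\<lambda>m. (f x - c m x)\<^sup>2) \<longlonglongrightarrow> 0" using AN b
    proof eventually_elim
      case (elim x)
      have "(\<lambda>m. c m x) \<longlonglongrightarrow> max (-1) (min 1 (f x))" unfolding c_def using h(2)[OF elim(1)]
        by (intro tendsto_max tendsto_min tendsto_const)
      moreover have "max (-1) (min 1 (f x)) = f x" using elim(2) by (auto simp: abs_le_iff)
      ultimately have "(\<lambda>m. (f x - c m x)\<^sup>2) \<longlonglongrightarrow> (f x - f x)\<^sup>2" by (intro tendsto_power tendsto_diff tendsto_const) simp
      then show ?case by simp
    qed
    show "AE x in gauss. norm ((f x - c m x)\<^sup>2) \<le> 4" for m using b
    proof eventually_elim
      case (elim x)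
      have "\<bar>f x - c m x\<bar> \<le> 2" using elim c2[of m x] by linarith
      then have "\<bar>f x - c m x\<bar>\<^sup>2 \<le> 2\<^sup>2" by (intro power_mono) auto
      then show ?case by simp
    qed
  qed auto
  then show ?thesis using that[OF c1 c2] by simp
qed

text \<open>Strong continuity of the semigroup at \<open>1\<close>, in weak form. It is clear for continuous bounded
  functions, and these are dense.\<close>
lemma corr_LIMSEQ:
  fixes f g :: "real^'n::finite => real"
  assumes fm: "f \<in> borel_measurable borel" and b: "AE x in gauss. \<bar>f x\<bar> \<le> 1" and g: "g \<in> L2"
    and S: "\<And>n. 0 \<le> S n" "\<And>n. S n < 1" "S \<longlonglongrightarrow> 1"
  shows "(\<lambda>n. corr (S n) f g) \<longlonglongrightarrow> (\<integral>x. f x * g x \<partial>gauss)"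
proof -
  obtain c where c: "\<And>m. continuous_on UNIV (c m)" "\<And>m x. \<bar>c m x\<bar> \<le> 1"
    "(\<lambda>m. \<integral>x. (f x - c m x)\<^sup>2 \<partial>gauss) \<longlonglongrightarrow> 0"
    using bounded_approx_continuous[OF fm b] by blast
  have f: "f \<in> L2" by (rule L2_bounded_AE[OF fm b])
  have [measurable]: "f \<in> borel_measurable borel" "g \<in> borel_measurable borel" "\<And>m. c m \<in> borel_measurable borel"
    using f g c(1) by (auto intro: borel_measurable_continuous_onI)
  have cL: "c m \<in> L2" for m by (rule L2_bounded) (use c(2) in auto)
  have dL: "(\<lambda>x. f x - c m x) \<in> L2" for m by (intro L2_diff f cL)
  define K where "K = (\<integral>x. (g x)\<^sup>2 \<partial>gauss)"
  define A where "A m = (\<integral>x. (f x - c m x)\<^sup>2 \<partial>gauss)" for m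
  have K0: "K \<ge> 0" by (simp add: K_def)
  have contC: "(\<lambda>n. corr (S n) (c m) g) \<longlonglongrightarrow> (\<integral>x. c m x * g x \<partial>gauss)" for m
  proof -
    have "(\<lambda>n. \<integral>x. g x * OU (S n) (c m) x \<partial>gauss) \<longlonglongrightarrow> (\<integral>x. g x * c m x \<partial>gauss)"
    proof (rule integral_dominated_convergence[where w="\<lambda>x. \<bar>g x\<bar>"])
      show "(\<lambda>x. g x * OU (S n) (c m) x) \<in> borel_measurable gauss" for n
        using borel_measurable_OU[of "c m" "S n"] by simp
      show "integrable gauss (\<lambda>x. \<bar>g x\<bar>)" using L2_integrable[OF g] by simp
      show "AE x in gauss. (\<lambda>n. g x * OU (S n) (c m) x) \<longlonglongrightarrow> g x * c m x"
      proof (rule AE_I2)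
        fix x :: "real^'n"
        have "(\<lambda>n. \<integral>z. c m (S n *\<^sub>R x + sqrt (1 - (S n)\<^sup>2) *\<^sub>R z) \<partial>gauss) \<longlonglongrightarrow> (\<integral>z. c m x \<partial>(gauss :: (real^'n) measure))"
        proof (rule integral_dominated_convergence[where w="\<lambda>_. 1"])
          show "AE z in gauss. (\<lambda>n. c m (S n *\<^sub>R x + sqrt (1 - (S n)\<^sup>2) *\<^sub>R z)) \<longlonglongrightarrow> c m x"
          proof (rule AE_I2)
            fix z :: "real^'n"
            have "(\<lambda>n. S n *\<^sub>R x + sqrt (1 - (S n)\<^sup>2) *\<^sub>R z) \<longlonglongrightarrow> 1 *\<^sub>R x + sqrt (1 - 1\<^sup>2) *\<^sub>R z"
              by (intro tendsto_intros S)
            then have "(\<lambda>n. S n *\<^sub>R x + sqrt (1 - (S n)\<^sup>2) *\<^sub>R z) \<longlonglongrightarrow> x" by simp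
            moreover have "isCont (c m) x" using c(1)[of m] by (simp add: continuous_on_eq_continuous_at)
            ultimately show "(\<lambda>n. c m (S n *\<^sub>R x + sqrt (1 - (S n)\<^sup>2) *\<^sub>R z)) \<longlonglongrightarrow> c m x" by (rule isCont_tendsto_compose[rotated])
          qed
        qed (use c(2) in auto)
        then have "(\<lambda>n. OU (S n) (c m) x) \<longlonglongrightarrow> c m x" by (simp add: OU_def gauss_prob_UNIV)
        then show "(\<lambda>n. g x * OU (S n) (c m) x) \<longlonglongrightarrow> g x * c m x" by (intro tendsto_mult tendsto_const)
      qed
      show "AE x in gauss. norm (g x * OU (S n) (c m) x) \<le> \<bar>g x\<bar>" for n
      proof (rule AE_I2)
        fix x :: "real^'n"
        have i: "integrable gauss (\<lambda>z. c m (S n *\<^sub>R x + sqrt (1 - (S n)\<^sup>2) *\<^sub>R z))" by (rule OU_integrable[OF cL S(1,2)])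
        have "OU (S n) (c m) x \<le> 1" unfolding OU_def
          by (rule gauss.integral_le_const[OF i]) (use c(2) in \<open>simp add: abs_le_iff\<close>)
        moreover have "OU (S n) (c m) x \<ge> -1" unfolding OU_def
          by (rule gauss.integral_ge_const[OF i]) (use c(2) in \<open>simp add: abs_le_iff minus_le_iff\<close>)
        ultimately have "\<bar>OU (S n) (c m) x\<bar> \<le> 1" by linarith
        then show "norm (g x * OU (S n) (c m) x) \<le> \<bar>g x\<bar>" by (simp add: abs_mult mult_left_le)
      qed
    qed auto
    then show ?thesis
      using corr_sym[OF cL g S(1,2)] by (simp add: corr_def mult.commute)
  qed
  have diff: "\<bar>corr (S n) f g - corr (S n) (c m) g\<bar> \<le> A m / (2 * t) + t * K / 2" if "t > 0" for n m t
  proof -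
    have P: "OU (S n) g \<in> L2" by (rule OU_L2(1)[OF g S(1,2)])
    have "corr (S n) f g - corr (S n) (c m) g = (\<integral>x. (f x - c m x) * OU (S n) g x \<partial>gauss)"
      unfolding corr_def by (subst Bochner_Integration.integral_diff[symmetric]) (auto intro: L2_mult f cL P simp: left_diff_distrib)
    also have "\<bar>...\<bar> \<le> (\<integral>x. \<bar>(f x - c m x) * OU (S n) g x\<bar> \<partial>gauss)" by (rule integral_abs_bound)
    also have "... \<le> (\<integral>x. (f x - c m x)\<^sup>2 / (2 * t) + t * (OU (S n) g x)\<^sup>2 / 2 \<partial>gauss)"
      using L2_mult[OF dL P] L2_sq[OF dL[of m]] L2_sq[OF P]
      by (intro integral_mono abs_mult_le_weighted that) auto
    also have "... = A m / (2 * t) + t * (\<integral>x. (OU (S n) g x)\<^sup>2 \<partial>gauss) / 2"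
      using L2_sq[OF dL[of m]] L2_sq[OF P] by (simp add: A_def)
    also have "... \<le> A m / (2 * t) + t * K / 2"
      using OU_L2_le[OF g S(1,2), of n] that by (simp add: K_def mult_left_mono)
    finally show ?thesis .
  qed
  have diff1: "\<bar>(\<integral>x. f x * g x \<partial>gauss) - (\<integral>x. c m x * g x \<partial>gauss)\<bar> \<le> A m / (2 * t) + t * K / 2" if "t > 0" for m t
  proof -
    have "(\<integral>x. f x * g x \<partial>gauss) - (\<integral>x. c m x * g x \<partial>gauss) = (\<integral>x. (f x - c m x) * g x \<partial>gauss)"
      by (subst Bochner_Integration.integral_diff[symmetric]) (auto intro: L2_mult f cL g simp: left_diff_distrib)
    also have "\<bar>...\<bar> \<le> (\<integral>x. \<bar>(f x - c m x) * g x\<bar> \<partial>gauss)" by (rule integral_abs_bound)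
    also have "... \<le> (\<integral>x. (f x - c m x)\<^sup>2 / (2 * t) + t * (g x)\<^sup>2 / 2 \<partial>gauss)"
      using L2_mult[OF dL g] L2_sq[OF dL[of m]] L2_sq[OF g]
      by (intro integral_mono abs_mult_le_weighted that) auto
    also have "... = A m / (2 * t) + t * K / 2"
      using L2_sq[OF dL[of m]] L2_sq[OF g] by (simp add: A_def K_def)
    finally show ?thesis .
  qed
  show ?thesis
  proof (rule LIMSEQ_I)
    fix e :: real assume e: "e > 0"
    define t where "t = e / (4 * (K + 1))"
    have t: "t > 0" using e K0 by (simp add: t_def)
    have tK: "t * K / 2 \<le> e / 8"
    proof -
      have "t * K \<le> t * (K + 1)" using t by simp
      also have "... = e / 4" using K0 by (simp add: t_def field_simps)
      finally show ?thesis by linarith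
    qed
    have "e * t / 4 > 0" using e t by simp
    then obtain m where m: "A m < e * t / 4"
      using LIMSEQ_D[OF c(3), of "e * t / 4"] by (force simp: A_def)
    then have Am: "A m / (2 * t) \<le> e / 8" using t by (simp add: field_simps)
    obtain n0 where n0: "\<And>n. n \<ge> n0 ==> \<bar>corr (S n) (c m) g - (\<integral>x. c m x * g x \<partial>gauss)\<bar> < e / 4"
      using LIMSEQ_D[OF contC, of "e/4"] e by auto
    have "norm (corr (S n) f g - (\<integral>x. f x * g x \<partial>gauss)) < e" if "n \<ge> n0" for n
      using n0[OF that] diff[OF t, of n m] diff1[OF t, of m] tK Am e unfolding real_norm_def by linarith
    then show "\<exists>no. \<forall>n\<ge>no. norm (corr (S n) f g - (\<integral>x. f x * g x \<partial>gauss)) < e" by blast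
  qed
qed

abbreviation mean_D :: "('n::finite => nat) => (real^'n => real) => real" where
  "mean_D \<kappa> f \<equiv> (\<integral>x. D \<kappa> f x \<partial>gauss)"

definition to_one :: "nat => real" where "to_one n = 1 - 1 / (real n + 2)"

lemma to_one: "0 \<le> to_one n" "to_one n < 1" "to_one \<longlonglongrightarrow> 1"
  unfolding to_one_def[abs_def] by (auto simp: field_simps) real_asymp

text \<open>Taylor's formula without remainder: the remainder involves only derivatives of order \<open>k\<close> of
  \<open>g\<close>.\<close>
lemma inner_null_space:
  assumes f: "f \<in> Hspace k" and b: "AE x in gauss. \<bar>f x\<bar> \<le> 1" and g: "g \<in> null_space k"
  shows "(\<integral>x. f x * g x \<partial>gauss) = (\<Sum>\<kappa> | mdeg \<kappa> < k. mean_D \<kappa> f * mean_D \<kappa> g)"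
proof -
  have gH: "g \<in> Hspace k" and g0: "\<And>\<kappa>. mdeg \<kappa> = k ==> AE x in gauss. D \<kappa> g x = 0" using g by (auto simp: null_space_def)
  have [measurable]: "f \<in> borel_measurable borel" "g \<in> borel_measurable borel" using Hspace_L2[OF f] Hspace_L2[OF gH] by auto
  show ?thesis
  proof (cases "k = 0")
    case True
    have "AE x in gauss. D (\<lambda>_. 0) g x = 0" by (rule g0) (simp add: mdeg_def True)
    then have "AE x in gauss. f x * g x = 0" using D_0[OF gH] by eventually_elim simp
    then have "(\<integral>x. f x * g x \<partial>gauss) = 0" by (rule integral_eq_zero_AE)
    then show ?thesis using True by simp
  next
    case False
    have phi0: "phi k f g x = 0" if "0 \<le> x" "x < 1" for x
    proof -
      have "corr x (D \<kappa> f) (D \<kappa> g) = 0" if \<kappa>: "mdeg \<kappa> = k" for \<kappa>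
      proof -
        have "corr x (D \<kappa> f) (D \<kappa> g) = corr x (D \<kappa> f) (\<lambda>_. 0)"
          by (rule corr_AE_cong[OF _ _ _ _ _ _ \<open>0 \<le> x\<close> \<open>x < 1\<close>])
            (use \<kappa> g0[OF \<kappa>] Hspace_D[OF f, of \<kappa>] Hspace_D[OF gH, of \<kappa>] in \<open>auto intro: L2_bounded[where C=0]\<close>)
        then show ?thesis by (simp add: corr_def OU_def)
      qed
      then show ?thesis by (simp add: phi_def)
    qed
    have eq: "corr r f g = (\<Sum>\<kappa> | mdeg \<kappa> < k. r ^ mdeg \<kappa> * (mean_D \<kappa> f * mean_D \<kappa> g))" if r: "0 \<le> r" "r < 1" for r
    proof -
      have "((\<lambda>x. real k * (r - x) ^ (k - 1) * phi k f g x) has_integral 0) {0..r}"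
        by (rule has_integral_is_0) (use phi0 r in auto)
      then have "corr r f g - (\<Sum>\<kappa> | mdeg \<kappa> < k. r ^ mdeg \<kappa> * (mean_D \<kappa> f * mean_D \<kappa> g)) = 0"
        using has_integral_unique corr_Taylor[OF f gH _ r] False by blast
      then show ?thesis by simp
    qed
    have "(\<lambda>n. corr (to_one n) f g) \<longlonglongrightarrow> (\<integral>x. f x * g x \<partial>gauss)"
      by (rule corr_LIMSEQ[OF _ b Hspace_L2[OF gH] to_one]) simp
    moreover have "(\<lambda>n. corr (to_one n) f g) \<longlonglongrightarrow> (\<Sum>\<kappa> | mdeg \<kappa> < k. 1 ^ mdeg \<kappa> * (mean_D \<kappa> f * mean_D \<kappa> g))"
      unfolding eq[OF to_one(1,2)] by (intro tendsto_intros to_one)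
    ultimately show ?thesis using LIMSEQ_unique by fastforce
  qed
qed

lemma null_space_L2: "g \<in> null_space k ==> g \<in> L2"
  using Hspace_L2 by (auto simp: null_space_def)

lemma inner_hn: "f \<in> Hspace k ==> mdeg \<kappa> \<le> k ==> (\<integral>x. f x * hn \<kappa> x \<partial>gauss) = mean_D \<kappa> f"
  using D_hermite[of f k \<kappa> 1 0] by simp

text \<open>The component of \<open>f\<close> orthogonal to the null space is what remains after subtracting the Hermite
  expansion below degree \<open>k\<close>, whose coefficients are the means of the derivatives.\<close>
lemma W_eq:
  assumes f: "f \<in> Hspace k" and b: "AE x in gauss. \<bar>f x\<bar> \<le> 1"
  shows "W k f = (\<integral>x. (f x)\<^sup>2 \<partial>gauss) - (\<Sum>\<kappa> | mdeg \<kappa> < k. (mean_D \<kappa> f)\<^sup>2)"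
proof -
  let ?P = "\<lambda>h. h \<in> L2 \<and> (\<lambda>x. f x - h x) \<in> null_space k \<and> (\<forall>g\<in>null_space k. L2_inner h g = 0)"
  have fL: "f \<in> L2" by (rule Hspace_L2[OF f])
  define g0 where "g0 x = (\<Sum>\<kappa> | mdeg \<kappa> < k. mean_D \<kappa> f * hn \<kappa> x)" for x
  have g0N: "g0 \<in> null_space k" unfolding g0_def[abs_def] by (rule hermite_sum_null_space)
  have g0L: "g0 \<in> L2" by (rule null_space_L2[OF g0N])
  have g0i: "(\<integral>x. g x * g0 x \<partial>gauss) = (\<Sum>\<kappa> | mdeg \<kappa> < k. mean_D \<kappa> f * mean_D \<kappa> g)" if g: "g \<in> Hspace k" for g
  proof -
    have "(\<integral>x. g x * g0 x \<partial>gauss) = (\<integral>x. (\<Sum>\<kappa> | mdeg \<kappa> < k. mean_D \<kappa> f * (g x * hn \<kappa> x)) \<partial>gauss)"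
      by (simp add: g0_def sum_distrib_left mult.left_commute)
    also have "... = (\<Sum>\<kappa> | mdeg \<kappa> < k. mean_D \<kappa> f * (\<integral>x. g x * hn \<kappa> x \<partial>gauss))"
      using L2_mult[OF Hspace_L2[OF g] hn_L2] by (subst Bochner_Integration.integral_sum) auto
    also have "... = (\<Sum>\<kappa> | mdeg \<kappa> < k. mean_D \<kappa> f * mean_D \<kappa> g)"
      by (intro sum.cong refl) (simp add: inner_hn[OF g])
    finally show ?thesis .
  qed
  define h0 where "h0 x = f x - g0 x" for x
  have h0L: "h0 \<in> L2" unfolding h0_def[abs_def] by (intro L2_diff fL g0L)
  have h0: "(\<integral>x. h0 x * g x \<partial>gauss) = 0" if g: "g \<in> null_space k" for g
  proof -
    have gH: "g \<in> Hspace k" using g by (simp add: null_space_def)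
    have "(\<integral>x. h0 x * g x \<partial>gauss) = (\<integral>x. f x * g x \<partial>gauss) - (\<integral>x. g x * g0 x \<partial>gauss)"
      unfolding h0_def using L2_mult[OF fL null_space_L2[OF g]] L2_mult[OF null_space_L2[OF g] g0L]
      by (subst Bochner_Integration.integral_diff[symmetric]) (auto simp: algebra_simps)
    then show ?thesis by (simp add: inner_null_space[OF f b g] g0i[OF gH])
  qed
  have "?P h0" using h0L h0 g0N by (simp add: h0_def L2_inner_def)
  then have P: "?P (high_part k f)" unfolding high_part_def by (rule someI[of ?P])
  define h where "h = high_part k f"
  have hL: "h \<in> L2" and hN: "(\<lambda>x. f x - h x) \<in> null_space k" and h: "\<And>g. g \<in> null_space k ==> (\<integral>x. h x * g x \<partial>gauss) = 0"
    using P by (auto simp: h_def L2_inner_def)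
  note fN = null_space_L2[OF hN]
  have e: "(\<integral>x. u x * (g0 x - (f x - h x)) \<partial>gauss) = 0"
    if u: "u \<in> L2" and z: "\<And>g. g \<in> null_space k ==> (\<integral>x. u x * g x \<partial>gauss) = 0" for u
    using z[OF g0N] z[OF hN] L2_mult[OF u g0L] L2_mult[OF u fN] by (simp add: right_diff_distrib)
  have s: "g0 x - (f x - h x) = h x - h0 x" for x by (simp add: h0_def)
  have "(\<integral>x. h x * h x \<partial>gauss) = (\<integral>x. h x * h0 x \<partial>gauss)"
    using e[OF hL h] L2_mult[OF hL hL] L2_mult[OF hL h0L] unfolding s by (simp add: right_diff_distrib)
  also have "... = (\<integral>x. h0 x * h0 x \<partial>gauss)"
    using e[OF h0L h0] L2_mult[OF h0L hL] L2_mult[OF h0L h0L] unfolding s by (simp add: right_diff_distrib mult.commute)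
  also have "... = (\<integral>x. h0 x * f x \<partial>gauss)"
    using h0[OF g0N] L2_mult[OF h0L fL] L2_mult[OF h0L g0L]
    by (subst (2) h0_def) (simp add: right_diff_distrib)
  also have "... = (\<integral>x. (f x)\<^sup>2 \<partial>gauss) - (\<integral>x. f x * g0 x \<partial>gauss)"
    using L2_mult[OF fL fL] L2_mult[OF fL g0L]
    by (simp add: h0_def algebra_simps power2_eq_square)
  also have "... = (\<integral>x. (f x)\<^sup>2 \<partial>gauss) - (\<Sum>\<kappa> | mdeg \<kappa> < k. (mean_D \<kappa> f)\<^sup>2)"
    by (simp add: g0i[OF f] power2_eq_square)
  finally have "(\<integral>x. (h x)\<^sup>2 \<partial>gauss) = (\<integral>x. (f x)\<^sup>2 \<partial>gauss) - (\<Sum>\<kappa> | mdeg \<kappa> < k. (mean_D \<kappa> f)\<^sup>2)"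
    by (simp add: power2_eq_square)
  moreover have "W k f = (\<integral>x. (h x)\<^sup>2 \<partial>gauss)"
  proof -
    have "\<bar>t\<bar> powr 2 = t\<^sup>2" for t :: real by (cases "t = 0") auto
    then have "W k f = ((\<integral>x. (h x)\<^sup>2 \<partial>gauss) powr (1/2))\<^sup>2" by (simp add: W_def Lp_norm_def h_def)
    also have "... = (\<integral>x. (h x)\<^sup>2 \<partial>gauss)" by (simp add: powr_half_sqrt)
    finally show ?thesis .
  qed
  ultimately show ?thesis by simp
qed

lemma W_nonneg: "0 \<le> W k f"
  by (simp add: W_def)

lemma integral_sq_le_1:
  fixes f :: "real^'n::finite => real"
  assumes [measurable]: "f \<in> borel_measurable borel" and b: "AE x in gauss. \<bar>f x\<bar> \<le> 1"
  shows "(\<integral>x. (f x)\<^sup>2 \<partial>gauss) \<le> 1"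
proof (rule gauss.integral_le_const)
  show "integrable gauss (\<lambda>x. (f x)\<^sup>2)" by (rule L2_sq[OF L2_bounded_AE[OF _ b]]) simp
  show "AE x in gauss. (f x)\<^sup>2 \<le> 1" using b by eventually_elim (simp add: abs_square_le_1)
qed

lemma W_le_1:
  assumes f: "f \<in> Hspace k" and b: "AE x in gauss. \<bar>f x\<bar> \<le> 1"
  shows "W k f \<le> 1"
proof -
  have "f \<in> borel_measurable borel" using Hspace_L2[OF f] by auto
  then have "(\<integral>x. (f x)\<^sup>2 \<partial>gauss) \<le> 1" using b by (rule integral_sq_le_1)
  moreover have "0 \<le> (\<Sum>\<kappa> | mdeg \<kappa> < k. (mean_D \<kappa> f)\<^sup>2)" by (intro sum_nonneg) simp
  ultimately show ?thesis by (simp add: W_eq[OF f b])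
qed

lemma phi_nonneg: "f \<in> Hspace k ==> 0 \<le> r ==> r < 1 ==> 0 \<le> phi k f f r"
  unfolding phi_def by (intro sum_nonneg corr_nonneg Hspace_D[of f k]) auto

lemma phi_mono: "f \<in> Hspace k ==> 0 \<le> r ==> r \<le> r' ==> r' < 1 ==> phi k f f r \<le> phi k f f r'"
  unfolding phi_def by (intro sum_mono corr_mono Hspace_D[of f k]) auto

text \<open>By Taylor's formula at correlation \<open>1\<close>, \<open>W\<close> is the integral of \<open>k (1 -
  r)\<^sup>k\<^sup>-\<^sup>1\<close> times \<open>phi k f f r\<close>. Accordingly \<open>- Q\<close> is an
  antiderivative of a majorant of this integrand.\<close>
lemma W_le_supersolution:
  assumes f: "f \<in> Hspace k" and b: "AE x in gauss. \<bar>f x\<bar> \<le> 1" and k: "k > 0"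
    and S: "finite S" and Qc: "continuous_on {0..1} Q" and Q0: "\<And>r. 0 \<le> r ==> r \<le> 1 ==> 0 \<le> Q r"
    and Qd: "\<And>r. 0 < r ==> r < 1 ==> r \<notin> S ==> (Q has_real_derivative Q' r) (at r)"
    and Q': "\<And>r. 0 < r ==> r < 1 ==> r \<notin> S ==> real k * (1 - r) ^ (k - 1) * phi k f f r \<le> - Q' r"
  shows "W k f \<le> Q 0"
proof -
  let ?T = "\<lambda>r. (\<Sum>\<kappa> | mdeg \<kappa> < k. r ^ mdeg \<kappa> * (mean_D \<kappa> f * mean_D \<kappa> f))"
  have le: "corr r f f - ?T r \<le> Q 0" if r: "0 \<le> r" "r < 1" for r
  proof -
    define q where "q x = (if x \<in> S \<or> x \<le> 0 then real k * (1 - x) ^ (k - 1) * phi k f f x else - Q' x)" for x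
    have I: "(q has_integral (- Q r - - Q 0)) {0..r}"
    proof (rule fundamental_theorem_of_calculus_interior_strong[OF S r(1)])
      fix x assume x: "x \<in> {0<..<r} - S"
      then have "((\<lambda>x. - Q x) has_real_derivative - Q' x) (at x)" using r by (intro DERIV_minus Qd) auto
      then show "((\<lambda>x. - Q x) has_vector_derivative q x) (at x)"
        using x by (simp add: q_def has_real_derivative_iff_has_vector_derivative)
    next
      show "continuous_on {0..r} (\<lambda>x. - Q x)" using r by (intro continuous_intros continuous_on_subset[OF Qc]) auto
    qed
    have "corr r f f - ?T r \<le> - Q r - - Q 0"
    proof (rule has_integral_le[OF corr_Taylor[OF f f k r] I])
      fix x assume x: "x \<in> {0..r}"
      then have p: "0 \<le> phi k f f x" using r by (intro phi_nonneg[OF f]) auto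
      have "(r - x) ^ (k - 1) \<le> (1 - x) ^ (k - 1)" using x r by (intro power_mono) auto
      then have 1: "real k * (r - x) ^ (k - 1) * phi k f f x \<le> real k * (1 - x) ^ (k - 1) * phi k f f x"
        using p by (intro mult_right_mono mult_left_mono) auto
      also have "... \<le> q x" using Q'[of x] x r by (simp add: q_def)
      finally show "real k * (r - x) ^ (k - 1) * phi k f f x \<le> q x" .
    qed
    then show ?thesis using Q0[of r] r by simp
  qed
  have fm: "f \<in> borel_measurable borel" using Hspace_L2[OF f] by auto
  have "(\<lambda>n. corr (to_one n) f f - ?T (to_one n)) \<longlonglongrightarrow> (\<integral>x. f x * f x \<partial>gauss) - ?T 1"
    by (intro tendsto_intros to_one corr_LIMSEQ[OF fm b Hspace_L2[OF f]])
  then have "(\<integral>x. f x * f x \<partial>gauss) - ?T 1 \<le> Q 0"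
    by (rule LIMSEQ_le_const2) (use le[OF to_one(1,2)] in blast)
  then show ?thesis by (simp add: W_eq[OF f b] power2_eq_square)
qed

section \<open>Spectral gap\<close>

lemma integral_Cauchy_Schwarz:
  assumes f: "f \<in> L2" and g: "g \<in> L2"
  shows "(\<integral>x. f x * g x \<partial>gauss)\<^sup>2 \<le> (\<integral>x. (f x)\<^sup>2 \<partial>gauss) * (\<integral>x. (g x)\<^sup>2 \<partial>gauss)"
proof -
  define A where "A = (\<integral>x. (f x)\<^sup>2 \<partial>gauss)"
  define B where "B = (\<integral>x. f x * g x \<partial>gauss)"
  define C where "C = (\<integral>x. (g x)\<^sup>2 \<partial>gauss)"
  have q: "0 \<le> A - 2 * l * B + l\<^sup>2 * C" for l
  proof -
    have "0 \<le> (\<integral>x. (f x - l * g x)\<^sup>2 \<partial>gauss)" by simp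
    also have "... = (\<integral>x. (f x)\<^sup>2 - 2 * l * (f x * g x) + l\<^sup>2 * (g x)\<^sup>2 \<partial>gauss)"
      by (intro Bochner_Integration.integral_cong refl) (simp add: power2_diff power_mult_distrib mult_ac)
    also have "... = A - 2 * l * B + l\<^sup>2 * C"
      using L2_sq[OF f] L2_sq[OF g] L2_mult[OF f g] by (simp add: A_def B_def C_def)
    finally show ?thesis .
  qed
  have "B\<^sup>2 \<le> A * C"
  proof (cases "C = 0")
    case True
    have "B = 0"
    proof (rule ccontr)
      assume "B \<noteq> 0"
      then show False using q[of "(A + 1) / (2 * B)"] True by simp
    qed
    then show ?thesis using True by simp
  next
    case False
    moreover have "C \<ge> 0" by (simp add: C_def)
    ultimately have C: "C > 0" by simp
    have "0 \<le> A - B\<^sup>2 / C" using q[of "B / C"] C by (simp add: power_divide power2_eq_square field_simps)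
    then show ?thesis using C by (simp add: field_simps)
  qed
  then show ?thesis by (simp add: A_def B_def C_def)
qed

lemma integral_OU:
  assumes g: "g \<in> L2" and r: "0 \<le> r" "r < 1"
  shows "(\<integral>x. OU r g x \<partial>gauss) = (\<integral>x. g x \<partial>gauss)"
proof -
  have "(\<integral>x. OU r g x \<partial>gauss) = corr r (\<lambda>_. 1) g" by (simp add: corr_def)
  also have "... = corr r g (\<lambda>_. 1)" by (rule corr_sym[OF _ g r]) simp
  also have "... = (\<integral>x. g x \<partial>gauss)" by (simp add: corr_def OU_def)
  finally show ?thesis .
qed

lemma OU_mono:
  assumes f: "f \<in> L2" and g: "g \<in> L2" and r: "0 \<le> r" "r < 1" and le: "\<And>x. f x \<le> g x"
  shows "OU r f x \<le> OU r g x"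
  unfolding OU_def by (intro integral_mono OU_integrable f g r le)

lemma corr_mono_fun:
  assumes f: "f \<in> L2" and g: "g \<in> L2" and r: "0 \<le> r" "r < 1" and le: "\<And>x. 0 \<le> f x" "\<And>x. f x \<le> g x"
  shows "corr r f f \<le> corr r g g"
  unfolding corr_def
proof (intro integral_mono corr_pair(2) f g r mult_mono OU_mono le)
  show "0 \<le> g x" for x using le order_trans by blast
  show "0 \<le> OU r f x" for x unfolding OU_def by (intro integral_nonneg_AE AE_I2 le)
qed

lemma corr_cmult: "corr r (\<lambda>x. a * f x) (\<lambda>x. b * g x) = a * b * corr r f g"
proof -
  have "(\<lambda>x. (a * f x) * OU r (\<lambda>x. b * g x) x) = (\<lambda>x. (a * b) * (f x * OU r g x))"
    by (simp add: OU_def mult_ac fun_eq_iff)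
  then show ?thesis unfolding corr_def by simp
qed

lemma corr_le_mean:
  assumes f: "f \<in> L2" and g: "g \<in> L2" and r: "0 \<le> r" "r < 1"
  shows "corr r f g \<le> (corr r f f + corr r g g) / 2"
proof -
  have s: "0 \<le> sqrt r" "sqrt r < 1" using r by auto
  note P = OU_L2(1)[OF f s] OU_L2(1)[OF g s]
  have "corr r f g = (\<integral>x. OU (sqrt r) f x * OU (sqrt r) g x \<partial>gauss)"
    using corr_split[OF f g s s] r by simp
  also have "... \<le> (\<integral>x. (OU (sqrt r) f x)\<^sup>2 / 2 + (OU (sqrt r) g x)\<^sup>2 / 2 \<partial>gauss)"
  proof (intro integral_mono L2_mult P)
    show "integrable gauss (\<lambda>x. (OU (sqrt r) f x)\<^sup>2 / 2 + (OU (sqrt r) g x)\<^sup>2 / 2)"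
      using L2_sq[OF P(1)] L2_sq[OF P(2)] by auto
    show "OU (sqrt r) f x * OU (sqrt r) g x \<le> (OU (sqrt r) f x)\<^sup>2 / 2 + (OU (sqrt r) g x)\<^sup>2 / 2" for x
      using sum_squares_bound[of "OU (sqrt r) f x" "OU (sqrt r) g x"] by simp
  qed
  also have "... = (corr r f f + corr r g g) / 2"
    using L2_sq[OF P(1)] L2_sq[OF P(2)] by (simp add: corr_sqrt f g r add_divide_distrib)
  finally show ?thesis .
qed

text \<open>Cauchy-Schwarz bounds the square of the form at \<open>r\<close> by the form at \<open>r\<^sup>2\<close>;
  this is iterated.\<close>
lemma corr_iterate:
  assumes f: "f \<in> L2" and r: "0 \<le> r" "r < 1"
  shows "corr r f f ^ (2 ^ m) \<le> (\<integral>x. (f x)\<^sup>2 \<partial>gauss) ^ (2 ^ m - 1) * corr (r ^ (2 ^ m)) f f"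
proof (induction m)
  case (Suc m)
  define K where "K = (\<integral>x. (f x)\<^sup>2 \<partial>gauss)"
  define R where "R = r ^ (2 ^ m)"
  have R: "0 \<le> R" "R < 1" using r by (auto simp: R_def power_less_one_iff)
  have K: "K \<ge> 0" by (simp add: K_def)
  have "corr r f f ^ (2 ^ Suc m) = (corr r f f ^ (2 ^ m))\<^sup>2" unfolding power_Suc power_mult[symmetric] by (simp add: mult.commute)
  also have "... \<le> (K ^ (2 ^ m - 1) * corr R f f)\<^sup>2"
    using Suc.IH corr_nonneg[OF f r] by (intro power_mono) (auto simp: K_def R_def)
  also have "... = (K ^ (2 ^ m - 1))\<^sup>2 * (corr R f f)\<^sup>2" by (rule power_mult_distrib)
  also have "... \<le> (K ^ (2 ^ m - 1))\<^sup>2 * (K * corr (R * R) f f)"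
  proof (rule mult_left_mono)
    show "(corr R f f)\<^sup>2 \<le> K * corr (R * R) f f"
    proof -
      have e: "corr (R * R) f f = (\<integral>x. (OU R f x)\<^sup>2 \<partial>gauss)" by (simp add: corr_split[OF f f R R] power2_eq_square)
      show ?thesis unfolding e unfolding corr_def K_def by (rule integral_Cauchy_Schwarz[OF f OU_L2(1)[OF f R]])
    qed
  qed simp
  also have "... = K ^ (2 * (2 ^ m - 1) + 1) * corr (R * R) f f"
    by (simp add: power_mult[symmetric] mult.commute)
  also have "2 * (2 ^ m - 1) + 1 = (2 ^ Suc m - 1 :: nat)"
    by (cases "2 ^ m :: nat") auto
  also have "R * R = r ^ (2 ^ Suc m)" by (simp add: R_def power_add[symmetric] mult_2)
  finally show ?case by (simp add: K_def)
qed simp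

text \<open>The spectral gap of the semigroup. By the Cauchy-Schwarz inequality, the quadratic form \<open>corr r f
  f\<close> is log-convex in \<open>ln r\<close>, so its decay rate is everywhere at least the rate as
  \<open>r\<close> tends to \<open>0\<close>, where it is differentiable and, for centred functions,
  vanishes.\<close>
lemma corr_centred_le:
  fixes f :: "real^'n::finite => real"
  assumes f: "f \<in> L2" and z: "(\<integral>x. f x \<partial>gauss) = 0" and r: "0 \<le> r" "r < 1"
  shows "corr r f f \<le> r * (\<integral>x. (f x)\<^sup>2 \<partial>gauss)"
proof (rule ccontr)
  define K where "K = (\<integral>x. (f x)\<^sup>2 \<partial>gauss)"
  assume "\<not> corr r f f \<le> r * (\<integral>x. (f x)\<^sup>2 \<partial>gauss)"
  then have gt: "corr r f f > r * K" by (simp add: K_def)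
  have c0: "corr 0 f f = 0" by (simp add: corr_def OU_0 z)
  have rp: "r > 0" using gt c0 r by (cases "r = 0") auto
  have "K \<ge> 0" by (simp add: K_def)
  moreover have "K \<noteq> 0"
  proof
    assume "K = 0"
    then have "(corr r f f)\<^sup>2 \<le> 0" using corr_iterate[OF f r, of 1] by (simp add: K_def)
    then show False using gt \<open>K = 0\<close> by simp
  qed
  ultimately have Kp: "K > 0" by simp
  obtain d' where "((\<lambda>r. corr r f f) has_real_derivative d') (at 0)"
    using corr_DERIV_kern[OF f f, of 0] by auto
  then have "((\<lambda>y. corr y f f / y) \<longlongrightarrow> d') (at 0)"
    by (simp add: has_field_derivative_iff c0)
  then have "eventually (\<lambda>y. corr y f f / y < \<bar>d'\<bar> + 1) (at 0)" by (rule order_tendstoD) simp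
  then obtain d where d: "d > 0" "\<And>y. y \<noteq> 0 ==> dist y 0 < d ==> corr y f f / y < \<bar>d'\<bar> + 1"
    by (auto simp: eventually_at)
  define C where "C = \<bar>d'\<bar> + 1"
  have small: "corr y f f \<le> C * y" if "0 < y" "y < d" for y
    using d(2)[of y] that by (simp add: C_def field_simps)
  define x where "x = corr r f f / (r * K)"
  have x: "x > 1" using gt rp Kp by (simp add: x_def)
  obtain n1 where n1: "C / K < x ^ n1" using real_arch_pow[OF x] by blast
  obtain n2 where n2: "r ^ n2 < d" using real_arch_pow_inv[OF d(1) r(2)] by blast
  define m where "m = max n1 n2"
  have m2: "m \<le> 2 ^ m" using less_exp[of m] by simp
  have "x ^ n1 \<le> x ^ (2 ^ m)" using x m2 by (intro power_increasing) (auto simp: m_def)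
  then have X: "C / K < x ^ (2 ^ m)" using n1 by simp
  have "r ^ (2 ^ m) \<le> r ^ n2" using r m2 by (intro power_decreasing) (auto simp: m_def)
  then have sm: "corr (r ^ (2 ^ m)) f f \<le> C * r ^ (2 ^ m)" using n2 rp by (intro small) auto
  have "corr r f f ^ (2 ^ m) \<le> K ^ (2 ^ m - 1) * (C * r ^ (2 ^ m))"
    using Kp by (intro order_trans[OF corr_iterate[OF f r, of m, folded K_def] mult_left_mono[OF sm]]) simp
  then have "K * corr r f f ^ (2 ^ m) \<le> K * (K ^ (2 ^ m - 1) * (C * r ^ (2 ^ m)))" using Kp by simp
  also have "... = C * (K * K ^ (2 ^ m - 1)) * r ^ (2 ^ m)" by (simp only: mult_ac)
  also have "K * K ^ (2 ^ m - 1) = K ^ (2 ^ m)"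
    unfolding power_Suc[symmetric] by (rule arg_cong[where f="power K"]) simp
  finally have "K * x ^ (2 ^ m) \<le> C" using rp Kp by (simp add: x_def power_divide power_mult_distrib field_simps)
  then show False using X Kp by (simp add: field_simps)
qed

lemma corr_le_mean_variance:
  fixes f :: "real^'n::finite => real"
  assumes f: "f \<in> L2" and r: "0 \<le> r" "r < 1"
  shows "corr r f f \<le> (1 - r) * (\<integral>x. f x \<partial>gauss)\<^sup>2 + r * (\<integral>x. (f x)\<^sup>2 \<partial>gauss)"
proof -
  define m where "m = (\<integral>x. f x \<partial>gauss)"
  define g where "g x = f x - m" for x
  have gL: "g \<in> L2" unfolding g_def[abs_def] by (intro L2_diff f L2_const)
  have P: "OU r g x = OU r f x - m" for x
    using OU_integrable[OF f r, of x] by (simp add: OU_def g_def)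
  have PL: "OU r f \<in> L2" by (rule OU_L2(1)[OF f r])
  have "corr r g g = (\<integral>x. f x * OU r f x - m * f x - m * OU r f x + m\<^sup>2 \<partial>gauss)"
    unfolding corr_def P by (intro Bochner_Integration.integral_cong refl) (simp add: g_def algebra_simps power2_eq_square)
  also have "... = corr r f f - m * m - m * m + m\<^sup>2"
    using corr_pair(2)[OF f f r] L2_integrable[OF f] L2_integrable[OF PL] integral_OU[OF f r]
    by (simp add: corr_def m_def)
  finally have 1: "corr r g g = corr r f f - m\<^sup>2" by (simp add: power2_eq_square)
  have "(\<integral>x. (g x)\<^sup>2 \<partial>gauss) = (\<integral>x. (f x)\<^sup>2 - 2 * m * f x + m\<^sup>2 \<partial>gauss)"
    by (intro Bochner_Integration.integral_cong refl) (simp add: g_def power2_diff)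
  also have "... = (\<integral>x. (f x)\<^sup>2 \<partial>gauss) - m\<^sup>2"
    using L2_sq[OF f] L2_integrable[OF f] by (simp add: m_def power2_eq_square)
  finally have 2: "(\<integral>x. (g x)\<^sup>2 \<partial>gauss) = (\<integral>x. (f x)\<^sup>2 \<partial>gauss) - m\<^sup>2" .
  have "(\<integral>x. g x \<partial>gauss) = 0" using L2_integrable[OF f] by (simp add: g_def m_def)
  from corr_centred_le[OF gL this r] show ?thesis unfolding 1 2 by (simp add: m_def algebra_simps)
qed

section \<open>Elementary inequalities for powers\<close>

lemma powr_le_tangent:
  fixes t e :: real
  assumes "t > 0" "0 \<le> e" "e \<le> 1"
  shows "t powr e \<le> 1 + e * (t - 1)"
  using Youngs_inequality_0[of e "1 - e" t 1] assms by (simp add: algebra_simps)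

lemma powr_ge_quadratic:
  fixes x e :: real
  assumes x: "x > -1" and e: "0 \<le> e" "e \<le> 1"
  shows "1 + e * x - x\<^sup>2 \<le> (1 + x) powr e"
proof -
  have d: "1 + (1 - e) * x > 0"
  proof -
    have "(1 - e) * x \<ge> (1 - e) * (-1)" using x e by (intro mult_left_mono) auto
    then show ?thesis using x e by (cases "e = 0") auto
  qed
  have "(1 + x) powr (1 - e) \<le> 1 + (1 - e) * x" using powr_le_tangent[of "1 + x" "1 - e"] x e by simp
  then have "(1 + x) / (1 + (1 - e) * x) \<le> (1 + x) / (1 + x) powr (1 - e)"
    using x by (intro divide_left_mono) (auto intro!: mult_pos_pos d)
  also have "... = (1 + x) powr e" using x by (simp add: powr_diff)
  finally have 1: "(1 + x) / (1 + (1 - e) * x) \<le> (1 + x) powr e" .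
  have "(1 - e) * x \<ge> (1 - e) * (-1)" using x e by (intro mult_left_mono) auto
  then have "(1 - e) * x \<ge> e - 1" by simp
  moreover have "e * (1 - e) = e - e * e" by (simp add: algebra_simps)
  moreover have "0 \<le> e * e" by simp
  ultimately have "e * (1 - e) - 1 - (1 - e) * x \<le> 0" by linarith
  then have "x\<^sup>2 * (e * (1 - e) - 1 - (1 - e) * x) \<le> 0" by (intro mult_nonneg_nonpos) auto
  then have "(1 + e * x - x\<^sup>2) * (1 + (1 - e) * x) \<le> 1 + x" by (simp add: algebra_simps power2_eq_square)
  then have "1 + e * x - x\<^sup>2 \<le> (1 + x) / (1 + (1 - e) * x)" using d by (simp add: pos_le_divide_eq)
  then show ?thesis using 1 by simp
qed

text \<open>The value \<open>c = (1 - e) / e\<close> is the correlation at which the second-order terms cancel; this is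
  where the exponent in hypercontractivity comes from.\<close>
lemma powr_third_order:
  fixes e c lo :: real
  assumes e: "1/2 < e" "e < 1" and c: "c = (1 - e) / e" and lo: "0 < lo" "lo \<le> 1"
  obtains C where "C \<ge> 0"
    "\<And>x. 1 + x \<ge> lo ==> (1 - c) * (2 * (1 + x) powr e - 1) + c * (1 + x) powr (2 * e) \<le> 1 + 2 * e * x + C * \<bar>x\<bar> ^ 3"
proof -
  define A where "A m = 2 * (1 - c) * (\<Prod>i<m. e - real i)" for m :: nat
  define B where "B m = c * (\<Prod>i<m. 2 * e - real i)" for m :: nat
  define df where "df m t = A m * t powr (e - real m) + B m * t powr (2 * e - real m) + (if m = 0 then - (1 - c) else 0)" for m :: nat and t :: real
  define C where "C = (\<bar>A 3\<bar> * lo powr (e - 3) + \<bar>B 3\<bar> * lo powr (2 * e - 3)) / 6"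
  have der: "(df m has_real_derivative df (Suc m) t) (at t)" if "t > 0" for m t
  proof -
    have "((\<lambda>t. A m * t powr (e - real m) + B m * t powr (2 * e - real m) + (if m = 0 then - (1 - c) else 0)) has_real_derivative
      (A m * ((e - real m) * t powr (e - real m - 1)) + B m * ((2 * e - real m) * t powr (2 * e - real m - 1)) + 0)) (at t)"
      by (intro DERIV_add DERIV_cmult has_real_derivative_powr that DERIV_const)
    then show ?thesis by (simp add: df_def[abs_def] A_def B_def mult_ac diff_diff_eq add.commute)
  qed
  have s: "(\<Sum>m<3. df m 1 / fact m * x ^ m) = 1 + 2 * e * x" for x
  proof -
    have "2 * (1 - c) * (e * (e - 1)) + c * (2 * e * (2 * e - 1)) = 0"
      using e unfolding c by (simp add: field_simps)
    then have d2: "df 2 1 = 0" by (simp add: df_def A_def B_def numeral_2_eq_2 lessThan_Suc mult_ac)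
    have d0: "df 0 1 = 1" by (simp add: df_def A_def B_def)
    have d1: "df (Suc 0) 1 = 2 * e" by (simp add: df_def A_def B_def algebra_simps)
    have "{..<3::nat} = {0, Suc 0, 2}" by auto
    then have sum3: "(\<Sum>m<3. df m 1 / fact m * x ^ m) = df 0 1 + (df (Suc 0) 1 * x + df 2 1 / 2 * x\<^sup>2)" by (simp only:) simp
    show ?thesis unfolding sum3 d0 d1 d2 by simp
  qed
  have "(1 - c) * (2 * (1 + x) powr e - 1) + c * (1 + x) powr (2 * e) \<le> 1 + 2 * e * x + C * \<bar>x\<bar> ^ 3" if x: "1 + x \<ge> lo" for x
  proof (cases "x = 0")
    case False
    have eq: "(1 - c) * (2 * (1 + x) powr e - 1) + c * (1 + x) powr (2 * e) = df 0 (1 + x)"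
      by (simp add: df_def A_def B_def algebra_simps)
    have "\<exists>t. (if 1 + x < 1 then 1 + x < t \<and> t < 1 else 1 < t \<and> t < 1 + x) \<and>
      df 0 (1 + x) = (\<Sum>m<3. df m 1 / fact m * (1 + x - 1) ^ m) + df 3 t / fact 3 * (1 + x - 1) ^ 3"
      by (rule Taylor[where a=lo and b="max 1 (1 + x)"]) (use x lo False der in auto)
    then obtain t where t: "if 1 + x < 1 then 1 + x < t \<and> t < 1 else 1 < t \<and> t < 1 + x"
      and T: "df 0 (1 + x) = (\<Sum>m<3. df m 1 / fact m * (1 + x - 1) ^ m) + df 3 t / fact 3 * (1 + x - 1) ^ 3" by blast
    have tlo: "t \<ge> lo" using t x lo by (auto split: if_splits)
    have "\<bar>df 3 t\<bar> \<le> \<bar>A 3\<bar> * t powr (e - 3) + \<bar>B 3\<bar> * t powr (2 * e - 3)"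
      using abs_triangle_ineq[of "A 3 * t powr (e - 3)" "B 3 * t powr (2 * e - 3)"] by (simp add: df_def abs_mult)
    also have "... \<le> \<bar>A 3\<bar> * lo powr (e - 3) + \<bar>B 3\<bar> * lo powr (2 * e - 3)"
      using tlo lo e by (intro add_mono mult_left_mono powr_mono2') auto
    finally have b: "\<bar>df 3 t\<bar> / 6 \<le> C" by (simp add: C_def)
    have "df 3 t / 6 * x ^ 3 \<le> \<bar>df 3 t / 6 * x ^ 3\<bar>" by simp
    also have "... = (\<bar>df 3 t\<bar> / 6) * \<bar>x\<bar> ^ 3" by (simp add: abs_mult power_abs)
    also have "... \<le> C * \<bar>x\<bar> ^ 3" using b by (intro mult_right_mono) auto
    finally have "df 3 t / 6 * x ^ 3 \<le> C * \<bar>x\<bar> ^ 3" .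
    moreover have "df 0 (1 + x) = 1 + 2 * e * x + df 3 t / 6 * x ^ 3"
    proof -
      have x1: "1 + x - 1 = x" by simp
      show ?thesis unfolding T x1 s by (simp add: fact_numeral)
    qed
    ultimately show ?thesis unfolding eq by simp
  qed simp
  moreover have "C \<ge> 0" by (simp add: C_def)
  ultimately show ?thesis using that by blast
qed

section \<open>One step\<close>

text \<open>Hypercontractivity for small perturbations of the constant \<open>1\<close>. The spectral gap replaces the
  form by a combination of squared mean and second moment, and the expansion of these has no first- or
  second-order term.\<close>
lemma corr_powr_centred_le:
  fixes \<xi> :: "real^'n::finite => real"
  assumes e: "1/2 < e" "e < 1" and c: "c = (1 - e) / e" and lo: "0 < lo"
    and C: "\<And>x. 1 + x \<ge> lo ==> (1 - c) * (2 * (1 + x) powr e - 1) + c * (1 + x) powr (2 * e) \<le> 1 + 2 * e * x + C * \<bar>x\<bar> ^ 3"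
    and [measurable]: "\<xi> \<in> borel_measurable borel" and b: "\<And>z. \<bar>\<xi> z\<bar> \<le> M" and l: "\<And>z. 1 + \<xi> z \<ge> lo"
    and z: "(\<integral>z. \<xi> z \<partial>gauss) = 0"
  shows "corr c (\<lambda>z. (1 + \<xi> z) powr e) (\<lambda>z. (1 + \<xi> z) powr e) \<le> 1 + C * (\<integral>z. \<bar>\<xi> z\<bar> ^ 3 \<partial>gauss) + (\<integral>z. (\<xi> z)\<^sup>2 \<partial>gauss)\<^sup>2"
proof -
  define F where "F z = (1 + \<xi> z) powr e" for z
  have cc: "0 \<le> c" "c < 1" using e unfolding c by (auto simp: field_simps)
  have p: "1 + \<xi> z > 0" for z using l[of z] lo by simp
  have M: "M \<ge> 0" using b[of 0] by linarith
  have [measurable]: "F \<in> borel_measurable borel" unfolding F_def[abs_def] by measurable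
  have Fb: "\<bar>F z\<bar> \<le> 1 + M" for z
  proof -
    have "F z \<le> 1 + e * \<xi> z" unfolding F_def using powr_le_tangent[of "1 + \<xi> z" e] p[of z] e by simp
    also have "e * \<xi> z \<le> e * M" using e b[of z] by (intro mult_left_mono) auto
    also have "e * M \<le> 1 * M" using e M by (intro mult_right_mono) auto
    finally show ?thesis by (simp add: F_def)
  qed
  have FL: "F \<in> L2" by (rule L2_bounded[OF _ Fb]) simp
  have \<xi>L: "\<xi> \<in> L2" by (rule L2_bounded[OF _ b]) simp
  have i3: "integrable gauss (\<lambda>z. \<bar>\<xi> z\<bar> ^ 3)"
    by (rule gauss.integrable_const_bound[where B="M ^ 3"]) (auto intro!: power_mono b)
  define m where "m = (\<integral>z. F z \<partial>gauss)"
  have m1: "m \<le> 1"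
  proof -
    have "m \<le> (\<integral>z. 1 + e * \<xi> z \<partial>gauss)" unfolding m_def
      using L2_integrable[OF FL] L2_integrable[OF \<xi>L] powr_le_tangent[of "1 + \<xi> _" e] p e
      by (intro integral_mono) (auto simp: F_def)
    then show ?thesis using L2_integrable[OF \<xi>L] z by simp
  qed
  have m2: "1 - m \<le> (\<integral>z. (\<xi> z)\<^sup>2 \<partial>gauss)"
  proof -
    have "(\<integral>z. 1 + e * \<xi> z - (\<xi> z)\<^sup>2 \<partial>gauss) \<le> m" unfolding m_def
    proof (rule integral_mono)
      show "1 + e * \<xi> z - (\<xi> z)\<^sup>2 \<le> F z" for z unfolding F_def using p[of z] e by (intro powr_ge_quadratic) auto
    qed (use L2_integrable[OF FL] L2_integrable[OF \<xi>L] L2_sq[OF \<xi>L] in auto)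
    then show ?thesis using L2_integrable[OF \<xi>L] L2_sq[OF \<xi>L] z by simp
  qed
  have F2: "(F z)\<^sup>2 = (1 + \<xi> z) powr (2 * e)" for z
    by (simp add: F_def power2_eq_square powr_add[symmetric])
  have "corr c F F \<le> (1 - c) * m\<^sup>2 + c * (\<integral>z. (F z)\<^sup>2 \<partial>gauss)"
    unfolding m_def by (rule corr_le_mean_variance[OF FL cc])
  also have "... = ((1 - c) * (2 * m - 1) + c * (\<integral>z. (F z)\<^sup>2 \<partial>gauss)) + (1 - c) * (1 - m)\<^sup>2"
    by (simp add: algebra_simps power2_eq_square)
  also have "(1 - c) * (2 * m - 1) + c * (\<integral>z. (F z)\<^sup>2 \<partial>gauss) = (\<integral>z. (1 - c) * (2 * F z - 1) + c * (F z)\<^sup>2 \<partial>gauss)"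
    using L2_integrable[OF FL] L2_sq[OF FL] by (simp add: m_def)
  also have "... \<le> (\<integral>z. 1 + 2 * e * \<xi> z + C * \<bar>\<xi> z\<bar> ^ 3 \<partial>gauss)"
  proof (rule integral_mono)
    show "(1 - c) * (2 * F z - 1) + c * (F z)\<^sup>2 \<le> 1 + 2 * e * \<xi> z + C * \<bar>\<xi> z\<bar> ^ 3" for z
      unfolding F2 unfolding F_def by (rule C[OF l])
  qed (use L2_integrable[OF FL] L2_sq[OF FL] L2_integrable[OF \<xi>L] i3 in auto)
  also have "... = 1 + C * (\<integral>z. \<bar>\<xi> z\<bar> ^ 3 \<partial>gauss)"
    using L2_integrable[OF \<xi>L] i3 z by simp
  also have "(1 - c) * (1 - m)\<^sup>2 \<le> 1 * ((\<integral>z. (\<xi> z)\<^sup>2 \<partial>gauss)\<^sup>2)"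
    using cc m1 m2 by (intro mult_mono power_mono) auto
  finally show ?thesis by (simp add: F_def[abs_def])
qed

lemma integrable_gauss_poly:
  assumes m: "m \<le> 4"
  shows "integrable gauss (\<lambda>z::real^'n::finite. (1 + norm z) ^ m)"
proof (rule Bochner_Integration.integrable_bound[where f="\<lambda>z::real^'n. (1 + norm z) ^ 4"])
  have b: "\<bar>(1 + norm z) ^ 4\<bar> \<le> 8192 * exp ((norm z)\<^sup>2 / 32)" for z :: "real^'n"
  proof -
    define y where "y = (norm z)\<^sup>2 / 32"
    have y: "y \<ge> 0" by (simp add: y_def)
    have "(1 + norm z)\<^sup>2 \<le> 2 + 2 * (norm z)\<^sup>2" using sum_squares_bound[of 1 "norm z"] by (simp add: power2_sum)
    also have "... \<le> 64 * (1 + y)" by (simp add: y_def)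
    finally have "((1 + norm z)\<^sup>2)\<^sup>2 \<le> (64 * (1 + y))\<^sup>2" by (intro power_mono) auto
    also have "... \<le> 8192 * (1 + y + y\<^sup>2 / 2)" using y by (simp add: power2_eq_square algebra_simps)
    also have "... \<le> 8192 * exp y" using exp_lower_Taylor_quadratic[OF y] by simp
    finally show ?thesis by (simp add: y_def flip: power_mult)
  qed
  show "integrable gauss (\<lambda>z::real^'n. (1 + norm z) ^ 4)"
    using L2_affine_integrable[of "\<lambda>_::real^'n. 1" 1 "\<lambda>z. (1 + norm z) ^ 4" 8192 0] b by simp
  show "AE z in gauss. norm ((1 + norm (z::real^'n)) ^ m) \<le> norm ((1 + norm z) ^ 4)"
    by (intro AE_I2) (use m in \<open>auto intro!: power_increasing\<close>)
qed simp

lemma gauss_bounded_integrable: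
  fixes f :: "real^'n::finite => real"
  assumes "f \<in> borel_measurable borel" "\<And>x. \<bar>f x\<bar> \<le> M"
  shows "integrable gauss f"
  by (rule gauss.integrable_const_bound[where B=M]) (use assms in auto)

lemma gauss_rot_bounded:
  fixes H :: "real^'n::finite => real"
  assumes [measurable]: "H \<in> borel_measurable borel" and b: "\<And>x. \<bar>H x\<bar> \<le> M" and cs: "t\<^sup>2 + s\<^sup>2 = 1" "s > 0"
  shows "(\<integral>x. H x \<partial>gauss) = (\<integral>x. (\<integral>z. H (t *\<^sub>R x + s *\<^sub>R z) \<partial>gauss) \<partial>gauss)"
proof -
  have i: "integrable gauss H" by (rule gauss_bounded_integrable) (use b in auto)
  show ?thesis
    using gauss2.integral_fst[OF gauss_mix_integrable(1)[OF cs i]] gauss_mix_integrable(2)[OF cs i] by simp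
qed

text \<open>A correlated Gaussian pair is the sum of two independent correlated pairs. One of them will be frozen while
  the other, small, one is averaged over.\<close>
lemma corr_rot:
  fixes f :: "real^'n::finite => real"
  assumes [measurable]: "f \<in> borel_measurable borel" and b: "\<And>x. \<bar>f x\<bar> \<le> M" and ts: "t\<^sup>2 + s\<^sup>2 = 1" "s > 0" "s \<le> 1"
    and c: "0 \<le> c" "c < 1"
  shows "corr c f f = (\<integral>x. (\<integral>x2. corr c (\<lambda>z. f (t *\<^sub>R x + s *\<^sub>R z)) (\<lambda>z. f (t *\<^sub>R (c *\<^sub>R x + sqrt (1 - c\<^sup>2) *\<^sub>R x2) + s *\<^sub>R z)) \<partial>gauss) \<partial>gauss)"
proof -
  define \<sigma> where "\<sigma> = sqrt (1 - c\<^sup>2)"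
  have M: "M \<ge> 0" using b[of 0] by linarith
  have bP: "\<bar>OU c g x\<bar> \<le> M" if [measurable]: "g \<in> borel_measurable borel" and "\<And>x. \<bar>g x\<bar> \<le> M" for g :: "real^'n => real" and x
  proof -
    have "\<bar>OU c g x\<bar> \<le> (\<integral>z. \<bar>g (c *\<^sub>R x + sqrt (1 - c\<^sup>2) *\<^sub>R z)\<bar> \<partial>gauss)" unfolding OU_def by (rule integral_abs_bound)
    also have "... \<le> M" by (intro gauss.integral_le_const gauss_bounded_integrable[where M=M] AE_I2) (use that in auto)
    finally show ?thesis .
  qed
  have "corr c f f = (\<integral>x. (\<integral>z. f (t *\<^sub>R x + s *\<^sub>R z) * OU c f (t *\<^sub>R x + s *\<^sub>R z) \<partial>gauss) \<partial>gauss)"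
    unfolding corr_def
  proof (rule gauss_rot_bounded[OF _ _ ts(1,2), where M="M * M"])
    show "\<bar>f x * OU c f x\<bar> \<le> M * M" for x unfolding abs_mult using b bP[of f x] M by (intro mult_mono) auto
  qed measurable
  also have "... = (\<integral>x. (\<integral>x2. corr c (\<lambda>z. f (t *\<^sub>R x + s *\<^sub>R z)) (\<lambda>z. f (t *\<^sub>R (c *\<^sub>R x + \<sigma> *\<^sub>R x2) + s *\<^sub>R z)) \<partial>gauss) \<partial>gauss)"
  proof (rule Bochner_Integration.integral_cong[OF refl])
    fix x :: "real^'n"
    define g where "g x2 z = f (t *\<^sub>R (c *\<^sub>R x + \<sigma> *\<^sub>R x2) + s *\<^sub>R z)" for x2 z
    have [measurable]: "(\<lambda>p. g (fst p) (snd p)) \<in> borel_measurable (borel \<Otimes>\<^sub>M borel)" unfolding g_def by measurable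
    have [measurable]: "g x2 \<in> borel_measurable borel" for x2 unfolding g_def by measurable
    have "OU c f (t *\<^sub>R x + s *\<^sub>R z) = (\<integral>x2. OU c (g x2) z \<partial>gauss)" for z
    proof -
      have "OU c f (t *\<^sub>R x + s *\<^sub>R z) = (\<integral>x2. (\<integral>z2. f (c *\<^sub>R (t *\<^sub>R x + s *\<^sub>R z) + \<sigma> *\<^sub>R (t *\<^sub>R x2 + s *\<^sub>R z2)) \<partial>gauss) \<partial>gauss)"
        unfolding OU_def \<sigma>_def[symmetric] by (rule gauss_rot_bounded[OF _ _ ts(1,2), where M=M]) (use b in auto)
      also have "... = (\<integral>x2. (\<integral>z2. g x2 (c *\<^sub>R z + \<sigma> *\<^sub>R z2) \<partial>gauss) \<partial>gauss)"
        by (simp add: g_def algebra_simps)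
      finally show ?thesis by (simp add: OU_def \<sigma>_def)
    qed
    then have "(\<integral>z. f (t *\<^sub>R x + s *\<^sub>R z) * OU c f (t *\<^sub>R x + s *\<^sub>R z) \<partial>gauss) = (\<integral>z. (\<integral>x2. f (t *\<^sub>R x + s *\<^sub>R z) * OU c (g x2) z \<partial>gauss) \<partial>gauss)"
      by simp
    also have "... = (\<integral>x2. (\<integral>z. f (t *\<^sub>R x + s *\<^sub>R z) * OU c (g x2) z \<partial>gauss) \<partial>gauss)"
    proof (rule gauss2.Fubini_integral[symmetric])
      have [measurable]: "(\<lambda>p. OU c (g (fst p)) (snd p)) \<in> borel_measurable (borel \<Otimes>\<^sub>M borel)"
        unfolding OU_def g_def by measurable
      have [measurable]: "(\<lambda>p. OU c (g (snd p)) (fst p)) \<in> borel_measurable (borel \<Otimes>\<^sub>M borel)"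
        unfolding OU_def g_def by measurable
      show "integrable (gauss \<Otimes>\<^sub>M gauss) (\<lambda>(z, x2). f (t *\<^sub>R x + s *\<^sub>R z) * OU c (g x2) z)"
      proof (rule gauss2.P.integrable_const_bound[where B="M * M"])
        show "AE p in gauss \<Otimes>\<^sub>M gauss. norm (case p of (z, x2) => f (t *\<^sub>R x + s *\<^sub>R z) * OU c (g x2) z) \<le> M * M"
          using M b bP[of "g _"] by (intro AE_I2) (auto simp: abs_mult g_def intro!: mult_mono)
      qed (simp add: case_prod_beta')
    qed
    finally show "(\<integral>z. f (t *\<^sub>R x + s *\<^sub>R z) * OU c f (t *\<^sub>R x + s *\<^sub>R z) \<partial>gauss)
      = (\<integral>x2. corr c (\<lambda>z. f (t *\<^sub>R x + s *\<^sub>R z)) (\<lambda>z. f (t *\<^sub>R (c *\<^sub>R x + \<sigma> *\<^sub>R x2) + s *\<^sub>R z)) \<partial>gauss)"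
      by (simp add: corr_def g_def[abs_def])
  qed
  finally show ?thesis by (simp add: \<sigma>_def)
qed

section \<open>Smoothing by the semigroup\<close>

lemma gauss_density_shift:
  "gauss_density (w - v) = gauss_density w * exp (v \<bullet> w - (norm v)\<^sup>2 / 2)"
proof -
  have "- (norm (w - v))\<^sup>2 / 2 = - (norm w)\<^sup>2 / 2 + (v \<bullet> w - (norm v)\<^sup>2 / 2)"
    unfolding power2_norm_eq_inner by (simp add: inner_diff_left inner_diff_right inner_commute field_simps)
  then show ?thesis unfolding gauss_density_def by (simp only: exp_add mult.assoc)
qed

text \<open>Cameron-Martin.\<close>
lemma gauss_shift:
  fixes g :: "real^'n::finite => real"
  assumes [measurable]: "g \<in> borel_measurable borel"
  shows "integrable gauss (\<lambda>w. g w * exp (v \<bullet> w - (norm v)\<^sup>2 / 2)) \<longleftrightarrow> integrable gauss (\<lambda>z. g (z + v))"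
    and "(\<integral>w. g w * exp (v \<bullet> w - (norm v)\<^sup>2 / 2) \<partial>gauss) = (\<integral>z. g (z + v) \<partial>gauss)"
proof -
  have e: "gauss_density w * (g w * exp (v \<bullet> w - (norm v)\<^sup>2 / 2)) = gauss_density (w - v) * g w" for w
    unfolding gauss_density_shift by simp
  have m: "(\<lambda>w. gauss_density (w - v) * g w) \<in> borel_measurable borel" by measurable
  have "integrable lborel (\<lambda>w. gauss_density (w - v) * g w) \<longleftrightarrow> integrable lborel (\<lambda>z. gauss_density z * g (z + v))"
    using lborel_affine_integrable[where s=1 and f="\<lambda>w. gauss_density (w - v) * g w" and \<mu>=v] m by (simp add: add.commute)
  then show "integrable gauss (\<lambda>w. g w * exp (v \<bullet> w - (norm v)\<^sup>2 / 2)) \<longleftrightarrow> integrable gauss (\<lambda>z. g (z + v))"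
    by (simp add: integrable_gauss_iff e)
  have "(\<integral>w. gauss_density (w - v) * g w \<partial>lborel) = (\<integral>z. gauss_density z * g (z + v) \<partial>lborel)"
    using lborel_affine_integral[where s=1 and f="\<lambda>w. gauss_density (w - v) * g w" and \<mu>=v] m by (simp add: add.commute)
  then show "(\<integral>w. g w * exp (v \<bullet> w - (norm v)\<^sup>2 / 2) \<partial>gauss) = (\<integral>z. g (z + v) \<partial>gauss)"
    by (simp add: integral_gauss_eq e)
qed

text \<open>The total variation distance of two Gaussians is bounded by the chi-square distance, which is explicit and
  of the order of the shift for small shifts; for large shifts the bound is trivial.\<close>
lemma gauss_shift_Lipschitz:
  fixes g :: "real^'n::finite => real"
  assumes [measurable]: "g \<in> borel_measurable borel" and b: "\<And>x. \<bar>g x\<bar> \<le> B"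
  shows "\<bar>(\<integral>z. g (z + v) \<partial>gauss) - (\<integral>z. g z \<partial>gauss)\<bar> \<le> 2 * B * norm v"
proof -
  have B: "B \<ge> 0" using b[of 0] by linarith
  have ig: "integrable gauss g" by (rule gauss_bounded_integrable[OF _ b]) simp
  have igv: "integrable gauss (\<lambda>z. g (z + v))" by (rule gauss_bounded_integrable[OF _ b]) simp
  consider "v = 0" | "norm v > 1" | "v \<noteq> 0" "norm v \<le> 1" by linarith
  then show ?thesis
  proof cases
    case 2
    have 1: "\<bar>\<integral>z. h z \<partial>gauss\<bar> \<le> B" if "integrable gauss h" "\<And>z. \<bar>h z\<bar> \<le> B" for h :: "real^'n => real"
    proof -
      have "\<bar>\<integral>z. h z \<partial>gauss\<bar> \<le> (\<integral>z. \<bar>h z\<bar> \<partial>gauss)" by (rule integral_abs_bound)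
      also have "... \<le> B" by (intro gauss.integral_le_const) (use that in auto)
      finally show ?thesis .
    qed
    have "\<bar>(\<integral>z. g (z + v) \<partial>gauss) - (\<integral>z. g z \<partial>gauss)\<bar> \<le> B + B"
      using 1[OF ig b] 1[OF igv b] by linarith
    also have "... \<le> 2 * B * norm v" using mult_left_mono[of 1 "norm v" "2 * B"] B 2 by simp
    finally show ?thesis .
  next
    case 3
    define t where "t = norm v"
    have t: "0 < t" "t \<le> 1" using 3 by (auto simp: t_def)
    define E where "E u w = exp (u \<bullet> w - (norm u)\<^sup>2 / 2)" for u w :: "real^'n"
    have [measurable]: "E u \<in> borel_measurable borel" for u unfolding E_def[abs_def] by measurable
    have iE: "integrable gauss (E u)" "(\<integral>w. E u w \<partial>gauss) = 1" for u
      using gauss_shift[of "\<lambda>_. 1" u] by (simp_all add: E_def[abs_def])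
    have E2: "(E v w)\<^sup>2 = exp (t\<^sup>2) * E (2 *\<^sub>R v) w" for w
      unfolding E_def power2_eq_square exp_add[symmetric] t_def by (simp add: field_simps power2_eq_square)
    have sq: "(E v w - 1)\<^sup>2 = exp (t\<^sup>2) * E (2 *\<^sub>R v) w - 2 * E v w + 1" for w
      unfolding E2[symmetric] by (simp add: power2_diff)
    have isq: "integrable gauss (\<lambda>w. (E v w - 1)\<^sup>2)" unfolding sq using iE by auto
    have "(\<integral>w. (E v w - 1)\<^sup>2 \<partial>gauss) = exp (t\<^sup>2) - 1" unfolding sq using iE by simp
    also have "... \<le> t\<^sup>2 + (t\<^sup>2)\<^sup>2" using exp_bound[of "t\<^sup>2"] t by (simp add: power_le_one)
    also have "(t\<^sup>2)\<^sup>2 \<le> t\<^sup>2" using t power_decreasing[of 2 4 t] by (simp flip: power_mult)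
    finally have chi: "(\<integral>w. (E v w - 1)\<^sup>2 \<partial>gauss) \<le> 2 * t\<^sup>2" by simp
    have "(\<integral>w. \<bar>E v w - 1\<bar> \<partial>gauss) \<le> (\<integral>w. (E v w - 1)\<^sup>2 / (2 * t) + t / 2 \<partial>gauss)"
    proof (rule integral_mono)
      show "\<bar>E v w - 1\<bar> \<le> (E v w - 1)\<^sup>2 / (2 * t) + t / 2" for w
        using abs_mult_le_weighted[OF t(1), of "E v w - 1" 1] by simp
    qed (use iE isq in auto)
    also have "... = (\<integral>w. (E v w - 1)\<^sup>2 \<partial>gauss) / (2 * t) + t / 2" using isq by simp
    also have "... \<le> (2 * t\<^sup>2) / (2 * t) + t / 2" using chi t by (intro add_mono divide_right_mono) auto
    also have "... \<le> 2 * t" using t by (simp add: power2_eq_square)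
    finally have L1: "(\<integral>w. \<bar>E v w - 1\<bar> \<partial>gauss) \<le> 2 * t" .
    have igE: "integrable gauss (\<lambda>w. g w * E v w)" using gauss_shift(1)[of g v] igv by (simp add: E_def)
    have "(\<integral>z. g (z + v) \<partial>gauss) - (\<integral>z. g z \<partial>gauss) = (\<integral>w. g w * E v w - g w \<partial>gauss)"
      using gauss_shift(2)[of g v] igE ig by (simp add: E_def)
    also have "\<bar>...\<bar> \<le> (\<integral>w. \<bar>g w * E v w - g w\<bar> \<partial>gauss)" by (rule integral_abs_bound)
    also have "... \<le> (\<integral>w. B * \<bar>E v w - 1\<bar> \<partial>gauss)"
    proof (rule integral_mono)
      show "\<bar>g w * E v w - g w\<bar> \<le> B * \<bar>E v w - 1\<bar>" for w
      proof -
        have "\<bar>g w * E v w - g w\<bar> = \<bar>g w\<bar> * \<bar>E v w - 1\<bar>" by (simp add: abs_mult[symmetric] algebra_simps)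
        also have "... \<le> B * \<bar>E v w - 1\<bar>" by (intro mult_right_mono b) simp
        finally show ?thesis .
      qed
    qed (use iE ig igE in auto)
    also have "... \<le> B * (2 * t)" using L1 B by (simp add: mult_left_mono)
    finally show ?thesis by (simp add: t_def mult_ac)
  qed simp
qed

lemma OU_Lipschitz:
  fixes g :: "real^'n::finite => real"
  assumes gm [measurable]: "g \<in> borel_measurable borel" and b: "\<And>x. \<bar>g x\<bar> \<le> B" and r: "0 \<le> r" "r \<le> R" "R < 1"
  shows "\<bar>OU r g x - OU r g y\<bar> \<le> 2 * B / sqrt (1 - R\<^sup>2) * norm (x - y)"
proof -
  define s where "s = sqrt (1 - r\<^sup>2)"
  define S where "S = sqrt (1 - R\<^sup>2)"
  have B: "B \<ge> 0" using b[of 0] by linarith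
  have s: "s > 0" and S: "S > 0" using OU_cs(2)[of r] OU_cs(2)[of R] r by (auto simp: s_def S_def)
  have Ss: "S \<le> s" unfolding S_def s_def using r by (intro real_sqrt_le_mono diff_left_mono power_mono) auto
  define v where "v = (r / s) *\<^sub>R (x - y)"
  have "OU r g x = (\<integral>z. g (r *\<^sub>R y + s *\<^sub>R (z + v)) \<partial>gauss)"
    unfolding OU_def s_def[symmetric]
  proof (intro Bochner_Integration.integral_cong refl arg_cong[where f=g])
    fix z
    show "r *\<^sub>R x + s *\<^sub>R z = r *\<^sub>R y + s *\<^sub>R (z + v)" using s by (simp add: v_def algebra_simps)
  qed
  then have "\<bar>OU r g x - OU r g y\<bar> \<le> 2 * B * norm v"
    using gauss_shift_Lipschitz[of "\<lambda>z. g (r *\<^sub>R y + s *\<^sub>R z)" B v] b by (simp add: OU_def s_def)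
  also have "norm v = r / s * norm (x - y)" using r s by (simp add: v_def)
  also have "2 * B * (r / s * norm (x - y)) \<le> 2 * B * (1 / S * norm (x - y))"
    using B r s S Ss by (intro mult_left_mono mult_right_mono frac_le) auto
  finally show ?thesis by (simp add: S_def)
qed

section \<open>Hypercontractivity\<close>

text \<open>One infinitesimal step of the semigroup, with an error of third order in the size \<open>s\<close> of the
  step. The argument is conditioned on the large part of the pair; the small part perturbs \<open>u\<close>
  relative to its conditional mean by \<open>O(s)\<close>, as \<open>u\<close> is Lipschitz and bounded
  below. The constant depends on \<open>u\<close> only through these bounds, so that steps can be iterated.\<close>
lemma corr_one_step:
  fixes e c \<delta> B L :: real
  assumes e: "1/2 < e" "e < 1" and c: "c = (1 - e) / e" and \<delta>: "0 < \<delta>" "\<delta> \<le> B" and L: "L \<ge> 0"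
  obtains C where "C \<ge> 0"
    "\<And>(u :: real^'n::finite => real) s. [|u \<in> borel_measurable borel; \<And>x. \<delta> \<le> u x; \<And>x. u x \<le> B; \<And>x y. \<bar>u x - u y\<bar> \<le> L * norm (x - y); 0 < s; s < 1|]
      ==> corr c (\<lambda>x. u x powr e) (\<lambda>x. u x powr e)
        \<le> corr c (\<lambda>x. OU (sqrt (1 - s\<^sup>2)) u x powr e) (\<lambda>x. OU (sqrt (1 - s\<^sup>2)) u x powr e) + C * s ^ 3"
proof -
  define lo where "lo = \<delta> / B"
  have lo: "0 < lo" "lo \<le> 1" using \<delta> by (auto simp: lo_def)
  have cc: "0 \<le> c" "c < 1" using e unfolding c by (auto simp: field_simps)
  obtain C1 where C1: "C1 \<ge> 0"
    "\<And>x. 1 + x \<ge> lo ==> (1 - c) * (2 * (1 + x) powr e - 1) + c * (1 + x) powr (2 * e) \<le> 1 + 2 * e * x + C1 * \<bar>x\<bar> ^ 3"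
    using powr_third_order[OF e c lo] by blast
  define E where "E m = (\<integral>z. (1 + norm z) ^ m \<partial>(gauss :: (real^'n) measure))" for m
  have E0: "E m \<ge> 0" for m unfolding E_def by (intro integral_nonneg_AE AE_I2) simp
  define K where "K = L * E 1 / \<delta>"
  have K: "K \<ge> 0" using L E0[of 1] \<delta> by (simp add: K_def)
  define C where "C = B powr e * B powr e * (C1 * (K ^ 3 * E 3) + (K\<^sup>2 * E 2)\<^sup>2)"
  have C0: "C \<ge> 0" using C1(1) K E0 by (simp add: C_def)
  have "corr c (\<lambda>x. u x powr e) (\<lambda>x. u x powr e)
        \<le> corr c (\<lambda>x. OU (sqrt (1 - s\<^sup>2)) u x powr e) (\<lambda>x. OU (sqrt (1 - s\<^sup>2)) u x powr e) + C * s ^ 3"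
    if um: "u \<in> borel_measurable borel" and ul: "\<And>x. \<delta> \<le> u x" and ub: "\<And>x. u x \<le> B" and uL: "\<And>x y. \<bar>u x - u y\<bar> \<le> L * norm (x - y)" and s: "0 < s" "s < 1"
    for u :: "real^'n => real" and s
  proof -
    note um [measurable]
    define t where "t = sqrt (1 - s\<^sup>2)"
    have s2: "s\<^sup>2 < 1" using s by (simp add: power_less_one_iff)
    have t: "0 \<le> t" "t < 1" "t\<^sup>2 + s\<^sup>2 = 1" "sqrt (1 - t\<^sup>2) = s" using s s2 by (auto simp: t_def)
    have uabs: "\<bar>u x\<bar> \<le> B" for x using ul[of x] ub[of x] \<delta> by linarith
    define U where "U = OU t u"
    have Um [measurable]: "U \<in> borel_measurable borel" unfolding U_def by measurable
    have iu: "integrable gauss (\<lambda>z. u (t *\<^sub>R x + s *\<^sub>R z))" for x by (rule gauss_bounded_integrable[OF _ uabs]) simp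
    have U: "U x = (\<integral>z. u (t *\<^sub>R x + s *\<^sub>R z) \<partial>gauss)" for x by (simp add: U_def OU_def t)
    have Ul: "\<delta> \<le> U x" for x unfolding U by (rule gauss.integral_ge_const[OF iu]) (use ul in auto)
    have Ub: "U x \<le> B" for x unfolding U by (rule gauss.integral_le_const[OF iu]) (use ub in auto)
    have Up: "U x > 0" for x using Ul[of x] \<delta> by linarith
    define \<xi> where "\<xi> x z = u (t *\<^sub>R x + s *\<^sub>R z) / U x - 1" for x z
    have xim [measurable]: "\<xi> x \<in> borel_measurable borel" for x unfolding \<xi>_def[abs_def] by measurable
    have xi0: "(\<integral>z. \<xi> x z \<partial>gauss) = 0" for x using iu[of x] Up[of x] by (simp add: \<xi>_def U[symmetric])
    have xil: "1 + \<xi> x z \<ge> lo" for x z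
      using ul[of "t *\<^sub>R x + s *\<^sub>R z"] Ub[of x] Up[of x] \<delta> by (simp add: \<xi>_def lo_def frac_le)
    have i1: "integrable gauss (\<lambda>z::real^'n. (1 + norm z) ^ m)" if "m \<le> 4" for m by (rule integrable_gauss_poly[OF that])
    have xiK: "\<bar>\<xi> x z\<bar> \<le> (K * s) * (1 + norm z)" for x z
    proof -
      have "u (t *\<^sub>R x + s *\<^sub>R z) - U x = (\<integral>z'. u (t *\<^sub>R x + s *\<^sub>R z) - u (t *\<^sub>R x + s *\<^sub>R z') \<partial>gauss)"
        using iu[of x] by (simp add: U)
      also have "\<bar>...\<bar> \<le> (\<integral>z'. \<bar>u (t *\<^sub>R x + s *\<^sub>R z) - u (t *\<^sub>R x + s *\<^sub>R z')\<bar> \<partial>gauss)" by (rule integral_abs_bound)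
      also have "... \<le> (\<integral>z'. L * s * (1 + norm z) * (1 + norm z') ^ 1 \<partial>(gauss :: (real^'n) measure))"
      proof (rule integral_mono)
        fix z' :: "real^'n"
        have "\<bar>u (t *\<^sub>R x + s *\<^sub>R z) - u (t *\<^sub>R x + s *\<^sub>R z')\<bar> \<le> L * norm (s *\<^sub>R (z - z'))"
          using uL[of "t *\<^sub>R x + s *\<^sub>R z" "t *\<^sub>R x + s *\<^sub>R z'"] by (simp add: algebra_simps)
        also have "... = L * s * norm (z - z')" using s by simp
        also have "... \<le> L * s * ((1 + norm z) * (1 + norm z'))"
        proof (rule mult_left_mono)
          have "norm (z - z') \<le> norm z + norm z'" by (rule norm_triangle_ineq4)
          also have "... \<le> (1 + norm z) * (1 + norm z')" by (simp add: algebra_simps)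
          finally show "norm (z - z') \<le> (1 + norm z) * (1 + norm z')" .
        qed (use L s in auto)
        finally show "\<bar>u (t *\<^sub>R x + s *\<^sub>R z) - u (t *\<^sub>R x + s *\<^sub>R z')\<bar> \<le> L * s * (1 + norm z) * (1 + norm z') ^ 1" by simp
      qed (use iu[of x] i1[of 1] in auto)
      also have "... = L * s * (1 + norm z) * E 1" unfolding E_def by simp
      finally have n: "\<bar>u (t *\<^sub>R x + s *\<^sub>R z) - U x\<bar> \<le> L * s * (1 + norm z) * E 1" .
      have "\<bar>\<xi> x z\<bar> = \<bar>u (t *\<^sub>R x + s *\<^sub>R z) - U x\<bar> / U x" using Up[of x] by (simp add: \<xi>_def field_simps)
      also have "... \<le> (L * s * (1 + norm z) * E 1) / \<delta>"
        using n Ul[of x] \<delta> by (intro frac_le) auto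
      finally show ?thesis by (simp add: K_def mult_ac)
    qed
    have xiM: "\<bar>\<xi> x z\<bar> \<le> 1 + B / \<delta>" for x z
    proof -
      have "0 \<le> u (t *\<^sub>R x + s *\<^sub>R z) / U x" using ul[of "t *\<^sub>R x + s *\<^sub>R z"] \<delta> Up[of x] by simp
      moreover have "u (t *\<^sub>R x + s *\<^sub>R z) / U x \<le> B / \<delta>" using ub ul[of "t *\<^sub>R x + s *\<^sub>R z"] Ul[of x] \<delta> by (intro frac_le) auto
      ultimately show ?thesis by (simp add: \<xi>_def)
    qed
    have pm: "(\<integral>z. \<bar>\<xi> x z\<bar> ^ m \<partial>gauss) \<le> (K * s) ^ m * E m" if "m \<le> 4" for x m
    proof -
      have "(\<integral>z. \<bar>\<xi> x z\<bar> ^ m \<partial>gauss) \<le> (\<integral>z. (K * s) ^ m * (1 + norm z) ^ m \<partial>(gauss :: (real^'n) measure))"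
      proof (rule integral_mono)
        show "integrable gauss (\<lambda>z. \<bar>\<xi> x z\<bar> ^ m)"
          by (rule gauss_bounded_integrable[where M="(1 + B / \<delta>) ^ m"]) (auto simp: xiM intro!: power_mono)
        show "\<bar>\<xi> x z\<bar> ^ m \<le> (K * s) ^ m * (1 + norm z) ^ m" for z
          unfolding power_mult_distrib[symmetric] using xiK[of x z] by (intro power_mono) auto
      qed (use i1[OF that] in auto)
      then show ?thesis by (simp add: E_def)
    qed
    define F where "F x z = (1 + \<xi> x z) powr e" for x z
    have FL: "F x \<in> L2" for x
    proof (rule L2_bounded)
      show "F x \<in> borel_measurable borel" unfolding F_def[abs_def] by measurable
      show "\<bar>F x z\<bar> \<le> (2 + B / \<delta>) powr e" for z
        using xiM[of x z] xil[of x z] lo e by (auto simp: F_def intro!: powr_mono2)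
    qed
    have FF: "corr c (F x) (F x) \<le> 1 + (C1 * (K ^ 3 * E 3) + (K\<^sup>2 * E 2)\<^sup>2) * s ^ 3" for x
    proof -
      have "corr c (F x) (F x) \<le> 1 + C1 * (\<integral>z. \<bar>\<xi> x z\<bar> ^ 3 \<partial>gauss) + (\<integral>z. (\<xi> x z)\<^sup>2 \<partial>gauss)\<^sup>2"
        unfolding F_def[abs_def] by (rule corr_powr_centred_le[OF e c lo(1) C1(2) xim xiM xil xi0])
      also have "... \<le> 1 + C1 * ((K * s) ^ 3 * E 3) + ((K * s)\<^sup>2 * E 2)\<^sup>2"
        using pm[of 3 x] pm[of 2 x] C1(1) by (intro add_mono mult_left_mono power_mono order_refl) auto
      also have "... = 1 + C1 * (K ^ 3 * E 3) * s ^ 3 + (K\<^sup>2 * E 2)\<^sup>2 * s ^ 4"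
        by (simp add: power_mult_distrib mult_ac flip: power_mult)
      also have "... \<le> 1 + C1 * (K ^ 3 * E 3) * s ^ 3 + (K\<^sup>2 * E 2)\<^sup>2 * s ^ 3"
        using s power_decreasing[of 3 4 s] by (intro add_mono mult_left_mono order_refl) auto
      finally show ?thesis by (simp add: algebra_simps)
    qed
    have uF: "u (t *\<^sub>R x + s *\<^sub>R z) powr e = U x powr e * F x z" for x z
    proof -
      have "U x * (1 + \<xi> x z) = u (t *\<^sub>R x + s *\<^sub>R z)" using Up[of x] by (simp add: \<xi>_def)
      then show ?thesis using Up[of x] xil[of x z] lo unfolding F_def by (subst powr_mult[symmetric]) auto
    qed
    have inner: "corr c (\<lambda>z. u (t *\<^sub>R x + s *\<^sub>R z) powr e) (\<lambda>z. u (t *\<^sub>R y + s *\<^sub>R z) powr e)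
      \<le> U x powr e * U y powr e + C * s ^ 3" for x y
    proof -
      define X where "X = (C1 * (K ^ 3 * E 3) + (K\<^sup>2 * E 2)\<^sup>2) * s ^ 3"
      have X0: "X \<ge> 0" using C1(1) K E0 s by (simp add: X_def)
      have "corr c (\<lambda>z. u (t *\<^sub>R x + s *\<^sub>R z) powr e) (\<lambda>z. u (t *\<^sub>R y + s *\<^sub>R z) powr e) = U x powr e * U y powr e * corr c (F x) (F y)"
        unfolding uF by (rule corr_cmult)
      also have "... \<le> U x powr e * U y powr e * (1 + X)"
        using corr_le_mean[OF FL FL cc, of x y] FF[of x] FF[of y] by (intro mult_left_mono) (auto simp: X_def)
      also have "... = U x powr e * U y powr e + U x powr e * U y powr e * X" by (simp add: algebra_simps)
      also have "U x powr e * U y powr e * X \<le> B powr e * B powr e * X"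
        using Ub Up X0 e by (intro mult_right_mono mult_mono powr_mono2) (auto intro: less_imp_le)
      finally show ?thesis by (simp add: X_def C_def mult.assoc)
    qed
    define \<sigma> where "\<sigma> = sqrt (1 - c\<^sup>2)"
    let ?y = "\<lambda>x x2. c *\<^sub>R x + \<sigma> *\<^sub>R x2"
    have pb: "\<bar>u x powr e\<bar> \<le> B powr e" "\<bar>U x powr e\<bar> \<le> B powr e" for x
      using e ub[of x] Ub[of x] ul[of x] Ul[of x] \<delta> by (auto intro!: powr_mono2)
    have VL: "(\<lambda>x. U x powr e) \<in> L2" by (rule L2_bounded[OF _ pb(2)]) measurable
    define J where "J x x2 = corr c (\<lambda>z. u (t *\<^sub>R x + s *\<^sub>R z) powr e) (\<lambda>z. u (t *\<^sub>R ?y x x2 + s *\<^sub>R z) powr e)" for x x2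
    have Jm [measurable]: "(\<lambda>p. J (fst p) (snd p)) \<in> borel_measurable (borel \<Otimes>\<^sub>M borel)"
      unfolding J_def corr_def OU_def by measurable
    have J0: "0 \<le> J x x2" for x x2
      unfolding J_def corr_def OU_def by (intro integral_nonneg_AE AE_I2 mult_nonneg_nonneg) auto
    have Jb: "\<bar>J x x2\<bar> \<le> B powr e * B powr e + C * s ^ 3" for x x2
    proof -
      have "U x powr e * U (?y x x2) powr e \<le> B powr e * B powr e"
        using pb(2)[of x] pb(2)[of "?y x x2"] by (intro mult_mono) auto
      then show ?thesis using inner[of x "?y x x2"] J0[of x x2] by (simp add: J_def)
    qed
    have Jp: "integrable (gauss \<Otimes>\<^sub>M gauss) (\<lambda>(x, x2). J x x2)"
      by (rule gauss2.P.integrable_const_bound[where B="B powr e * B powr e + C * s ^ 3"]) (use Jb in \<open>auto simp: case_prod_beta'\<close>)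
    have "corr c (\<lambda>x. u x powr e) (\<lambda>x. u x powr e) = (\<integral>x. (\<integral>x2. J x x2 \<partial>gauss) \<partial>gauss)"
      unfolding J_def \<sigma>_def by (rule corr_rot[OF _ pb(1) t(3) s(1) less_imp_le[OF s(2)] cc]) measurable
    also have "... = (\<integral>p. (case p of (x, x2) => J x x2) \<partial>(gauss \<Otimes>\<^sub>M gauss))"
      by (rule gauss2.integral_fst[OF Jp])
    also have "... \<le> (\<integral>p. (case p of (x, x2) => U x powr e * U (?y x x2) powr e) + C * s ^ 3 \<partial>(gauss \<Otimes>\<^sub>M gauss))"
    proof (rule integral_mono[OF Jp])
      show "integrable (gauss \<Otimes>\<^sub>M gauss) (\<lambda>p. (case p of (x, x2) => U x powr e * U (?y x x2) powr e) + C * s ^ 3)"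
        using corr_integrable[OF VL VL cc] by (simp add: \<sigma>_def)
      show "(case p of (x, x2) => J x x2) \<le> (case p of (x, x2) => U x powr e * U (?y x x2) powr e) + C * s ^ 3" for p
        using inner by (cases p) (simp add: J_def)
    qed
    also have "... = (\<integral>p. (case p of (x, x2) => U x powr e * U (?y x x2) powr e) \<partial>(gauss \<Otimes>\<^sub>M gauss)) + C * s ^ 3"
    proof -
      have "measure (gauss \<Otimes>\<^sub>M gauss) (space (gauss \<Otimes>\<^sub>M gauss :: ((real^'n) \<times> (real^'n)) measure)) = 1"
        by (rule gauss2.P.prob_space)
      then show ?thesis using corr_integrable[OF VL VL cc] by (simp add: \<sigma>_def)
    qed
    also have "(\<integral>p. (case p of (x, x2) => U x powr e * U (?y x x2) powr e) \<partial>(gauss \<Otimes>\<^sub>M gauss)) = corr c (\<lambda>x. U x powr e) (\<lambda>x. U x powr e)"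
      using corr_pair(1)[OF VL VL cc] by (simp add: \<sigma>_def)
    finally show ?thesis by (simp add: U_def t_def)
  qed
  then show ?thesis using that C0 by blast
qed

section \<open>Hypercontractivity\<close>

lemma powr_le_tangent':
  fixes y m e :: real
  assumes "y > 0" "m > 0" "0 \<le> e" "e \<le> 1"
  shows "y powr e \<le> m powr e * (1 + e * (y / m - 1))"
proof -
  have "y powr e = m powr e * (y / m) powr e" using assms by (simp add: powr_divide)
  also have "... \<le> m powr e * (1 + e * (y / m - 1))"
    using assms by (intro mult_left_mono powr_le_tangent) auto
  finally show ?thesis .
qed

lemma OU_bounds:
  assumes gm: "g \<in> borel_measurable borel" and b: "\<And>x. a \<le> g x" "\<And>x. g x \<le> B" and r: "0 \<le> r" "r < 1"
  shows "a \<le> OU r g x" "OU r g x \<le> B"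
proof -
  have L: "g \<in> L2" by (rule L2_bounded[OF gm, where C="max \<bar>a\<bar> \<bar>B\<bar>"]) (use b in \<open>smt (verit)\<close>)
  note i = OU_integrable[OF L r, of x]
  show "a \<le> OU r g x" unfolding OU_def by (rule gauss.integral_ge_const[OF i]) (use b in auto)
  show "OU r g x \<le> B" unfolding OU_def by (rule gauss.integral_le_const[OF i]) (use b in auto)
qed

text \<open>The functional \<open>\<Phi>\<close> interpolates between the correlation of \<open>G\<close> to the power
  \<open>e\<close> (at \<open>r = 1\<close>) and the power of the mean (at \<open>r = 0\<close>), and nearly
  decreases in each small step from \<open>r\<close> towards \<open>0\<close>.\<close>
lemma corr_powr_OU_le:
  fixes G :: "real^'n::finite => real"
  assumes e: "1/2 < e" "e < 1" and c: "c = (1 - e) / e" and \<delta>: "0 < \<delta>"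
    and Gm: "G \<in> borel_measurable borel" and G: "\<And>x. \<delta> \<le> G x" "\<And>x. G x \<le> B" and r0: "0 < r0" "r0 < 1"
  shows "corr c (\<lambda>x. OU r0 G x powr e) (\<lambda>x. OU r0 G x powr e) \<le> (\<integral>x. G x \<partial>gauss) powr (2 * e)"
proof -
  note Gm [measurable]
  define \<Phi> where "\<Phi> r = corr c (\<lambda>x. OU r G x powr e) (\<lambda>x. OU r G x powr e)" for r
  define m where "m = (\<integral>x. G x \<partial>gauss)"
  define V where "V = (\<integral>x. (G x)\<^sup>2 \<partial>gauss)"
  have cc: "0 \<le> c" "c < 1" using e unfolding c by (auto simp: field_simps)
  have \<delta>B: "\<delta> \<le> B" using G(1)[of 0] G(2)[of 0] by linarith
  have Gabs: "\<bar>G x\<bar> \<le> B" for x using G(1)[of x] G(2)[of x] \<delta> by linarith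
  have GL: "G \<in> L2" by (rule L2_bounded[OF _ Gabs]) simp
  have m: "m \<ge> \<delta>" unfolding m_def by (rule gauss.integral_ge_const[OF L2_integrable[OF GL]]) (use G in auto)
  have mp: "m > 0" using m \<delta> by linarith
  have V0: "V \<ge> 0" by (simp add: V_def)
  \<comment> \<open>the powers lie below their tangents at the mean, and these are affine in \<open>OU r G\<close>\<close>
  have low: "\<Phi> r \<le> m powr (2 * e) * (1 + r\<^sup>2 * V / m\<^sup>2)" if r: "0 \<le> r" "r < 1" for r
  proof -
    define P where "P = OU r G"
    have PL: "P \<in> L2" unfolding P_def by (rule OU_L2(1)[OF GL r])
    have Pb: "\<delta> \<le> P x" "P x \<le> B" for x unfolding P_def by (rule OU_bounds[OF Gm G r])+
    have Pp: "P x > 0" for x using Pb(1)[of x] \<delta> by linarith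
    have [measurable]: "P \<in> borel_measurable borel" using PL by auto
    define l where "l x = m powr e * (1 - e) + (m powr e * (e / m)) * P x" for x
    have lL: "l \<in> L2" unfolding l_def[abs_def] by (intro L2_add L2_cmult PL L2_const)
    have Pl: "P x powr e \<le> l x" for x
      using powr_le_tangent'[OF Pp mp, of e x] e by (simp add: l_def algebra_simps)
    have vL: "(\<lambda>x. P x powr e) \<in> L2"
      by (rule L2_bounded[where C="B powr e"]) (use Pb Pp e in \<open>auto intro!: powr_mono2 intro: less_imp_le\<close>)
    have P1: "(\<integral>x. P x \<partial>gauss) = m" unfolding P_def m_def by (rule integral_OU[OF GL r])
    have P2: "(\<integral>x. (P x)\<^sup>2 \<partial>gauss) \<le> m\<^sup>2 + r\<^sup>2 * V"
    proof -
      have "r * r \<le> r * 1" using r by (intro mult_left_mono) auto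
      then have rr: "0 \<le> r * r" "r * r < 1" using r by auto
      have "(\<integral>x. (P x)\<^sup>2 \<partial>gauss) = corr (r * r) G G"
        by (simp add: corr_split[OF GL GL r r] P_def power2_eq_square)
      also have "... \<le> (1 - r * r) * m\<^sup>2 + r * r * V"
        unfolding m_def V_def by (rule corr_le_mean_variance[OF GL rr])
      also have "... \<le> 1 * m\<^sup>2 + r * r * V" using rr by (intro add_right_mono mult_right_mono) auto
      finally show ?thesis by (simp add: power2_eq_square)
    qed
    have M: "m powr e * m powr e = m powr (2 * e)" by (simp add: powr_add[symmetric])
    have l1: "(\<integral>x. l x \<partial>gauss) = m powr e"
      using L2_integrable[OF PL] P1 mp by (simp add: l_def field_simps)
    have l2: "(\<integral>x. (l x)\<^sup>2 \<partial>gauss) \<le> m powr (2 * e) * (1 + r\<^sup>2 * V / m\<^sup>2)"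
    proof -
      have "(\<integral>x. (l x)\<^sup>2 \<partial>gauss) = (\<integral>x. m powr (2*e) * ((1-e)\<^sup>2 + (2 * (1 - e) * e / m) * P x + (e\<^sup>2 / m\<^sup>2) * (P x)\<^sup>2) \<partial>gauss)"
        unfolding M[symmetric] using mp
        by (intro Bochner_Integration.integral_cong refl) (simp add: l_def power2_eq_square field_simps)
      also have "... = m powr (2*e) * ((1-e)\<^sup>2 + (2 * (1 - e) * e / m) * m + (e\<^sup>2 / m\<^sup>2) * (\<integral>x. (P x)\<^sup>2 \<partial>gauss))"
        using L2_integrable[OF PL] L2_sq[OF PL] P1 by simp
      also have "... \<le> m powr (2*e) * ((1-e)\<^sup>2 + (2 * (1 - e) * e / m) * m + (e\<^sup>2 / m\<^sup>2) * (m\<^sup>2 + r\<^sup>2 * V))"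
        by (intro mult_left_mono add_mono order_refl P2) auto
      also have "(1-e)\<^sup>2 + (2 * (1 - e) * e / m) * m + (e\<^sup>2 / m\<^sup>2) * (m\<^sup>2 + r\<^sup>2 * V) = 1 + e\<^sup>2 * (r\<^sup>2 * V / m\<^sup>2)"
        using mp by (simp add: field_simps power2_eq_square)
      also have "m powr (2*e) * (1 + e\<^sup>2 * (r\<^sup>2 * V / m\<^sup>2)) \<le> m powr (2*e) * (1 + 1 * (r\<^sup>2 * V / m\<^sup>2))"
        using e V0 by (intro mult_left_mono add_mono mult_right_mono order_refl) (auto simp: power_le_one)
      finally show ?thesis by simp
    qed
    have "\<Phi> r \<le> corr c l l" unfolding \<Phi>_def P_def[symmetric] by (rule corr_mono_fun[OF vL lL cc _ Pl]) simp
    also have "... \<le> (1 - c) * (m powr e)\<^sup>2 + c * (\<integral>x. (l x)\<^sup>2 \<partial>gauss)"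
      using corr_le_mean_variance[OF lL cc] unfolding l1 .
    also have "(m powr e)\<^sup>2 = m powr (2 * e)" using M by (simp add: power2_eq_square)
    also have "(1 - c) * m powr (2 * e) + c * (\<integral>x. (l x)\<^sup>2 \<partial>gauss)
      \<le> (1 - c) * (m powr (2 * e) * (1 + r\<^sup>2 * V / m\<^sup>2)) + c * (m powr (2 * e) * (1 + r\<^sup>2 * V / m\<^sup>2))"
      using cc l2 V0 by (intro add_mono mult_left_mono) (auto simp: mult_le_cancel_left1)
    also have "... = m powr (2 * e) * (1 + r\<^sup>2 * V / m\<^sup>2)" unfolding distrib_right[symmetric] by simp
    finally show ?thesis .
  qed
  define L where "L = 2 * B / sqrt (1 - r0\<^sup>2)"
  have L0: "L \<ge> 0" using OU_cs(2)[of r0] r0 \<delta> \<delta>B by (simp add: L_def)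
  obtain C where C0: "C \<ge> 0" and C: "\<And>(u :: real^'n => real) s. [|u \<in> borel_measurable borel; \<And>x. \<delta> \<le> u x; \<And>x. u x \<le> B; \<And>x y. \<bar>u x - u y\<bar> \<le> L * norm (x - y); 0 < s; s < 1|]
      ==> corr c (\<lambda>x. u x powr e) (\<lambda>x. u x powr e)
        \<le> corr c (\<lambda>x. OU (sqrt (1 - s\<^sup>2)) u x powr e) (\<lambda>x. OU (sqrt (1 - s\<^sup>2)) u x powr e) + C * s ^ 3"
    using corr_one_step[OF e c \<delta> \<delta>B L0, where 'n='n] by blast
  have step: "\<Phi> r \<le> \<Phi> (sqrt (1 - s\<^sup>2) * r) + C * s ^ 3" if r: "0 \<le> r" "r \<le> r0" and s: "0 < s" "s < 1" for r s
  proof -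
    have r1: "r < 1" using r r0 by linarith
    have t: "0 \<le> sqrt (1 - s\<^sup>2)" "sqrt (1 - s\<^sup>2) \<le> 1" using OU_cs[of s] s by auto
    have P: "OU (sqrt (1 - s\<^sup>2)) (OU r G) = OU (sqrt (1 - s\<^sup>2) * r) G"
      by (intro ext OU_semigroup GL t r r1)
    show ?thesis unfolding \<Phi>_def P[symmetric]
    proof (rule C[OF _ _ _ _ s])
      show "OU r G \<in> borel_measurable borel" by measurable
      show "\<delta> \<le> OU r G x" "OU r G x \<le> B" for x by (rule OU_bounds[OF Gm G r(1) r1])+
      show "\<bar>OU r G x - OU r G y\<bar> \<le> L * norm (x - y)" for x y
        unfolding L_def by (rule OU_Lipschitz[OF Gm Gabs r r0(2)])
    qed
  qed
  have iter: "\<Phi> r0 \<le> \<Phi> (sqrt (1 - s\<^sup>2) ^ k * r0) + real k * (C * s ^ 3)" if s: "0 < s" "s < 1" for s k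
  proof (induction k)
    case (Suc k)
    have t: "0 \<le> sqrt (1 - s\<^sup>2)" "sqrt (1 - s\<^sup>2) \<le> 1" using OU_cs[of s] s by auto
    have "sqrt (1 - s\<^sup>2) ^ k * r0 \<le> 1 * r0" using t r0 by (intro mult_right_mono power_le_one) auto
    then have "\<Phi> (sqrt (1 - s\<^sup>2) ^ k * r0) \<le> \<Phi> (sqrt (1 - s\<^sup>2) * (sqrt (1 - s\<^sup>2) ^ k * r0)) + C * s ^ 3"
      using t r0 s by (intro step) auto
    then show ?case using Suc.IH by (simp add: algebra_simps)
  qed simp
  \<comment> \<open>The step size for \<open>k\<close> steps: the exponent exceeds \<open>1/3\<close>, so that the sum of the errors vanishes,
    and is below \<open>1/2\<close>, so that the steps reach correlation \<open>0\<close> in the limit.\<close>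
  define S where "S k = (real k + 2) powr (- 3/8)" for k :: nat
  have S: "0 < S k" "S k < 1" for k
  proof -
    show "0 < S k" by (simp add: S_def)
    have "(real k + 2) powr (- 3/8) < (real k + 2) powr 0" by (rule powr_less_mono) auto
    then show "S k < 1" by (simp add: S_def)
  qed
  have le: "\<Phi> r0 \<le> m powr (2 * e) * (1 + (1 - (S k)\<^sup>2) ^ k * V / m\<^sup>2) + real k * (C * (S k) ^ 3)" for k
  proof -
    define t where "t = sqrt (1 - (S k)\<^sup>2)"
    have t: "0 \<le> t" "t \<le> 1" "t\<^sup>2 = 1 - (S k)\<^sup>2" using OU_cs[of "S k"] S[of k] by (auto simp: t_def)
    have tk: "t ^ k \<le> 1" "0 \<le> t ^ k" using t by (auto simp: power_le_one)
    have lt: "t ^ k * r0 < 1" using tk r0 mult_right_mono[of "t ^ k" 1 r0] by linarith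
    have "\<Phi> r0 \<le> \<Phi> (t ^ k * r0) + real k * (C * (S k) ^ 3)" unfolding t_def by (rule iter[OF S])
    also have "\<Phi> (t ^ k * r0) \<le> m powr (2 * e) * (1 + (t ^ k * r0)\<^sup>2 * V / m\<^sup>2)" using tk r0 lt by (intro low) auto
    also have "... \<le> m powr (2 * e) * (1 + (t ^ k)\<^sup>2 * V / m\<^sup>2)"
    proof -
      have "(t ^ k * r0)\<^sup>2 \<le> (t ^ k)\<^sup>2" using tk r0 by (intro power_mono) (auto simp: mult_left_le)
      then show ?thesis using V0 by (intro mult_left_mono add_left_mono divide_right_mono mult_right_mono) auto
    qed
    also have "(t ^ k)\<^sup>2 = (1 - (S k)\<^sup>2) ^ k" by (simp add: t(3)[symmetric] mult.commute flip: power_mult)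
    finally show ?thesis by simp
  qed
  have "(\<lambda>k. m powr (2 * e) * (1 + (1 - (S k)\<^sup>2) ^ k * V / m\<^sup>2) + C * (real k * (S k) ^ 3)) \<longlonglongrightarrow> m powr (2 * e) * (1 + 0 * V / m\<^sup>2) + C * 0"
  proof (intro tendsto_intros)
    have S2: "(S k)\<^sup>2 = (real k + 2) powr (- 3/4)" for k
      unfolding S_def power2_eq_square powr_add[symmetric] by simp
    have S3: "(S k) ^ 3 = (real k + 2) powr (- 9/8)" for k
      unfolding S_def power3_eq_cube powr_add[symmetric] by simp
    show "(\<lambda>k. (1 - (S k)\<^sup>2) ^ k) \<longlonglongrightarrow> 0" unfolding S2 by real_asymp
    show "(\<lambda>k. real k * (S k) ^ 3) \<longlonglongrightarrow> 0" unfolding S3 by real_asymp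
  qed (use mp in auto)
  then have "\<Phi> r0 \<le> m powr (2 * e) * (1 + 0 * V / m\<^sup>2) + C * 0"
    by (rule LIMSEQ_le_const) (use le in \<open>auto simp: mult_ac\<close>)
  then show ?thesis by (simp add: \<Phi>_def m_def)
qed

lemma corr_isCont:
  assumes "f \<in> L2" "g \<in> L2" "\<bar>r\<bar> < 1"
  shows "isCont (\<lambda>r. corr r f g) r"
  using corr_DERIV_kern[OF assms] by (rule DERIV_isCont)

text \<open>Hypercontractivity of the semigroup, in the form of a bound on the correlation of a function with itself:
  \<open>corr_powr_OU_le\<close> for \<open>h\<close> to the power \<open>q\<close>, shifted by \<open>d >
  0\<close> to be bounded below. The limit \<open>s = 1\<close> is not taken in the power but after Jensen's
  inequality for the concave power \<open>e\<close>, where continuity of \<open>corr\<close> in the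
  correlation suffices.\<close>
theorem corr_hypercontractive:
  fixes h :: "real^'n::finite => real"
  assumes hm: "h \<in> borel_measurable borel" and h: "\<And>x. 0 \<le> h x" "\<And>x. h x \<le> R" and q: "1 < q" "q < 2"
  shows "corr (q - 1) h h \<le> (\<integral>x. h x powr q \<partial>gauss) powr (2 / q)"
proof -
  note hm [measurable]
  define e where "e = 1 / q"
  define c where "c = q - 1"
  have e: "1/2 < e" "e < 1" and ce: "c = (1 - e) / e" and cc: "0 \<le> c" "c < 1" using q by (auto simp: e_def c_def field_simps)
  have habs: "\<bar>h x\<bar> \<le> R" for x using h[of x] by simp
  have hL: "h \<in> L2" by (rule L2_bounded[OF _ habs]) simp
  have hq: "\<bar>h x powr q\<bar> \<le> R powr q" for x using h[of x] q by (auto intro!: powr_mono2)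
  have iq: "integrable gauss (\<lambda>x. h x powr q)" by (rule gauss_bounded_integrable[OF _ hq]) measurable
  define A where "A = (\<integral>x. h x powr q \<partial>gauss)"
  have A0: "A \<ge> 0" unfolding A_def by (intro integral_nonneg_AE AE_I2) simp
  have 1: "corr (c * (s * s)) h h \<le> (A + d) powr (2 * e)" if s: "0 < s" "s < 1" and d: "0 < d" for s d
  proof -
    define G where "G x = h x powr q + d" for x
    have [measurable]: "G \<in> borel_measurable borel" unfolding G_def[abs_def] by measurable
    have G: "d \<le> G x" "G x \<le> R powr q + d" for x using hq[of x] by (auto simp: G_def)
    have Gp: "G x > 0" for x using G(1)[of x] d by linarith
    have hG: "h x \<le> G x powr e" for x
    proof -
      have "h x = (h x powr q) powr e" using h(1)[of x] q by (simp add: powr_powr e_def)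
      also have "... \<le> G x powr e" using e d by (intro powr_mono2) (auto simp: G_def)
      finally show ?thesis .
    qed
    have GeL: "(\<lambda>x. G x powr e) \<in> L2"
      by (rule L2_bounded[where C="(R powr q + d) powr e"]) (use G Gp e in \<open>auto intro!: powr_mono2 intro: less_imp_le\<close>)
    have GL: "G \<in> L2"
      by (rule L2_bounded[where C="R powr q + d"]) (use G Gp in \<open>auto simp: abs_of_pos\<close>)
    have s': "0 \<le> s" using s by simp
    have PG: "d \<le> OU s G x" "OU s G x \<le> R powr q + d" for x by (rule OU_bounds[OF _ G s' s(2)], measurable)+
    have PGp: "OU s G x > 0" for x using PG(1)[of x] d by linarith
    have vL: "(\<lambda>x. OU s G x powr e) \<in> L2"
      by (rule L2_bounded[where C="(R powr q + d) powr e"]) (use PG PGp e in \<open>auto intro!: powr_mono2 intro: less_imp_le\<close>)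
    have J: "OU s h x \<le> OU s G x powr e" for x
    proof -
      define m where "m = OU s G x"
      have m: "m > 0" using PGp by (simp add: m_def)
      have "OU s h x \<le> OU s (\<lambda>y. m powr e * (1 - e) + (m powr e * e / m) * G y) x"
      proof (rule OU_mono[OF hL _ s' s(2)])
        show "(\<lambda>y. m powr e * (1 - e) + (m powr e * e / m) * G y) \<in> L2" by (intro L2_add L2_const L2_cmult GL)
        show "h y \<le> m powr e * (1 - e) + (m powr e * e / m) * G y" for y
          using order_trans[OF hG powr_le_tangent'[OF Gp m, of e y]] e by (simp add: algebra_simps)
      qed
      also have "... = m powr e * (1 - e) + (m powr e * e / m) * m"
        using OU_integrable[OF GL s' s(2), of x] by (simp add: OU_def m_def)
      also have "... = m powr e" using m by (simp add: algebra_simps)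
      finally show ?thesis by (simp add: m_def)
    qed
    have "corr (c * (s * s)) h h = corr c (OU s h) (OU s h)"
    proof -
      have cs: "0 \<le> sqrt c" "sqrt c \<le> 1" "sqrt c < 1" using cc by auto
      have "sqrt c * s \<le> 1 * s" using cs s by (intro mult_right_mono) auto
      then have "sqrt c * s < 1" using s by linarith
      moreover have "0 \<le> sqrt c * s" using cs s by simp
      ultimately have css: "0 \<le> sqrt c * s" "sqrt c * s < 1" by simp_all
      have "corr c (OU s h) (OU s h) = (\<integral>x. (OU (sqrt c) (OU s h) x)\<^sup>2 \<partial>gauss)"
        by (rule corr_sqrt[OF OU_L2(1)[OF hL s' s(2)] cc])
      also have "... = (\<integral>x. OU (sqrt c * s) h x * OU (sqrt c * s) h x \<partial>gauss)"
        by (simp add: OU_semigroup[OF hL cs(1,2) s' s(2)] power2_eq_square)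
      also have "... = corr ((sqrt c * s) * (sqrt c * s)) h h" by (rule corr_split[OF hL hL css css, symmetric])
      also have "(sqrt c * s) * (sqrt c * s) = c * (s * s)" using cc by (simp add: algebra_simps)
      finally show ?thesis by simp
    qed
    also have "... \<le> corr c (\<lambda>x. OU s G x powr e) (\<lambda>x. OU s G x powr e)"
    proof (rule corr_mono_fun[OF OU_L2(1)[OF hL s' s(2)] vL cc _ J])
      show "0 \<le> OU s h x" for x unfolding OU_def by (intro integral_nonneg_AE AE_I2 h)
    qed
    also have "... \<le> (\<integral>x. G x \<partial>gauss) powr (2 * e)"
      by (rule corr_powr_OU_le[OF e ce d _ G s]) measurable
    also have "(\<integral>x. G x \<partial>gauss) = A + d" using iq by (simp add: G_def A_def)
    finally show ?thesis .
  qed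
  have 2: "corr (c * (s * s)) h h \<le> A powr (2 * e)" if s: "0 < s" "s < 1" for s
  proof (rule LIMSEQ_le_const)
    show "(\<lambda>n. (A + 1 / real (Suc n)) powr (2 * e)) \<longlonglongrightarrow> A powr (2 * e)"
    proof (rule tendsto_powr')
      show "(\<lambda>n. A + 1 / real (Suc n)) \<longlonglongrightarrow> A" using tendsto_add[OF tendsto_const lim_1_over_n[THEN LIMSEQ_Suc], of A] by simp
    qed (use A0 e in auto)
    show "\<exists>N. \<forall>n\<ge>N. corr (c * (s * s)) h h \<le> (A + 1 / real (Suc n)) powr (2 * e)"
      using 1[OF s] by simp
  qed
  have "(\<lambda>n. corr (c * (to_one (Suc n) * to_one (Suc n))) h h) \<longlonglongrightarrow> corr c h h"
  proof (rule isCont_tendsto_compose[of c "\<lambda>r. corr r h h"])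
    show "isCont (\<lambda>r. corr r h h) c" by (rule corr_isCont[OF hL hL]) (use cc in simp)
    have "(\<lambda>n. c * (to_one (Suc n) * to_one (Suc n))) \<longlonglongrightarrow> c * (1 * 1)"
      by (intro tendsto_intros LIMSEQ_Suc to_one)
    then show "(\<lambda>n. c * (to_one (Suc n) * to_one (Suc n))) \<longlonglongrightarrow> c" by simp
  qed
  then have "corr c h h \<le> A powr (2 * e)"
  proof (rule LIMSEQ_le_const2)
    have "0 < to_one (Suc n)" for n by (simp add: to_one_def field_simps)
    then show "\<exists>N. \<forall>n\<ge>N. corr (c * (to_one (Suc n) * to_one (Suc n))) h h \<le> A powr (2 * e)"
      using 2 to_one(2) by blast
  qed
  then show ?thesis by (simp add: c_def A_def e_def)
qed

section \<open>Bounds on the correlation of the gradient\<close>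

lemma powr_le_1_sq:
  fixes t p :: real
  assumes "0 \<le> t" "0 \<le> p" "p \<le> 2"
  shows "t powr p \<le> 1 + t\<^sup>2"
proof (cases "t \<le> 1")
  case True
  then have "t powr p \<le> 1 powr p" using assms by (intro powr_mono2) auto
  then show ?thesis by (simp add: add_increasing2)
next
  case False
  then have "t powr p \<le> t powr 2" using assms by (intro powr_mono) auto
  then show ?thesis using False by simp
qed

lemma L2_powr_integrable:
  assumes h: "h \<in> L2" "\<And>x. 0 \<le> h x" and p: "0 \<le> p" "p \<le> 2"
  shows "integrable gauss (\<lambda>x. h x powr p)"
proof (rule Bochner_Integration.integrable_bound)
  show "integrable gauss (\<lambda>x. 1 + (h x)\<^sup>2)" using L2_sq[OF h(1)] by simp
  show "AE x in gauss. norm (h x powr p) \<le> norm (1 + (h x)\<^sup>2)"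
    using powr_le_1_sq[OF h(2) p] by (intro AE_I2) (simp add: abs_of_nonneg)
  show "(\<lambda>x. h x powr p) \<in> borel_measurable gauss" using h(1) by measurable
qed

lemma powr_ge_tangent:
  fixes y m p :: real
  assumes y: "0 \<le> y" and m: "0 < m" and p: "1 \<le> p"
  shows "m powr p * (1 + p * (y / m - 1)) \<le> y powr p"
proof (cases "y = 0")
  case False
  define t where "t = y / m"
  have t: "t > 0" using False y m by (simp add: t_def)
  have "t = (t powr p) powr (1 / p)" using t p by (simp add: powr_powr)
  also have "... \<le> 1 + (1 / p) * (t powr p - 1)" using t p by (intro powr_le_tangent) auto
  finally have "p * t \<le> p * (1 + (1 / p) * (t powr p - 1))" using p by (intro mult_left_mono) auto
  also have "... = p + t powr p - 1" using p by (simp add: field_simps)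
  finally have "1 + p * (t - 1) \<le> t powr p" by (simp add: algebra_simps)
  then have "m powr p * (1 + p * (t - 1)) \<le> m powr p * t powr p" by (intro mult_left_mono) auto
  also have "... = y powr p" using m y by (simp add: t_def powr_divide)
  finally show ?thesis by (simp add: t_def)
next
  case True
  have "m powr p * (1 + p * (0 - 1)) \<le> 0" using p by (intro mult_nonneg_nonpos) auto
  then show ?thesis using True by simp
qed

lemma OU_Jensen:
  fixes h :: "real^'n::finite => real"
  assumes h: "h \<in> L2" "\<And>x. 0 \<le> h x" and p: "1 \<le> p" "p \<le> 2" and r: "0 \<le> r" "r < 1"
  shows "(\<integral>x. OU r h x powr p \<partial>gauss) \<le> (\<integral>x. h x powr p \<partial>gauss)"
proof -
  have p0: "0 \<le> p" using p by simp
  define q where "q x = h x powr p" for x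
  have iq: "integrable gauss q" unfolding q_def[abs_def] by (rule L2_powr_integrable[OF h p0 p(2)])
  have Ph: "0 \<le> OU r h x" for x unfolding OU_def by (intro integral_nonneg_AE AE_I2 h)
  note mix = gauss_mix_integrable[OF OU_cs(1,2)[OF r] iq]
  have "AE x in gauss. integrable gauss (\<lambda>z. q (r *\<^sub>R x + sqrt (1 - r\<^sup>2) *\<^sub>R z))"
    by (rule gauss2.AE_integrable_fst[OF mix(1)])
  then have "AE x in gauss. OU r h x powr p \<le> OU r q x"
  proof eventually_elim
    case (elim x)
    define m where "m = OU r h x"
    show ?case
    proof (cases "m = 0")
      case True
      then show ?thesis by (simp add: m_def OU_def q_def)
    next
      case False
      then have m: "m > 0" using Ph[of x] by (simp add: m_def)
      note ih = OU_integrable[OF h(1) r, of x]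
      have "m powr p = (\<integral>z. m powr p * (1 + p * (h (r *\<^sub>R x + sqrt (1 - r\<^sup>2) *\<^sub>R z) / m - 1)) \<partial>gauss)"
        using ih m by (simp add: m_def OU_def)
      also have "... \<le> (\<integral>z. q (r *\<^sub>R x + sqrt (1 - r\<^sup>2) *\<^sub>R z) \<partial>gauss)"
        using ih elim unfolding q_def by (intro integral_mono powr_ge_tangent h m p) auto
      finally show ?thesis by (simp add: m_def OU_def)
    qed
  qed
  then have "(\<integral>x. OU r h x powr p \<partial>gauss) \<le> (\<integral>x. OU r q x \<partial>gauss)"
  proof (rule integral_mono_AE[rotated 2])
    show "integrable gauss (\<lambda>x. OU r h x powr p)" by (rule L2_powr_integrable[OF OU_L2(1)[OF h(1) r] Ph p0 p(2)])
    show "integrable gauss (OU r q)" unfolding OU_def using gauss2.integrable_fst[OF mix(1)] .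
  qed
  also have "... = (\<integral>x. q x \<partial>gauss)"
    using gauss2.integral_fst[OF mix(1)] mix(2) by (simp add: OU_def)
  finally show ?thesis by (simp add: q_def)
qed

definition fam_norm :: "'i set => ('i => 'a => real) => 'a => real" where
  "fam_norm S F x = sqrt (\<Sum>\<kappa>\<in>S. (F \<kappa> x)\<^sup>2)"

lemma fam_norm_nonneg: "0 \<le> fam_norm S F x"
  by (simp add: fam_norm_def sum_nonneg)

lemma fam_norm_sq: "(fam_norm S F x)\<^sup>2 = (\<Sum>\<kappa>\<in>S. (F \<kappa> x)\<^sup>2)"
  by (simp add: fam_norm_def sum_nonneg)

lemma fam_norm_Cauchy_Schwarz: "(\<Sum>\<kappa>\<in>S. F \<kappa> x * G \<kappa> y) \<le> fam_norm S F x * fam_norm S G y"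
proof -
  have "(\<Sum>\<kappa>\<in>S. F \<kappa> x * G \<kappa> y) \<le> (\<Sum>\<kappa>\<in>S. \<bar>F \<kappa> x\<bar> * \<bar>G \<kappa> y\<bar>)"
    by (intro sum_mono) (metis abs_ge_self abs_mult)
  also have "... \<le> L2_set (\<lambda>\<kappa>. F \<kappa> x) S * L2_set (\<lambda>\<kappa>. G \<kappa> y) S" by (rule L2_set_mult_ineq)
  finally show ?thesis by (simp add: L2_set_def fam_norm_def)
qed

lemma fam_norm_L2:
  assumes S: "finite S" and F: "\<And>\<kappa>. \<kappa> \<in> S ==> F \<kappa> \<in> L2"
  shows "fam_norm S F \<in> L2"
proof -
  have [measurable]: "\<And>\<kappa>. \<kappa> \<in> S ==> F \<kappa> \<in> borel_measurable borel" using F by auto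
  have "fam_norm S F \<in> borel_measurable borel" unfolding fam_norm_def[abs_def] by measurable
  then show ?thesis using L2_sq[OF F] S by (simp add: L2_def fam_norm_sq)
qed

text \<open>The Euclidean norm of an average is at most the average of the norm, by duality.\<close>
lemma fam_norm_OU:
  assumes S: "finite S" and F: "\<And>\<kappa>. \<kappa> \<in> S ==> F \<kappa> \<in> L2" and r: "0 \<le> r" "r < 1"
  shows "fam_norm S (\<lambda>\<kappa>. OU r (F \<kappa>)) x \<le> OU r (fam_norm S F) x"
proof -
  define n where "n = fam_norm S (\<lambda>\<kappa>. OU r (F \<kappa>)) x"
  define y where "y z = r *\<^sub>R x + sqrt (1 - r\<^sup>2) *\<^sub>R z" for z
  have n0: "n \<ge> 0" by (simp add: n_def fam_norm_nonneg)
  have i: "integrable gauss (\<lambda>z. F \<kappa> (y z))" if "\<kappa> \<in> S" for \<kappa> unfolding y_def by (rule OU_integrable[OF F[OF that] r])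
  have iN: "integrable gauss (\<lambda>z. fam_norm S F (y z))" unfolding y_def by (rule OU_integrable[OF fam_norm_L2[OF S F] r])
  have "n * n = (\<Sum>\<kappa>\<in>S. OU r (F \<kappa>) x * (\<integral>z. F \<kappa> (y z) \<partial>gauss))"
    unfolding n_def power2_eq_square[symmetric] fam_norm_sq by (simp add: power2_eq_square OU_def y_def)
  also have "... = (\<integral>z. (\<Sum>\<kappa>\<in>S. OU r (F \<kappa>) x * F \<kappa> (y z)) \<partial>gauss)"
    using i by (subst Bochner_Integration.integral_sum) auto
  also have "... \<le> (\<integral>z. n * fam_norm S F (y z) \<partial>gauss)"
  proof (rule integral_mono)
    show "(\<Sum>\<kappa>\<in>S. OU r (F \<kappa>) x * F \<kappa> (y z)) \<le> n * fam_norm S F (y z)" for z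
      unfolding n_def by (rule fam_norm_Cauchy_Schwarz)
  qed (use i iN in auto)
  also have "... = n * OU r (fam_norm S F) x" by (simp add: OU_def y_def)
  finally have *: "n * n \<le> n * OU r (fam_norm S F) x" .
  show ?thesis
  proof (cases "n = 0")
    case True
    have "0 \<le> OU r (fam_norm S F) x" unfolding OU_def by (intro integral_nonneg_AE AE_I2 fam_norm_nonneg)
    then show ?thesis using True by (simp add: n_def)
  next
    case False
    then have "n > 0" using n0 by simp
    then have "n \<le> OU r (fam_norm S F) x" using * by simp
    then show ?thesis by (simp add: n_def)
  qed
qed

lemma Young_powr:
  fixes a b p :: real
  assumes "0 \<le> a" "0 \<le> b" "1 \<le> p"
  shows "a * b powr (p - 1) \<le> a powr p / p + (1 - 1 / p) * b powr p"
proof (cases "a = 0 \<or> b = 0")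
  case False
  then have ab: "a > 0" "b > 0" using assms by auto
  have "(a powr p) powr (1 / p) * (b powr p) powr (1 - 1 / p) \<le> (1 / p) * a powr p + (1 - 1 / p) * b powr p"
    using ab assms by (intro Youngs_inequality_0) auto
  moreover have "p * (1 - 1 / p) = p - 1" using assms by (simp add: field_simps)
  ultimately show ?thesis using ab assms by (simp add: powr_powr)
next
  case True
  then show ?thesis using assms by auto
qed

text \<open>Young's inequality applied to the normalized integrands.\<close>
lemma integral_powr_interpolate:
  assumes g: "g \<in> L2" "\<And>x. 0 \<le> g x" and p: "0 < p" "p \<le> q" "q < 2"
  shows "(\<integral>x. g x powr q \<partial>gauss) \<le> (\<integral>x. g x powr p \<partial>gauss) powr ((2 - q) / (2 - p)) * (\<integral>x. (g x)\<^sup>2 \<partial>gauss) powr (1 - (2 - q) / (2 - p))"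
proof -
  define \<theta> where "\<theta> = (2 - q) / (2 - p)"
  have th: "0 \<le> \<theta>" "\<theta> \<le> 1" using p by (auto simp: \<theta>_def)
  have qe: "p * \<theta> + 2 * (1 - \<theta>) = q"
  proof -
    have "\<theta> * (2 - p) = 2 - q" using p by (simp add: \<theta>_def)
    then show ?thesis by (simp add: algebra_simps)
  qed
  define A where "A = (\<integral>x. g x powr p \<partial>gauss)"
  define B where "B = (\<integral>x. (g x)\<^sup>2 \<partial>gauss)"
  have ip: "integrable gauss (\<lambda>x. g x powr p)" by (rule L2_powr_integrable[OF g]) (use p in auto)
  have iq: "integrable gauss (\<lambda>x. g x powr q)" by (rule L2_powr_integrable[OF g]) (use p in auto)
  have A0: "0 \<le> A" and B0: "0 \<le> B" by (simp_all add: A_def B_def)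
  have zero: "(\<integral>x. g x powr q \<partial>gauss) = 0" if "AE x in gauss. g x = 0"
    by (rule integral_eq_zero_AE) (use that in eventually_elim, simp)
  show ?thesis
  proof (cases "A = 0 \<or> B = 0")
    case True
    then have "AE x in gauss. g x = 0"
    proof
      assume "A = 0"
      then have "AE x in gauss. g x powr p = 0" unfolding A_def by (subst (asm) integral_nonneg_eq_0_iff_AE[OF ip]) auto
      then show ?thesis by eventually_elim simp
    next
      assume "B = 0"
      then have "AE x in gauss. (g x)\<^sup>2 = 0" unfolding B_def by (subst (asm) integral_nonneg_eq_0_iff_AE[OF L2_sq[OF g(1)]]) auto
      then show ?thesis by eventually_elim simp
    qed
    then show ?thesis using zero by simp
  next
    case False
    then have Ap: "A > 0" and Bp: "B > 0" using A0 B0 by auto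
    have "(\<integral>x. g x powr q \<partial>gauss) \<le> (\<integral>x. (A powr \<theta> * B powr (1 - \<theta>)) * (\<theta> / A * g x powr p + (1 - \<theta>) / B * (g x)\<^sup>2) \<partial>gauss)"
    proof (rule integral_mono[OF iq])
      show "integrable gauss (\<lambda>x. (A powr \<theta> * B powr (1 - \<theta>)) * (\<theta> / A * g x powr p + (1 - \<theta>) / B * (g x)\<^sup>2))"
        using ip L2_sq[OF g(1)] by auto
      fix x
      show "g x powr q \<le> (A powr \<theta> * B powr (1 - \<theta>)) * (\<theta> / A * g x powr p + (1 - \<theta>) / B * (g x)\<^sup>2)"
      proof (cases "g x = 0")
        case False
        then have gp: "g x > 0" using g(2)[of x] by simp
        have "(g x powr p / A) powr \<theta> * ((g x)\<^sup>2 / B) powr (1 - \<theta>) \<le> \<theta> * (g x powr p / A) + (1 - \<theta>) * ((g x)\<^sup>2 / B)"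
          using gp Ap Bp th by (intro Youngs_inequality_0) auto
        moreover have "(g x powr p / A) powr \<theta> * ((g x)\<^sup>2 / B) powr (1 - \<theta>) = g x powr q / (A powr \<theta> * B powr (1 - \<theta>))"
        proof -
          have gsq: "(g x)\<^sup>2 = g x powr 2" using gp by simp
          have e2: "(g x)\<^sup>2 powr (1 - \<theta>) = g x powr (2 * (1 - \<theta>))" unfolding gsq by (rule powr_powr)
          have "(g x powr p / A) powr \<theta> * ((g x)\<^sup>2 / B) powr (1 - \<theta>) = (g x powr (p * \<theta>) * g x powr (2 * (1 - \<theta>))) / (A powr \<theta> * B powr (1 - \<theta>))"
            using gp Ap Bp unfolding e2[symmetric] by (simp add: powr_divide powr_powr)
          then show ?thesis unfolding powr_add[symmetric] qe .
        qed
        ultimately show ?thesis using Ap Bp by (simp add: pos_divide_le_eq mult.commute)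
      qed (use Ap Bp th in auto)
    qed
    also have "... = (A powr \<theta> * B powr (1 - \<theta>)) * (\<theta> / A * A + (1 - \<theta>) / B * B)"
      using ip L2_sq[OF g(1)] by (simp add: A_def B_def)
    also have "... = A powr \<theta> * B powr (1 - \<theta>)" using Ap Bp by simp
    finally show ?thesis by (simp add: A_def B_def \<theta>_def)
  qed
qed

definition grad_moment :: "real => (('n::finite => nat) set) => (real^'n => real) => real" where
  "grad_moment p S f = (\<integral>x. fam_norm S (\<lambda>\<kappa>. D \<kappa> f) x powr p \<partial>gauss)"

text \<open>One factor \<open>G\<close> (the smoothed gradient) of \<open>h G\<close> is split as \<open>G\<close> to
  the powers \<open>p - 1\<close> and \<open>2 - p\<close>. The second is estimated by the sup bound, and
  the rest by the \<open>p\<close>-th moment, since smoothing does not increase it.\<close>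
lemma corr_sum_le:
  fixes f :: "real^'n::finite => real"
  assumes f: "f \<in> Hspace k" and b: "AE x in gauss. \<bar>f x\<bar> \<le> 1" and S: "S \<subseteq> {\<kappa>. mdeg \<kappa> = k}"
    and p: "1 \<le> p" "p < 2" and r: "0 \<le> r" "r < 1"
  shows "(\<Sum>\<kappa>\<in>S. corr r (D \<kappa> f) (D \<kappa> f)) \<le> grad_moment p S f * (1 - r\<^sup>2) powr (- real k * (2 - p) / 2)"
proof -
  define F where "F \<kappa> = D \<kappa> f" for \<kappa>
  have Sf: "finite S" using S by (rule finite_subset) simp
  have FL: "F \<kappa> \<in> L2" if "\<kappa> \<in> S" for \<kappa> unfolding F_def using Hspace_D[OF f, of \<kappa>] S that by auto
  have PL: "OU r (F \<kappa>) \<in> L2" if "\<kappa> \<in> S" for \<kappa> by (rule OU_L2(1)[OF FL[OF that] r])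
  define h where "h = fam_norm S F"
  define G where "G = fam_norm S (\<lambda>\<kappa>. OU r (F \<kappa>))"
  have hL: "h \<in> L2" unfolding h_def by (rule fam_norm_L2[OF Sf FL])
  have GL: "G \<in> L2" unfolding G_def by (rule fam_norm_L2[OF Sf PL])
  have h0: "0 \<le> h x" and G0: "0 \<le> G x" for x by (simp_all add: h_def G_def fam_norm_nonneg)
  have p0: "0 \<le> p" "p \<le> 2" using p by auto
  note ih = L2_powr_integrable[OF hL h0 p0] and iG = L2_powr_integrable[OF GL G0 p0]
  define N where "N = (\<integral>x. h x powr p \<partial>gauss)"
  have N: "grad_moment p S f = N" by (simp add: grad_moment_def N_def h_def F_def[abs_def])
  have r2: "1 - r\<^sup>2 > 0" using r by (simp add: abs_square_less_1)
  define R where "R = (1 - r\<^sup>2) powr (- real k / 2)"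
  have GR: "G x \<le> R" for x
  proof -
    have "(G x)\<^sup>2 \<le> 1 / (1 - r\<^sup>2) ^ k" unfolding G_def fam_norm_sq F_def by (rule OU_D_bound[OF f b r S])
    also have "... = R\<^sup>2"
    proof -
      have "R\<^sup>2 = (1 - r\<^sup>2) powr (- real k)" by (simp add: R_def power2_eq_square powr_add[symmetric])
      then show ?thesis using r2 by (simp add: powr_minus powr_realpow inverse_eq_divide)
    qed
    finally show ?thesis by (rule power2_le_imp_le) (simp add: R_def)
  qed
  define R' where "R' = R powr (2 - p)"
  have R': "R' = (1 - r\<^sup>2) powr (- real k * (2 - p) / 2)" by (simp add: R'_def R_def powr_powr)
  have R'0: "0 \<le> R'" by (simp add: R'_def)
  have pt: "h x * G x \<le> R' * (h x powr p / p + (1 - 1 / p) * G x powr p)" for x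
  proof (cases "G x = 0")
    case True
    then show ?thesis using R'0 p by (simp add: mult_nonneg_nonneg)
  next
    case False
    then have Gp: "G x > 0" using G0[of x] by simp
    have "h x * G x = (h x * G x powr (p - 1)) * G x powr (2 - p)"
      using Gp by (simp add: mult.assoc powr_add[symmetric])
    also have "... \<le> (h x powr p / p + (1 - 1 / p) * G x powr p) * R'"
    proof (intro mult_mono)
      show "h x * G x powr (p - 1) \<le> h x powr p / p + (1 - 1 / p) * G x powr p" by (rule Young_powr[OF h0 G0 p(1)])
      show "G x powr (2 - p) \<le> R'" unfolding R'_def using GR Gp p by (intro powr_mono2) auto
    qed (use p in auto)
    finally show ?thesis by (simp add: mult.commute)
  qed
  have "(\<Sum>\<kappa>\<in>S. corr r (D \<kappa> f) (D \<kappa> f)) = (\<integral>x. (\<Sum>\<kappa>\<in>S. F \<kappa> x * OU r (F \<kappa>) x) \<partial>gauss)"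
    using corr_pair(2)[OF FL FL r] by (subst Bochner_Integration.integral_sum) (auto simp: corr_def F_def)
  also have "... \<le> (\<integral>x. h x * G x \<partial>gauss)"
  proof (rule integral_mono)
    show "(\<Sum>\<kappa>\<in>S. F \<kappa> x * OU r (F \<kappa>) x) \<le> h x * G x" for x
      unfolding h_def G_def by (rule fam_norm_Cauchy_Schwarz)
    show "integrable gauss (\<lambda>x. \<Sum>\<kappa>\<in>S. F \<kappa> x * OU r (F \<kappa>) x)" by (intro Bochner_Integration.integrable_sum corr_pair(2)[OF FL FL r])
    show "integrable gauss (\<lambda>x. h x * G x)" by (rule L2_mult[OF hL GL])
  qed
  also have "... \<le> (\<integral>x. R' * (h x powr p / p + (1 - 1 / p) * G x powr p) \<partial>gauss)"
    using ih iG by (intro integral_mono pt L2_mult[OF hL GL]) auto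
  also have "... = R' * (N / p + (1 - 1 / p) * (\<integral>x. G x powr p \<partial>gauss))"
    using ih iG by (simp add: N_def)
  also have "... \<le> R' * (N / p + (1 - 1 / p) * N)"
  proof -
    have "(\<integral>x. G x powr p \<partial>gauss) \<le> (\<integral>x. OU r h x powr p \<partial>gauss)"
    proof (rule integral_mono[OF iG])
      have "0 \<le> OU r h x" for x unfolding OU_def by (intro integral_nonneg_AE AE_I2 h0)
      then show "integrable gauss (\<lambda>x. OU r h x powr p)" by (rule L2_powr_integrable[OF OU_L2(1)[OF hL r] _ p0])
      show "G x powr p \<le> OU r h x powr p" for x
        unfolding G_def h_def using fam_norm_OU[OF Sf FL r] p by (intro powr_mono2 fam_norm_nonneg) auto
    qed
    also have "... \<le> N" unfolding N_def by (rule OU_Jensen[OF hL h0 p(1) p0(2) r])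
    finally show ?thesis using p R'0 by (intro mult_left_mono add_left_mono) auto
  qed
  also have "N / p + (1 - 1 / p) * N = N" using p by (simp add: field_simps)
  finally show ?thesis by (simp add: N R' mult.commute)
qed

text \<open>Half of the smoothing, by \<open>sqrt r\<close> on either side, produces bounded functions whose second
  moment is the form at \<open>r\<close>. The remaining correlation \<open>(1 - \<alpha>) / (1 +
  \<alpha>)\<close> is \<open>q - 1\<close> for \<open>q = 2 / (1 + \<alpha>)\<close>, so hypercontractivity
  bounds the form by the \<open>q\<close>-th moment, and \<open>\<alpha> \<le> (2 - p) / p\<close> says that
  \<open>q\<close> lies between \<open>p\<close> and \<open>2\<close>.\<close>
lemma corr_sum_hypercontractive:
  fixes f :: "real^'n::finite => real"
  assumes f: "f \<in> Hspace k" and b: "AE x in gauss. \<bar>f x\<bar> \<le> 1" and S: "S \<subseteq> {\<kappa>. mdeg \<kappa> = k}"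
    and p: "1 \<le> p" "p < 2" and r: "0 \<le> r" "r < 1" and \<alpha>: "0 < \<alpha>" "\<alpha> < 1" "\<alpha> \<le> (2 - p) / p" and l: "l = 1 - \<alpha> * p / (2 - p)"
  shows "(\<Sum>\<kappa>\<in>S. corr (r * ((1 - \<alpha>) / (1 + \<alpha>))) (D \<kappa> f) (D \<kappa> f))
    \<le> grad_moment p S f powr (2 * (1 - l) / p) * (grad_moment p S f * (1 - r\<^sup>2) powr (- real k * (2 - p) / 2)) powr l"
proof -
  define q where "q = 2 / (1 + \<alpha>)"
  define c where "c = q - 1"
  have q: "1 < q" "q < 2" using \<alpha> by (auto simp: q_def field_simps)
  have pq: "p \<le> q"
  proof -
    have "\<alpha> * p \<le> 2 - p" using \<alpha>(3) p by (simp add: pos_le_divide_eq)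
    then show ?thesis using \<alpha> by (simp add: q_def pos_le_divide_eq algebra_simps)
  qed
  have ce: "c = (1 - \<alpha>) / (1 + \<alpha>)" using \<alpha> by (simp add: c_def q_def field_simps)
  have cc: "0 \<le> c" "c < 1" using q by (auto simp: c_def)
  define s where "s = sqrt r"
  have s: "0 \<le> s" "s < 1" "s * s = r" using r by (auto simp: s_def)
  define F where "F \<kappa> = D \<kappa> f" for \<kappa>
  define G where "G \<kappa> = OU s (F \<kappa>)" for \<kappa>
  have Sf: "finite S" using S by (rule finite_subset) simp
  have FL: "F \<kappa> \<in> L2" if "\<kappa> \<in> S" for \<kappa> unfolding F_def using Hspace_D[OF f, of \<kappa>] S that by auto
  have GL: "G \<kappa> \<in> L2" if "\<kappa> \<in> S" for \<kappa> unfolding G_def by (rule OU_L2(1)[OF FL[OF that] s(1,2)])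
  define h where "h = fam_norm S F"
  define g where "g = fam_norm S G"
  have hL: "h \<in> L2" unfolding h_def by (rule fam_norm_L2[OF Sf FL])
  have gL: "g \<in> L2" unfolding g_def by (rule fam_norm_L2[OF Sf GL])
  have h0: "0 \<le> h x" and g0: "0 \<le> g x" for x by (simp_all add: h_def g_def fam_norm_nonneg)
  have p0: "0 \<le> p" "p \<le> 2" using p by auto
  define N where "N = (\<integral>x. h x powr p \<partial>gauss)"
  have N: "grad_moment p S f = N" by (simp add: grad_moment_def N_def h_def F_def[abs_def])
  have N0: "N \<ge> 0" by (simp add: N_def)
  have s2: "1 - s\<^sup>2 > 0" using s by (simp add: abs_square_less_1)
  have gb: "g x \<le> sqrt (1 / (1 - s\<^sup>2) ^ k)" for x
    unfolding g_def fam_norm_def G_def F_def by (intro real_sqrt_le_mono OU_D_bound[OF f b s(1,2) S])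
  define T where "T = (\<Sum>\<kappa>\<in>S. corr r (F \<kappa>) (F \<kappa>))"
  have T: "T \<le> N * (1 - r\<^sup>2) powr (- real k * (2 - p) / 2)"
    unfolding T_def F_def N[symmetric] by (rule corr_sum_le[OF f b S p r])
  have T0: "T \<ge> 0" unfolding T_def by (intro sum_nonneg corr_nonneg FL r)
  have "corr (r * c) (F \<kappa>) (F \<kappa>) = corr c (G \<kappa>) (G \<kappa>)" if \<kappa>: "\<kappa> \<in> S" for \<kappa>
  proof -
    have sc: "0 \<le> sqrt c" "sqrt c \<le> 1" using cc by auto
    have "sqrt c * s \<le> 1 * s" using sc s by (intro mult_right_mono) auto
    then have "sqrt c * s < 1" using s by linarith
    moreover have "0 \<le> sqrt c * s" using sc s by simp
    ultimately have css: "0 \<le> sqrt c * s" "sqrt c * s < 1" by simp_all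
    have "corr c (G \<kappa>) (G \<kappa>) = (\<integral>x. (OU (sqrt c) (G \<kappa>) x)\<^sup>2 \<partial>gauss)" by (rule corr_sqrt[OF GL[OF \<kappa>] cc])
    also have "... = (\<integral>x. OU (sqrt c * s) (F \<kappa>) x * OU (sqrt c * s) (F \<kappa>) x \<partial>gauss)"
      unfolding G_def by (simp add: OU_semigroup[OF FL[OF \<kappa>] sc s(1,2)] power2_eq_square)
    also have "... = corr ((sqrt c * s) * (sqrt c * s)) (F \<kappa>) (F \<kappa>)" by (rule corr_split[OF FL FL css css, OF \<kappa> \<kappa>, symmetric])
    also have "(sqrt c * s) * (sqrt c * s) = c * (s * s)" using cc by (simp add: algebra_simps)
    finally show ?thesis by (simp add: s(3) mult.commute)
  qed
  then have "(\<Sum>\<kappa>\<in>S. corr (r * c) (F \<kappa>) (F \<kappa>)) = (\<Sum>\<kappa>\<in>S. corr c (G \<kappa>) (G \<kappa>))" by simp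
  also have "... = (\<integral>x. (\<Sum>\<kappa>\<in>S. G \<kappa> x * OU c (G \<kappa>) x) \<partial>gauss)"
    using corr_pair(2)[OF GL GL cc] by (subst Bochner_Integration.integral_sum) (auto simp: corr_def)
  also have "... \<le> (\<integral>x. g x * OU c g x \<partial>gauss)"
  proof (rule integral_mono)
    show "(\<Sum>\<kappa>\<in>S. G \<kappa> x * OU c (G \<kappa>) x) \<le> g x * OU c g x" for x
    proof -
      have "(\<Sum>\<kappa>\<in>S. G \<kappa> x * OU c (G \<kappa>) x) \<le> g x * fam_norm S (\<lambda>\<kappa>. OU c (G \<kappa>)) x"
        unfolding g_def by (rule fam_norm_Cauchy_Schwarz)
      also have "... \<le> g x * OU c g x" unfolding g_def by (intro mult_left_mono fam_norm_OU Sf GL cc fam_norm_nonneg)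
      finally show ?thesis .
    qed
    show "integrable gauss (\<lambda>x. \<Sum>\<kappa>\<in>S. G \<kappa> x * OU c (G \<kappa>) x)" by (intro Bochner_Integration.integrable_sum corr_pair(2)[OF GL GL cc])
    show "integrable gauss (\<lambda>x. g x * OU c g x)" by (rule corr_pair(2)[OF gL gL cc])
  qed
  also have "... = corr c g g" by (simp add: corr_def)
  also have "... \<le> (\<integral>x. g x powr q \<partial>gauss) powr (2 / q)"
    unfolding c_def by (rule corr_hypercontractive[OF _ g0 gb q]) (use gL in measurable)
  also have "... \<le> (N powr ((2 - q) / (2 - p)) * T powr (1 - (2 - q) / (2 - p))) powr (2 / q)"
  proof (intro powr_mono2)
    have "(\<integral>x. g x powr p \<partial>gauss) \<le> (\<integral>x. OU s h x powr p \<partial>gauss)"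
    proof (rule integral_mono[OF L2_powr_integrable[OF gL g0 p0]])
      have "0 \<le> OU s h x" for x unfolding OU_def by (intro integral_nonneg_AE AE_I2 h0)
      then show "integrable gauss (\<lambda>x. OU s h x powr p)" by (rule L2_powr_integrable[OF OU_L2(1)[OF hL s(1,2)] _ p0])
      show "g x powr p \<le> OU s h x powr p" for x
        unfolding g_def h_def G_def using fam_norm_OU[OF Sf FL s(1,2)] p by (intro powr_mono2 fam_norm_nonneg) auto
    qed
    also have "... \<le> N" unfolding N_def by (rule OU_Jensen[OF hL h0 p(1) p0(2) s(1,2)])
    finally have gN: "(\<integral>x. g x powr p \<partial>gauss) \<le> N" .
    have gT: "(\<integral>x. (g x)\<^sup>2 \<partial>gauss) = T"
    proof -
      have "(\<integral>x. (g x)\<^sup>2 \<partial>gauss) = (\<Sum>\<kappa>\<in>S. \<integral>x. (G \<kappa> x)\<^sup>2 \<partial>gauss)"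
        unfolding g_def fam_norm_sq using L2_sq[OF GL] by (subst Bochner_Integration.integral_sum) auto
      then show ?thesis unfolding T_def G_def s_def using corr_sqrt[OF FL r] by simp
    qed
    have "(\<integral>x. g x powr q \<partial>gauss) \<le> (\<integral>x. g x powr p \<partial>gauss) powr ((2 - q) / (2 - p)) * T powr (1 - (2 - q) / (2 - p))"
      using integral_powr_interpolate[OF gL g0 _ pq q(2)] p unfolding gT by simp
    also have "... \<le> N powr ((2 - q) / (2 - p)) * T powr (1 - (2 - q) / (2 - p))"
      using gN p q by (intro mult_right_mono powr_mono2) auto
    finally show "(\<integral>x. g x powr q \<partial>gauss) \<le> N powr ((2 - q) / (2 - p)) * T powr (1 - (2 - q) / (2 - p))" .
  qed (use q in auto)
  also have "... = N powr (2 * (1 - l) / p) * T powr l"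
  proof -
    have 1: "(2 - q) / (2 - p) * (2 / q) = 2 * (1 - l) / p"
    proof -
      have "(2 - q) / q = \<alpha>" using \<alpha> by (simp add: q_def field_simps)
      moreover have "(2 - q) / (2 - p) * (2 / q) = 2 * ((2 - q) / q) / (2 - p)" by (simp add: mult_ac)
      ultimately have "(2 - q) / (2 - p) * (2 / q) = 2 * \<alpha> / (2 - p)" by simp
      also have "... = 2 * (1 - l) / p" using p by (simp add: l)
      finally show ?thesis .
    qed
    have 2: "(1 - (2 - q) / (2 - p)) * (2 / q) = l"
    proof -
      have "(1 - (2 - q) / (2 - p)) * (2 / q) = 2 / q - 2 * (1 - l) / p" unfolding 1[symmetric] left_diff_distrib by simp
      also have "... = (1 + \<alpha>) - 2 * \<alpha> / (2 - p)"
        using p \<alpha> by (intro arg_cong2[where f="(-)"]) (auto simp: q_def l)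
      also have "1 + \<alpha> - 2 * \<alpha> / (2 - p) = l" using p by (simp add: l field_simps)
      finally show ?thesis .
    qed
    show ?thesis by (simp only: powr_mult powr_powr 1 2 powr_ge_zero)
  qed
  also have "... \<le> N powr (2 * (1 - l) / p) * (N * (1 - r\<^sup>2) powr (- real k * (2 - p) / 2)) powr l"
  proof -
    have "l \<ge> 0" using \<alpha>(3) p by (simp add: l field_simps)
    then show ?thesis using T T0 by (intro mult_left_mono powr_mono2) auto
  qed
  finally show ?thesis by (simp add: ce F_def N)
qed

section \<open>A polynomial inequality\<close>

text \<open>The coefficients, as polynomials in \<open>z\<close>, of a polynomial in \<open>a\<close> and
  \<open>z\<close> with respect to the Bernstein basis \<open>a\<^sup>i (1 -
  a)\<^sup>7\<^sup>-\<^sup>i\<close> on \<open>[0, 1]\<close>.\<close>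
lemma bernstein_rows_nonneg:
  fixes z :: real
  assumes z: "z \<ge> 0"
  shows "0 \<le> 24 * z ^ 2 + 24 * z ^ 3"
    "0 \<le> 24 - 72 * z + 116 * z ^ 2 + 256 * z ^ 3 + 32 * z ^ 4"
    "0 \<le> 316 - 332 * z + 84 * z ^ 2 + 1152 * z ^ 3 + 304 * z ^ 4 + 16 * z ^ 5"
    "0 \<le> 1436 - 120 * z - 152 * z ^ 2 + 3112 * z ^ 3 + 1272 * z ^ 4 + 128 * z ^ 5"
    "0 \<le> 3104 + 1628 * z + 440 * z ^ 2 + 5728 * z ^ 3 + 3032 * z ^ 4 + 432 * z ^ 5"
    "0 \<le> 3392 + 3084 * z + 1612 * z ^ 2 + 6760 * z ^ 3 + 4200 * z ^ 4 + 752 * z ^ 5"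
    "0 \<le> 1700 + 1720 * z + 940 * z ^ 2 + 4080 * z ^ 3 + 2984 * z ^ 4 + 640 * z ^ 5"
    "0 < 252 + 44 * z - 248 * z ^ 2 + 696 * z ^ 3 + 736 * z ^ 4 + 192 * z ^ 5"
proof -
  have "0 \<le> z * (z - 1)\<^sup>2" "0 \<le> z * (12 * z - 1)\<^sup>2" using z by auto
  then have 1: "0 \<le> z ^ 3 - 2 * z ^ 2 + z" "0 \<le> 144 * z ^ 3 - 24 * z ^ 2 + z"
    by (simp_all add: power2_eq_square power3_eq_cube algebra_simps)
  have "0 \<le> (z - 1)\<^sup>2" "0 \<le> (2 * z - 1)\<^sup>2" "0 \<le> (8 * z - 5)\<^sup>2" "0 \<le> (3 * z - 2)\<^sup>2" by simp_all
  then have 2: "0 \<le> z ^ 2 - 2 * z + 1" "0 \<le> 4 * z ^ 2 - 4 * z + 1" "0 \<le> 64 * z ^ 2 - 80 * z + 25" "0 \<le> 9 * z ^ 2 - 12 * z + 4"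
    by (simp_all add: power2_eq_square algebra_simps)
  have p: "0 \<le> z ^ 2" "0 \<le> z ^ 3" "0 \<le> z ^ 4" "0 \<le> z ^ 5" using z by simp_all
  show "0 \<le> 24 * z ^ 2 + 24 * z ^ 3"
    using z 1 2 p by linarith
  show "0 \<le> 24 - 72 * z + 116 * z ^ 2 + 256 * z ^ 3 + 32 * z ^ 4"
    using z 1 2 p by linarith
  show "0 \<le> 316 - 332 * z + 84 * z ^ 2 + 1152 * z ^ 3 + 304 * z ^ 4 + 16 * z ^ 5"
    using z 1 2 p by linarith
  show "0 \<le> 1436 - 120 * z - 152 * z ^ 2 + 3112 * z ^ 3 + 1272 * z ^ 4 + 128 * z ^ 5"
    using z 1 2 p by linarith
  show "0 \<le> 3104 + 1628 * z + 440 * z ^ 2 + 5728 * z ^ 3 + 3032 * z ^ 4 + 432 * z ^ 5"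
    using z 1 2 p by linarith
  show "0 \<le> 3392 + 3084 * z + 1612 * z ^ 2 + 6760 * z ^ 3 + 4200 * z ^ 4 + 752 * z ^ 5"
    using z 1 2 p by linarith
  show "0 \<le> 1700 + 1720 * z + 940 * z ^ 2 + 4080 * z ^ 3 + 2984 * z ^ 4 + 640 * z ^ 5"
    using z 1 2 p by linarith
  show "0 < 252 + 44 * z - 248 * z ^ 2 + 696 * z ^ 3 + 736 * z ^ 4 + 192 * z ^ 5"
    using z 1 2 p by linarith
qed

lemma polynomial_identity:
  fixes a z :: real
  shows "2 * ((1 + a) * (1 + z) - a) * ((1 + z) * a * ((2 * (1 + z) - 1) * (1 + a)\<^sup>2 + 1) * (2 * a * (1 + z) + 3) * ((2 * a * (1 + z))\<^sup>2 + 4 * (2 * a * (1 + z)) + 2 + 4 * a)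
      + z * (1 + a)\<^sup>2 * (2 * (1 + z) * (1 + a) - a) * ((2 * a * (1 + z))\<^sup>2 + 4 * (2 * a * (1 + z)) + 6))
    - (z * (1 + a)\<^sup>2 * (2 * (1 + z) * (1 + a) - a) + a\<^sup>2 * (1 + z) * (1 + a)) * ((2 * a * (1 + z))\<^sup>2 + 4 * (2 * a * (1 + z)) + 6) * ((2 * a * (1 + z))\<^sup>2 + 4 * (2 * a * (1 + z)) + 2 + 4 * a)
    = (1 - a) ^ 7 * (24 * z ^ 2 + 24 * z ^ 3) + a ^ 1 * (1 - a) ^ 6 * (24 - 72 * z + 116 * z ^ 2 + 256 * z ^ 3 + 32 * z ^ 4) + a ^ 2 * (1 - a) ^ 5 * (316 - 332 * z + 84 * z ^ 2 + 1152 * z ^ 3 + 304 * z ^ 4 + 16 * z ^ 5) + a ^ 3 * (1 - a) ^ 4 * (1436 - 120 * z - 152 * z ^ 2 + 3112 * z ^ 3 + 1272 * z ^ 4 + 128 * z ^ 5) + a ^ 4 * (1 - a) ^ 3 * (3104 + 1628 * z + 440 * z ^ 2 + 5728 * z ^ 3 + 3032 * z ^ 4 + 432 * z ^ 5) + a ^ 5 * (1 - a) ^ 2 * (3392 + 3084 * z + 1612 * z ^ 2 + 6760 * z ^ 3 + 4200 * z ^ 4 + 752 * z ^ 5) + a ^ 6 * (1 - a) ^ 1 * (1700 + 1720 * z + 940 * z ^ 2 + 4080 * z ^ 3 + 2984 * z ^ 4 + 640 * z ^ 5) + a ^ 7 * (252 + 44 * z - 248 * z ^ 2 + 696 * z ^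 3 + 736 * z ^ 4 + 192 * z ^ 5)"
  by algebra

text \<open>\<open>final_inequality\<close> with all denominators cleared.\<close>
lemma final_polynomial_less:
  fixes a z :: real
  assumes a: "0 < a" "a \<le> 1" and z: "z \<ge> 0"
  defines "\<beta> \<equiv> 1 + z" and "p \<equiv> 1 + a"
  defines "\<tau> \<equiv> 2 * a * \<beta>" and "K \<equiv> 2 * \<beta> * p - a"
  defines "D1 \<equiv> \<tau>\<^sup>2 + 4 * \<tau> + 6" and "D2 \<equiv> \<tau>\<^sup>2 + 4 * \<tau> + 2 + 4 * a"
  shows "(z * p\<^sup>2 * K + a\<^sup>2 * \<beta> * p) * D1 * D2 < 2 * (p * \<beta> - a) * (\<beta> * a * ((2 * \<beta> - 1) * p\<^sup>2 + 1) * (\<tau> + 3) * D2 + z * p\<^sup>2 * K * D1)"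
proof -
  note rows = bernstein_rows_nonneg[OF z]
  have a1: "0 \<le> 1 - a" "0 \<le> a" using a by auto
  have t0: "0 \<le> (1 - a) ^ 7 * (24 * z ^ 2 + 24 * z ^ 3)"
    using a by (intro mult_nonneg_nonneg rows zero_le_power zero_less_power a1)
  have t1: "0 \<le> a ^ 1 * (1 - a) ^ 6 * (24 - 72 * z + 116 * z ^ 2 + 256 * z ^ 3 + 32 * z ^ 4)"
    using a by (intro mult_nonneg_nonneg rows zero_le_power zero_less_power a1)
  have t2: "0 \<le> a ^ 2 * (1 - a) ^ 5 * (316 - 332 * z + 84 * z ^ 2 + 1152 * z ^ 3 + 304 * z ^ 4 + 16 * z ^ 5)"
    using a by (intro mult_nonneg_nonneg rows zero_le_power zero_less_power a1)
  have t3: "0 \<le> a ^ 3 * (1 - a) ^ 4 * (1436 - 120 * z - 152 * z ^ 2 + 3112 * z ^ 3 + 1272 * z ^ 4 + 128 * z ^ 5)"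
    using a by (intro mult_nonneg_nonneg rows zero_le_power zero_less_power a1)
  have t4: "0 \<le> a ^ 4 * (1 - a) ^ 3 * (3104 + 1628 * z + 440 * z ^ 2 + 5728 * z ^ 3 + 3032 * z ^ 4 + 432 * z ^ 5)"
    using a by (intro mult_nonneg_nonneg rows zero_le_power zero_less_power a1)
  have t5: "0 \<le> a ^ 5 * (1 - a) ^ 2 * (3392 + 3084 * z + 1612 * z ^ 2 + 6760 * z ^ 3 + 4200 * z ^ 4 + 752 * z ^ 5)"
    using a by (intro mult_nonneg_nonneg rows zero_le_power zero_less_power a1)
  have t6: "0 \<le> a ^ 6 * (1 - a) ^ 1 * (1700 + 1720 * z + 940 * z ^ 2 + 4080 * z ^ 3 + 2984 * z ^ 4 + 640 * z ^ 5)"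
    using a by (intro mult_nonneg_nonneg rows zero_le_power zero_less_power a1)
  have t7: "0 < a ^ 7 * (252 + 44 * z - 248 * z ^ 2 + 696 * z ^ 3 + 736 * z ^ 4 + 192 * z ^ 5)"
    using a by (intro mult_pos_pos rows zero_le_power zero_less_power a1)
  have "0 < (1 - a) ^ 7 * (24 * z ^ 2 + 24 * z ^ 3) + a ^ 1 * (1 - a) ^ 6 * (24 - 72 * z + 116 * z ^ 2 + 256 * z ^ 3 + 32 * z ^ 4) + a ^ 2 * (1 - a) ^ 5 * (316 - 332 * z + 84 * z ^ 2 + 1152 * z ^ 3 + 304 * z ^ 4 + 16 * z ^ 5) + a ^ 3 * (1 - a) ^ 4 * (1436 - 120 * z - 152 * z ^ 2 + 3112 * z ^ 3 + 1272 * z ^ 4 + 128 * z ^ 5) + a ^ 4 * (1 - a) ^ 3 * (3104 + 1628 * z + 440 * z ^ 2 + 5728 * z ^ 3 + 3032 * z ^ 4 + 432 * z ^ 5) + a ^ 5 * (1 - a) ^ 2 * (3392 + 3084 * z + 1612 * z ^ 2 + 6760 * z ^ 3 + 4200 * z ^ 4 + 752 * z ^ 5) + a ^ 6 * (1 - a) ^ 1 * (1700 + 1720 * z + 940 * z ^ 2 + 4080 * z ^ 3 + 2984 * z ^ 4 + 640 * z ^ 5) + a ^ 7 * (252 + 44 * z - 248 * z ^ 2 + 696 * z ^ 3 + 736 * z ^ 4 + 192 * z ^ 5)"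
    by (intro add_nonneg_pos[OF _ t7] add_nonneg_nonneg t0 t1 t2 t3 t4 t5 t6)
  then show ?thesis
    unfolding polynomial_identity[symmetric] \<beta>_def p_def \<tau>_def K_def D1_def D2_def by (simp only: diff_gt_0_iff_gt)
qed

text \<open>This decides that the supersolution of \<open>growth_lower_bound\<close> ends below \<open>1\<close>:
  \<open>b \<eta> - b / \<beta>\<close> is what it gains over the line of slope one up to \<open>u0 = b /
  \<beta>\<close>, and the right-hand side is what it loses afterwards.\<close>
lemma final_inequality:
  fixes a z \<eta> F1 F2 :: real
  assumes a: "0 < a" "a \<le> 1" and z: "z \<ge> 0"
  defines "\<beta> \<equiv> 1 + z" and "b \<equiv> a / (1 + a)"
  defines "\<tau> \<equiv> 2 * a * \<beta>"
  assumes \<eta>: "\<eta> \<le> 1 + b\<^sup>2 / (2 * \<beta> - b)"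
    and F1: "(\<tau> + 3) / (\<tau>\<^sup>2 + 4 * \<tau> + 6) \<le> F1" and F2: "1 / (\<tau>\<^sup>2 + 4 * \<tau> + 2 + 4 * a) \<le> F2"
  shows "b * \<eta> - b / \<beta> < (1 - b / \<beta>) * (2 * (a * ((\<beta> - (1 - b) * \<beta> * \<eta>) * F1 + z * F2)))"
    and "0 \<le> \<beta> - (1 - b) * \<beta> * \<eta>"
proof -
  define p where "p = 1 + a"
  define K where "K = 2 * \<beta> * p - a"
  define D1 where "D1 = \<tau>\<^sup>2 + 4 * \<tau> + 6"
  define D2 where "D2 = \<tau>\<^sup>2 + 4 * \<tau> + 2 + 4 * a"
  have be: "\<beta> \<ge> 1" and p: "p > 0" using a z by (auto simp: \<beta>_def p_def)
  have K: "K > 0"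
  proof -
    have "2 * 1 * 1 \<le> 2 * \<beta> * p" using be a by (intro mult_mono) (auto simp: p_def)
    then show ?thesis using a by (simp add: K_def)
  qed
  have t: "\<tau> > 0" using a be by (simp add: \<tau>_def)
  have D: "D1 > 0" "D2 > 0" using t a by (auto simp: D1_def D2_def add_pos_pos)
  have b1: "1 - b = 1 / p" and b: "b = a / p" using a by (auto simp: b_def p_def field_simps)
  have pK: "p * K - a = (2 * \<beta> - 1) * p\<^sup>2 + 1" by (simp add: K_def p_def power2_eq_square algebra_simps)
  have "2 * \<beta> - b = K / p" using p by (simp add: b K_def field_simps)
  then have "b\<^sup>2 / (2 * \<beta> - b) = a\<^sup>2 / (p * K)" using p K by (simp add: b power2_eq_square)
  then have et: "\<eta> \<le> 1 + a\<^sup>2 / (p * K)" using \<eta> by simp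
  define Y where "Y = \<beta> * a * ((2 * \<beta> - 1) * p\<^sup>2 + 1) / (p\<^sup>2 * K)"
  have Y0: "Y \<ge> 0" unfolding Y_def using be a p K by (intro divide_nonneg_pos mult_nonneg_nonneg add_nonneg_nonneg) auto
  have Y: "Y \<le> \<beta> - (1 - b) * \<beta> * \<eta>"
  proof -
    have "\<beta> - (1 - b) * \<beta> * (1 + a\<^sup>2 / (p * K)) = \<beta> * (p * K * (p - 1) - a\<^sup>2) / (p\<^sup>2 * K)"
      unfolding b1 using p K by (simp add: field_simps power2_eq_square)
    also have "p * K * (p - 1) - a\<^sup>2 = a * (p * K - a)" by (simp add: p_def algebra_simps power2_eq_square)
    finally have e: "\<beta> - (1 - b) * \<beta> * (1 + a\<^sup>2 / (p * K)) = Y" unfolding pK by (simp add: Y_def mult.assoc)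
    have "(1 - b) * \<beta> * \<eta> \<le> (1 - b) * \<beta> * (1 + a\<^sup>2 / (p * K))" using et b1 p be by (intro mult_left_mono) auto
    then show ?thesis using e by linarith
  qed
  show "0 \<le> \<beta> - (1 - b) * \<beta> * \<eta>" using Y Y0 by linarith
  define Q where "Q = p ^ 3 * K * \<beta> * D1 * D2"
  have Q: "Q > 0" using p K be D by (simp add: Q_def)
  have bb: "0 \<le> 1 - b / \<beta>"
  proof -
    have "b < 1" using b1 p by (simp add: field_simps) (use a in \<open>simp add: p_def b_def\<close>)
    then show ?thesis using be by (simp add: pos_divide_le_eq)
  qed
  have "b * \<eta> - b / \<beta> \<le> b * (1 + a\<^sup>2 / (p * K)) - b / \<beta>" using et b a p by (intro diff_right_mono mult_left_mono) auto
  also have "... = a * ((z * p\<^sup>2 * K + a\<^sup>2 * \<beta> * p) * D1 * D2) / Q"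
  proof -
    have z': "z = \<beta> - 1" by (simp add: \<beta>_def)
    have b0: "\<beta> \<noteq> 0" "p \<noteq> 0" "K \<noteq> 0" "D1 \<noteq> 0" "D2 \<noteq> 0" using be p K D by auto
    show ?thesis unfolding z' b Q_def using b0 by (simp add: divide_simps) (simp add: power2_eq_square power3_eq_cube algebra_simps)
  qed
  also have "... < a * (2 * (p * \<beta> - a) * (\<beta> * a * ((2 * \<beta> - 1) * p\<^sup>2 + 1) * (\<tau> + 3) * D2 + z * p\<^sup>2 * K * D1)) / Q"
    using final_polynomial_less[OF a z] a Q unfolding \<beta>_def[symmetric] p_def[symmetric] \<tau>_def[symmetric] K_def[symmetric] D1_def[symmetric] D2_def[symmetric]
    by (intro divide_strict_right_mono mult_strict_left_mono) auto
  also have "... = (1 - b / \<beta>) * (2 * (a * (Y * ((\<tau> + 3) / D1) + z * (1 / D2))))"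
  proof -
    have b0: "\<beta> \<noteq> 0" "p \<noteq> 0" "K \<noteq> 0" "D1 \<noteq> 0" "D2 \<noteq> 0" using be p K D by auto
    define G where "G = (2 * \<beta> - 1) * p\<^sup>2 + 1"
    show ?thesis unfolding Y_def b Q_def G_def[symmetric] using b0
      by (simp add: divide_simps) (simp add: power2_eq_square power3_eq_cube algebra_simps)
  qed
  also have "... \<le> (1 - b / \<beta>) * (2 * (a * ((\<beta> - (1 - b) * \<beta> * \<eta>) * F1 + z * F2)))"
    using a z bb Y Y0 F1 F2 t D
    by (intro mult_left_mono add_mono mult_mono) (auto simp: D1_def D2_def)
  finally show "b * \<eta> - b / \<beta> < (1 - b / \<beta>) * (2 * (a * ((\<beta> - (1 - b) * \<beta> * \<eta>) * F1 + z * F2)))" .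
qed

section \<open>Exponential integrals\<close>

text \<open>A Pade approximation of the exponential; it makes the estimates of \<open>exp_integral_bounds\<close>
  rational.\<close>
lemma exp_minus_Pade:
  fixes t :: real
  assumes "t \<ge> 0"
  shows "6 - 2 * t \<le> (t\<^sup>2 + 4 * t + 6) * exp (- t)"
proof -
  define h where "h t = (t\<^sup>2 + 4 * t + 6) * exp (- t) - 6 + 2 * t" for t :: real
  have "h 0 \<le> h t"
  proof (rule DERIV_nonneg_imp_nondecreasing[OF assms])
    fix x :: real assume x: "0 \<le> x" "x \<le> t"
    have "(h has_real_derivative 2 - (2 + 2 * x + x\<^sup>2) * exp (- x)) (at x)"
      unfolding h_def by (auto intro!: derivative_eq_intros simp: algebra_simps)
    moreover have "(2 + 2 * x + x\<^sup>2) * exp (- x) \<le> 2"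
      using exp_lower_Taylor_quadratic[OF x(1)] by (simp add: exp_minus field_simps)
    ultimately show "\<exists>y. (h has_real_derivative y) (at x) \<and> 0 \<le> y" by force
  qed
  then show ?thesis by (simp add: h_def)
qed

text \<open>The right-hand sides are the integrals over \<open>[0, 1]\<close> of \<open>exp (- t x)\<close> times
  \<open>1 - x\<close> and \<open>x - a\<^sup>2 x\<^sup>2\<close>.\<close>
lemma exp_integral_bounds:
  fixes t a :: real
  assumes t: "t > 0" and a: "0 \<le> a" "a \<le> 1"
  shows "(t + 3) / (t\<^sup>2 + 4 * t + 6) \<le> (t - 1 + exp (- t)) / t\<^sup>2"
    and "1 / (t\<^sup>2 + 4 * t + 2 + 4 * a) \<le> (1 - (1 + t) * exp (- t)) / t\<^sup>2 - a\<^sup>2 * ((2 - (2 + 2 * t + t\<^sup>2) * exp (- t)) / t ^ 3)"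
proof -
  define D where "D = t\<^sup>2 + 4 * t + 6"
  define E where "E = t\<^sup>2 + 2 * t + 2"
  have D: "D > 0" and E: "E > 0" using t by (auto simp: D_def E_def add_pos_pos)
  have p: "6 - 2 * t \<le> D * exp (- t)" using exp_minus_Pade[of t] t by (simp add: D_def)
  have "(t + 3) * t\<^sup>2 = (t - 1) * D + (6 - 2 * t)" by (simp add: D_def algebra_simps power2_eq_square)
  also have "... \<le> (t - 1 + exp (- t)) * D" using p by (simp add: algebra_simps)
  finally show "(t + 3) / (t\<^sup>2 + 4 * t + 6) \<le> (t - 1 + exp (- t)) / t\<^sup>2"
    using t D unfolding D_def[symmetric] by (simp add: divide_simps mult.commute)
  have 1: "1 / E \<le> (1 - (1 + t) * exp (- t)) / t\<^sup>2"
  proof -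
    have "E * exp (- t) \<le> 2" using exp_lower_Taylor_quadratic[of t] t by (simp add: E_def exp_minus field_simps)
    then have "(1 + t) * (E * exp (- t)) \<le> (1 + t) * 2" using t by (intro mult_left_mono) auto
    then have "t\<^sup>2 \<le> (1 - (1 + t) * exp (- t)) * E" by (simp add: E_def algebra_simps power2_eq_square)
    then show ?thesis using t E by (simp add: divide_simps mult.commute)
  qed
  have 2: "1 / D \<le> (1 - (1 + t) * exp (- t)) / t\<^sup>2 - (2 - (2 + 2 * t + t\<^sup>2) * exp (- t)) / t ^ 3"
  proof -
    have "(t + 2) * (6 - 2 * t) \<le> (t + 2) * (D * exp (- t))" using t p by (intro mult_left_mono) auto
    moreover have "(t - 2) * D + (t + 2) * (6 - 2 * t) = t ^ 3" by (simp add: D_def algebra_simps power2_eq_square power3_eq_cube)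
    ultimately have "t ^ 3 \<le> (t - 2 + (t + 2) * exp (- t)) * D" by (simp add: algebra_simps)
    then have "1 / D \<le> (t - 2 + (t + 2) * exp (- t)) / t ^ 3" using t D by (simp add: divide_simps mult.commute)
    also have "... = (1 - (1 + t) * exp (- t)) / t\<^sup>2 - (2 - (2 + 2 * t + t\<^sup>2) * exp (- t)) / t ^ 3"
      using t by (simp add: field_simps power2_eq_square power3_eq_cube)
    finally show ?thesis .
  qed
  have a2: "a\<^sup>2 \<le> a" "a\<^sup>2 \<le> 1" using a by (auto simp: power2_eq_square mult_left_le mult_le_one)
  have "1 / (t\<^sup>2 + 4 * t + 2 + 4 * a) \<le> 1 / ((1 - a\<^sup>2) * E + a\<^sup>2 * D)"
  proof (rule divide_left_mono)
    have "(1 - a\<^sup>2) * E + a\<^sup>2 * D = t\<^sup>2 + 2 * t + 2 + a\<^sup>2 * (2 * t + 4)" by (simp add: D_def E_def algebra_simps)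
    moreover have "a\<^sup>2 * (2 * t) \<le> 1 * (2 * t)" using a2 t by (intro mult_right_mono) auto
    ultimately show "(1 - a\<^sup>2) * E + a\<^sup>2 * D \<le> t\<^sup>2 + 4 * t + 2 + 4 * a" using a2 by (simp add: algebra_simps)
    have "0 < (1 - a\<^sup>2) * E + a\<^sup>2 * D"
    proof (cases "a = 0")
      case False
      then have "0 < a\<^sup>2 * D" using D by simp
      moreover have "0 \<le> (1 - a\<^sup>2) * E" using a2 E by simp
      ultimately show ?thesis by linarith
    qed (use E in simp)
    then show "0 < (t\<^sup>2 + 4 * t + 2 + 4 * a) * ((1 - a\<^sup>2) * E + a\<^sup>2 * D)"
      using t a by (intro mult_pos_pos) (auto intro!: add_pos_nonneg)
  qed simp
  also have "... \<le> (1 - a\<^sup>2) * (1 / E) + a\<^sup>2 * (1 / D)"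
  proof -
    \<comment> \<open>convexity of the reciprocal\<close>
    define l where "l = a\<^sup>2"
    have l: "0 \<le> l" "l \<le> 1" using a2 by (auto simp: l_def)
    have pos: "0 < (1 - l) * E + l * D"
    proof (cases "l = 0")
      case False
      then have "0 < l * D" using D l by simp
      moreover have "0 \<le> (1 - l) * E" using l E by simp
      ultimately show ?thesis by linarith
    qed (use E in simp)
    have "0 \<le> l * (1 - l) * (D - E)\<^sup>2" using l by simp
    then have "D * E \<le> ((1 - l) * D + l * E) * ((1 - l) * E + l * D)"
      by (simp add: algebra_simps power2_eq_square)
    then have "1 \<le> (((1 - l) * D + l * E) / (D * E)) * ((1 - l) * E + l * D)"
      using D E by (simp add: divide_simps)
    then have "1 / ((1 - l) * E + l * D) \<le> ((1 - l) * D + l * E) / (D * E)" using pos by (simp add: pos_divide_le_eq)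
    also have "... = (1 - l) * (1 / E) + l * (1 / D)" using D E by (simp add: field_simps)
    finally show ?thesis by (simp add: l_def)
  qed
  also have "... \<le> (1 - a\<^sup>2) * ((1 - (1 + t) * exp (- t)) / t\<^sup>2)
      + a\<^sup>2 * ((1 - (1 + t) * exp (- t)) / t\<^sup>2 - (2 - (2 + 2 * t + t\<^sup>2) * exp (- t)) / t ^ 3)"
    using a2 by (intro add_mono mult_left_mono 1 2) auto
  also have "... = (1 - (1 + t) * exp (- t)) / t\<^sup>2 - a\<^sup>2 * ((2 - (2 + 2 * t + t\<^sup>2) * exp (- t)) / t ^ 3)"
  proof -
    have "(1 - l) * A + l * (A - B) = A - l * B" for l A B :: real by (simp add: algebra_simps)
    then show ?thesis .
  qed
  finally show "1 / (t\<^sup>2 + 4 * t + 2 + 4 * a) \<le> (1 - (1 + t) * exp (- t)) / t\<^sup>2 - a\<^sup>2 * ((2 - (2 + 2 * t + t\<^sup>2) * exp (- t)) / t ^ 3)" .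
qed

section \<open>Comparison with a differential inequality\<close>

text \<open>\<open>P u \<ge> u U u\<close> since \<open>U\<close> is nonincreasing, so the derivative \<open>k
  P\<^sup>k\<^sup>-\<^sup>1 P'\<close> of \<open>P\<^sup>k\<close> dominates \<open>k
  u\<^sup>k\<^sup>-\<^sup>1 U\<^sup>k\<close>.\<close>
lemma supersolution_ge_1:
  assumes f: "f \<in> Hspace k" and b: "AE x in gauss. \<bar>f x\<bar> \<le> 1" and k: "k > 0" and w: "W k f > 0"
    and Pc: "continuous_on {0..1} P" and P0: "0 \<le> P 0" and S: "finite S"
    and Pd: "\<And>u. 0 < u ==> u < 1 ==> u \<notin> S ==> (P has_real_derivative P' u) (at u)"
    and Pu: "\<And>u. 0 < u ==> u < 1 ==> u \<notin> S ==> (phi k f f (1 - u) / W k f) powr (1 / real k) \<le> P' u"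
  shows "1 \<le> P 1"
proof -
  define w where "w = W k f"
  have w: "w > 0" using w by (simp add: w_def)
  define U where "U u = (phi k f f (1 - u) / w) powr (1 / real k)" for u
  have U0: "0 \<le> U u" for u by (simp add: U_def)
  have Uk: "w * U u ^ k = phi k f f (1 - u)" if "0 < u" "u < 1" for u
  proof -
    have x: "phi k f f (1 - u) / w \<ge> 0" using phi_nonneg[OF f, of "1 - u"] that w by simp
    have "U u ^ k = phi k f f (1 - u) / w"
    proof (cases "phi k f f (1 - u) / w = 0")
      case False
      then have "phi k f f (1 - u) / w > 0" using x by linarith
      then have "U u > 0" using False unfolding U_def by (subst powr_gt_zero) simp
      then have "U u ^ k = U u powr real k" by (simp add: powr_realpow)
      also have "... = (phi k f f (1 - u) / w) powr (1 / real k * real k)" unfolding U_def by (rule powr_powr)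
      also have "1 / real k * real k = 1" using k by simp
      finally have "U u ^ k = (phi k f f (1 - u) / w) powr 1" .
      also have "... = phi k f f (1 - u) / w" by (rule powr_one[OF x])
      finally show ?thesis .
    next
      case True
      show ?thesis unfolding U_def True using k by simp
    qed
    then show ?thesis using w by simp
  qed
  have Um: "U v \<le> U u" if "0 < u" "u \<le> v" "v < 1" for u v
    unfolding U_def using that w k phi_nonneg[OF f, of "1 - v"] phi_mono[OF f, of "1 - v" "1 - u"]
    by (intro powr_mono2 divide_right_mono divide_nonneg_pos) auto
  have PU: "U u \<le> P' u" if "0 < u" "u < 1" "u \<notin> S" for u
    using Pu[OF that] by (simp add: U_def w_def)
  have ge: "c * u \<le> P u" if u: "0 < u" "u \<le> 1" and c: "\<And>v. 0 < v ==> v < u ==> c \<le> U v" for u c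
  proof -
    define q where "q v = (if v \<in> S \<or> v \<le> 0 \<or> u \<le> v then 0 else P' v - c)" for v
    have "(q has_integral (P u - c * u) - (P 0 - c * 0)) {0..u}"
    proof (rule fundamental_theorem_of_calculus_interior_strong[OF S])
      show "0 \<le> u" using u by simp
      show "continuous_on {0..u} (\<lambda>v. P v - c * v)"
        using u by (intro continuous_intros continuous_on_subset[OF Pc]) auto
      fix v assume v: "v \<in> {0<..<u} - S"
      then have "((\<lambda>v. P v - c * v) has_real_derivative P' v - c * 1) (at v)"
        using u by (intro DERIV_diff Pd DERIV_cmult DERIV_ident) auto
      then show "((\<lambda>v. P v - c * v) has_vector_derivative q v) (at v)"
        using v by (simp add: q_def has_real_derivative_iff_has_vector_derivative)
    qed
    moreover have "0 \<le> q v" if "v \<in> {0..u}" for v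
      using PU[of v] c[of v] u by (auto simp: q_def)
    ultimately have "0 \<le> (P u - c * u) - (P 0 - c * 0)" by (rule has_integral_nonneg)
    then show ?thesis using P0 by simp
  qed
  have Pnn: "0 \<le> P u" if "0 \<le> u" "u \<le> 1" for u
    using ge[of u 0] U0 P0 that by (cases "u = 0") auto
  have "W k f \<le> w * P (1 - 0) ^ k"
  proof (rule W_le_supersolution[OF f b k, where S="(\<lambda>s. 1 - s) ` S" and Q="\<lambda>r. w * P (1 - r) ^ k"])
    show "finite ((\<lambda>s. 1 - s) ` S)" using S by simp
    show "continuous_on {0..1} (\<lambda>r. w * P (1 - r) ^ k)"
      by (intro continuous_intros continuous_on_compose2[OF Pc]) auto
    show "0 \<le> w * P (1 - r) ^ k" if "0 \<le> r" "r \<le> 1" for r using Pnn[of "1 - r"] that w by simp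
    fix r :: real assume r: "0 < r" "r < 1" "r \<notin> (\<lambda>s. 1 - s) ` S"
    have u: "0 < 1 - r" "1 - r < 1" "1 - r \<notin> S" using r by (auto simp: image_iff)
    have "((\<lambda>r. 1 - r) has_real_derivative - 1) (at r)" by (auto intro!: derivative_eq_intros)
    from DERIV_chain2[OF Pd[OF u] this]
    have dP: "((\<lambda>r. P (1 - r)) has_real_derivative P' (1 - r) * - 1) (at r)" .
    show "((\<lambda>r. w * P (1 - r) ^ k) has_real_derivative - (w * (real k * (P (1 - r) ^ (k - 1) * P' (1 - r))))) (at r)"
      using DERIV_cmult[OF DERIV_power[OF dP, of k], of w] by (simp add: mult_ac)
    have 1: "((1 - r) * U (1 - r)) ^ (k - 1) \<le> P (1 - r) ^ (k - 1)"
      using ge[of "1 - r" "U (1 - r)"] Um u U0 by (intro power_mono) (auto simp: mult.commute)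
    have "real k * (1 - r) ^ (k - 1) * phi k f f r = real k * (1 - r) ^ (k - 1) * (w * U (1 - r) ^ k)"
      using Uk[OF u(1,2)] by simp
    also have "U (1 - r) ^ k = U (1 - r) ^ (k - 1) * U (1 - r)" using k by (cases k) auto
    also have "real k * (1 - r) ^ (k - 1) * (w * (U (1 - r) ^ (k - 1) * U (1 - r))) = w * (real k * (((1 - r) * U (1 - r)) ^ (k - 1) * U (1 - r)))"
      by (simp add: power_mult_distrib mult_ac)
    also have "... \<le> w * (real k * (P (1 - r) ^ (k - 1) * P' (1 - r)))"
      using w 1 PU[OF u] U0 Pnn[of "1 - r"] u by (intro mult_left_mono mult_mono) auto
    finally show "real k * (1 - r) ^ (k - 1) * phi k f f r \<le> - (- (w * (real k * (P (1 - r) ^ (k - 1) * P' (1 - r)))))" by simp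
  qed
  then have "1 \<le> P 1 ^ k" using w by (simp add: w_def)
  then show ?thesis using Pnn[of 1] k by (meson linorder_not_le order_refl power_less_one_iff zero_le_one less_imp_le not_gr0)
qed

text \<open>\<open>U1\<close> is the interpolation bound at correlation \<open>1 - u\<close>, \<open>U2\<close> is
  hypercontractivity from correlation \<open>1 - u0\<close>, and \<open>\<zeta>\<close> measures how small
  \<open>W\<close> is. For negative \<open>\<zeta>\<close> integrating \<open>U1\<close> suffices. Otherwise
  the supersolution follows \<open>U1\<close> up to a point \<open>u0\<close>, then \<open>U2\<close> until
  \<open>\<alpha>\<close> reaches its largest admissible value \<open>a\<close>, and then the monotonicity
  of \<open>U\<close>.\<close>
lemma growth_lower_bound:
  fixes U :: "real => real" and a b A \<zeta> :: real
  assumes a: "0 < a" "a \<le> 1" and b: "b = a / (1 + a)" and A: "A > 0"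
    and U1: "\<And>u. 0 < u ==> u < 1 ==> U u \<le> A * (u * (2 - u)) powr - b"
    and U2: "\<And>u0 \<alpha>. 0 < u0 ==> u0 < 1 ==> 0 < \<alpha> ==> \<alpha> < 1 ==> \<alpha> \<le> a ==>
      U (1 - (1 - u0) * ((1 - \<alpha>) / (1 + \<alpha>))) \<le> (A * (u0 * (2 - u0)) powr - b) powr (1 - \<alpha> / a) * exp (- 2 * \<alpha> * \<zeta>)"
    and U_mono: "\<And>u v. 0 < u ==> u \<le> v ==> v < 1 ==> U v \<le> U u"
    and cmp: "\<And>P P' S. continuous_on {0..1} P ==> 0 \<le> P 0 ==> finite S
      ==> (\<And>u. 0 < u ==> u < 1 ==> u \<notin> S ==> (P has_real_derivative P' u) (at u))
      ==> (\<And>u. 0 < u ==> u < 1 ==> u \<notin> S ==> U u \<le> P' u) ==> 1 \<le> P (1::real)"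
  shows "(1 - b) * (2 * b) powr b * (1 + max 0 \<zeta>) powr (1 - b) \<le> A"
proof -
  have b01: "0 < b" "b < 1" "2 * b \<le> 1" using a by (auto simp: b field_simps)
  show ?thesis
  proof (cases "\<zeta> \<ge> 0")
    case False
    have "1 \<le> A / (1 - b) * 1 powr (1 - b)"
    proof (rule cmp[where P="\<lambda>u. A / (1 - b) * u powr (1 - b)" and P'="\<lambda>u. A * u powr - b" and S="{}"])
      show "continuous_on {0..1} (\<lambda>u. A / (1 - b) * u powr (1 - b))"
        using b01 by (intro continuous_intros continuous_on_powr') auto
      fix u :: real assume u: "0 < u" "u < 1"
      have "((\<lambda>u. A / (1 - b) * u powr (1 - b)) has_real_derivative A / (1 - b) * ((1 - b) * u powr (1 - b - 1))) (at u)"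
        by (intro DERIV_cmult has_real_derivative_powr u)
      then show "((\<lambda>u. A / (1 - b) * u powr (1 - b)) has_real_derivative A * u powr - b) (at u)"
        using b01 by simp
      have "(u * (2 - u)) powr - b \<le> u powr - b" using u b01 by (intro powr_mono2') auto
      then show "U u \<le> A * u powr - b" using U1[OF u] A by (meson less_imp_le mult_left_mono order_trans)
    qed auto
    then have "1 - b \<le> A" using b01 by (simp add: pos_le_divide_eq)
    moreover have "(2 * b) powr b \<le> 1" using b01 by (simp add: powr_le1)
    then have "(1 - b) * (2 * b) powr b \<le> (1 - b) * 1" using b01 by (intro mult_left_mono) auto
    ultimately show ?thesis using False by simp
  next
    case True
    define \<beta> where "\<beta> = 1 + \<zeta>"
    have be: "\<beta> \<ge> 1" using True by (simp add: \<beta>_def)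
    define A0 where "A0 = (1 - b) * (2 * b) powr b * \<beta> powr (1 - b)"
    have A00: "A0 > 0" using b01 be by (simp add: A0_def)
    have "A0 \<le> A"
    proof (rule ccontr)
      assume "\<not> A0 \<le> A"
      then have AA: "A \<le> A0" by simp
      \<comment> \<open>at this point the bound \<open>U1\<close> is \<open>(1 - b) \<beta>\<close>, up to the factor \<open>\<eta>\<close>, which is close to \<open>1\<close>\<close>
      define u0 where "u0 = b / \<beta>"
      have u0: "0 < u0" "u0 < 1" "2 * u0 \<le> 1"
      proof -
        show "0 < u0" using b01 be by (simp add: u0_def)
        have "b / \<beta> \<le> b / 1" using b01 be by (intro divide_left_mono) auto
        then show "u0 < 1" "2 * u0 \<le> 1" using b01 by (auto simp: u0_def)
      qed
      define \<eta> where "\<eta> = (1 - u0 / 2) powr - b"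
      define X where "X = (1 - b) * \<beta> * \<eta>"
      define \<mu> where "\<mu> = 2 * \<beta>"
      define J0 where "J0 s = (1 - exp (- (\<mu> * s))) / \<mu>" for s
      define J1 where "J1 s = (1 - (1 + \<mu> * s) * exp (- (\<mu> * s))) / \<mu>\<^sup>2" for s
      define J2 where "J2 s = (2 - (2 + 2 * (\<mu> * s) + (\<mu> * s)\<^sup>2) * exp (- (\<mu> * s))) / \<mu> ^ 3" for s
      define Xi where "Xi s = (\<beta> - X) * (J0 s - J1 s / a) + \<zeta> * (J1 s / a - J2 s)" for s
      have mu: "\<mu> > 0" using be by (simp add: \<mu>_def)
      have etap: "\<eta> > 0" using u0 by (simp add: \<eta>_def)
      have X0: "X > 0" using b01 be etap by (simp add: X_def)
      have A0X: "A0 * (u0 * (2 - u0)) powr - b = X"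
      proof -
        have "u0 * (2 - u0) = (2 * b) * (1 - u0 / 2) / \<beta>" using be by (simp add: u0_def field_simps)
        then have "(u0 * (2 - u0)) powr - b = ((2 * b) powr - b * \<eta>) / \<beta> powr - b"
          using b01 be u0 by (simp add: powr_mult powr_divide \<eta>_def)
        also have "... = \<eta> * \<beta> powr b / (2 * b) powr b" using be b01 by (simp add: powr_minus field_simps)
        finally have "A0 * (u0 * (2 - u0)) powr - b = (1 - b) * \<eta> * (\<beta> powr (1 - b) * \<beta> powr b)"
          using b01 by (simp add: A0_def)
        also have "\<beta> powr (1 - b) * \<beta> powr b = \<beta>" using be by (simp add: powr_add[symmetric])
        finally show ?thesis by (simp add: X_def mult_ac)
      qed
      have et: "\<eta> \<le> 1 + b\<^sup>2 / (2 * \<beta> - b)"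
      proof -
        have "\<eta> = (1 / (1 - u0 / 2)) powr b" using u0 by (simp add: \<eta>_def powr_minus_divide powr_divide)
        also have "... \<le> 1 + b * (1 / (1 - u0 / 2) - 1)" using u0 b01 by (intro powr_le_tangent) auto
        also have "1 / (1 - u0 / 2) - 1 = b / (2 * \<beta> - b)"
        proof -
          have "b < 2 * \<beta>" using b01 be by linarith
          then show ?thesis using be by (simp add: u0_def field_simps)
        qed
        finally show ?thesis by (simp add: power2_eq_square)
      qed
      define \<tau> where "\<tau> = 2 * a * \<beta>"
      have ta: "\<tau> > 0" "\<mu> * a = \<tau>" "\<mu> = \<tau> / a" using a be by (auto simp: \<tau>_def \<mu>_def)
      define F1 where "F1 = (\<tau> - 1 + exp (- \<tau>)) / \<tau>\<^sup>2"
      define F2 where "F2 = (1 - (1 + \<tau>) * exp (- \<tau>)) / \<tau>\<^sup>2 - a\<^sup>2 * ((2 - (2 + 2 * \<tau> + \<tau>\<^sup>2) * exp (- \<tau>)) / \<tau> ^ 3)"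
      have Xia: "Xi a = a * ((\<beta> - (1 - b) * \<beta> * \<eta>) * F1 + \<zeta> * F2)"
      proof -
        have 1: "J0 a - J1 a / a = a * F1"
          unfolding J0_def J1_def F1_def ta(2) unfolding ta(3) using a ta(1)
          by (simp add: field_simps power2_eq_square)
        have 2: "J1 a / a - J2 a = a * F2"
          unfolding J2_def J1_def F2_def ta(2) unfolding ta(3) using a ta(1)
          by (simp add: field_simps power2_eq_square power3_eq_cube)
        show ?thesis unfolding Xi_def 1 2 X_def by (simp add: algebra_simps)
      qed
      have bounds: "(\<tau> + 3) / (\<tau>\<^sup>2 + 4 * \<tau> + 6) \<le> F1" "1 / (\<tau>\<^sup>2 + 4 * \<tau> + 2 + 4 * a) \<le> F2"
        unfolding F1_def F2_def using exp_integral_bounds[of \<tau> a] ta(1) a by auto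
      have fin: "b * \<eta> - b / \<beta> < (1 - b / \<beta>) * (2 * Xi a)" and Xb: "0 \<le> \<beta> - X"
        using final_inequality[OF a True, of \<eta> F1 F2] et bounds unfolding Xia X_def
        by (simp_all add: \<beta>_def b \<tau>_def)
      \<comment> \<open>the parameter \<open>\<alpha>\<close> for which \<open>U2\<close> is a bound at \<open>u\<close>\<close>
      define al where "al u = (u - u0) / (2 - u0 - u)" for u
      define Th where "Th s = 1 - (1 - s) / (1 + s) * exp (- 2 * s * \<zeta>) - 2 * Xi s" for s
      define ua where "ua = 1 - (1 - u0) * ((1 - a) / (1 + a))"
      define E where "E = exp (- 2 * a * \<zeta>)"
      define P1 where "P1 u = A0 * (2 - u0) powr - b / (1 - b) * u powr (1 - b)" for u
      define P2 where "P2 u = b * \<eta> + (1 - u0) * Th (al u)" for u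
      define P3 where "P3 u = P2 ua + E * (u - ua)" for u
      define P where "P u = (if u \<le> u0 then P1 u else if u \<le> ua then P2 u else P3 u)" for u
      define B where "B s = (\<beta> - X) * (1 - s / a) + \<zeta> * (s / a - s\<^sup>2)" for s
      define Th' where "Th' s = (2 / (1 + s)\<^sup>2 + 2 * \<zeta> * ((1 - s) / (1 + s))) * exp (- 2 * s * \<zeta>) - 2 * (exp (- (\<mu> * s)) * B s)" for s
      define P' where "P' u = (if u \<le> u0 then A0 * (2 - u0) powr - b * u powr - b else if u \<le> ua then Th' (al u) * (1 + al u)\<^sup>2 / 2 else E)" for u
      have ua: "u0 < ua" "ua \<le> 1"
      proof -
        have "(1 - u0) * ((1 - a) / (1 + a)) < (1 - u0) * 1" using u0 a by (intro mult_strict_left_mono) auto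
        then show "u0 < ua" by (simp add: ua_def)
        show "ua \<le> 1" using u0 a by (simp add: ua_def)
      qed
      have alua: "al ua = a"
      proof -
        have "2 - u0 - ua = (1 - u0) * (2 / (1 + a))" "ua - u0 = (1 - u0) * (2 * a / (1 + a))"
          using a by (auto simp: ua_def field_simps)
        then have "al ua = ((1 - u0) * (2 * a / (1 + a))) / ((1 - u0) * (2 / (1 + a)))" unfolding al_def by (simp only:)
        also have "... = a" using u0 a by (subst mult_divide_mult_cancel_left) auto
        finally show ?thesis .
      qed
      have den: "2 - u0 - u > 0" if "u \<le> 1" for u using that u0 by linarith
      have inv: "1 - (1 - u0) * ((1 - al u) / (1 + al u)) = u" if "u \<le> 1" for u
      proof -
        have e: "1 - al u = (1 - u) * (2 / (2 - u0 - u))" "1 + al u = (1 - u0) * (2 / (2 - u0 - u))"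
          using den[OF that] by (auto simp: al_def field_simps)
        have "(1 - al u) / (1 + al u) = (1 - u) / (1 - u0)"
          unfolding e using den[OF that] by (subst mult_divide_mult_cancel_right) auto
        then show ?thesis using u0 by simp
      qed
      have alp: "1 + al u = 2 * (1 - u0) / (2 - u0 - u)" if "u \<le> 1" for u
        using den[OF that] by (auto simp: al_def field_simps)
      have al_mono: "al u \<le> al v" if "u \<le> v" "v \<le> 1" for u v
      proof -
        have "2 * (1 - u0) / (2 - u0 - u) \<le> 2 * (1 - u0) / (2 - u0 - v)"
          using that den[of u] den[of v] u0 by (intro divide_left_mono mult_pos_pos) auto
        then show ?thesis using alp[of u] alp[of v] that by simp
      qed
      have dJ0: "(J0 has_real_derivative exp (- (\<mu> * s))) (at s)" for s
        unfolding J0_def[abs_def] using mu by (auto intro!: derivative_eq_intros simp: field_simps)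
      have dJ1: "(J1 has_real_derivative s * exp (- (\<mu> * s))) (at s)" for s
        unfolding J1_def[abs_def] using mu by (auto intro!: derivative_eq_intros simp: field_simps power2_eq_square)
      have dJ2: "(J2 has_real_derivative s\<^sup>2 * exp (- (\<mu> * s))) (at s)" for s
        unfolding J2_def[abs_def] using mu by (auto intro!: derivative_eq_intros simp: field_simps power2_eq_square power3_eq_cube)
      have dXi: "(Xi has_real_derivative exp (- (\<mu> * s)) * B s) (at s)" for s
      proof -
        have "(Xi has_real_derivative (\<beta> - X) * (exp (- (\<mu> * s)) - s * exp (- (\<mu> * s)) / a)
          + \<zeta> * (s * exp (- (\<mu> * s)) / a - s\<^sup>2 * exp (- (\<mu> * s)))) (at s)"
          unfolding Xi_def[abs_def] by (intro DERIV_add DERIV_cmult DERIV_diff DERIV_cdivide dJ0 dJ1 dJ2)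
        then show ?thesis by (simp add: B_def algebra_simps)
      qed
      have dTh: "(Th has_real_derivative Th' s) (at s)" if "1 + s > 0" for s
      proof -
        have 1: "((\<lambda>s. (1 - s) / (1 + s)) has_real_derivative - (2 / (1 + s)\<^sup>2)) (at s)"
          using that by (auto intro!: derivative_eq_intros simp: field_simps power2_eq_square)
        have 2: "((\<lambda>s. exp (- 2 * s * \<zeta>)) has_real_derivative - 2 * \<zeta> * exp (- 2 * s * \<zeta>)) (at s)"
          by (auto intro!: derivative_eq_intros)
        have "(Th has_real_derivative 0 - (- (2 / (1 + s)\<^sup>2) * exp (- 2 * s * \<zeta>) + (- 2 * \<zeta> * exp (- 2 * s * \<zeta>)) * ((1 - s) / (1 + s)))
          - 2 * (exp (- (\<mu> * s)) * B s)) (at s)"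
          unfolding Th_def[abs_def] by (intro DERIV_diff DERIV_mult DERIV_cmult DERIV_const dXi 1 2)
        then show ?thesis by (simp add: Th'_def algebra_simps)
      qed
      have dal: "(al has_real_derivative (1 + al u)\<^sup>2 / (2 * (1 - u0))) (at u)" if "u \<le> 1" for u
      proof -
        have "(al has_real_derivative (1 * (2 - u0 - u) - (u - u0) * (- 1)) / ((2 - u0 - u) * (2 - u0 - u))) (at u)"
          unfolding al_def[abs_def] using den[OF that] by (intro DERIV_divide) (auto intro!: derivative_eq_intros)
        moreover have "(1 * (2 - u0 - u) - (u - u0) * (- 1)) / ((2 - u0 - u) * (2 - u0 - u)) = (1 + al u)\<^sup>2 / (2 * (1 - u0))"
        proof -
          have n: "1 * (2 - u0 - u) - (u - u0) * (- 1) = 2 * (1 - u0)" by simp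
          have "(x / y)\<^sup>2 / x = x / (y * y)" if "x \<noteq> 0" for x y :: real using that by (simp add: power2_eq_square)
          from this[of "2 * (1 - u0)" "2 - u0 - u"] show ?thesis unfolding n alp[OF \<open>u \<le> 1\<close>] using u0 by simp
        qed
        ultimately show ?thesis by simp
      qed
      have dP2: "(P2 has_real_derivative Th' (al u) * (1 + al u)\<^sup>2 / 2) (at u)" if "u \<le> 1" for u
      proof -
        have p: "1 + al u > 0" unfolding alp[OF that] using den[OF that] u0 by simp
        have "(P2 has_real_derivative 0 + (1 - u0) * (Th' (al u) * ((1 + al u)\<^sup>2 / (2 * (1 - u0))))) (at u)"
          unfolding P2_def[abs_def] by (intro DERIV_add DERIV_const DERIV_cmult DERIV_chain2[OF dTh[OF p] dal[OF that]])
        moreover have "0 + d * (x * (y / (2 * d))) = x * y / 2" if "d > 0" for d x y :: real using that by simp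
        ultimately show ?thesis using u0(2) by (simp only: diff_gt_0_iff_gt)
      qed
      have P1u0: "P1 u0 = b * \<eta>"
      proof -
        have "P1 u0 = A0 * (2 - u0) powr - b / (1 - b) * (u0 powr - b * u0)"
          using u0 powr_add[of u0 "- b" 1] by (simp add: P1_def)
        also have "... = (A0 * (u0 * (2 - u0)) powr - b) / (1 - b) * u0" using u0 by (simp add: powr_mult)
        also have "... = \<beta> * \<eta> * u0" unfolding A0X using b01 by (simp add: X_def)
        also have "... = b * \<eta>" using be by (simp add: u0_def)
        finally show ?thesis .
      qed
      have P2u0: "P2 u0 = b * \<eta>"
        using mu by (simp add: P2_def al_def Th_def Xi_def J0_def J1_def J2_def)
      have P1c: "continuous_on {0..1} P1"
        unfolding P1_def[abs_def] using b01 by (intro continuous_intros continuous_on_powr') auto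
      have P2c: "continuous_on {0..1} P2"
        by (intro continuous_at_imp_continuous_on ballI DERIV_isCont[OF dP2]) simp
      have P3c: "continuous_on {0..1} P3" unfolding P3_def[abs_def] by (intro continuous_intros)
      have Pc: "continuous_on {0..1} P"
        unfolding P_def[abs_def]
      proof (rule continuous_on_cases_le)
        show "continuous_on {t \<in> {0..1}. t \<le> u0} P1" by (rule continuous_on_subset[OF P1c]) auto
        have "continuous_on {0..1} (\<lambda>u. if u \<le> ua then P2 u else P3 u)"
        proof (rule continuous_on_cases_le)
          show "continuous_on {t \<in> {0..1}. t \<le> ua} P2" by (rule continuous_on_subset[OF P2c]) auto
          show "continuous_on {t \<in> {0..1}. ua \<le> t} P3" by (rule continuous_on_subset[OF P3c]) auto
        qed (auto simp: P3_def intro: continuous_on_id)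
        then show "continuous_on {t \<in> {0..1}. u0 \<le> t} (\<lambda>u. if u \<le> ua then P2 u else P3 u)"
          by (rule continuous_on_subset) auto
      qed (use ua P1u0 P2u0 in \<open>auto intro: continuous_on_id\<close>)
      have mid: "U u \<le> Th' (al u) * (1 + al u)\<^sup>2 / 2" if u: "u0 < u" "u \<le> ua" "u < 1" for u
      proof -
        define s where "s = al u"
        define e where "e = exp (- 2 * s * \<zeta>)"
        have s: "0 < s" "s \<le> a" "s < 1"
        proof -
          show "0 < s" using u den[of u] by (simp add: s_def al_def)
          show "s \<le> a" unfolding s_def alua[symmetric] using u ua by (intro al_mono) auto
          show "s < 1" using u den[of u] by (simp add: s_def al_def)
        qed
        have l: "0 \<le> 1 - s / a" "1 - s / a \<le> 1" using s a by auto
        have Ap: "0 < A * (u0 * (2 - u0)) powr - b" using A u0 by simp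
        have AX: "A * (u0 * (2 - u0)) powr - b \<le> X"
          unfolding A0X[symmetric] using AA by (intro mult_right_mono) auto
        have "U u \<le> (A * (u0 * (2 - u0)) powr - b) powr (1 - s / a) * e"
          using U2[OF u0(1,2) s(1,3,2)] inv[of u] u by (simp add: s_def e_def)
        also have "... \<le> (1 + (1 - s / a) * (X - 1)) * e"
        proof (rule mult_right_mono)
          have "(A * (u0 * (2 - u0)) powr - b) powr (1 - s / a) \<le> X powr (1 - s / a)"
            using Ap AX l by (intro powr_mono2) auto
          also have "... \<le> 1 + (1 - s / a) * (X - 1)" using X0 l by (intro powr_le_tangent) auto
          finally show "(A * (u0 * (2 - u0)) powr - b) powr (1 - s / a) \<le> 1 + (1 - s / a) * (X - 1)" .
        qed (simp add: e_def)
        also have "1 + (1 - s / a) * (X - 1) = 1 + \<zeta> * ((1 - s) * (1 + s)) - B s"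
        proof -
          have "1 + (1 - v) * (X - 1) = 1 + \<zeta> * ((1 - s) * (1 + s)) - ((1 + \<zeta> - X) * (1 - v) + \<zeta> * (v - s\<^sup>2))" for v
            by (simp add: algebra_simps power2_eq_square)
          then show ?thesis unfolding B_def \<beta>_def .
        qed
        also have "(1 + \<zeta> * ((1 - s) * (1 + s)) - B s) * e \<le> (1 + \<zeta> * ((1 - s) * (1 + s))) * e - (1 + s)\<^sup>2 * (exp (- (\<mu> * s)) * B s)"
        proof -
          have B0: "0 \<le> B s"
          proof -
            have "s * s \<le> 1 * s" using s by (intro mult_right_mono) auto
            also have "... \<le> s / a" using s a by (simp add: pos_le_divide_eq)
            finally have "0 \<le> s / a - s\<^sup>2" by (simp add: power2_eq_square)
            then show ?thesis unfolding B_def using Xb l True by simp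
          qed
          have "(1 + s) * exp (- s) \<le> 1" using exp_ge_add_one_self[of s] by (simp add: exp_minus field_simps)
          then have "((1 + s) * exp (- s))\<^sup>2 \<le> 1" using s by (simp add: power_le_one)
          then have "((1 + s) * exp (- s))\<^sup>2 * (e * B s) \<le> 1 * (e * B s)" using B0 by (intro mult_right_mono) (auto simp: e_def)
          moreover have "exp (- (\<mu> * s)) = (exp (- s))\<^sup>2 * e"
            unfolding e_def power2_eq_square exp_add[symmetric] by (simp add: \<mu>_def \<beta>_def algebra_simps)
          ultimately have "(1 + s)\<^sup>2 * (exp (- (\<mu> * s)) * B s) \<le> e * B s" by (simp add: power_mult_distrib mult_ac)
          then show ?thesis by (simp add: algebra_simps)
        qed
        also have "... = Th' s * (1 + s)\<^sup>2 / 2"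
        proof -
          have "(1 + \<zeta> * (t * y)) * e - y\<^sup>2 * x = ((2 / y\<^sup>2 + 2 * \<zeta> * (t / y)) * e - 2 * x) * y\<^sup>2 / 2" if "y \<noteq> 0" for t x y :: real
            using that by (simp add: field_simps power2_eq_square)
          from this[of "1 + s" "1 - s"] show ?thesis using s(1) unfolding Th'_def e_def[symmetric] by simp
        qed
        finally show ?thesis by (simp add: s_def)
      qed
      have "1 \<le> P 1"
      proof (rule cmp[OF Pc, where S="{u0, ua}" and P'=P'])
        show "0 \<le> P 0" using u0 by (simp add: P_def P1_def)
        fix u :: real assume u: "0 < u" "u < 1" "u \<notin> {u0, ua}"
        have "u < u0 \<or> u0 < u \<and> u < ua \<or> ua < u" using u by force
        consider "u < u0" | "u0 < u" "u < ua" | "ua < u" using u by force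
        then show "(P has_real_derivative P' u) (at u)"
        proof cases
          case 1
          have "((\<lambda>u. A0 * (2 - u0) powr - b / (1 - b) * u powr (1 - b)) has_real_derivative
            A0 * (2 - u0) powr - b / (1 - b) * ((1 - b) * u powr (1 - b - 1))) (at u)"
            by (intro DERIV_cmult has_real_derivative_powr u)
          then have "(P1 has_real_derivative P' u) (at u)" using b01 1 by (simp add: P1_def[abs_def] P'_def mult.assoc)
          then show ?thesis by (rule has_field_derivative_transform_within_open[of _ _ _ "{..<u0}"]) (use 1 in \<open>auto simp: P_def\<close>)
        next
          case 2
          then have "(P2 has_real_derivative P' u) (at u)" using dP2[of u] u by (simp add: P'_def)
          then show ?thesis by (rule has_field_derivative_transform_within_open[of _ _ _ "{u0<..<ua}"]) (use 2 in \<open>auto simp: P_def\<close>)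
        next
          case 3
          have "(P3 has_real_derivative 0 + E * (1 - 0)) (at u)"
            unfolding P3_def[abs_def] by (intro DERIV_add DERIV_const DERIV_cmult DERIV_diff DERIV_ident)
          then have "(P3 has_real_derivative P' u) (at u)" using 3 ua by (simp add: P'_def)
          then show ?thesis by (rule has_field_derivative_transform_within_open[of _ _ _ "{ua<..}"]) (use 3 ua in \<open>auto simp: P_def\<close>)
        qed
        from \<open>u < u0 \<or> u0 < u \<and> u < ua \<or> ua < u\<close>
        consider "u < u0" | "u0 < u" "u < ua" | "ua < u" by blast
        then show "U u \<le> P' u"
        proof cases
          case 1
          have "(u * (2 - u)) powr - b \<le> (u * (2 - u0)) powr - b"
            using u 1 u0 b01 by (intro powr_mono2' mult_left_mono) auto
          then have "A * (u * (2 - u)) powr - b \<le> A0 * (u * (2 - u0)) powr - b"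
            using AA A00 A by (intro mult_mono) auto
          then have "U u \<le> A0 * (u * (2 - u0)) powr - b" using U1[OF u(1,2)] by linarith
          then show ?thesis using 1 by (simp add: P'_def powr_mult mult_ac)
        next
          case 2
          then show ?thesis using mid[of u] u by (simp add: P'_def)
        next
          case 3
          have "a \<noteq> 1"
          proof
            assume "a = 1"
            then have "ua = 1" by (simp add: ua_def)
            then show False using 3 u by simp
          qed
          then have "U ua \<le> (A * (u0 * (2 - u0)) powr - b) powr (1 - a / a) * exp (- 2 * a * \<zeta>)"
            unfolding ua_def using a u0 by (intro U2) auto
          also have "... = E" using A u0 a by (simp add: E_def)
          finally have "U ua \<le> E" .
          moreover have "U u \<le> U ua" using 3 u ua u0 by (intro U_mono) auto
          ultimately show ?thesis using 3 ua by (simp add: P'_def)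
        qed
      qed simp
      moreover have "P 1 = P2 ua + E * (1 - ua)" using u0 ua by (cases "ua = 1") (auto simp: P_def P3_def)
      moreover have "P2 ua + E * (1 - ua) = b * \<eta> + (1 - u0) * (1 - 2 * Xi a)"
      proof -
        have 1: "1 - ua = (1 - u0) * ((1 - a) / (1 + a))" by (simp add: ua_def)
        have 2: "h + d * (1 - c * E - x) + E * (d * c) = h + d * (1 - x)" for h d c x :: real by (simp add: algebra_simps)
        show ?thesis unfolding P2_def alua Th_def E_def[symmetric] 1 by (rule 2)
      qed
      moreover have "b * \<eta> + (1 - u0) * (1 - 2 * Xi a) < 1"
        using fin unfolding u0_def[symmetric] by (simp add: algebra_simps)
      ultimately show False by linarith
    qed
    then show ?thesis using True by (simp add: A0_def \<beta>_def)
  qed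
qed

section \<open>The constants\<close>

text \<open>This bounds the maximum in the definition of \<open>M_const\<close> by a power of \<open>b = (2 - p) /
  2\<close>; \<open>1 - exp (- x)\<close> is compared with \<open>x / (1 + x / 2)\<close>.\<close>
lemma one_minus_exp_le:
  fixes x b :: real
  assumes x: "x \<ge> 0" and b: "0 < b" "b \<le> 1 / 2"
  shows "1 - exp (- x) \<le> b powr b * x powr (1 - b)"
proof (cases "x = 0")
  case False
  then have x: "x > 0" using x by simp
  define h where "h x = (2 + x) * exp (- x) - 2 + x" for x :: real
  have "h 0 \<le> h x"
  proof (rule DERIV_nonneg_imp_nondecreasing[where f=h and a=0 and b=x])
    fix t :: real assume t: "0 \<le> t" "t \<le> x"
    have "(h has_real_derivative 1 - (1 + t) * exp (- t)) (at t)"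
      unfolding h_def by (auto intro!: derivative_eq_intros simp: algebra_simps)
    moreover have "(1 + t) * exp (- t) \<le> 1"
      using exp_ge_add_one_self[of t] by (simp add: exp_minus field_simps)
    ultimately show "\<exists>y. (h has_real_derivative y) (at t) \<and> 0 \<le> y" by force
  qed (use x in simp)
  then have h0: "0 \<le> h x / 2" by (simp add: h_def)
  have eq: "(1 - exp (- x)) * (1 + x / 2) = x - h x / 2" unfolding h_def by (simp add: field_simps)
  have "(1 - exp (- x)) * (1 + x / 2) \<le> x" unfolding eq using h0 by linarith
  then have 1: "1 - exp (- x) \<le> x / (1 + x / 2)" using x by (simp add: pos_le_divide_eq)
  define y where "y = x / b"
  have y: "y > 0" using x b by (simp add: y_def)
  have "sqrt y \<le> 1 + y / 4"
  proof -
    have "0 \<le> (sqrt y / 2 - 1)\<^sup>2" by simp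
    then show ?thesis using y by (simp add: power2_diff power_divide)
  qed
  then have "sqrt y powr (2 * b) \<le> (1 + y / 4) powr (2 * b)" using y b by (intro powr_mono2) auto
  also have "... \<le> 1 + 2 * b * (1 + y / 4 - 1)" using y b by (intro powr_le_tangent) auto
  also have "... = 1 + x / 2" using b by (simp add: y_def)
  also have "sqrt y powr (2 * b) = y powr b" using y by (simp add: powr_half_sqrt[symmetric] powr_powr)
  finally have "x powr b / b powr b \<le> 1 + x / 2" using x b by (simp add: y_def powr_divide)
  then have "x / (1 + x / 2) \<le> x / (x powr b / b powr b)" using x b by (intro divide_left_mono) (auto intro!: mult_pos_pos)
  also have "... = b powr b * x powr (1 - b)" using x by (simp add: powr_diff)
  finally show ?thesis using 1 by simp
qed simp

lemma
  fixes p :: real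
  assumes p: "1 \<le> p" "p < 2"
  defines "b \<equiv> (2 - p) / 2"
  shows M_const_le: "M_const p \<le> (1 - b) * (2 * b) powr b"
    and M_const_ge: "(1 - exp (- 1)) / 2 \<le> M_const p"
    and M_const_pos: "0 < M_const p"
proof -
  have b1: "0 < b" "b \<le> 1 / 2" using p by (auto simp: b_def)
  have b2: "p = 2 * (1 - b)" by (simp add: b_def diff_divide_distrib)
  have b3: "p / 2 = 1 - b" unfolding b2 by simp
  note b = b1 b3 b2
  define Q where "Q x = (1 - exp (- x)) / x powr (p / 2)" for x :: real
  have Q: "Q x \<le> b powr b" if "x \<in> {0..}" for x
  proof (cases "x = 0")
    case False
    then have "x > 0" using that by simp
    then show ?thesis using one_minus_exp_le[of x b] b(1,2) by (simp add: Q_def b(3) pos_divide_le_eq)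
  qed (simp add: Q_def)
  have M: "M_const p = p * 2 powr (- p / 2) * (SUP x\<in>{0..}. Q x)" by (simp add: M_const_def Q_def)
  have c: "p * 2 powr (- p / 2) * b powr b = (1 - b) * (2 * b) powr b"
  proof -
    have "2 * 2 powr (- p / 2) = 2 powr b"
    proof -
      have "- p / 2 = - (p / 2)" by simp
      then have "1 + - p / 2 = b" using b(3) by linarith
      then have "2 powr b = 2 powr (1 + - p / 2)" by (simp only:)
      then show ?thesis by (simp only: powr_add powr_one)
    qed
    moreover have "p * 2 powr (- p / 2) * b powr b = (1 - b) * (2 * 2 powr (- p / 2)) * b powr b" by (simp add: b(4))
    ultimately show ?thesis using b by (simp add: powr_mult mult.assoc)
  qed
  have "(SUP x\<in>{0..}. Q x) \<le> b powr b" by (rule cSUP_least) (use Q in auto)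
  then have "M_const p \<le> p * 2 powr (- p / 2) * b powr b" unfolding M using p by (intro mult_left_mono) auto
  then show "M_const p \<le> (1 - b) * (2 * b) powr b" unfolding c .
  have "Q 1 \<le> (SUP x\<in>{0..}. Q x)" by (rule cSUP_upper) (auto intro!: bdd_aboveI[where M="b powr b"] Q)
  then have s: "1 - exp (- 1) \<le> (SUP x\<in>{0..}. Q x)" by (simp add: Q_def)
  have e: "exp (- 1 :: real) < 1" by simp
  have "2 powr (- 1) \<le> 2 powr (- p / 2)" using p by (intro powr_mono) auto
  then have "1 * (1/2) \<le> p * 2 powr (- p / 2)" using p by (intro mult_mono) (auto simp: powr_minus)
  then have "(1/2) * (1 - exp (- 1)) \<le> p * 2 powr (- p / 2) * (SUP x\<in>{0..}. Q x)"
    using s e p by (intro mult_mono) auto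
  then show g: "(1 - exp (- 1)) / 2 \<le> M_const p" unfolding M by simp
  have "0 < (1 - exp (- 1 :: real)) / 2" using e by simp
  then show "0 < M_const p" using g by (rule less_le_trans)
qed

text \<open>\<open>M_const\<close> is bounded away from \<open>0\<close>, so the bracket in \<open>C_const\<close> is at
  most of order \<open>1 / (2 - p)\<close>, and its exponent is at least \<open>- 1\<close>.\<close>
lemma C_const_lower_bound: "\<exists>c::real. c > 0 \<and> (\<forall>p::real. 1 \<le> p \<longrightarrow> p < 2 \<longrightarrow> C_const p \<ge> c * (2 - p))"
proof -
  define m :: real where "m = (1 - exp (- 1)) / 2"
  have m: "0 < m" "m < 1" 
  proof -
    have e: "0 < exp (- 1 :: real)" "exp (- 1 :: real) < 1" by simp_all
    have "2 * m = 1 - exp (- 1)" by (simp add: m_def)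
    then show "0 < m" "m < 1" using e by linarith+
  qed
  define K where "K = m powr - 2 + 1"
  have K: "K \<ge> 1" by (simp add: K_def)
  have "C_const p \<ge> (1 / K) * (2 - p)" if p: "1 \<le> p" "p < 2" for p
  proof -
    have Mm: "m \<le> M_const p" unfolding m_def by (rule M_const_ge[OF p])
    have p2: "2 / p \<le> 2" "0 < 2 / p" using p by (auto simp: field_simps)
    have "M_const p powr (- 2 / p) \<le> m powr (- 2 / p)" using Mm m p by (intro powr_mono2') auto
    also have "... \<le> m powr - 2" using m p2 by (intro powr_mono') auto
    also have "... \<le> m powr - 2 / (2 - p)" using p by (simp add: pos_le_divide_eq mult_left_le)
    finally have 1: "M_const p powr (- 2 / p) \<le> m powr - 2 / (2 - p)" .
    have "p / (2 * exp 1 * (2 - p)) \<le> 1 / (2 - p)"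
    proof -
      have "p \<le> 2 * exp 1" using p exp_ge_add_one_self[of 1] by linarith
      then have "p / (2 * exp 1) / (2 - p) \<le> 1 / (2 - p)" using p by (intro divide_right_mono) (auto simp: pos_divide_le_eq)
      then show ?thesis by simp
    qed
    with 1 have s: "M_const p powr (- 2 / p) + p / (2 * exp 1 * (2 - p)) \<le> K / (2 - p)"
      by (simp add: K_def add_divide_distrib)
    have pos: "0 < M_const p powr (- 2 / p) + p / (2 * exp 1 * (2 - p))"
      using M_const_pos[OF p] p by (intro add_pos_pos) auto
    have K1: "1 \<le> K / (2 - p)" using K p by (simp add: pos_le_divide_eq)
    have "(1 / K) * (2 - p) = (K / (2 - p)) powr - 1" using K p by (simp add: powr_minus_divide)
    also have "... \<le> (K / (2 - p)) powr (- p / 2)" using K1 p by (intro powr_mono) auto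
    also have "... \<le> C_const p" unfolding C_const_def using s pos p by (intro powr_mono2') auto
    finally show ?thesis .
  qed
  moreover have "0 < 1 / K" using K by simp
  ultimately show ?thesis by blast
qed

section \<open>The bound\<close>

text \<open>Both parts of the theorem, from the two bounds on \<open>phi\<close>. The number \<open>d\<close> of
  derivatives over which the moment is shared is \<open>1\<close> or a binomial coefficient; it enters only
  through \<open>W / d\<close>.\<close>
lemma W_bound:
  fixes f :: "real^'n::finite => real"
  assumes f: "f \<in> Hspace k" and bd: "AE x in gauss. \<bar>f x\<bar> \<le> 1" and k: "k > 0" and p: "1 \<le> p" "p < 2"
    and d: "d \<ge> 1" and N0: "N \<ge> 0"
    and H1: "\<And>r. 0 \<le> r ==> r < 1 ==> phi k f f r \<le> d * (N * (1 - r\<^sup>2) powr (- real k * (2 - p) / 2))"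
    and H2: "\<And>r \<alpha> l. 0 \<le> r ==> r < 1 ==> 0 < \<alpha> ==> \<alpha> < 1 ==> \<alpha> \<le> (2 - p) / p ==> l = 1 - \<alpha> * p / (2 - p) ==>
      phi k f f (r * ((1 - \<alpha>) / (1 + \<alpha>))) \<le> d * (N powr (2 * (1 - l) / p) * (N * (1 - r\<^sup>2) powr (- real k * (2 - p) / 2)) powr l)"
  shows "C_const p ^ k * (W k f / d) * (1 + 1 / (2 * real k) * ln (d / W k f)) powr (real k * p / 2) \<le> N"
proof (cases "W k f = 0")
  case False
  then have W: "W k f > 0" using W_nonneg[of k f] by linarith
  define w where "w = W k f / d"
  have w: "0 < w" "w \<le> 1"
    using W d W_le_1[OF f bd] by (auto simp: w_def pos_divide_le_eq)
  define b where "b = (2 - p) / 2"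
  define a where "a = (2 - p) / p"
  have a: "0 < a" "a \<le> 1" and b: "b = a / (1 + a)" "0 < b" "b < 1" "1 - b = p / 2"
    using p by (auto simp: a_def b_def field_simps)
  have Np: "N > 0"
  proof (rule ccontr)
    assume "\<not> N > 0"
    then have "N = 0" using N0 by simp
    have "1 \<le> (0::real)"
    proof (rule supersolution_ge_1[OF f bd k W, where P="\<lambda>_. 0" and P'="\<lambda>_. 0" and S="{}"])
      fix u :: real assume "0 < u" "u < 1"
      then have "phi k f f (1 - u) = 0" using H1[of "1 - u"] phi_nonneg[OF f, of "1 - u"] \<open>N = 0\<close> by simp
      then show "(phi k f f (1 - u) / W k f) powr (1 / real k) \<le> 0" by simp
    qed auto
    then show False by simp
  qed
  define A where "A = (N / w) powr (1 / real k)"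
  define Ek where "Ek = (N powr (2 / p) / w) powr (1 / real k)"
  \<comment> \<open>makes \<open>exp (- 2 * \<alpha> * \<zeta>)\<close> the power \<open>\<alpha> / a\<close> of \<open>Ek\<close>\<close>
  define \<zeta> where "\<zeta> = - ln Ek / (2 * a)"
  have A: "A > 0" and Ek: "Ek > 0" using Np w by (auto simp: A_def Ek_def)
  have dw: "x / W k f \<le> y / w" if "x \<le> d * y" for x y
    using that W d by (simp add: w_def pos_divide_le_eq field_simps)
  have kb: "- real k * (2 - p) / 2 = - b * real k" by (simp add: b_def field_simps)
  have u2: "1 - (1 - u)\<^sup>2 = u * (2 - u)" for u :: real by (simp add: power2_eq_square algebra_simps)
  have "(1 - b) * (2 * b) powr b * (1 + max 0 \<zeta>) powr (1 - b) \<le> A"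
  proof (rule growth_lower_bound[OF a b(1) A, where U="\<lambda>u. (phi k f f (1 - u) / W k f) powr (1 / real k)"])
    fix u :: real assume u: "0 < u" "u < 1"
    have "phi k f f (1 - u) / W k f \<le> N * (u * (2 - u)) powr (- b * real k) / w"
      using H1[of "1 - u"] u unfolding kb u2 by (intro dw) auto
    then have "(phi k f f (1 - u) / W k f) powr (1 / real k) \<le> (N / w * (u * (2 - u)) powr (- b * real k)) powr (1 / real k)"
      using u W phi_nonneg[OF f, of "1 - u"] by (intro powr_mono2) auto
    also have "... = A * (u * (2 - u)) powr - b"
      using k by (simp only: A_def powr_mult powr_powr) simp
    finally show "(phi k f f (1 - u) / W k f) powr (1 / real k) \<le> A * (u * (2 - u)) powr - b" .
  next
    fix u0 \<alpha> :: real assume u0: "0 < u0" "u0 < 1" and \<alpha>: "0 < \<alpha>" "\<alpha> < 1" "\<alpha> \<le> a"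
    define l where "l = 1 - \<alpha> * p / (2 - p)"
    have l: "1 - \<alpha> / a = l" "1 - l = \<alpha> / a" by (auto simp: l_def a_def)
    define z where "z = (u0 * (2 - u0)) powr (- b * real k)"
    have z: "z > 0" using u0 by (simp add: z_def)
    define x1 where "x1 = N powr (2 / p) / w"
    define x2 where "x2 = N / w * z"
    have x: "x1 > 0" "x2 > 0" using Np w z by (auto simp: x1_def x2_def)
    have "phi k f f ((1 - u0) * ((1 - \<alpha>) / (1 + \<alpha>))) / W k f \<le> N powr (2 * (1 - l) / p) * (N * z) powr l / w"
      using H2[of "1 - u0" \<alpha> l] u0 \<alpha> unfolding kb u2 z_def a_def by (intro dw) (auto simp: l_def)
    also have "... = x1 powr (1 - l) * x2 powr l"
    proof -
      have ww: "w = w powr (1 - l) * w powr l" using w by (simp add: powr_add[symmetric])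
      have "x1 powr (1 - l) * x2 powr l = (N powr (2 / p * (1 - l)) / w powr (1 - l)) * ((N * z) powr l / w powr l)"
        using Np w z by (simp add: x1_def x2_def powr_divide powr_powr powr_mult)
      also have "... = N powr (2 / p * (1 - l)) * (N * z) powr l / (w powr (1 - l) * w powr l)" by simp
      finally show ?thesis unfolding ww[symmetric] by simp
    qed
    finally have "(phi k f f ((1 - u0) * ((1 - \<alpha>) / (1 + \<alpha>))) / W k f) powr (1 / real k) \<le> (x1 powr (1 - l) * x2 powr l) powr (1 / real k)"
    proof (intro powr_mono2)
      have lt: "(1 - u0) * ((1 - \<alpha>) / (1 + \<alpha>)) < 1"
      proof -
        have "(1 - u0) * ((1 - \<alpha>) / (1 + \<alpha>)) \<le> 1 - u0" using u0 \<alpha> by (intro mult_left_le) auto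
        then show ?thesis by (rule le_less_trans) (use u0 in simp)
      qed
      have ge: "0 \<le> (1 - u0) * ((1 - \<alpha>) / (1 + \<alpha>))" using u0 \<alpha> by simp
      show "0 \<le> phi k f f ((1 - u0) * ((1 - \<alpha>) / (1 + \<alpha>))) / W k f"
        using phi_nonneg[OF f ge lt] W by simp
    qed auto
    also have "... = (x2 powr (1 / real k)) powr l * (x1 powr (1 / real k)) powr (1 - l)"
      by (simp only: powr_mult powr_powr powr_ge_zero mult.commute)
    also have "x2 powr (1 / real k) = A * (u0 * (2 - u0)) powr - b"
      using k by (simp only: x2_def z_def A_def powr_mult powr_powr) simp
    also have "(x1 powr (1 / real k)) powr (1 - l) = exp (- 2 * \<alpha> * \<zeta>)"
    proof -
      have "(x1 powr (1 / real k)) powr (1 - l) = exp ((\<alpha> / a) * ln Ek)" using Ek unfolding l by (simp add: powr_def Ek_def x1_def)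
      also have "(\<alpha> / a) * ln Ek = - 2 * \<alpha> * \<zeta>" using a by (simp add: \<zeta>_def)
      finally show ?thesis .
    qed
    finally show "(phi k f f (1 - (1 - (1 - u0) * ((1 - \<alpha>) / (1 + \<alpha>)))) / W k f) powr (1 / real k)
      \<le> (A * (u0 * (2 - u0)) powr - b) powr (1 - \<alpha> / a) * exp (- 2 * \<alpha> * \<zeta>)" unfolding l by simp
  next
    fix u v :: real assume "0 < u" "u \<le> v" "v < 1"
    then show "(phi k f f (1 - v) / W k f) powr (1 / real k) \<le> (phi k f f (1 - u) / W k f) powr (1 / real k)"
      using W k phi_nonneg[OF f, of "1 - v"] phi_mono[OF f, of "1 - v" "1 - u"]
      by (intro powr_mono2 divide_right_mono divide_nonneg_pos) auto
  next
    fix P P' :: "real => real" and S :: "real set"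
    assume "continuous_on {0..1} P" "0 \<le> P 0" "finite S"
      "\<And>u. 0 < u ==> u < 1 ==> u \<notin> S ==> (P has_real_derivative P' u) (at u)"
      "\<And>u. 0 < u ==> u < 1 ==> u \<notin> S ==> (phi k f f (1 - u) / W k f) powr (1 / real k) \<le> P' u"
    then show "1 \<le> P 1" by (rule supersolution_ge_1[OF f bd k W])
  qed
  moreover have "M_const p * (1 + max 0 \<zeta>) powr (1 - b) \<le> (1 - b) * (2 * b) powr b * (1 + max 0 \<zeta>) powr (1 - b)"
    using M_const_le[OF p] unfolding b_def by (intro mult_right_mono) auto
  ultimately have MA: "M_const p * (1 + max 0 \<zeta>) powr (p / 2) \<le> A" unfolding b(4) by linarith
  have Mp: "M_const p > 0" by (rule M_const_pos[OF p])
  define y where "y = A powr (2 / p)"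
  define c where "c = M_const p powr (- 2 / p) + p / (2 * exp 1 * (2 - p))"
  have y: "y > 0" using A by (simp add: y_def)
  have c: "c > 0" unfolding c_def using Mp p by (intro add_pos_pos) auto
  have 1: "1 + \<zeta> \<le> y * M_const p powr (- 2 / p)"
  proof -
    have "(M_const p * (1 + max 0 \<zeta>) powr (p / 2)) powr (2 / p) \<le> y" unfolding y_def
      using MA Mp p by (intro powr_mono2) auto
    moreover have "(M_const p * (1 + max 0 \<zeta>) powr (p / 2)) powr (2 / p) = M_const p powr (2 / p) * (1 + max 0 \<zeta>)"
    proof -
      have "((1 + max 0 \<zeta>) powr (p / 2)) powr (2 / p) = 1 + max 0 \<zeta>"
        unfolding powr_powr using p by simp
      then show ?thesis by (simp add: powr_mult)
    qed
    ultimately have "M_const p powr (2 / p) * (1 + max 0 \<zeta>) \<le> y" by simp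
    then have "1 + max 0 \<zeta> \<le> y / M_const p powr (2 / p)" using Mp by (simp add: pos_le_divide_eq mult.commute)
    also have "... = y * M_const p powr (- 2 / p)" by (simp add: powr_minus_divide)
    finally show ?thesis by simp
  qed
  have 2: "ln y / (2 * a) \<le> y * (p / (2 * exp 1 * (2 - p)))"
  proof -
    have "ln (y / exp 1) \<le> y / exp 1 - 1" using y by (intro ln_le_minus_one) auto
    then have "ln y \<le> y / exp 1" using y by (simp add: ln_div)
    then have "ln y / (2 * a) \<le> (y / exp 1) / (2 * a)" using a by (intro divide_right_mono) auto
    also have "... = y * (p / (2 * exp 1 * (2 - p)))" using p by (simp add: a_def)
    finally show ?thesis .
  qed
  define L where "L = 1 / (2 * real k) * ln (1 / w)"
  have L0: "L \<ge> 0" using w by (simp add: L_def)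
  have zL: "\<zeta> = L - ln y / (2 * a)"
  proof -
    have lE: "ln Ek = (2 / p * ln N - ln w) / real k" using Np w by (simp add: Ek_def ln_powr ln_div)
    have ly: "ln y = 2 / p * ((ln N - ln w) / real k)" using Np w by (simp add: y_def A_def ln_powr ln_div)
    have "ln Ek = ln y + a / real k * ln w"
      unfolding lE ly using p k by (simp add: a_def field_simps)
    then show ?thesis using a w k by (simp add: \<zeta>_def L_def ln_div field_simps)
  qed
  have "1 + L \<le> y * c" using 1 2 unfolding zL c_def by (simp add: distrib_left)
  then have "(1 + L) powr (real k * p / 2) \<le> (y * c) powr (real k * p / 2)" using L0 p by (intro powr_mono2) auto
  also have "... = N / w * c powr (real k * p / 2)"
  proof -
    have "y powr (real k * p / 2) = N / w"
      unfolding y_def A_def powr_powr using k p Np w by simp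
    then show ?thesis by (simp add: powr_mult)
  qed
  finally have "w * (1 + L) powr (real k * p / 2) \<le> N * c powr (real k * p / 2)" using w by (simp add: field_simps)
  moreover have "C_const p ^ k * c powr (real k * p / 2) = 1"
  proof -
    have "C_const p = c powr (- p / 2)" by (simp add: C_const_def c_def)
    then have "C_const p ^ k = c powr (- p / 2 * real k)" using c by (simp add: powr_realpow[symmetric] powr_powr)
    then show ?thesis using c by (simp add: powr_add[symmetric] algebra_simps)
  qed
  moreover have "0 \<le> C_const p ^ k" by (simp add: C_const_def)
  ultimately have "C_const p ^ k * (w * (1 + L) powr (real k * p / 2)) \<le> N"
    using mult_left_mono[of "w * (1 + L) powr (real k * p / 2)" "N * c powr (real k * p / 2)" "C_const p ^ k"]
    by (simp add: mult.left_commute)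
  moreover have "1 / w = d / W k f" by (simp add: w_def)
  ultimately show ?thesis unfolding L_def by (simp add: w_def mult.assoc)
qed (use N0 in simp)

lemma Lp_norm_powr:
  assumes "p > 0"
  shows "Lp_norm p g powr p = (\<integral>x. \<bar>g x\<bar> powr p \<partial>gauss)"
proof -
  have "0 \<le> (\<integral>x. \<bar>g x\<bar> powr p \<partial>gauss)" by simp
  then show ?thesis using assms by (simp add: Lp_norm_def powr_powr)
qed

lemma Linf_norm_le_AE:
  fixes f :: "real^'n::finite => real"
  assumes [measurable]: "f \<in> borel_measurable borel" and "Linf_norm f \<le> 1"
  shows "AE x in gauss. \<bar>f x\<bar> \<le> 1"
proof -
  have "AE x in gauss. ereal \<bar>f x\<bar> \<le> esssup gauss (\<lambda>x. ereal \<bar>f x\<bar>)" by (rule esssup_AE)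
  then show ?thesis
  proof eventually_elim
    case (elim x)
    then have "ereal \<bar>f x\<bar> \<le> 1" using assms(2) unfolding Linf_norm_def by (rule order_trans)
    then show ?case by simp
  qed
qed

lemma card_mdeg_le: "card {\<kappa> :: 'n::finite => nat. mdeg \<kappa> = k} \<le> (CARD('n) + k - 1) choose k"
proof -
  obtain xs :: "'n list" where xs: "set xs = UNIV" "distinct xs" using finite_distinct_list[of "UNIV :: 'n set"] by auto
  have len: "length xs = CARD('n)" using xs distinct_card by fastforce
  let ?T = "{l :: nat list. length l = CARD('n) \<and> sum_list l = k}"
  have T: "card ?T = (CARD('n) + k - 1) choose k" using card_length_sum_list[of "CARD('n)" k] by (simp add: add.commute)
  have n: "CARD('n) > 0" by simp
  then have "k \<le> CARD('n) + k - 1" by arith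
  then have "card ?T > 0" unfolding T by (rule zero_less_binomial)
  then have fT: "finite ?T" by (rule card_ge_0_finite)
  have "inj_on (\<lambda>\<kappa>. map \<kappa> xs) {\<kappa> :: 'n => nat. mdeg \<kappa> = k}"
    by (rule inj_onI) (use xs in \<open>auto simp: fun_eq_iff\<close>)
  moreover have "(\<lambda>\<kappa>. map \<kappa> xs) ` {\<kappa> :: 'n => nat. mdeg \<kappa> = k} \<subseteq> ?T"
    using xs len by (auto simp: mdeg_def sum_list_distinct_conv_sum_set)
  ultimately have "card {\<kappa> :: 'n => nat. mdeg \<kappa> = k} \<le> card ?T" using fT by (rule card_inj_on_le)
  then show ?thesis unfolding T .
qed

lemma ex_mdeg: "{\<kappa> :: 'n::finite => nat. mdeg \<kappa> = k} \<noteq> {}"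
proof -
  obtain i :: 'n where True by blast
  have "mdeg (\<lambda>j. if j = i then k else 0) = k" by (simp add: mdeg_def)
  then show ?thesis by blast
qed

text \<open>In degree \<open>0\<close> the weight is the second moment, which is at most the \<open>p\<close>-th for a
  function bounded by \<open>1\<close>.\<close>
lemma moment_degree_0:
  fixes f :: "real^'n::finite => real"
  assumes f: "f \<in> Hspace 0" and bd: "AE x in gauss. \<bar>f x\<bar> \<le> 1" and p: "1 \<le> p" "p < 2"
  shows "W 0 f \<le> (\<integral>x. \<bar>D (\<lambda>_. 0) f x\<bar> powr p \<partial>gauss)"
proof -
  have DL: "D (\<lambda>_. 0) f \<in> L2" by (rule Hspace_D[OF f]) (simp add: mdeg_def)
  have DA: "(\<lambda>x. \<bar>D (\<lambda>_. 0) f x\<bar>) \<in> L2" using DL by (auto simp: L2_def)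
  have "W 0 f = (\<integral>x. (f x)\<^sup>2 \<partial>gauss)" by (simp add: W_eq[OF f bd])
  also have "... \<le> (\<integral>x. \<bar>D (\<lambda>_. 0) f x\<bar> powr p \<partial>gauss)"
  proof (rule integral_mono_AE)
    show "integrable gauss (\<lambda>x. (f x)\<^sup>2)" by (rule L2_sq[OF Hspace_L2[OF f]])
    show "integrable gauss (\<lambda>x. \<bar>D (\<lambda>_. 0) f x\<bar> powr p)" by (rule L2_powr_integrable[OF DA]) (use p in auto)
    show "AE x in gauss. (f x)\<^sup>2 \<le> \<bar>D (\<lambda>_. 0) f x\<bar> powr p" using D_0[OF f] bd
    proof eventually_elim
      case (elim x)
      show ?case
      proof (cases "f x = 0")
        case False
        have "(f x)\<^sup>2 = \<bar>f x\<bar> powr 2" using False by simp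
        also have "... \<le> \<bar>f x\<bar> powr p" using elim p False by (intro powr_mono') auto
        finally show ?thesis using elim by simp
      qed simp
    qed
  qed
  finally show ?thesis .
qed

theorem theorem1p8:
  "(\<forall>(k::nat) (f :: real ^ 'n::finite \<Rightarrow> real) (p::real).
      f \<in> Hspace k \<longrightarrow> Linf_norm f \<le> 1 \<longrightarrow> 1 \<le> p \<longrightarrow> p < 2 \<longrightarrow>
        Lp_norm p (grad_norm k f) powr p
          \<ge> C_const p ^ k * W k f
              * (1 + 1 / (2 * real k) * ln (1 / W k f)) powr (real k * p / 2)
      \<and> (MAX \<kappa>\<in>{\<kappa>. mdeg \<kappa> = k}. Lp_norm p (D \<kappa> f) powr p)
          \<ge> C_const p ^ k * (W k f / real ((CARD('n) + k - 1) choose k))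
              * (1 + 1 / (2 * real k) * ln (real ((CARD('n) + k - 1) choose k) / W k f))
                  powr (real k * p / 2))
   \<and> (\<exists>c::real. c > 0 \<and> (\<forall>p::real. 1 \<le> p \<longrightarrow> p < 2 \<longrightarrow> C_const p \<ge> c * (2 - p)))"
proof (intro conjI[OF _ C_const_lower_bound] allI impI)
  fix k :: nat and f :: "real ^ 'n \<Rightarrow> real" and p :: real
  assume f: "f \<in> Hspace k" and inf: "Linf_norm f \<le> 1" and p: "1 \<le> p" "p < 2"
  let ?S = "{\<kappa> :: 'n \<Rightarrow> nat. mdeg \<kappa> = k}"
  let ?d = "real ((CARD('n) + k - 1) choose k)"
  let ?N = "MAX \<kappa>\<in>?S. Lp_norm p (D \<kappa> f) powr p"
  have p0: "p > 0" using p by simp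
  have fm: "f \<in> borel_measurable borel" using Hspace_L2[OF f] by auto
  have bd: "AE x in gauss. \<bar>f x\<bar> \<le> 1" by (rule Linf_norm_le_AE[OF fm inf])
  have gm: "Lp_norm p (grad_norm k f) powr p = grad_moment p ?S f"
  proof -
    have "\<bar>grad_norm k f x\<bar> = fam_norm ?S (\<lambda>\<kappa>. D \<kappa> f) x" for x
      by (simp add: grad_norm_def fam_norm_def sum_nonneg)
    then show ?thesis by (simp add: Lp_norm_powr[OF p0] grad_moment_def)
  qed
  have gs: "Lp_norm p (D \<kappa> f) powr p = grad_moment p {\<kappa>} f" for \<kappa>
    by (simp add: Lp_norm_powr[OF p0] grad_moment_def fam_norm_def)
  have gm0: "0 \<le> grad_moment p S f" for S by (simp add: grad_moment_def)
  show "C_const p ^ k * W k f * (1 + 1 / (2 * real k) * ln (1 / W k f)) powr (real k * p / 2) \<le> Lp_norm p (grad_norm k f) powr p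
    \<and> C_const p ^ k * (W k f / ?d) * (1 + 1 / (2 * real k) * ln (?d / W k f)) powr (real k * p / 2) \<le> ?N"
  proof (cases "k = 0")
    case True
    have S0: "?S = {\<lambda>_. 0}" using True by (auto simp: mdeg_def)
    have "\<bar>grad_norm k f x\<bar> = \<bar>D (\<lambda>_. 0) f x\<bar>" for x by (simp add: grad_norm_def S0)
    then have 1: "Lp_norm p (grad_norm k f) powr p = (\<integral>x. \<bar>D (\<lambda>_. 0) f x\<bar> powr p \<partial>gauss)" by (simp add: Lp_norm_powr[OF p0])
    have 2: "?N = (\<integral>x. \<bar>D (\<lambda>_. 0) f x\<bar> powr p \<partial>gauss)" by (simp add: S0 Lp_norm_powr[OF p0])
    show ?thesis using moment_degree_0[OF f[unfolded True] bd p] unfolding 1 2 by (simp add: True)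
  next
    case False
    then have k: "k > 0" by simp
    have A: "C_const p ^ k * (W k f / 1) * (1 + 1 / (2 * real k) * ln (1 / W k f)) powr (real k * p / 2) \<le> grad_moment p ?S f"
    proof (rule W_bound[OF f bd k p _ gm0])
      fix r :: real assume r: "0 \<le> r" "r < 1"
      show "phi k f f r \<le> 1 * (grad_moment p ?S f * (1 - r\<^sup>2) powr (- real k * (2 - p) / 2))"
        unfolding phi_def mult_1 by (rule corr_sum_le[OF f bd order_refl p r])
      fix \<alpha> l :: real assume "0 < \<alpha>" "\<alpha> < 1" "\<alpha> \<le> (2 - p) / p" "l = 1 - \<alpha> * p / (2 - p)"
      then show "phi k f f (r * ((1 - \<alpha>) / (1 + \<alpha>))) \<le> 1 * (grad_moment p ?S f powr (2 * (1 - l) / p) * (grad_moment p ?S f * (1 - r\<^sup>2) powr (- real k * (2 - p) / 2)) powr l)"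
        unfolding phi_def mult_1 by (rule corr_sum_hypercontractive[OF f bd order_refl p r])
    qed simp
    have fS: "finite ?S" by simp
    have NS: "grad_moment p {\<kappa>} f \<le> ?N" if "\<kappa> \<in> ?S" for \<kappa>
      unfolding gs using that fS by (intro Max_ge) auto
    have N0: "0 \<le> ?N"
    proof -
      obtain \<kappa> where "\<kappa> \<in> ?S" using ex_mdeg[where 'n='n, of k] by blast
      then show ?thesis using NS[of \<kappa>] gm0[of "{\<kappa>}"] by linarith
    qed
    have card: "real (card ?S) \<le> ?d" using card_mdeg_le[where 'n='n, of k] by simp
    have d1: "1 \<le> ?d"
    proof -
      have "0 < card ?S" using ex_mdeg[where 'n='n, of k] fS by (simp add: card_gt_0_iff)
      then show ?thesis using card by linarith
    qed
    have sum_le: "phi k f f r \<le> ?d * V" if "\<And>\<kappa>. \<kappa> \<in> ?S \<Longrightarrow> corr r (D \<kappa> f) (D \<kappa> f) \<le> V" "0 \<le> V" for r V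
    proof -
      have "phi k f f r \<le> real (card ?S) * V" unfolding phi_def using that(1) by (intro sum_bounded_above) auto
      also have "... \<le> ?d * V" using card that(2) by (intro mult_right_mono) auto
      finally show ?thesis .
    qed
    have B: "C_const p ^ k * (W k f / ?d) * (1 + 1 / (2 * real k) * ln (?d / W k f)) powr (real k * p / 2) \<le> ?N"
    proof (rule W_bound[OF f bd k p d1 N0])
      fix r :: real assume r: "0 \<le> r" "r < 1"
      define E where "E = (1 - r\<^sup>2) powr (- real k * (2 - p) / 2)"
      have E: "0 \<le> E" by (simp add: E_def)
      show "phi k f f r \<le> ?d * (?N * (1 - r\<^sup>2) powr (- real k * (2 - p) / 2))"
      proof (rule sum_le)
        fix \<kappa> assume \<kappa>: "\<kappa> \<in> ?S"
        have "corr r (D \<kappa> f) (D \<kappa> f) \<le> grad_moment p {\<kappa>} f * E"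
          unfolding E_def using corr_sum_le[OF f bd _ p r, of "{\<kappa>}"] \<kappa> by simp
        also have "... \<le> ?N * E" using NS[OF \<kappa>] E by (rule mult_right_mono)
        finally show "corr r (D \<kappa> f) (D \<kappa> f) \<le> ?N * (1 - r\<^sup>2) powr (- real k * (2 - p) / 2)" by (simp add: E_def)
      qed (use N0 in simp)
      fix \<alpha> l :: real assume \<alpha>: "0 < \<alpha>" "\<alpha> < 1" "\<alpha> \<le> (2 - p) / p" and l: "l = 1 - \<alpha> * p / (2 - p)"
      have l0: "0 \<le> l" "0 \<le> 1 - l" using \<alpha> p by (auto simp: l field_simps)
      show "phi k f f (r * ((1 - \<alpha>) / (1 + \<alpha>))) \<le> ?d * (?N powr (2 * (1 - l) / p) * (?N * (1 - r\<^sup>2) powr (- real k * (2 - p) / 2)) powr l)"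
      proof (rule sum_le)
        fix \<kappa> assume \<kappa>: "\<kappa> \<in> ?S"
        have "corr (r * ((1 - \<alpha>) / (1 + \<alpha>))) (D \<kappa> f) (D \<kappa> f) \<le> grad_moment p {\<kappa>} f powr (2 * (1 - l) / p) * (grad_moment p {\<kappa>} f * E) powr l"
          unfolding E_def using corr_sum_hypercontractive[OF f bd _ p r \<alpha> l, of "{\<kappa>}"] \<kappa> by simp
        also have "... \<le> ?N powr (2 * (1 - l) / p) * (?N * E) powr l"
          using NS[OF \<kappa>] gm0[of "{\<kappa>}"] l0 p E by (intro mult_mono powr_mono2) auto
        finally show "corr (r * ((1 - \<alpha>) / (1 + \<alpha>))) (D \<kappa> f) (D \<kappa> f) \<le> ?N powr (2 * (1 - l) / p) * (?N * (1 - r\<^sup>2) powr (- real k * (2 - p) / 2)) powr l"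
          by (simp add: E_def)
      qed simp
    qed
    show ?thesis using A B unfolding gm by simp
  qed
qed

end
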